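(* Let $\phi:X\rightarrow Y$ be a surjective morphism between smooth complex projective varieties, with $\dim Y>0$. If $X$ is strongly approximately rationally (resp. elliptically) connected, then $Y$ is approximately rationally (resp. elliptically) connected in the naive sense in any projective embedding $Y\subset\mathbb{P}^N$. In particular, $Y$ is not Kobayashi hyperbolic.
   Context: Everything is over $\mathbb{C}$; neighborhoods are for the Euclidean topology. A rational (resp. elliptic) curve in a complex manifold $M$ is the image of a nonconstant holomorphic map from $\mathbb{P}^1$ (resp. from a smooth projective curve of genus $1$) to $M$. A chain of curves is a finite nonempty sequence $C_1,\dots,C_k$ of such curves with $C_i\cap C_{i+1}\neq\emptyset$; it joins $x$ and $y$ if $x\in C_1$, $y\in C_k$. Let $X$ be a projective variety contained in a complex manifold $M$. $X$ is approximately rationally connected in the naive sense in $M$ if for every neighborhood $U\subset M$ of $X$, any two points of $X$ are contained in a rational curve $C\subset U$. $X$ is approximately elliptically connected in the naive sense in $M$ if for every neighborhood $U\subset M$ of $X$, any two points of $X$ can be joined by a chain of elliptic curves contained in $U$. $X$ is strongly approximately rationally (resp. elliptically) connected if for every embedding $j:X\hookrightarrow P$ into a product $P$ of two projective spaces, $j(X)$ is approximately rationally (resp. elliptically) connected in the naive sense in $P$. A variety is Kobayashi hyperbolic if its Kobayashi pseudodistance is a distance. *)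

theory Defs
  imports
    "HOL-Analysis.Analysis"
    "HOL-Library.Poly_Mapping"
    "HOL-Library.Extended_Nat"
    "HOL-Library.Function_Algebras"
    "HOL-Computational_Algebra.Polynomial"
begin

section \<open>Complex vector spaces of functions\<close>

definition cscale :: "complex \<Rightarrow> ('b \<Rightarrow> complex) \<Rightarrow> ('b \<Rightarrow> complex)" where
  "cscale c f = (\<lambda>x. c * f x)"

interpretation cfun: vector_space cscale
  by unfold_locales (simp_all add: cscale_def fun_eq_iff distrib_left distrib_right mult.assoc)


section \<open>Projective space with its Euclidean topology\<close>

text \<open>
  The dimension of the ambient projective space is quantified over inside definitions, so vectors
  of \<open>\<complex>\<^sup>n\<^sup>+\<^sup>1\<close> are functions on \<open>nat\<close> supported in \<open>{0..n}\<close>; the topology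
  on functions is the product topology, which induces the usual one on these vectors. A point of
  projective space is the set of its vectors of homogeneous coordinates.
\<close>

type_synonym ppoint = "(nat \<Rightarrow> complex) set"

definition coord_vectors :: "nat \<Rightarrow> (nat \<Rightarrow> complex) set" where
  "coord_vectors n = {v. v \<noteq> (\<lambda>_. 0) \<and> (\<forall>i>n. v i = 0)}"

definition proj_pt :: "(nat \<Rightarrow> complex) \<Rightarrow> ppoint" where
  "proj_pt v = {cscale c v | c. c \<noteq> 0}"

definition proj_space :: "nat \<Rightarrow> ppoint set" where
  "proj_space n = proj_pt ` coord_vectors n"

definition proj_top :: "nat \<Rightarrow> ppoint topology" where
  "proj_top n = topology (\<lambda>U. U \<subseteq> proj_space n \<and>
     openin (top_of_set (coord_vectors n)) {v \<in> coord_vectors n. proj_pt v \<in> U})"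

lemma openin_proj_top:
  "openin (proj_top n) U \<longleftrightarrow> U \<subseteq> proj_space n \<and>
     openin (top_of_set (coord_vectors n)) {v \<in> coord_vectors n. proj_pt v \<in> U}"
proof -
  let ?V = "\<lambda>U. {v \<in> coord_vectors n. proj_pt v \<in> U}"
  have "istopology (\<lambda>U. U \<subseteq> proj_space n \<and> openin (top_of_set (coord_vectors n)) (?V U))"
  proof (unfold istopology_def, intro conjI allI impI)
    fix S T
    assume S: "S \<subseteq> proj_space n \<and> openin (top_of_set (coord_vectors n)) (?V S)"
      and T: "T \<subseteq> proj_space n \<and> openin (top_of_set (coord_vectors n)) (?V T)"
    show "S \<inter> T \<subseteq> proj_space n" using S by blast
    have "?V (S \<inter> T) = ?V S \<inter> ?V T" by blast
    then show "openin (top_of_set (coord_vectors n)) (?V (S \<inter> T))"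
      using S T by (simp only: openin_Int)
  next
    fix K
    assume K: "\<forall>S\<in>K. S \<subseteq> proj_space n \<and> openin (top_of_set (coord_vectors n)) (?V S)"
    show "\<Union>K \<subseteq> proj_space n" using K by blast
    have "?V (\<Union>K) = \<Union>(?V ` K)" by blast
    moreover have "openin (top_of_set (coord_vectors n)) (\<Union>(?V ` K))"
      using K by (intro openin_Union) auto
    ultimately show "openin (top_of_set (coord_vectors n)) (?V (\<Union>K))" by simp
  qed
  then show ?thesis
    unfolding proj_top_def by (simp add: topology_inverse')
qed

lemma topspace_proj_top: "topspace (proj_top n) = proj_space n"
proof -
  have "{v \<in> coord_vectors n. proj_pt v \<in> proj_space n} = coord_vectors n"
    by (auto simp: proj_space_def)
  then have "openin (proj_top n) (proj_space n)"
    by (simp add: openin_proj_top)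
  then have "proj_space n \<subseteq> topspace (proj_top n)"
    by (rule openin_subset)
  moreover have "topspace (proj_top n) \<subseteq> proj_space n"
    using openin_topspace[of "proj_top n"] unfolding openin_proj_top[of n "topspace (proj_top n)"]
    by (rule conjunct1)
  ultimately show ?thesis
    by (rule subset_antisym[rotated])
qed


section \<open>Projective varieties\<close>

type_synonym mpoly = "(nat \<Rightarrow>\<^sub>0 nat) \<Rightarrow>\<^sub>0 complex"

definition mpoly_eval :: "mpoly \<Rightarrow> (nat \<Rightarrow> complex) \<Rightarrow> complex" where
  "mpoly_eval F v = (\<Sum>m\<in>Poly_Mapping.keys F.
     Poly_Mapping.lookup F m * (\<Prod>i\<in>Poly_Mapping.keys m. v i ^ Poly_Mapping.lookup m i))"

text \<open>Homogeneous polynomials of degree \<open>d\<close> in the variables \<open>x\<^sub>0, \<dots>, x\<^sub>n\<close>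
  (including the zero polynomial).\<close>

definition forms :: "nat \<Rightarrow> nat \<Rightarrow> mpoly set" where
  "forms n d = {F. \<forall>m\<in>Poly_Mapping.keys F. Poly_Mapping.keys m \<subseteq> {..n} \<and>
     (\<Sum>i\<in>Poly_Mapping.keys m. Poly_Mapping.lookup m i) = d}"

definition vanishes_at :: "mpoly \<Rightarrow> ppoint \<Rightarrow> bool" where
  "vanishes_at F p \<longleftrightarrow> (\<forall>v\<in>p. mpoly_eval F v = 0)"

definition zariski_closed :: "nat \<Rightarrow> ppoint set \<Rightarrow> bool" where
  "zariski_closed n X \<longleftrightarrow> (\<exists>S. S \<subseteq> (\<Union>d. forms n d) \<and>
     X = {p \<in> proj_space n. \<forall>F\<in>S. vanishes_at F p})"

definition projective_variety :: "nat \<Rightarrow> ppoint set \<Rightarrow> bool" where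
  "projective_variety n X \<longleftrightarrow> zariski_closed n X \<and> X \<noteq> {} \<and>
     (\<forall>A B. zariski_closed n A \<and> zariski_closed n B \<and> X = A \<union> B \<longrightarrow> X = A \<or> X = B)"

definition variety_dim :: "nat \<Rightarrow> ppoint set \<Rightarrow> enat" where
  "variety_dim n X = Sup {enat k | k. \<exists>Z. (\<forall>i\<le>k. projective_variety n (Z i) \<and> Z i \<subseteq> X) \<and>
     (\<forall>i<k. Z i \<subset> Z (Suc i))}"

text \<open>The tangent space at \<open>v\<close> of the affine cone over \<open>X\<close>: the common kernel of the
  differentials at \<open>v\<close> of all forms vanishing on \<open>X\<close>.\<close>

definition cone_tangent_space :: "nat \<Rightarrow> ppoint set \<Rightarrow> (nat \<Rightarrow> complex) \<Rightarrow> (nat \<Rightarrow> complex) set" where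
  "cone_tangent_space n X v = {w. (\<forall>i>n. w i = 0) \<and>
     (\<forall>d. \<forall>F\<in>forms n d. (\<forall>p\<in>X. vanishes_at F p) \<longrightarrow>
        deriv (\<lambda>t. mpoly_eval F (\<lambda>i. v i + t * w i)) 0 = 0)}"

text \<open>Jacobian criterion; the cone has one dimension more than \<open>X\<close>.\<close>

definition smooth_projective_variety :: "nat \<Rightarrow> ppoint set \<Rightarrow> bool" where
  "smooth_projective_variety n X \<longleftrightarrow> projective_variety n X \<and>
     (\<forall>p\<in>X. \<forall>v\<in>p. enat (cfun.dim (cone_tangent_space n X v)) = variety_dim n X + 1)"


section \<open>Morphisms and embeddings\<close>

text \<open>A morphism between closed subsets of projective spaces is given, on a Zariski neighborhood
  \<open>X - Z\<close> of each point, by forms of the same degree without common zeros.\<close>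

definition variety_morphism ::
  "nat \<Rightarrow> ppoint set \<Rightarrow> nat \<Rightarrow> ppoint set \<Rightarrow> (ppoint \<Rightarrow> ppoint) \<Rightarrow> bool" where
  "variety_morphism n X m Y \<phi> \<longleftrightarrow> \<phi> ` X \<subseteq> Y \<and>
     (\<forall>p\<in>X. \<exists>Z d F. zariski_closed n Z \<and> p \<notin> Z \<and> (\<forall>i\<le>m. F i \<in> forms n d) \<and>
        (\<forall>q\<in>X - Z. \<forall>v\<in>q. (\<exists>i\<le>m. mpoly_eval (F i) v \<noteq> 0) \<and>
           \<phi> q = proj_pt (\<lambda>i. if i \<le> m then mpoly_eval (F i) v else 0)))"

definition variety_isomorphism ::
  "nat \<Rightarrow> ppoint set \<Rightarrow> nat \<Rightarrow> ppoint set \<Rightarrow> (ppoint \<Rightarrow> ppoint) \<Rightarrow> bool" where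
  "variety_isomorphism n X m Y \<phi> \<longleftrightarrow> bij_betw \<phi> X Y \<and>
     variety_morphism n X m Y \<phi> \<and> variety_morphism m Y n X (inv_into X \<phi>)"

definition projective_embedding :: "nat \<Rightarrow> ppoint set \<Rightarrow> nat \<Rightarrow> (ppoint \<Rightarrow> ppoint) \<Rightarrow> bool" where
  "projective_embedding n X N i \<longleftrightarrow>
     zariski_closed N (i ` X) \<and> variety_isomorphism n X N (i ` X) i"

text \<open>As usual, the structure of algebraic variety on a product of two projective spaces is the
  one transported from its image under the Segre embedding. The product \<open>v i * w j\<close> is put at
  position \<open>i * (b + 1) + j\<close>.\<close>

definition segre :: "nat \<Rightarrow> nat \<Rightarrow> ppoint \<times> ppoint \<Rightarrow> ppoint" where
  "segre a b = (\<lambda>(p, q).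
     {(\<lambda>k. if k < (a + 1) * (b + 1) then v (k div (b + 1)) * w (k mod (b + 1)) else 0)
       | v w. v \<in> p \<and> w \<in> q})"

definition biprojective_embedding ::
  "nat \<Rightarrow> ppoint set \<Rightarrow> nat \<Rightarrow> nat \<Rightarrow> (ppoint \<Rightarrow> ppoint \<times> ppoint) \<Rightarrow> bool" where
  "biprojective_embedding n X a b j \<longleftrightarrow> j ` X \<subseteq> proj_space a \<times> proj_space b \<and>
     projective_embedding n X ((a + 1) * (b + 1) - 1) (segre a b \<circ> j)"


section \<open>Complex manifolds and holomorphic maps\<close>

text \<open>A complex manifold is presented by its topology and an atlas; a chart consists of its domain
  and of the set of its complex coordinate functions. Only projective spaces and their
  products occur below, with their standard charts.\<close>

record 'a complex_manifold =
  mtop :: "'a topology"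
  charts :: "('a set \<times> ('a \<Rightarrow> complex) set) set"

definition affine_coord :: "nat \<Rightarrow> nat \<Rightarrow> ppoint \<Rightarrow> complex" where
  "affine_coord k i p = (let v = (SOME v. v \<in> p) in v i / v k)"

definition proj_manifold :: "nat \<Rightarrow> ppoint complex_manifold" where
  "proj_manifold n = \<lparr>mtop = proj_top n,
     charts = {({p \<in> proj_space n. \<forall>v\<in>p. v k \<noteq> 0}, {affine_coord k i | i. i \<le> n \<and> i \<noteq> k}) | k. k \<le> n}\<rparr>"

definition prod_manifold ::
  "'a complex_manifold \<Rightarrow> 'b complex_manifold \<Rightarrow> ('a \<times> 'b) complex_manifold" where
  "prod_manifold M N = \<lparr>mtop = prod_topology (mtop M) (mtop N),
     charts = {(U \<times> V, (\<lambda>c. c \<circ> fst) ` cs \<union> (\<lambda>c. c \<circ> snd) ` ds) | U cs V ds.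
       (U, cs) \<in> charts M \<and> (V, ds) \<in> charts N}\<rparr>"

text \<open>Holomorphic maps from an open subset of the complex plane.\<close>

definition holomorphic_into :: "'a complex_manifold \<Rightarrow> complex set \<Rightarrow> (complex \<Rightarrow> 'a) \<Rightarrow> bool" where
  "holomorphic_into M \<Omega> g \<longleftrightarrow> open \<Omega> \<and> continuous_map (top_of_set \<Omega>) (mtop M) g \<and>
     (\<forall>(U, cs)\<in>charts M. \<forall>c\<in>cs. (c \<circ> g) holomorphic_on {z \<in> \<Omega>. g z \<in> U})"

text \<open>Inverses of holomorphic charts of a smooth projective curve \<open>C\<close> of the projective space of
  dimension \<open>n\<close>. An injective holomorphic map into a smooth curve is automatically an immersion.\<close>

definition inverse_chart :: "nat \<Rightarrow> ppoint set \<Rightarrow> complex set \<Rightarrow> (complex \<Rightarrow> ppoint) \<Rightarrow> bool" where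
  "inverse_chart n C \<Omega> \<gamma> \<longleftrightarrow> holomorphic_into (proj_manifold n) \<Omega> \<gamma> \<and>
     openin (subtopology (proj_top n) C) (\<gamma> ` \<Omega>) \<and>
     homeomorphic_map (top_of_set \<Omega>) (subtopology (proj_top n) (\<gamma> ` \<Omega>)) \<gamma>"

definition smooth_projective_curve :: "nat \<Rightarrow> ppoint set \<Rightarrow> bool" where
  "smooth_projective_curve n C \<longleftrightarrow> smooth_projective_variety n C \<and> variety_dim n C = 1"

definition holomorphic_curve_map ::
  "nat \<Rightarrow> ppoint set \<Rightarrow> 'a complex_manifold \<Rightarrow> (ppoint \<Rightarrow> 'a) \<Rightarrow> bool" where
  "holomorphic_curve_map n C M f \<longleftrightarrow> continuous_map (subtopology (proj_top n) C) (mtop M) f \<and>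
     (\<forall>\<Omega> \<gamma>. inverse_chart n C \<Omega> \<gamma> \<longrightarrow> holomorphic_into M \<Omega> (f \<circ> \<gamma>))"

text \<open>The degree \<open>k\<close> part of the homogeneous coordinate ring of \<open>X\<close>, realised as functions
  on the affine cone (extended by zero), and its dimension.\<close>

definition coordinate_ring_part :: "nat \<Rightarrow> ppoint set \<Rightarrow> nat \<Rightarrow> ((nat \<Rightarrow> complex) \<Rightarrow> complex) set" where
  "coordinate_ring_part n X k = {(\<lambda>v. if v \<in> \<Union>X then mpoly_eval F v else 0) | F. F \<in> forms n k}"

definition hilbert_function :: "nat \<Rightarrow> ppoint set \<Rightarrow> nat \<Rightarrow> nat" where
  "hilbert_function n X k = cfun.dim (coordinate_ring_part n X k)"

text \<open>The genus of a smooth projective curve, as its arithmetic genus \<open>1 - P(0)\<close> with \<open>P\<close> the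
  Hilbert polynomial (arithmetic and geometric genus agree for such curves).\<close>

definition curve_has_genus :: "nat \<Rightarrow> ppoint set \<Rightarrow> int \<Rightarrow> bool" where
  "curve_has_genus n C g \<longleftrightarrow> (\<exists>P :: rat poly.
     (\<forall>\<^sub>F k in sequentially. of_nat (hilbert_function n C k) = poly P (of_nat k)) \<and>
     of_int g = 1 - poly P 0)"


section \<open>Rational and elliptic curves, approximate connectedness\<close>

definition rational_curve :: "'a complex_manifold \<Rightarrow> 'a set \<Rightarrow> bool" where
  "rational_curve M C \<longleftrightarrow> (\<exists>f. holomorphic_curve_map 1 (proj_space 1) M f \<and>
     \<not> f constant_on proj_space 1 \<and> C = f ` proj_space 1)"

definition elliptic_curve :: "'a complex_manifold \<Rightarrow> 'a set \<Rightarrow> bool" where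
  "elliptic_curve M C \<longleftrightarrow> (\<exists>n E f. smooth_projective_curve n E \<and> curve_has_genus n E 1 \<and>
     holomorphic_curve_map n E M f \<and> \<not> f constant_on E \<and> C = f ` E)"

definition elliptic_chain :: "'a complex_manifold \<Rightarrow> 'a set list \<Rightarrow> bool" where
  "elliptic_chain M Cs \<longleftrightarrow> Cs \<noteq> [] \<and> (\<forall>C\<in>set Cs. elliptic_curve M C) \<and>
     successively (\<lambda>C D. C \<inter> D \<noteq> {}) Cs"

definition naively_approx_rationally_connected :: "'a complex_manifold \<Rightarrow> 'a set \<Rightarrow> bool" where
  "naively_approx_rationally_connected M X \<longleftrightarrow>
     (\<forall>U. openin (mtop M) U \<and> X \<subseteq> U \<longrightarrow>
        (\<forall>x\<in>X. \<forall>y\<in>X. \<exists>C. rational_curve M C \<and> C \<subseteq> U \<and> x \<in> C \<and> y \<in> C))"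

definition naively_approx_elliptically_connected :: "'a complex_manifold \<Rightarrow> 'a set \<Rightarrow> bool" where
  "naively_approx_elliptically_connected M X \<longleftrightarrow>
     (\<forall>U. openin (mtop M) U \<and> X \<subseteq> U \<longrightarrow>
        (\<forall>x\<in>X. \<forall>y\<in>X. \<exists>Cs. elliptic_chain M Cs \<and> (\<forall>C\<in>set Cs. C \<subseteq> U) \<and>
           x \<in> hd Cs \<and> y \<in> last Cs))"

definition strongly_approx_rationally_connected :: "nat \<Rightarrow> ppoint set \<Rightarrow> bool" where
  "strongly_approx_rationally_connected n X \<longleftrightarrow>
     (\<forall>a b j. biprojective_embedding n X a b j \<longrightarrow>
        naively_approx_rationally_connected (prod_manifold (proj_manifold a) (proj_manifold b)) (j ` X))"

definition strongly_approx_elliptically_connected :: "nat \<Rightarrow> ppoint set \<Rightarrow> bool" where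
  "strongly_approx_elliptically_connected n X \<longleftrightarrow>
     (\<forall>a b j. biprojective_embedding n X a b j \<longrightarrow>
        naively_approx_elliptically_connected (prod_manifold (proj_manifold a) (proj_manifold b)) (j ` X))"


section \<open>Kobayashi hyperbolicity\<close>

definition poincare_dist :: "complex \<Rightarrow> complex \<Rightarrow> real" where
  "poincare_dist a b = 2 * artanh (cmod ((a - b) / (1 - cnj a * b)))"

text \<open>Chains of holomorphic discs \<open>f\<close> in \<open>Y\<close> with two marked parameters \<open>a\<close>, \<open>b\<close>. Since \<open>Y\<close> is
  a complex submanifold, holomorphic maps to \<open>Y\<close> are those to the ambient space with image in \<open>Y\<close>.\<close>

definition disc_chain ::
  "nat \<Rightarrow> ppoint set \<Rightarrow> ppoint \<Rightarrow> ppoint \<Rightarrow> ((complex \<Rightarrow> ppoint) \<times> complex \<times> complex) list \<Rightarrow> bool" where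
  "disc_chain n Y x y L \<longleftrightarrow> L \<noteq> [] \<and>
     (\<forall>(f, a, b)\<in>set L. holomorphic_into (proj_manifold n) (ball 0 1) f \<and> f ` ball 0 1 \<subseteq> Y \<and>
        a \<in> ball 0 1 \<and> b \<in> ball 0 1) \<and>
     (case hd L of (f, a, b) \<Rightarrow> f a = x) \<and>
     (case last L of (f, a, b) \<Rightarrow> f b = y) \<and>
     successively (\<lambda>(f, a, b) (g, c, d). f b = g c) L"

text \<open>For a smooth projective variety \<open>Y\<close> the infimum is over a nonempty set, as \<open>Y\<close> is connected.
  The value outside \<open>Y\<close> is irrelevant; it is \<open>0\<close> because the locale \<open>Metric_space\<close> requires
  nonnegativity and symmetry on the whole type.\<close>

definition kobayashi_pseudodist :: "nat \<Rightarrow> ppoint set \<Rightarrow> ppoint \<Rightarrow> ppoint \<Rightarrow> real" where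
  "kobayashi_pseudodist n Y x y = (if x \<in> Y \<and> y \<in> Y
     then Inf {(\<Sum>(f, a, b)\<leftarrow>L. poincare_dist a b) | L. disc_chain n Y x y L} else 0)"

definition kobayashi_hyperbolic :: "nat \<Rightarrow> ppoint set \<Rightarrow> bool" where
  "kobayashi_hyperbolic n Y \<longleftrightarrow> Metric_space Y (kobayashi_pseudodist n Y)"

end

(*
The graph of phi, embedded in the product of two projective spaces, is approximated by curves of the
given kind, and their projections to the second factor approximate Y.

If Y were hyperbolic, entire curves in ever smaller neighborhoods of Y, rescaled as in Brody's
theorem, would converge to a nonconstant entire curve in Y, along which the Kobayashi
pseudodistance vanishes. So every rational or elliptic curve has to be dominated by an entire curve.

For a smooth curve E of arithmetic genus one embedded by forms, the maximum principle bounds the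
dimension of the space of forms of degree k by one plus the number of zeros of a form. With the
Hilbert polynomial d k this shows that all forms of large degree k have exactly d k zeros, as many as
there are independent ones, so zeros can be prescribed. If some quotient of forms has a single simple
pole, its inverse is an entire curve. Otherwise quotients x, y of forms with poles of order two and
three at one point satisfy y^2 = cubic(x), and dx / (2 y) is a holomorphic form without zeros. Its
local primitives are charts that differ by translations, and they glue to an entire curve.
*)
theory Submission
 imports Defs "HOL-Complex_Analysis.Complex_Analysis" "HOL-Library.Diagonal_Subsequence"
begin

text \<open>Genus one is given only as the vanishing constant term of the Hilbert polynomial, so it
  enters through one number: in large degree k the forms on E have dimension d k, while zero
  counting alone allows one more. This defect of one makes prescribing zeros exact. The Jacobian
  criterion gives a tangent line, not a chart: n - 1 equations with independent differentials cut
  out an arc, and irreducibility is needed to see that the arc lies in E. Likewise E is only Zariski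
  irreducible; its connectedness is a result of the count, as two components would each carry d k
  zeros. Until then the arguments live on one component, which is Zariski dense. A quotient with a
  single simple pole would contradict genus one, but it is used rather than excluded; its absence
  makes the poles of orders two and three exact and prevents a singular cubic. The inverses of the
  primitives live on discs of one common radius, since E is compact, and therefore extend to the
  whole plane. A projected curve may shrink to a point: two distinct points on the projection rule
  this out, and such members of a chain are dropped.\<close>

abbreviation "hol_map n == holomorphic_into (proj_manifold n)"

section \<open>Forms and polynomials as functions\<close>

definition monom_fun :: "(nat \<Rightarrow>\<^sub>0 nat) => (nat => complex) => complex" where
 "monom_fun m v = (\<Prod>i\<in>Poly_Mapping.keys m. v i ^ Poly_Mapping.lookup m i)"

text \<open>Forms are handled as functions on coordinate vectors: products, powers and substitutions
  are then plain operations on functions, and a syntactic polynomial appears only as a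
  witness.\<close>

definition form_fun :: "nat => nat => ((nat => complex) => complex) => bool" where
 "form_fun n d f \<longleftrightarrow> (EX F:forms n d. f = mpoly_eval F)"

lemma mpoly_eval_superset:
 assumes "finite S" "Poly_Mapping.keys F <= S"
 shows "mpoly_eval F v = (\<Sum>m\<in>S. Poly_Mapping.lookup F m * monom_fun m v)"
 unfolding mpoly_eval_def monom_fun_def
 by (rule sum.mono_neutral_left) (use assms in "auto simp: in_keys_iff")

lemma monom_fun_superset:
 assumes "finite S" "Poly_Mapping.keys m <= S"
 shows "monom_fun m v = (\<Prod>i\<in>S. v i ^ Poly_Mapping.lookup m i)"
 unfolding monom_fun_def
 by (rule prod.mono_neutral_left) (use assms in "auto simp: in_keys_iff")

lemma form_funI: "F : forms n d ==> form_fun n d (mpoly_eval F)"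
 by (auto simp: form_fun_def)

lemma form_fun_zero: "form_fun n d (%_. 0)"
proof -
 have "0 : forms n d" by (simp add: forms_def)
 moreover have "mpoly_eval 0 = (%_. 0)" by (simp add: mpoly_eval_def fun_eq_iff)
 ultimately show ?thesis unfolding form_fun_def by metis
qed

lemma form_fun_add:
 assumes "form_fun n d f" "form_fun n d g"
 shows "form_fun n d (%v. f v + g v)"
proof -
 obtain F G where F: "F : forms n d" "f = mpoly_eval F" and G: "G : forms n d" "g = mpoly_eval G"
  using assms by (auto simp: form_fun_def)
 have "mpoly_eval (F + G) v = mpoly_eval F v + mpoly_eval G v" for v
 proof -
  let ?S = "Poly_Mapping.keys F \<union> Poly_Mapping.keys G"
  have "finite ?S" "Poly_Mapping.keys (F + G) <= ?S" using Poly_Mapping.keys_add by (simp, metis)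
  then have "mpoly_eval (F + G) v = (\<Sum>m\<in>?S. Poly_Mapping.lookup (F + G) m * monom_fun m v)"
   by (rule mpoly_eval_superset)
  also have "\<dots> = (\<Sum>m\<in>?S. Poly_Mapping.lookup F m * monom_fun m v)
    + (\<Sum>m\<in>?S. Poly_Mapping.lookup G m * monom_fun m v)"
   by (simp add: lookup_add distrib_right sum.distrib)
  also have "\<dots> = mpoly_eval F v + mpoly_eval G v"
   by (simp add: mpoly_eval_superset[of ?S])
  finally show ?thesis .
 qed
 moreover have "F + G : forms n d"
  using F(1) G(1) Poly_Mapping.keys_add[of F G] unfolding forms_def by blast
 ultimately show ?thesis unfolding form_fun_def F G by (auto intro!: bexI[of _ "F + G"])
qed

lemma form_fun_monom:
 assumes "Poly_Mapping.keys m <= {..n}" "(\<Sum>i\<in>Poly_Mapping.keys m. Poly_Mapping.lookup m i) = d"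
 shows "form_fun n d (%v. c * monom_fun m v)"
proof -
 have "Poly_Mapping.single m c : forms n d" using assms by (auto simp: forms_def)
 moreover have "mpoly_eval (Poly_Mapping.single m c) = (%v. c * monom_fun m v)"
 proof
  fix v
  show "mpoly_eval (Poly_Mapping.single m c) v = c * monom_fun m v"
   by (subst mpoly_eval_superset[of "{m}"]) auto
 qed
 ultimately show ?thesis unfolding form_fun_def by metis
qed

lemma form_fun_sum: "(!!i. i : S ==> form_fun n d (f i)) ==> form_fun n d (%v. \<Sum>i\<in>S. f i v)"
proof (induction S rule: infinite_finite_induct)
 case (insert x F)
 then show ?case by (simp add: form_fun_add)
qed (auto simp: form_fun_zero)

text \<open>Products, substitution and scaling of forms are checked on monomials through this
  expansion.\<close>

lemma form_fun_expand:
 assumes "form_fun n d f"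
 obtains S c where "finite S"
  "!!m. m : S ==> Poly_Mapping.keys m <= {..n} & (\<Sum>i\<in>Poly_Mapping.keys m. Poly_Mapping.lookup m i) = d"
  "f = (%v. \<Sum>m\<in>S. c m * monom_fun m v)"
proof -
 obtain F where F: "F : forms n d" "f = mpoly_eval F" using assms by (auto simp: form_fun_def)
 show ?thesis
  by (rule that[of "Poly_Mapping.keys F" "Poly_Mapping.lookup F"])
    (use F in "auto simp: forms_def mpoly_eval_def monom_fun_def fun_eq_iff")
qed

lemma monom_fun_add: "monom_fun (m + m') v = monom_fun m v * monom_fun m' v"
proof -
 let ?S = "Poly_Mapping.keys m \<union> Poly_Mapping.keys m'"
 have "finite ?S" "Poly_Mapping.keys (m + m') <= ?S" using Poly_Mapping.keys_add by (simp, metis)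
 then have "monom_fun (m + m') v = (\<Prod>i\<in>?S. v i ^ Poly_Mapping.lookup (m + m') i)"
  by (rule monom_fun_superset)
 also have "\<dots> = monom_fun m v * monom_fun m' v"
  by (simp add: lookup_add power_add prod.distrib monom_fun_superset[of ?S])
 finally show ?thesis .
qed

lemma degree_superset:
 assumes "finite S" "Poly_Mapping.keys m <= S"
 shows "(\<Sum>i\<in>Poly_Mapping.keys m. Poly_Mapping.lookup m i) = (\<Sum>i\<in>S. Poly_Mapping.lookup (m :: nat \<Rightarrow>\<^sub>0 nat) i)"
 by (rule sum.mono_neutral_left) (use assms in "auto simp: in_keys_iff")

lemma degree_add:
 "(\<Sum>i\<in>Poly_Mapping.keys (m + m'). Poly_Mapping.lookup (m + m') i) =
  (\<Sum>i\<in>Poly_Mapping.keys m. Poly_Mapping.lookup m i) +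
  (\<Sum>i\<in>Poly_Mapping.keys m'. Poly_Mapping.lookup (m' :: nat \<Rightarrow>\<^sub>0 nat) i)"
proof -
 define S where "S = Poly_Mapping.keys m \<union> Poly_Mapping.keys m'"
 have S: "finite S" "Poly_Mapping.keys (m + m') <= S" "Poly_Mapping.keys m <= S" "Poly_Mapping.keys m' <= S"
  unfolding S_def by (rule finite_UnI[OF finite_keys finite_keys] Poly_Mapping.keys_add Un_upper1 Un_upper2)+
 show ?thesis
  unfolding degree_superset[OF S(1,2)] degree_superset[OF S(1,3)] degree_superset[OF S(1,4)]
  by (simp add: lookup_add sum.distrib)
qed

lemma form_fun_mult:
 assumes "form_fun n d f" "form_fun n e g"
 shows "form_fun n (d + e) (%v. f v * g v)"
proof -
 obtain S c where S: "finite S"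
  "!!m. m : S ==> Poly_Mapping.keys m <= {..n} & (\<Sum>i\<in>Poly_Mapping.keys m. Poly_Mapping.lookup m i) = d"
  "f = (%v. \<Sum>m\<in>S. c m * monom_fun m v)" using form_fun_expand[OF assms(1)] by blast
 obtain T c' where T: "finite T"
  "!!m. m : T ==> Poly_Mapping.keys m <= {..n} & (\<Sum>i\<in>Poly_Mapping.keys m. Poly_Mapping.lookup m i) = e"
  "g = (%v. \<Sum>m\<in>T. c' m * monom_fun m v)" using form_fun_expand[OF assms(2)] by blast
 have "f v * g v = (\<Sum>m\<in>S. \<Sum>m'\<in>T. (c m * c' m') * monom_fun (m + m') v)" for v
  unfolding S T sum_product by (intro sum.cong refl) (simp add: monom_fun_add)
 moreover have "form_fun n (d + e) (%v. \<Sum>m\<in>S. \<Sum>m'\<in>T. (c m * c' m') * monom_fun (m + m') v)"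
 proof (intro form_fun_sum form_fun_monom)
  fix m m' assume "m : S" "m' : T"
  then show "Poly_Mapping.keys (m + m') <= {..n}"
   using S(2) T(2) Poly_Mapping.keys_add[of m m'] by blast
  show "(\<Sum>i\<in>Poly_Mapping.keys (m + m'). Poly_Mapping.lookup (m + m') i) = d + e"
   using S(2)[OF \<open>m : S\<close>] T(2)[OF \<open>m' : T\<close>] by (simp add: degree_add)
 qed
 ultimately show ?thesis by simp
qed

lemma form_fun_const: "form_fun n 0 (%_. c)"
 using form_fun_monom[of 0 n 0 c] by (simp add: monom_fun_def)

lemma form_fun_coord: "i <= n ==> form_fun n 1 (%v. v i)"
 using form_fun_monom[of "Poly_Mapping.single i 1" n 1 1] by (simp add: monom_fun_def)

lemma form_fun_cmult: "form_fun n d f ==> form_fun n d (%v. c * f v)"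
 using form_fun_mult[OF form_fun_const] by fastforce

lemma form_fun_diff: "form_fun n d f ==> form_fun n d g ==> form_fun n d (%v. f v - g v)"
 using form_fun_add[OF _ form_fun_cmult[of n d g "-1"]] by simp

lemma form_fun_power: "form_fun n d f ==> form_fun n (k * d) (%v. f v ^ k)"
proof (induction k)
 case 0 then show ?case using form_fun_const[of n 1] by simp
next
 case (Suc k) then show ?case using form_fun_mult[of n d f "k * d"] by simp
qed

lemma form_fun_prod:
 "(!!i. i : S ==> form_fun n (d i) (f i)) ==> form_fun n (\<Sum>i\<in>S. d i) (%v. \<Prod>i\<in>S. f i v)"
proof (induction S rule: infinite_finite_induct)
 case (insert x F)
 then show ?case by (simp add: form_fun_mult)
qed (use form_fun_const[of n 1] in auto)

lemma form_fun_subst: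
 assumes "form_fun n d f" "!!i. i <= n ==> form_fun n' e (g i)"
 shows "form_fun n' (d * e) (%v. f (%i. g i v))"
proof -
 obtain S c where S: "finite S"
  "!!m. m : S ==> Poly_Mapping.keys m <= {..n} & (\<Sum>i\<in>Poly_Mapping.keys m. Poly_Mapping.lookup m i) = d"
  "f = (%v. \<Sum>m\<in>S. c m * monom_fun m v)" using form_fun_expand[OF assms(1)] by blast
 show ?thesis unfolding S(3)
 proof (intro form_fun_sum form_fun_cmult)
  fix m assume m: "m : S"
  have "form_fun n' (\<Sum>i\<in>Poly_Mapping.keys m. Poly_Mapping.lookup m i * e)
    (%v. \<Prod>i\<in>Poly_Mapping.keys m. g i v ^ Poly_Mapping.lookup m i)"
   using S(2)[OF m] assms(2) by (intro form_fun_prod form_fun_power) auto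
  then show "form_fun n' (d * e) (%v. monom_fun m (%i. g i v))"
   using S(2)[OF m] by (simp add: monom_fun_def sum_distrib_right[symmetric])
 qed
qed

lemma form_fun_depends:
 assumes "form_fun n d f" "!!i. i <= n ==> v i = w i"
 shows "f v = f w"
proof -
 obtain S c where S: "finite S"
  "!!m. m : S ==> Poly_Mapping.keys m <= {..n} & (\<Sum>i\<in>Poly_Mapping.keys m. Poly_Mapping.lookup m i) = d"
  "f = (%v. \<Sum>m\<in>S. c m * monom_fun m v)" using form_fun_expand[OF assms(1)] by blast
 have "monom_fun m v = monom_fun m w" if "m : S" for m
  unfolding monom_fun_def by (rule prod.cong) (use S(2)[OF that] assms(2) in auto)
 then show ?thesis unfolding S(3) by simp
qed

lemma form_fun_homogeneous:
 assumes "form_fun n d f"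
 shows "f (%i. c * v i) = c ^ d * f v"
proof -
 obtain S k where S: "finite S"
  "!!m. m : S ==> Poly_Mapping.keys m <= {..n} & (\<Sum>i\<in>Poly_Mapping.keys m. Poly_Mapping.lookup m i) = d"
  "f = (%v. \<Sum>m\<in>S. k m * monom_fun m v)" using form_fun_expand[OF assms(1)] by blast
 have "monom_fun m (%i. c * v i) = c ^ d * monom_fun m v" if "m : S" for m
  using S(2)[OF that] unfolding monom_fun_def
  by (auto simp: power_mult_distrib prod.distrib power_sum[symmetric])
 then show ?thesis unfolding S(3) by (simp add: sum_distrib_left algebra_simps)
qed

lemma form_fun_cscale: "form_fun n d f ==> f (cscale c v) = c ^ d * f v"
 by (simp add: cscale_def form_fun_homogeneous)

section \<open>Inhomogeneous polynomials in the coordinates 0, ..., n\<close>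

inductive poly_fun :: "nat => ((nat => complex) => complex) => bool" for n where
 const: "poly_fun n (%_. c)"
| coord: "i <= n ==> poly_fun n (%v. v i)"
| add: "poly_fun n f ==> poly_fun n g ==> poly_fun n (%v. f v + g v)"
| mult: "poly_fun n f ==> poly_fun n g ==> poly_fun n (%v. f v * g v)"

lemma poly_fun_cmult: "poly_fun n f ==> poly_fun n (%v. c * f v)"
 using poly_fun.mult[OF poly_fun.const] by fastforce

lemma poly_fun_diff: "poly_fun n f ==> poly_fun n g ==> poly_fun n (%v. f v - g v)"
 using poly_fun.add[OF _ poly_fun_cmult[of n g "-1"]] by simp

lemma poly_fun_sum: "(!!i. i : S ==> poly_fun n (f i)) ==> poly_fun n (%v. \<Sum>i\<in>S. f i v)"
 by (induction S rule: infinite_finite_induct) (auto intro: poly_fun.intros)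

lemma poly_fun_prod: "(!!i. i : S ==> poly_fun n (f i)) ==> poly_fun n (%v. \<Prod>i\<in>S. f i v)"
 by (induction S rule: infinite_finite_induct) (auto intro: poly_fun.intros)

lemma poly_fun_power: "poly_fun n f ==> poly_fun n (%v. f v ^ k)"
 by (induction k) (auto intro: poly_fun.intros)

lemma form_fun_poly_fun:
 assumes "form_fun n d f" shows "poly_fun n f"
proof -
 obtain S c where S: "finite S"
  "!!m. m : S ==> Poly_Mapping.keys m <= {..n} & (\<Sum>i\<in>Poly_Mapping.keys m. Poly_Mapping.lookup m i) = d"
  "f = (%v. \<Sum>m\<in>S. c m * monom_fun m v)" using form_fun_expand[OF assms(1)] by blast
 show ?thesis unfolding S(3) monom_fun_def
  by (intro poly_fun_sum poly_fun_cmult poly_fun_prod poly_fun_power poly_fun.coord) (use S(2) in auto)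
qed

text \<open>Equations found in the chart \<open>v k = 1\<close> have to be read as forms.
  Multiplying by a power of \<open>v k\<close> does this; nothing is claimed where
  \<open>v k = 0\<close>.\<close>

lemma poly_fun_homogenize:
 assumes "poly_fun n f" "k <= n"
 obtains d g where "form_fun n d g" "!!v. v k ~= 0 ==> g v = v k ^ d * f (%i. v i / v k)"
proof -
 from assms have "EX d g. form_fun n d g & (ALL v. v k ~= 0 --> g v = v k ^ d * f (%i. v i / v k))"
 proof (induction rule: poly_fun.induct)
  case (const c)
  then show ?case using form_fun_const[of n c] by (intro exI[of _ 0] exI[of _ "%_. c"]) simp
 next
  case (coord i)
  then show ?case using form_fun_coord[of i n] by (intro exI[of _ 1] exI[of _ "%v. v i"]) simp
 next
  case (add f g)
  then obtain d e F G where F: "form_fun n d F" "!!v. v k ~= 0 ==> F v = v k ^ d * f (%i. v i / v k)"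
   and G: "form_fun n e G" "!!v. v k ~= 0 ==> G v = v k ^ e * g (%i. v i / v k)" by metis
  \<comment> \<open>The summands may have different degrees; each is padded with the power of
    \<open>v k\<close> given by the degree of the other.\<close>
  have 1: "form_fun n (e + d) (%v. v k ^ e * F v)" "form_fun n (e + d) (%v. v k ^ d * G v)"
   using form_fun_mult[OF form_fun_power[OF form_fun_coord[OF \<open>k <= n\<close>], of e] F(1)]
    form_fun_mult[OF form_fun_power[OF form_fun_coord[OF \<open>k <= n\<close>], of d] G(1)]
   by (simp_all add: add.commute)
  show ?case
   by (rule exI[of _ "e + d"], rule exI, rule conjI[OF form_fun_add[OF 1]])
     (simp add: F(2) G(2) power_add algebra_simps)
 next
  case (mult f g)
  then obtain d e F G where F: "form_fun n d F" "!!v. v k ~= 0 ==> F v = v k ^ d * f (%i. v i / v k)"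
   and G: "form_fun n e G" "!!v. v k ~= 0 ==> G v = v k ^ e * g (%i. v i / v k)" by metis
  show ?case
   by (rule exI[of _ "d + e"], rule exI, rule conjI[OF form_fun_mult[OF F(1) G(1)]])
     (simp add: F(2) G(2) power_add algebra_simps)
 qed
 then show ?thesis using that by blast
qed

lemma poly_fun_continuous: "poly_fun n f ==> continuous_on A f"
 by (induction rule: poly_fun.induct) (auto intro!: continuous_intros continuous_on_coordinatewise_then_product
   intro: continuous_on_product_coordinates continuous_on_subset)

lemma poly_fun_tendsto:
 assumes "poly_fun n f" "!!i. i <= n ==> ((%t. g t i) \<longlongrightarrow> c i) F"
 shows "((%t. f (g t)) \<longlongrightarrow> f c) F"
 using assms by (induction rule: poly_fun.induct) (auto intro!: tendsto_intros)

lemma poly_fun_holomorphic: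
 assumes "poly_fun n f" "!!i. i <= n ==> (%t. g t i) holomorphic_on A"
 shows "(%t. f (g t)) holomorphic_on A"
 using assms by (induction rule: poly_fun.induct) (auto intro!: holomorphic_intros)

lemma poly_fun_depends:
 assumes "poly_fun n f" "!!i. i <= n ==> v i = w i"
 shows "f v = f w"
 using assms by (induction rule: poly_fun.induct) auto

section \<open>Points of projective space\<close>

lemma proj_pt_self: "v : proj_pt v"
 by (auto simp: proj_pt_def cscale_def intro!: exI[of _ 1])

lemma proj_pt_eq: "proj_pt v = proj_pt w \<longleftrightarrow> (EX c. c ~= 0 & v = cscale c w)"
proof
 assume "proj_pt v = proj_pt w"
 then have "v : proj_pt w" using proj_pt_self by auto
 then show "EX c. c ~= 0 & v = cscale c w" by (auto simp: proj_pt_def)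
next
 assume "EX c. c ~= 0 & v = cscale c w"
 then obtain c where c: "c ~= 0" "v = cscale c w" by auto
 have "x : proj_pt w" if "x : proj_pt v" for x
 proof -
  obtain b where "b ~= 0" "x = cscale b v" using \<open>x : proj_pt v\<close> unfolding proj_pt_def by blast
  then have "x = cscale (b * c) w" "b * c ~= 0" using c by (auto simp: cscale_def mult.assoc)
  then show ?thesis unfolding proj_pt_def by blast
 qed
 moreover have "x : proj_pt v" if "x : proj_pt w" for x
 proof -
  obtain b where "b ~= 0" "x = cscale b w" using \<open>x : proj_pt w\<close> unfolding proj_pt_def by blast
  then have "x = cscale (b / c) v" "b / c ~= 0" using c by (auto simp: cscale_def)
  then show ?thesis unfolding proj_pt_def by blast
 qed
 ultimately show "proj_pt v = proj_pt w" by blast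
qed

lemma proj_pt_cscale: "c ~= 0 ==> proj_pt (cscale c v) = proj_pt v"
 by (subst proj_pt_eq) auto

lemma proj_space_point:
 assumes "p : proj_space n" "v : p"
 shows "p = proj_pt v" "v : coord_vectors n"
proof -
 obtain w where w: "w : coord_vectors n" "p = proj_pt w" using assms by (auto simp: proj_space_def)
 obtain c where c: "c ~= 0" "v = cscale c w" using assms w by (auto simp: proj_pt_def)
 show "p = proj_pt v" using c w proj_pt_cscale by metis
 show "v : coord_vectors n" using w c by (auto simp: coord_vectors_def cscale_def fun_eq_iff)
qed

lemma proj_spaceI: "v : coord_vectors n ==> proj_pt v : proj_space n"
 by (auto simp: proj_space_def)

lemma proj_space_nonempty_pt: "p : proj_space n ==> EX v. v : p"
 using proj_pt_self by (auto simp: proj_space_def)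

lemma coord_vectors_nonzero:
 assumes "v : coord_vectors n" shows "EX i<=n. v i ~= 0"
proof (rule ccontr)
 assume "\<not> (EX i<=n. v i ~= 0)"
 then have "v i = 0" for i using assms by (cases "i <= n") (auto simp: coord_vectors_def)
 then have "v = (%_. 0)" by blast
 then show False using assms by (simp add: coord_vectors_def)
qed

text \<open>The 2 x 2 minors turn equality of points into polynomial equations. These pass to limits
  and are accessible to the identity theorem, although a point has no canonical coordinate
  vector.\<close>

lemma proj_pt_eq_minors:
 assumes "v : coord_vectors n" "w : coord_vectors n"
 shows "proj_pt v = proj_pt w \<longleftrightarrow> (ALL i<=n. ALL j<=n. v i * w j = v j * w i)"
proof
 assume "proj_pt v = proj_pt w"
 then obtain c where "v = cscale c w" by (auto simp: proj_pt_eq)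
 then show "ALL i<=n. ALL j<=n. v i * w j = v j * w i" by (auto simp: cscale_def)
next
 assume *: "ALL i<=n. ALL j<=n. v i * w j = v j * w i"
 obtain k where k: "k <= n" "w k ~= 0" using coord_vectors_nonzero assms by blast
 have "v = cscale (v k / w k) w"
 proof
  fix i show "v i = cscale (v k / w k) w i"
  proof (cases "i <= n")
   case True then show ?thesis using * k by (simp add: cscale_def field_simps)
  next
   case False then show ?thesis using assms by (simp add: cscale_def coord_vectors_def)
  qed
 qed
 moreover have "v k / w k ~= 0"
 proof
  assume "v k / w k = 0"
  then have "v = cscale 0 w" using calculation by metis
  then show False using assms by (simp add: coord_vectors_def cscale_def fun_eq_iff)
 qed
 ultimately show "proj_pt v = proj_pt w" using proj_pt_eq by blast
qed

lemma form_fun_vanish_point: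
 assumes "form_fun n d f" "p : proj_space n" "v : p" "w : p"
 shows "f v = 0 \<longleftrightarrow> f w = 0"
proof -
 have "p = proj_pt v" using proj_space_point assms by blast
 then show ?thesis using assms form_fun_cscale[OF assms(1)] by (auto simp: proj_pt_def)
qed

section \<open>Zariski closed sets, described by the functions of their equations\<close>

lemma zariski_closed_sub: "zariski_closed n X ==> X <= proj_space n"
 by (auto simp: zariski_closed_def)

lemma zariski_closedI:
 assumes "!!f. f : S ==> EX d. form_fun n d f"
  "!!p. p : X \<longleftrightarrow> p : proj_space n & (ALL f:S. ALL v:p. f v = 0)"
 shows "zariski_closed n X"
proof -
 let ?T = "{F : (\<Union>d. forms n d). mpoly_eval F : S}"
 have "X = {p : proj_space n. ALL F:?T. vanishes_at F p}"
 proof (intro set_eqI)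
  fix p
  have "(ALL f:S. ALL v:p. f v = 0) \<longleftrightarrow> (ALL F:?T. vanishes_at F p)"
  proof
   assume *: "ALL F:?T. vanishes_at F p"
   show "ALL f:S. ALL v:p. f v = 0"
   proof
    fix f assume "f : S"
    then obtain d where "form_fun n d f" using assms(1) by blast
    then obtain F where "F : forms n d" "f = mpoly_eval F"
     by (auto simp: form_fun_def)
    then have "F : ?T" using \<open>f : S\<close> by auto
    then show "ALL v:p. f v = 0" using * \<open>f = mpoly_eval F\<close> unfolding vanishes_at_def by blast
   qed
  qed (auto simp: vanishes_at_def)
  then show "p : X \<longleftrightarrow> p : {p : proj_space n. ALL F:?T. vanishes_at F p}"
   using assms(2) by blast
 qed
 then show ?thesis unfolding zariski_closed_def by blast
qed

lemma zariski_closedE: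
 assumes "zariski_closed n X"
 obtains S where "!!f. f : S ==> EX d. form_fun n d f"
  "!!p. p : X \<longleftrightarrow> p : proj_space n & (ALL f:S. ALL v:p. f v = 0)"
proof -
 obtain T where T: "T <= (\<Union>d. forms n d)" "X = {p : proj_space n. ALL F:T. vanishes_at F p}"
  using assms by (auto simp: zariski_closed_def)
 show ?thesis
  by (rule that[of "mpoly_eval ` T"]) (use T in "auto simp: vanishes_at_def intro: form_funI")
qed

lemma zariski_closed_separate:
 assumes "zariski_closed n X" "p : proj_space n" "p \<notin> X"
 obtains d f where "form_fun n d f" "!!q v. q : X ==> v : q ==> f v = 0" "!!v. v : p ==> f v ~= 0"
proof -
 obtain S where S: "!!f. f : S ==> EX d. form_fun n d f"
  "!!p. p : X \<longleftrightarrow> p : proj_space n & (ALL f:S. ALL v:p. f v = 0)"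
  using zariski_closedE[OF assms(1)] by blast
 obtain f w where f: "f : S" "w : p" "f w ~= 0" using S(2) assms by blast
 obtain d where d: "form_fun n d f" using S(1) f by blast
 show ?thesis
  by (rule that[OF d]) (use f d S(2) form_fun_vanish_point[OF d assms(2)] in blast)+
qed

lemma zariski_closed_zeros:
 assumes "zariski_closed n X" "form_fun n d f"
 shows "zariski_closed n {p : X. ALL v:p. f v = 0}"
proof -
 obtain S where S: "!!f. f : S ==> EX d. form_fun n d f"
  "!!p. p : X \<longleftrightarrow> p : proj_space n & (ALL f:S. ALL v:p. f v = 0)"
  using zariski_closedE[OF assms(1)] by blast
 show ?thesis
  by (rule zariski_closedI[of "insert f S"]) (use S assms in auto)
qed

lemma zariski_closed_Un:
 assumes "zariski_closed n X" "zariski_closed n Y"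
 shows "zariski_closed n (X \<union> Y)"
proof -
 obtain S where S: "!!f. f : S ==> EX d. form_fun n d f"
  "!!p. p : X \<longleftrightarrow> p : proj_space n & (ALL f:S. ALL v:p. f v = 0)"
  using zariski_closedE[OF assms(1)] by blast
 obtain T where T: "!!f. f : T ==> EX d. form_fun n d f"
  "!!p. p : Y \<longleftrightarrow> p : proj_space n & (ALL f:T. ALL v:p. f v = 0)"
  using zariski_closedE[OF assms(2)] by blast
 let ?U = "{(%v. f v * g v) | f g. f : S & g : T}"
 show ?thesis
 proof (rule zariski_closedI[of ?U])
  show "EX d. form_fun n d h" if h: "h : ?U" for h
  proof -
   obtain f g where fg: "h = (%v. f v * g v)" "f : S" "g : T" using h by blast
   obtain d e where "form_fun n d f" "form_fun n e g" using S(1)[OF fg(2)] T(1)[OF fg(3)] by blast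
   then show ?thesis unfolding fg(1) using form_fun_mult by blast
  qed
  fix p
  show "p : X \<union> Y \<longleftrightarrow> p : proj_space n & (ALL f:?U. ALL v:p. f v = 0)"
  proof
   assume R: "p : proj_space n & (ALL f:?U. ALL v:p. f v = 0)"
   show "p : X \<union> Y"
   proof (rule ccontr)
    assume "p \<notin> X \<union> Y"
    then obtain f v g w where *: "f : S" "v : p" "f v ~= 0" "g : T" "w : p" "g w ~= 0"
     using R S(2)[of p] T(2)[of p] by auto
    obtain e where "form_fun n e g" using T(1) * by blast
    then have "g v ~= 0" using form_fun_vanish_point[of n e g p v w] * R by auto
    moreover have "(%v. f v * g v) : ?U" using *(1,4) by (intro CollectI exI[of _ f] exI[of _ g] conjI refl)
    then have "f v * g v = 0" using conjunct2[OF R] *(2) by (drule_tac bspec) auto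
    ultimately show False using * by simp
   qed
  next
   assume "p : X \<union> Y"
   then show "p : proj_space n & (ALL f:?U. ALL v:p. f v = 0)" using S(2)[of p] T(2)[of p] by auto
  qed
 qed
qed

lemma zariski_closed_singleton:
 assumes "p : proj_space n" shows "zariski_closed n {p}"
proof -
 obtain w where w: "w : coord_vectors n" "p = proj_pt w" using assms by (auto simp: proj_space_def)
 let ?S = "{(%v. v i * w j - v j * w i) | i j. i <= n & j <= n}"
 show ?thesis
 proof (rule zariski_closedI[of ?S])
  show "EX d. form_fun n d f" if f: "f : ?S" for f
  proof -
   obtain i j where "f = (%v. v i * w j - v j * w i)" "i <= n" "j <= n" using f by blast
   then have "f = (%v. w j * v i - w i * v j)" by (simp add: mult.commute)
   then show ?thesis using \<open>i <= n\<close> \<open>j <= n\<close>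
    by (auto intro!: exI[of _ 1] form_fun_diff form_fun_cmult form_fun_coord[unfolded One_nat_def])
  qed
  fix q
  have "q = p \<longleftrightarrow> (ALL i<=n. ALL j<=n. ALL v:q. v i * w j = v j * w i)" if q: "q : proj_space n"
  proof -
   obtain v where v: "v : q" using q proj_space_nonempty_pt by blast
   then have "q = proj_pt v" "!!u. u : q ==> u : coord_vectors n & q = proj_pt u"
    using proj_space_point q by blast+
   then show ?thesis using w proj_pt_eq_minors[OF _ w(1)] v by metis
  qed
  then show "q : {p} \<longleftrightarrow> q : proj_space n & (ALL f:?S. ALL v:q. f v = 0)"
   using assms by fastforce
 qed
qed

lemma projective_variety_singleton:
 assumes "p : proj_space n" shows "projective_variety n {p}"
 using zariski_closed_singleton[OF assms] unfolding projective_variety_def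
 by (auto simp: singleton_Un_iff)

lemma variety_dim_ge:
 assumes "!!i. i <= k ==> projective_variety n (Z i) & Z i <= X" "!!i. i < k ==> Z i \<subset> Z (Suc i)"
 shows "enat k <= variety_dim n X"
 unfolding variety_dim_def by (rule Sup_upper) (use assms in auto)

text \<open>A chain of length at least one begins with a nonempty closed set that is properly
  contained in the next one.\<close>

lemma variety_dim_pos_two_points:
 assumes "variety_dim n X > 0"
 obtains p q where "p : X" "q : X" "p ~= q"
proof -
 have "\<not> variety_dim n X <= 0" using assms by simp
 then obtain k Z where k: "enat k > 0" "ALL i<=k. projective_variety n (Z i) & Z i <= X"
   "ALL i<k. Z i \<subset> Z (Suc i)"
  unfolding variety_dim_def by (auto simp: Sup_le_iff zero_enat_def)
 then have "0 < k" by (simp add: zero_enat_def)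
 then have "Z 0 \<subset> Z 1" "Z 0 ~= {}" "Z 1 <= X" using k by (auto simp: projective_variety_def Suc_le_eq)
 then show ?thesis using that by blast
qed

section \<open>The topology of projective space\<close>

lemma holomorphic_on_locally:
 assumes "!!z. z : S ==> EX e>0. f holomorphic_on ball z e"
 shows "f holomorphic_on S"
 unfolding holomorphic_on_def
proof
 fix z assume "z : S"
 then obtain e where "e > 0" "f holomorphic_on ball z e" using assms by blast
 then have "f field_differentiable at z"
  by (auto intro: holomorphic_on_imp_differentiable_at)
 then show "f field_differentiable at z within S" by (rule field_differentiable_at_within)
qed

lemma continuous_map_proj_pt: "continuous_map (top_of_set (coord_vectors n)) (proj_top n) proj_pt"
 unfolding continuous_map_def topspace_proj_top openin_proj_top by (auto intro: proj_spaceI)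

lemma openin_proj_top_scale_invariant:
 assumes "!!v c. c ~= 0 ==> Q (cscale c v) = Q v"
  and "openin (top_of_set (coord_vectors n)) {v : coord_vectors n. Q v}"
 shows "openin (proj_top n) {p : proj_space n. ALL v:p. Q v}"
proof -
 have "{v : coord_vectors n. proj_pt v : {p : proj_space n. ALL v:p. Q v}} = {v : coord_vectors n. Q v}"
 proof (intro set_eqI iffI)
  fix v assume "v : {v : coord_vectors n. Q v}"
  then show "v : {v : coord_vectors n. proj_pt v : {p : proj_space n. ALL v:p. Q v}}"
   using assms(1) proj_spaceI[of v n] by (auto simp: proj_pt_def)
 qed (use proj_pt_self in auto)
 then show ?thesis using assms(2) unfolding openin_proj_top by auto
qed

lemma openin_coord_vectors:
 assumes "open {v. Q v}" shows "openin (top_of_set (coord_vectors n)) {v : coord_vectors n. Q v}"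
proof -
 have "{v : coord_vectors n. Q v} = coord_vectors n \<inter> {v. Q v}" by auto
 then show ?thesis using openin_open_Int[OF assms] by simp
qed

lemma continuous_coord: "continuous_on A (%v::nat => complex. v i)"
 by (rule continuous_on_subset[OF continuous_on_product_coordinates]) auto

lemma openin_form_nonzero:
 assumes "form_fun n d f"
 shows "openin (proj_top n) {p : proj_space n. ALL v:p. f v ~= 0}"
proof (rule openin_proj_top_scale_invariant)
 show "(f (cscale c v) ~= 0) = (f v ~= 0)" if "c ~= 0" for c v
  using that form_fun_cscale[OF assms] by simp
 have "open (f -` (- {0}))"
  by (rule open_vimage) (use poly_fun_continuous[OF form_fun_poly_fun[OF assms]] in auto)
 then have "open {v. f v ~= 0}" by (simp add: vimage_def Compl_eq)
 then show "openin (top_of_set (coord_vectors n)) {v : coord_vectors n. f v ~= 0}"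
  by (rule openin_coord_vectors)
qed

lemma openin_affine_chart:
 assumes "k <= n" shows "openin (proj_top n) {p : proj_space n. ALL v:p. v k ~= 0}"
 using openin_form_nonzero[OF form_fun_coord[OF assms]] .

lemma zariski_closed_closedin:
 assumes "zariski_closed n X" shows "closedin (proj_top n) X"
proof -
 have "EX T. openin (proj_top n) T & p : T & T <= proj_space n - X" if p: "p : proj_space n - X" for p
 proof -
  obtain d f where f: "form_fun n d f" "!!q v. q : X ==> v : q ==> f v = 0" "!!v. v : p ==> f v ~= 0"
   using zariski_closed_separate[OF assms, of p] p by blast
  have "q : proj_space n ==> ALL v:q. f v ~= 0 ==> q \<notin> X" for q
   using f(2) proj_space_nonempty_pt by blast
  then show ?thesis
   using openin_form_nonzero[OF f(1)] p f(3)
   by (intro exI[of _ "{p : proj_space n. ALL v:p. f v ~= 0}"]) auto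
 qed
 then have "openin (proj_top n) (proj_space n - X)" by (subst openin_subopen) blast
 then show ?thesis
  unfolding closedin_def topspace_proj_top using zariski_closed_sub[OF assms] by blast
qed

text \<open>The unit sphere for the maximum norm. This norm fits the product topology: the sphere is
  a closed subset of a product of discs and single points, hence compact, and it maps onto
  projective space.\<close>

definition unit_vectors :: "nat => (nat => complex) set" where
 "unit_vectors n = {v. (ALL i<=n. cmod (v i) <= 1) & (EX i<=n. cmod (v i) = 1) & (ALL i>n. v i = 0)}"

lemma unit_vectors_coord: "v : unit_vectors n ==> v : coord_vectors n"
 unfolding unit_vectors_def coord_vectors_def by fastforce

lemma compact_unit_vectors: "compact (unit_vectors n)"
proof -
 let ?B = "PiE UNIV (%i. if i <= n then cball (0::complex) 1 else {0})"
 have "compactin (product_topology (%i. euclidean) UNIV) ?B"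
  by (subst compactin_PiE) auto
 then have 1: "compact ?B" by (simp add: euclidean_product_topology)
 have "closed {v::nat => complex. cmod (v i) = 1}" for i
  by (intro closed_Collect_eq continuous_intros continuous_coord)
 then have "closed (\<Union>i\<in>{..n}. {v::nat => complex. cmod (v i) = 1})" by (intro closed_UN) auto
 moreover have "unit_vectors n = ?B \<inter> (\<Union>i\<in>{..n}. {v. cmod (v i) = 1})"
  unfolding unit_vectors_def by (auto simp: PiE_iff split: if_splits)
 ultimately show ?thesis using 1 by (simp add: compact_Int_closed)
qed

lemma unit_vector_exists:
 assumes "v : coord_vectors n"
 obtains c where "c > 0" "cscale (of_real c) v : unit_vectors n"
  "!!i. i <= n ==> cmod (v i) <= 1 / c"
proof -
 define m where "m = Max ((%i. cmod (v i)) ` {..n})"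
 have le: "cmod (v i) <= m" if "i <= n" for i using that unfolding m_def by (intro Max_ge) auto
 have "m : (%i. cmod (v i)) ` {..n}" unfolding m_def by (rule Max_in) auto
 then obtain k where k: "k <= n" "cmod (v k) = m" by auto
 obtain i where "i <= n" "v i ~= 0" using coord_vectors_nonzero[OF assms] by blast
 then have "m > 0" using le[of i] by (meson zero_less_norm_iff less_le_trans)
 show ?thesis
 proof (rule that[of "1 / m"])
  show "cscale (of_real (1 / m)) v : unit_vectors n"
   using \<open>m > 0\<close> le k assms
   by (auto simp: unit_vectors_def cscale_def norm_divide coord_vectors_def intro!: exI[of _ k])
 qed (use \<open>m > 0\<close> le in auto)
qed

lemma unit_vector_of_point:
 assumes "p : proj_space n" obtains v where "v : p" "v : unit_vectors n"
proof -
 obtain w where w: "w : coord_vectors n" "p = proj_pt w" using assms by (auto simp: proj_space_def)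
 obtain c where "c > 0" "cscale (complex_of_real c) w : unit_vectors n" using unit_vector_exists[OF w(1)] by blast
 moreover from this have "cscale (complex_of_real c) w : p" unfolding w proj_pt_def by auto
 ultimately show ?thesis using that by blast
qed

lemma compact_space_proj_top: "compact_space (proj_top n)"
proof -
 have "proj_pt ` unit_vectors n = proj_space n"
 proof
  show "proj_pt ` unit_vectors n <= proj_space n" using unit_vectors_coord proj_spaceI by blast
  show "proj_space n <= proj_pt ` unit_vectors n"
  proof
   fix p assume p: "p : proj_space n"
   then obtain v where "v : p" "v : unit_vectors n" by (rule unit_vector_of_point)
   then show "p : proj_pt ` unit_vectors n" using proj_space_point(1)[OF p] by blast
  qed
 qed
 moreover have "compactin (top_of_set (coord_vectors n)) (unit_vectors n)"
  using compact_unit_vectors unit_vectors_coord by (auto simp: compactin_subtopology)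
 ultimately show ?thesis
  unfolding compact_space_def topspace_proj_top
  using image_compactin[OF _ continuous_map_proj_pt] by metis
qed

lemma zariski_closed_compactin: "zariski_closed n X ==> compactin (proj_top n) X"
 using zariski_closed_closedin closedin_compact_space compact_space_proj_top by blast

section \<open>Holomorphic maps to projective space\<close>

lemma affine_coord_eq:
 assumes "p : proj_space n" "v : p" "v k ~= 0"
 shows "affine_coord k i p = v i / v k"
proof -
 have "(SOME v. v : p) : p" using assms(2) by (rule someI[of "%v. v : p"])
 moreover have "p = proj_pt v" using proj_space_point assms by blast
 ultimately obtain c where "c ~= 0" "(SOME v. v : p) = cscale c v" by (auto simp: proj_pt_def)
 then show ?thesis unfolding affine_coord_def by (simp add: cscale_def)
qed

lemma chart_point_iff: "(ALL w:proj_pt v. w k ~= 0) \<longleftrightarrow> v k ~= 0"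
 using proj_pt_self[of v] by (auto simp: proj_pt_def cscale_def)

lemma continuous_coords:
 assumes "!!i. i <= n ==> continuous_on A (%t. v t i)" "!!t. t : A ==> v t : coord_vectors n"
 shows "continuous_on A v"
proof (rule continuous_on_coordinatewise_then_product)
 fix i show "continuous_on A (%x. v x i)"
 proof (cases "i <= n")
  case False
  then have "v x i = 0" if "x : A" for x using assms(2)[OF that] by (simp add: coord_vectors_def)
  then show ?thesis using continuous_on_cong[of A A "%x. v x i" "%_. 0"] by simp
 qed (use assms in auto)
qed

text \<open>Local homogeneous lifts replace charts: continuity comes from the quotient map
  \<open>proj_pt\<close>, and every affine coordinate is a quotient of two entries of the
  lift.\<close>

lemma holomorphic_intoI:
 assumes "open Om"
  and loc: "!!z. z : Om ==> EX e>0. EX v. ball z e <= Om & (ALL i<=n. (%t. v t i) holomorphic_on ball z e) \<and>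
    (ALL t:ball z e. v t : coord_vectors n & g t = proj_pt (v t))"
 shows "hol_map n Om g"
proof -
 have inP: "g z : proj_space n" if z: "z : Om" for z
 proof -
  obtain e v where "e > 0" "ALL t:ball z e. v t : coord_vectors n & g t = proj_pt (v t)"
   using loc[OF z] by blast
  then show ?thesis using proj_spaceI[of "v z" n] by auto
 qed
 have cont: "continuous_map (top_of_set Om) (proj_top n) g"
  unfolding continuous_map_def topspace_proj_top
 proof (intro conjI allI impI)
  show "g : topspace (top_of_set Om) \<rightarrow> proj_space n" using inP by simp
  fix U assume U: "openin (proj_top n) U"
  obtain T where T: "open T" "{v : coord_vectors n. proj_pt v : U} = coord_vectors n \<inter> T"
   using U unfolding openin_proj_top openin_open by blast
  have "open {z : Om. g z : U}"
  proof (subst open_subopen, intro ballI)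
   fix z assume z: "z : {z : Om. g z : U}"
   then obtain e v where e: "e > 0" "ball z e <= Om" "ALL i<=n. (%t. v t i) holomorphic_on ball z e"
    "ALL t:ball z e. v t : coord_vectors n & g t = proj_pt (v t)" using loc[of z] by blast
   have "continuous_on (ball z e) v"
    by (rule continuous_coords[of n]) (use e in "auto intro: holomorphic_on_imp_continuous_on")
   then have op: "open (ball z e \<inter> v -` T)"
    by (rule continuous_open_preimage[OF _ open_ball T(1)])
   have iff: "g t : U \<longleftrightarrow> v t : T" if "t : ball z e" for t
   proof -
    have "v t : {v : coord_vectors n. proj_pt v : U} \<longleftrightarrow> v t : coord_vectors n \<inter> T"
     by (simp only: T(2))
    then show ?thesis using e(4)[rule_format, OF that] by simp
   qed
   show "EX T. open T & z : T & T <= {z : Om. g z : U}"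
    by (rule exI[of _ "ball z e \<inter> v -` T"]) (use op z e(1,2) iff in auto)
  qed
  then show "openin (top_of_set Om) {x : topspace (top_of_set Om). g x : U}"
   using assms(1) by (simp add: openin_open_eq Collect_conj_eq)
 qed
 have hol: "(affine_coord k i \<circ> g) holomorphic_on {z : Om. g z : {p : proj_space n. ALL v:p. v k ~= 0}}"
  if ki: "k <= n" "i <= n" for k i
 proof (rule holomorphic_on_locally)
  fix z assume z: "z : {z : Om. g z : {p : proj_space n. ALL v:p. v k ~= 0}}"
  then obtain e v where e: "e > 0" "ball z e <= Om" "ALL i<=n. (%t. v t i) holomorphic_on ball z e"
    "ALL t:ball z e. v t : coord_vectors n & g t = proj_pt (v t)" using loc[of z] by blast
  have "v z k ~= 0" using z e proj_pt_self[of "v z"] by auto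
  moreover have "continuous_on (ball z e) (%t. v t k)"
   using e ki by (auto intro: holomorphic_on_imp_continuous_on)
  ultimately obtain d where d: "d > 0" "!!t. t : ball z e ==> dist z t < d ==> v t k ~= 0"
   using continuous_on_avoid[of "ball z e" "%t. v t k" z 0] e(1) by auto
  have h: "(%t. v t j) holomorphic_on ball z (min e d)" if "j <= n" for j
   by (rule holomorphic_on_subset[of _ "ball z e"]) (use e that in auto)
  have "(%t. v t i / v t k) holomorphic_on ball z (min e d)"
   by (rule holomorphic_on_divide[OF h h]) (use ki d in auto)
  moreover have "v t i / v t k = (affine_coord k i \<circ> g) t" if t: "t : ball z (min e d)" for t
   using affine_coord_eq[of "g t" n "v t" k i] e(4) d(2) t proj_pt_self[of "v t"] proj_spaceI[of "v t" n] by auto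
  ultimately have "(affine_coord k i \<circ> g) holomorphic_on ball z (min e d)"
   by (rule holomorphic_transform)
  then show "EX e>0. (affine_coord k i \<circ> g) holomorphic_on ball z e"
   using e(1) d(1) by (intro exI[of _ "min e d"]) auto
 qed
 show ?thesis
  unfolding holomorphic_into_def proj_manifold_def using assms(1) cont hol by auto
qed

lemma holomorphic_into_proj_space:
 assumes "hol_map n Om g" "z : Om" shows "g z : proj_space n"
proof -
 have "continuous_map (top_of_set Om) (proj_top n) g"
  using assms by (simp add: holomorphic_into_def proj_manifold_def)
 then show ?thesis using assms(2) by (auto simp: continuous_map_def topspace_proj_top Pi_iff)
qed

text \<open>Converse of \<open>holomorphic_intoI\<close>: the affine coordinates of the chart
  \<open>k\<close>, completed by 1 at position \<open>k\<close>, form a lift. The normalisation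
  determines the lift, so that lifts from different sources can be compared.\<close>

lemma holomorphic_into_lift_chart:
 assumes g: "hol_map n Om g" and z: "z : Om"
  and k: "k <= n" "!!w. w : g z ==> w k ~= 0"
 obtains e v where "e > 0" "ball z e <= Om" "!!i. (%t. v t i) holomorphic_on ball z e"
  "!!t. t : ball z e ==> v t : coord_vectors n" "!!t. t : ball z e ==> v t k = 1"
  "!!t. t : ball z e ==> g t = proj_pt (v t)"
proof -
 let ?U = "{p : proj_space n. ALL v:p. v k ~= 0}"
 have op: "open Om" and cont: "continuous_map (top_of_set Om) (proj_top n) g"
  using g by (auto simp: holomorphic_into_def proj_manifold_def)
 have hol: "(affine_coord k i \<circ> g) holomorphic_on {z : Om. g z : ?U}" if "i <= n" "i ~= k" for i
 proof -
  have "(?U, {affine_coord k i | i. i <= n & i ~= k}) : charts (proj_manifold n)"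
   unfolding proj_manifold_def using k(1) by auto
  moreover have "affine_coord k i : {affine_coord k i | i. i <= n & i ~= k}" using that by blast
  ultimately show ?thesis using g unfolding holomorphic_into_def by (auto dest!: bspec)
 qed
 have "openin (top_of_set Om) {z : Om. g z : ?U}"
  using openin_continuous_map_preimage[OF cont openin_affine_chart[OF k(1)]] by simp
 then have "open {z : Om. g z : ?U}" using op openin_open_trans by blast
 moreover have "z : {z : Om. g z : ?U}" using z k holomorphic_into_proj_space[OF g z] by auto
 ultimately obtain e where e: "e > 0" "ball z e <= {z : Om. g z : ?U}"
  by (meson open_contains_ball)
 define v where "v = (%t i. if i <= n then if i = k then 1 else affine_coord k i (g t) else 0)"
 have v: "v t = (%i. w i / w k)" if t: "t : ball z e" "w : g t" for t w
 proof
  fix i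
  have gt: "g t : proj_space n" "w k ~= 0" "w : coord_vectors n"
   using t e(2) proj_space_point(2)[of "g t" n w] by auto
  show "v t i = w i / w k"
   unfolding v_def using affine_coord_eq[OF gt(1) t(2) gt(2)] gt k(1) by (auto simp: coord_vectors_def)
 qed
 have v2: "v t : coord_vectors n & v t k = 1 & g t = proj_pt (v t)" if t: "t : ball z e" for t
 proof -
  have gt: "g t : proj_space n" using t e(2) by auto
  obtain w where w: "w : g t" using proj_space_nonempty_pt[OF gt] by blast
  have wk: "w k ~= 0" "w : coord_vectors n" "g t = proj_pt w"
   using w t e(2) proj_space_point[OF gt w] by auto
  have "v t = cscale (1 / w k) w" using v[OF t w] by (simp add: cscale_def)
  then have "g t = proj_pt (v t)" using wk proj_pt_cscale by simp
  moreover have "v t : g t" using calculation proj_pt_self by auto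
  ultimately show ?thesis using proj_space_point(2)[OF gt] k(1) by (auto simp: v_def)
 qed
 have "(%t. v t i) holomorphic_on ball z e" for i
 proof (cases "i <= n & i ~= k")
  case True
  then have "(affine_coord k i \<circ> g) holomorphic_on ball z e"
   using hol e(2) holomorphic_on_subset by blast
  then show ?thesis using True by (simp add: v_def o_def)
 next
  case False
  then consider "i = k" | "\<not> i <= n" by blast
  then have "v t i = (if i = k then 1 else 0)" for t
   by cases (use k(1) in "simp_all add: v_def")
  then show ?thesis by simp
 qed
 then show ?thesis using that[of e v] e v2 by blast
qed

lemma holomorphic_into_lift:
 assumes g: "hol_map n Om g" and z: "z : Om"
 obtains e v where "e > 0" "ball z e <= Om" "!!i. (%t. v t i) holomorphic_on ball z e"
  "!!t. t : ball z e ==> v t : coord_vectors n"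
  "!!t. t : ball z e ==> g t = proj_pt (v t)"
proof -
 obtain w where w: "w : coord_vectors n" "g z = proj_pt w"
  using holomorphic_into_proj_space[OF g z] by (auto simp: proj_space_def)
 then obtain k where "k <= n" "w k ~= 0" using coord_vectors_nonzero by blast
 then show ?thesis
  using holomorphic_into_lift_chart[OF g z, of k thesis] chart_point_iff[of w k] w(2) that by blast
qed

lemma holomorphic_into_open: "holomorphic_into M Om g ==> open Om"
 by (simp add: holomorphic_into_def)

lemma holomorphic_into_cong:
 assumes "hol_map n Om g" "!!z. z : Om ==> h z = g z"
 shows "hol_map n Om h"
proof (rule holomorphic_intoI)
 show "open Om" using assms(1) by (rule holomorphic_into_open)
 fix z assume z: "z : Om"
 obtain e v where "e > 0" "ball z e <= Om" "!!i. (%t. v t i) holomorphic_on ball z e"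
  "!!t. t : ball z e ==> v t : coord_vectors n"
  "!!t. t : ball z e ==> g t = proj_pt (v t)" using holomorphic_into_lift[OF assms(1) z] by blast
 then show "EX e>0. EX v. ball z e <= Om & (ALL i<=n. (%t. v t i) holomorphic_on ball z e) \<and>
    (ALL t:ball z e. v t : coord_vectors n & h t = proj_pt (v t))"
  using assms(2) by (intro exI[of _ e] exI[of _ v] conjI) auto
qed

lemma holomorphic_into_local:
 assumes "open Om" "!!z. z : Om ==> EX e>0. ball z e <= Om & hol_map n (ball z e) g"
 shows "hol_map n Om g"
proof (rule holomorphic_intoI)
 show "open Om" by fact
 fix z assume z: "z : Om"
 obtain d where d: "d > 0" "ball z d <= Om" "hol_map n (ball z d) g"
  using assms(2)[OF z] by blast
 obtain e v where "e > 0" "ball z e <= ball z d" "!!i. (%t. v t i) holomorphic_on ball z e"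
  "!!t. t : ball z e ==> v t : coord_vectors n"
  "!!t. t : ball z e ==> g t = proj_pt (v t)"
  using holomorphic_into_lift[OF d(3), of z] d(1) centre_in_ball by metis
 then show "EX e>0. EX v. ball z e <= Om & (ALL i<=n. (%t. v t i) holomorphic_on ball z e) \<and>
    (ALL t:ball z e. v t : coord_vectors n & g t = proj_pt (v t))"
  using d(2) by (intro exI[of _ e] exI[of _ v] conjI) auto
qed

lemma holomorphic_into_compose:
 assumes g: "hol_map n Om g" and s: "s holomorphic_on A" "open A" "s ` A <= Om"
 shows "hol_map n A (g \<circ> s)"
proof (rule holomorphic_intoI)
 show "open A" by fact
 fix z assume z: "z : A"
 obtain e v where e: "e > 0" "ball (s z) e <= Om" "!!i. (%t. v t i) holomorphic_on ball (s z) e"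
  "!!t. t : ball (s z) e ==> v t : coord_vectors n"
  "!!t. t : ball (s z) e ==> g t = proj_pt (v t)" using holomorphic_into_lift[OF g, of "s z"] s(3) z by blast
 have "open (A \<inter> s -` ball (s z) e)"
  by (rule continuous_open_preimage[OF holomorphic_on_imp_continuous_on[OF s(1)] s(2) open_ball])
 then obtain d where d: "d > 0" "ball z d <= A \<inter> s -` ball (s z) e"
  using z e(1) by (metis Int_iff centre_in_ball open_contains_ball vimageI)
 have "((%t. v t i) \<circ> s) holomorphic_on ball z d" for i
  by (rule holomorphic_on_compose_gen[OF _ e(3)])
    (use d s(1) holomorphic_on_subset in "blast+")
 then show "EX e>0. EX v. ball z e <= A & (ALL i<=n. (%t. v t i) holomorphic_on ball z e) \<and>
    (ALL t:ball z e. v t : coord_vectors n & (g \<circ> s) t = proj_pt (v t))"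
  using d e by (intro exI[of _ d] exI[of _ "v \<circ> s"] conjI) (auto simp: o_def)
qed

lemma holomorphic_into_subset:
 assumes "hol_map n Om g" "open A" "A <= Om"
 shows "hol_map n A g"
 using holomorphic_into_compose[OF assms(1) holomorphic_on_ident assms(2)] assms(3) by (simp add: o_def)

text \<open>The connectedness argument behind the identity theorem in the plane: the set of centres
  of discs on which \<open>P\<close> holds is open, and \<open>step\<close> makes its complement
  open.\<close>

lemma connected_spread:
 fixes P :: "complex => bool"
 assumes "connected Om" "open Om"
  and step: "!!z. z : Om ==> EX e>0. ball z e <= Om \<and>
   (ALL W. open W & W <= ball z e & W ~= {} & (ALL t:W. P t) --> (ALL t:ball z e. P t))"
  and start: "open W" "W <= Om" "W ~= {}" "!!t. t : W ==> P t"
  and "t : Om"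
 shows "P t"
proof -
 define A where "A = {z : Om. EX e>0. ball z e <= Om & (ALL t:ball z e. P t)}"
 have opA: "open A"
 proof (subst open_contains_ball, intro ballI)
  fix z assume "z : A"
  then obtain e where e: "e > 0" "ball z e <= Om" "ALL t:ball z e. P t" by (auto simp: A_def)
  have "ball z e <= A"
  proof
   fix y assume y: "y : ball z e"
   then obtain d where "d > 0" "ball y d <= ball z e" by (meson open_ball open_contains_ball)
   then show "y : A" unfolding A_def using e y by blast
  qed
  then show "EX e>0. ball z e <= A" using e(1) by blast
 qed
 have opB: "open (Om - A)"
 proof (subst open_contains_ball, intro ballI)
  fix z assume z: "z : Om - A"
  then obtain e where e: "e > 0" "ball z e <= Om"
   "ALL W. open W & W <= ball z e & W ~= {} & (ALL t:W. P t) --> (ALL t:ball z e. P t)"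
   using step[of z] by blast
  have "ball z e \<inter> A = {}"
  proof (rule ccontr)
   assume "ball z e \<inter> A ~= {}"
   moreover have "open (ball z e \<inter> A)" using opA by blast
   moreover have "ALL t:ball z e \<inter> A. P t" unfolding A_def using centre_in_ball by blast
   ultimately have "ALL t:ball z e. P t" using e(3)[THEN spec, of "ball z e \<inter> A"] by blast
   then show False using z e(1,2) by (auto simp: A_def)
  qed
  then show "EX e>0. ball z e <= Om - A" using e(1,2) by blast
 qed
 have "A ~= {}"
 proof -
  obtain z where "z : W" using start(3) by blast
  then obtain e where "e > 0" "ball z e <= W" using start(1) by (meson open_contains_ball)
  then have "z : A" unfolding A_def using start(2,4) \<open>z : W\<close> by blast
  then show ?thesis by blast
 qed
 moreover have "A <= Om" by (auto simp: A_def)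
 ultimately have "A = Om"
  using connectedD[OF assms(1) opA opB] by blast
 then have "t : A" using \<open>t : Om\<close> by simp
 then show ?thesis unfolding A_def using centre_in_ball by blast
qed

lemma holomorphic_zero_spread:
 assumes "f holomorphic_on ball z e" "open W" "W <= ball z e" "W ~= {}" "!!t. t : W ==> f t = 0"
  "t : ball z e"
 shows "f t = 0"
 using analytic_continuation_open[OF assms(2) open_ball assms(4) connected_ball assms(3) assms(1), of "%_. 0"]
  assms(5,6) by simp

text \<open>Two maps agree exactly where all minors of their lifts vanish, and on a common disc
  these minors are holomorphic functions.\<close>

theorem holomorphic_into_identity:
 assumes g: "hol_map n Om g" and h: "hol_map n Om h"
  and "connected Om" "open W" "W <= Om" "W ~= {}" "!!t. t : W ==> g t = h t" "t : Om"
 shows "g t = h t"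
proof (rule connected_spread[where P = "%t. g t = h t"])
 show "open Om" using g by (rule holomorphic_into_open)
 fix z assume z: "z : Om"
 obtain e v where e: "e > 0" "ball z e <= Om" "!!i. (%t. v t i) holomorphic_on ball z e"
  "!!t. t : ball z e ==> v t : coord_vectors n"
  "!!t. t : ball z e ==> g t = proj_pt (v t)" using holomorphic_into_lift[OF g z] by blast
 obtain d w where d: "d > 0" "ball z d <= Om" "!!i. (%t. w t i) holomorphic_on ball z d"
  "!!t. t : ball z d ==> w t : coord_vectors n"
  "!!t. t : ball z d ==> h t = proj_pt (w t)" using holomorphic_into_lift[OF h z] by blast
 define r where "r = min e d"
 have r: "r > 0" "ball z r <= ball z e" "ball z r <= ball z d" using e(1) d(1) by (auto simp: r_def)
 have eq: "g t = h t \<longleftrightarrow> (ALL i<=n. ALL j<=n. v t i * w t j = v t j * w t i)" if t: "t : ball z r" for t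
  using proj_pt_eq_minors[of "v t" n "w t"] e(4,5)[OF subsetD[OF r(2) t]] d(4,5)[OF subsetD[OF r(3) t]] by simp
 have hol: "(%t. v t i * w t j - v t j * w t i) holomorphic_on ball z r" for i j
  by (intro holomorphic_intros holomorphic_on_subset[OF e(3)] holomorphic_on_subset[OF d(3)] r)
 have "ALL t:ball z r. g t = h t"
  if W: "open W" "W <= ball z r" "W ~= {}" "ALL t:W. g t = h t" for W
 proof
  fix t assume t: "t : ball z r"
  have "v t i * w t j - v t j * w t i = 0" if "i <= n" "j <= n" for i j
  proof (rule holomorphic_zero_spread[OF hol W(1-3) _ t])
   fix s assume s: "s : W"
   then show "v s i * w s j - v s j * w s i = 0" using eq[of s] W(2,4) that by auto
  qed
  then show "g t = h t" using eq[OF t] by auto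
 qed
 then show "EX e>0. ball z e <= Om \<and>
   (ALL W. open W & W <= ball z e & W ~= {} & (ALL t:W. g t = h t) --> (ALL t:ball z e. g t = h t))"
  using r e(2) by (intro exI[of _ r]) auto
qed (use assms in auto)

section \<open>Morphisms and graphs\<close>

lemma variety_morphism_iff:
 "variety_morphism n X m Y \<phi> \<longleftrightarrow> \<phi> ` X <= Y \<and>
   (ALL p:X. EX Z d f. zariski_closed n Z & p \<notin> Z & (ALL i<=m. form_fun n d (f i)) \<and>
    (ALL q:X - Z. ALL v:q. (EX i<=m. f i v ~= 0) & \<phi> q = proj_pt (%i. if i <= m then f i v else 0)))"
 (is "_ \<longleftrightarrow> _ & (ALL p:X. ?Q p)")
proof -
 have "(EX Z d F. zariski_closed n Z & p \<notin> Z & (ALL i<=m. F i : forms n d) \<and>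
    (ALL q:X - Z. ALL v:q. (EX i<=m. mpoly_eval (F i) v ~= 0) \<and>
      \<phi> q = proj_pt (%i. if i <= m then mpoly_eval (F i) v else 0))) \<longleftrightarrow> ?Q p" (is "?P \<longleftrightarrow> _") for p
 proof
  assume ?P
  then obtain Z d F where 1: "zariski_closed n Z" "p \<notin> Z" "ALL i<=m. F i : forms n d"
   "ALL q:X - Z. ALL v:q. (EX i<=m. mpoly_eval (F i) v ~= 0) \<and>
      \<phi> q = proj_pt (%i. if i <= m then mpoly_eval (F i) v else 0)" by blast
  show "?Q p"
   by (rule exI[of _ Z], rule exI[of _ d], rule exI[of _ "%i. mpoly_eval (F i)"])
     (use 1 in "simp add: form_funI")
 next
  assume "?Q p"
  then obtain Z d f where 1: "zariski_closed n Z" "p \<notin> Z" "ALL i<=m. form_fun n d (f i)"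
   "ALL q:X - Z. ALL v:q. (EX i<=m. f i v ~= 0) & \<phi> q = proj_pt (%i. if i <= m then f i v else 0)" by blast
  have "ALL i. EX F. i <= m --> F : forms n d & f i = mpoly_eval F" using 1(3) by (auto simp: form_fun_def)
  then obtain F where F: "!!i. i <= m ==> F i : forms n d & f i = mpoly_eval (F i)" by metis
  have eq: "(%i. if i <= m then mpoly_eval (F i) v else 0) = (%i. if i <= m then f i v else 0)" for v
   using F by auto
  have ex: "(EX i<=m. mpoly_eval (F i) v ~= 0) \<longleftrightarrow> (EX i<=m. f i v ~= 0)" for v
   using F by auto
  show ?P
   by (rule exI[of _ Z], rule exI[of _ d], rule exI[of _ F]) (use 1 F in "simp add: eq ex")
 qed
 then show ?thesis unfolding variety_morphism_def by simp
qed

lemma variety_morphismE: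
 assumes "variety_morphism n X m Y \<phi>" "p : X"
 obtains Z d f where "zariski_closed n Z" "p \<notin> Z" "ALL i<=m. form_fun n d (f i)"
  "ALL q:X - Z. ALL v:q. (EX i<=m. f i v ~= 0) & \<phi> q = proj_pt (%i. if i <= m then f i v else 0)"
 using assms(1)[unfolded variety_morphism_iff, THEN conjunct2, THEN bspec, OF assms(2)]
 by (elim exE conjE) (rule that)

text \<open>Substituting the forms of \<phi> into those of \<psi> represents the composition away
  from two sets: the one where the representation of \<phi> fails and the preimage of the one where
  that of \<psi> fails. The preimage is again closed because its equations are substituted
  forms.\<close>

lemma variety_morphism_compose:
 assumes X: "X <= proj_space n" and Y: "Y <= proj_space m"
  and \<phi>: "variety_morphism n X m Y \<phi>" and \<psi>: "variety_morphism m Y N W \<psi>"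
 shows "variety_morphism n X N W (\<psi> \<circ> \<phi>)"
 unfolding variety_morphism_iff
proof (intro conjI ballI)
 have "\<phi> ` X <= Y" "\<psi> ` Y <= W" using \<phi> \<psi> by (simp_all add: variety_morphism_def)
 then show "(\<psi> \<circ> \<phi>) ` X <= W" by auto
 fix p assume p: "p : X"
 then have \<phi>p: "\<phi> p : Y" using \<phi> unfolding variety_morphism_def by auto
 obtain Z d f where f: "zariski_closed n Z" "p \<notin> Z" "ALL i<=m. form_fun n d (f i)"
   "ALL q:X - Z. ALL v:q. (EX i<=m. f i v ~= 0) & \<phi> q = proj_pt (%i. if i <= m then f i v else 0)"
  using variety_morphismE[OF \<phi> p] .
 obtain Z' e g where g: "zariski_closed m Z'" "\<phi> p \<notin> Z'" "ALL i<=N. form_fun m e (g i)"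
   "ALL q:Y - Z'. ALL v:q. (EX i<=N. g i v ~= 0) & \<psi> q = proj_pt (%i. if i <= N then g i v else 0)"
  using variety_morphismE[OF \<psi> \<phi>p] .
 obtain S where S: "!!h. h : S ==> EX d. form_fun m d h"
  "!!p. p : Z' \<longleftrightarrow> p : proj_space m & (ALL h:S. ALL v:p. h v = 0)"
  using zariski_closedE[OF g(1)] by blast
 define fv where "fv = (%v i. if i <= m then f i v else 0)"
 let ?S = "(%h v. h (%i. f i v)) ` S"
 have Sform: "EX d. form_fun n d k" if "k : ?S" for k
  using that S(1) form_fun_subst[of m _ _ n d f] f(3) by blast
 define V where "V = {q : proj_space n. ALL h:?S. ALL v:q. h v = 0}"
 have V: "zariski_closed n V" by (rule zariski_closedI[of ?S]) (use Sform in "auto simp: V_def")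
 have heq: "h (%i. f i v) = h (fv v)" if "form_fun m c h" for h v c
  by (rule form_fun_depends[OF that]) (simp add: fv_def)
 have fvp: "\<phi> q = proj_pt (fv v) & fv v : \<phi> q" if "q : X - Z" "v : q" for q v
  using f(4) that proj_pt_self unfolding fv_def by auto
 have key: "\<phi> q \<notin> Z'" if q: "q : X - (Z \<union> V)" for q
 proof
  assume a: "\<phi> q : Z'"
  have "h (%i. f i v) = 0" if hv: "h : S" "v : q" for h v
  proof -
   obtain c where "form_fun m c h" using S(1) hv by blast
   then have "h (%i. f i v) = h (fv v)" by (rule heq)
   also have "\<dots> = 0" using a S(2) fvp[of q v] q hv by blast
   finally show ?thesis .
  qed
  then have "q : V" using q X unfolding V_def by auto
  then show False using q by blast
 qed
 have pV: "p \<notin> V"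
 proof
  assume pV: "p : V"
  have pm: "\<phi> p : proj_space m" using \<phi>p Y by blast
  obtain v where v: "v : p" using proj_space_nonempty_pt p X by blast
  have "h w = 0" if hw: "h : S" "w : \<phi> p" for h w
  proof -
   obtain c where c: "form_fun m c h" using S(1) hw by blast
   have "h (fv v) = 0" using pV v hw(1) heq[OF c] unfolding V_def by auto
   then show ?thesis using form_fun_vanish_point[OF c pm _ hw(2)] fvp[of p v] p f(2) v by blast
  qed
  then have "\<phi> p : Z'" using S(2) pm by blast
  then show False using g(2) by blast
 qed
 show "EX Z d f. zariski_closed n Z & p \<notin> Z & (ALL i<=N. form_fun n d (f i)) \<and>
   (ALL q:X - Z. ALL v:q. (EX i<=N. f i v ~= 0) & (\<psi> \<circ> \<phi>) q = proj_pt (%i. if i <= N then f i v else 0))"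
 proof (rule exI[of _ "Z \<union> V"], rule exI[of _ "e * d"], rule exI[of _ "%i v. g i (%j. f j v)"],
   intro conjI allI impI ballI)
  show "zariski_closed n (Z \<union> V)" using zariski_closed_Un f(1) V by blast
  show "p \<notin> Z \<union> V" using f(2) pV by blast
  show "form_fun n (e * d) ((%i v. g i (%j. f j v)) i)" if "i <= N" for i
   using form_fun_subst[of m e "g i" n d f] g(3) f(3) that by blast
  fix q v assume qv: "q : X - (Z \<union> V)" "v : q"
  have eq: "g i (%j. f j v) = g i (fv v)" if "i <= N" for i using heq g(3) that by blast
  have "\<phi> q : Y - Z'" using key[OF qv(1)] qv(1) \<phi> unfolding variety_morphism_def by blast
  then have *: "(EX i<=N. g i (fv v) ~= 0) & \<psi> (\<phi> q) = proj_pt (%i. if i <= N then g i (fv v) else 0)"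
   using g(4) fvp[of q v] qv by blast
  then show "EX i<=N. (%i v. g i (%j. f j v)) i v ~= 0" using eq by auto
  have "(%i. if i <= N then g i (%j. f j v) else 0) = (%i. if i <= N then g i (fv v) else 0)"
   using eq by auto
  then show "(\<psi> \<circ> \<phi>) q = proj_pt (%i. if i <= N then (%i v. g i (%j. f j v)) i v else 0)" using * by simp
 qed
qed

section \<open>Segre coordinates of a pair of points\<close>

definition segre_vec :: "nat => nat => (nat => complex) => (nat => complex) => nat => complex" where
 "segre_vec a b v w = (%k. if k < (a + 1) * (b + 1) then v (k div (b + 1)) * w (k mod (b + 1)) else 0)"

lemma segre_index_less: "i <= a ==> j <= b ==> i * (b + 1) + j < (a + 1) * (b + 1)" for a b :: nat
proof -
 assume "i <= a" "j <= b"
 then have "i * (b + 1) <= a * (b + 1)" by (intro mult_right_mono) auto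
 then show ?thesis using \<open>j <= b\<close> by simp
qed

lemma segre_index_split:
 fixes a b k :: nat
 assumes "k < (a + 1) * (b + 1)"
 shows "k div (b + 1) <= a" "k mod (b + 1) <= b" "k = (k div (b + 1)) * (b + 1) + k mod (b + 1)"
proof -
 have "k div (b + 1) < a + 1" using assms by (simp add: less_mult_imp_div_less)
 then show "k div (b + 1) <= a" by simp
 have "k mod (b + 1) < b + 1" by simp
 then show "k mod (b + 1) <= b" by linarith
qed (rule div_mult_mod_eq[symmetric])

lemma segre_vec_index: "i <= a ==> j <= b ==> segre_vec a b v w (i * (b + 1) + j) = v i * w j"
 using segre_index_less[of i a j b] unfolding segre_vec_def
 by (simp del: add_Suc_right add_Suc One_nat_def add: div_add1_eq mod_add_eq)

lemma segre_eq:
 assumes "p = proj_pt v" "q = proj_pt w"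
 shows "segre a b (p, q) = proj_pt (segre_vec a b v w)"
proof -
 have eq: "segre_vec a b (cscale c v) (cscale d w) = cscale (c * d) (segre_vec a b v w)" for c d
  by (auto simp: segre_vec_def cscale_def fun_eq_iff)
 have "segre a b (p, q) = {segre_vec a b v' w' | v' w'. v' : p & w' : q}"
  unfolding segre_def segre_vec_def by simp
 also have "\<dots> = {segre_vec a b (cscale c v) (cscale d w) | c d. c ~= 0 & d ~= 0}"
  unfolding assms proj_pt_def by blast
 also have "\<dots> = {cscale c (segre_vec a b v w) | c. c ~= 0}"
 proof (intro set_eqI iffI)
  fix x assume "x : {segre_vec a b (cscale c v) (cscale d w) | c d. c ~= 0 & d ~= 0}"
  then show "x : {cscale c (segre_vec a b v w) | c. c ~= 0}" unfolding eq by force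
 next
  fix x assume "x : {cscale c (segre_vec a b v w) | c. c ~= 0}"
  then obtain c where "c ~= 0" "x = cscale (c * 1) (segre_vec a b v w)" by auto
  then show "x : {segre_vec a b (cscale c v) (cscale d w) | c d. c ~= 0 & d ~= 0}"
   unfolding eq[symmetric] by (intro CollectI exI[of _ c] exI[of _ 1]) simp
 qed
 finally show ?thesis unfolding proj_pt_def .
qed

lemma segre_vec_coord:
 assumes "v : coord_vectors a" "w : coord_vectors b"
 shows "segre_vec a b v w : coord_vectors ((a + 1) * (b + 1) - 1)"
proof -
 obtain i where i: "i <= a" "v i ~= 0" using coord_vectors_nonzero[OF assms(1)] by blast
 obtain j where j: "j <= b" "w j ~= 0" using coord_vectors_nonzero[OF assms(2)] by blast
 have "segre_vec a b v w (i * (b + 1) + j) ~= 0" using segre_vec_index[OF i(1) j(1)] i j by simp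
 then have "segre_vec a b v w ~= (%_. 0)" by metis
 then show ?thesis unfolding coord_vectors_def by (auto simp: segre_vec_def)
qed

text \<open>The graph of a morphism is closed in the product: where the morphism is given by forms
 \<open>f\<^sub>i\<close>, the graph is cut out by \<open>w\<^sub>i f\<^sub>j(v) = w\<^sub>j f\<^sub>i(v)\<close>, and multiplying by the forms that vanish on
 the locus where this representation is not valid makes the equations global.\<close>

locale graph =
 fixes n N :: nat and X :: "ppoint set" and W :: "ppoint set" and \<phi> :: "ppoint => ppoint"
 assumes X: "zariski_closed n X" and W: "W <= proj_space N"
  and morph: "variety_morphism n X N W \<phi>"
begin

abbreviation "K \<equiv> (n + 1) * (N + 1) - 1"
abbreviation "idx i j \<equiv> i * (N + 1) + j"
definition "h = segre n N \<circ> (%x. (x, \<phi> x))"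

lemma phi_mem: "x : X ==> \<phi> x : proj_space N"
 using morph W unfolding variety_morphism_def by blast

lemma h_eq:
 assumes "x : X" "v : x" "w : \<phi> x"
 shows "h x = proj_pt (segre_vec n N v w)" "segre_vec n N v w : coord_vectors K"
proof -
 have x: "x : proj_space n" using X assms zariski_closed_sub by blast
 have 1: "x = proj_pt v" "v : coord_vectors n" using proj_space_point[OF x assms(2)] by blast+
 have 2: "\<phi> x = proj_pt w" "w : coord_vectors N" using proj_space_point[OF phi_mem[OF assms(1)] assms(3)] by blast+
 show "h x = proj_pt (segre_vec n N v w)" unfolding h_def o_def by (rule segre_eq[OF 1(1) 2(1)])
 show "segre_vec n N v w : coord_vectors K" using segre_vec_coord 1 2 by blast
qed

lemma rep_point:
 assumes "x : X"
 obtains v w where "v : x" "w : \<phi> x" "v : coord_vectors n" "w : coord_vectors N" "x = proj_pt v" "\<phi> x = proj_pt w"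
proof -
 have x: "x : proj_space n" using X assms zariski_closed_sub by blast
 obtain v where v: "v : x" using proj_space_nonempty_pt[OF x] by blast
 obtain w where w: "w : \<phi> x" using proj_space_nonempty_pt[OF phi_mem[OF assms]] by blast
 show ?thesis using that[OF v w] proj_space_point[OF x v] proj_space_point[OF phi_mem[OF assms] w] by blast
qed

lemma idx_le: "i <= n ==> j <= N ==> idx i j <= K"
 using segre_index_less[of i n j N] by linarith

lemma h_inj: "inj_on h X"
proof (rule inj_onI)
 fix x y assume xy: "x : X" "y : X" "h x = h y"
 obtain v w where v: "v : x" "w : \<phi> x" "v : coord_vectors n" "w : coord_vectors N" "x = proj_pt v" "\<phi> x = proj_pt w"
  using rep_point[OF xy(1)] by blast
 obtain v' w' where v': "v' : y" "w' : \<phi> y" "v' : coord_vectors n" "w' : coord_vectors N" "y = proj_pt v'" "\<phi> y = proj_pt w'"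
  using rep_point[OF xy(2)] by blast
 have "proj_pt (segre_vec n N v w) = proj_pt (segre_vec n N v' w')"
  using h_eq[OF xy(1) v(1,2)] h_eq[OF xy(2) v'(1,2)] xy(3) by simp
 then obtain c where c: "segre_vec n N v w = cscale c (segre_vec n N v' w')" by (auto simp: proj_pt_eq)
 have c': "v i * w j = c * (v' i * w' j)" if "i <= n" "j <= N" for i j
  using fun_cong[OF c, of "idx i j"] segre_vec_index[OF that] by (simp add: cscale_def)
 obtain b where b: "b <= N" "w b ~= 0" using coord_vectors_nonzero[OF v(4)] by blast
 have "v i * v' j = v j * v' i" if "i <= n" "j <= n" for i j
 proof -
  have "w b * (v i * v' j) = (v i * w b) * v' j" by simp
  also have "\<dots> = (v j * w b) * v' i" unfolding c'[OF that(1) b(1)] c'[OF that(2) b(1)] by simp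
  finally have "w b * (v i * v' j) = w b * (v j * v' i)" by simp
  then show ?thesis using b by simp
 qed
 then show "x = y" using proj_pt_eq_minors[OF v(3) v'(3)] v(5) v'(5) by simp
qed

definition "local_rep Z d f \<longleftrightarrow> zariski_closed n Z & (ALL i<=N. form_fun n d (f i)) \<and>
 (ALL q:X - Z. ALL v:q. (EX i<=N. f i v ~= 0) & \<phi> q = proj_pt (%i. if i <= N then f i v else 0))"

lemma local_rep_exists:
 assumes "p : X" obtains Z d f where "local_rep Z d f" "p \<notin> Z"
 by (rule variety_morphismE[OF morph assms]) (rule that, auto simp: local_rep_def)

text \<open>A coordinate vector of the Segre space is read as a matrix \<open>z (idx c b)\<close>.
  \<open>minor_eqs\<close> says that it has rank one. Column \<open>b\<close> is then a multiple of
  the source point and row \<open>c\<close> a multiple of the image point, so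
  \<open>source_eqs\<close> asks the columns to lie on \<open>X\<close>, and
  \<open>graph_eqs\<close> asks the rows to be the image of the columns. The factor \<open>g\<close>
  switches an equation off on the set \<open>Z\<close> where the representation by \<open>f\<close>
  is not valid.\<close>

definition "minor_eqs = {(%z. z (idx c b) * z (idx c' b') - z (idx c b') * z (idx c' b)) | c c' b b'.
 c <= n & c' <= n & b <= N & b' <= N}"
definition "source_eqs = {(%z. f (%c. z (idx c b))) | f d b. form_fun n d f \<and>
 (ALL x:X. ALL v:x. f v = 0) & b <= N}"
definition "graph_eqs = {(%z. g (%c. z (idx c b)) *
  (z (idx c i) * f j (%c. z (idx c b)) - z (idx c j) * f i (%c. z (idx c b)))) | g e Z d f b c i j.
 local_rep Z d f & form_fun n e g & (ALL x:Z. ALL v:x. g v = 0) & b <= N & c <= n & i <= N & j <= N}"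

lemma form_row: "form_fun n d f ==> b <= N ==> form_fun K d (%z. f (%c. z (idx c b)))"
 using form_fun_subst[of n d f K 1 "%c z. z (idx c b)"] form_fun_coord[OF idx_le] by simp

lemma eqs_form:
 assumes "f : minor_eqs \<union> source_eqs \<union> graph_eqs" shows "EX d. form_fun K d f"
proof -
 have co: "form_fun K 1 (%z. z (idx i j))" if "i <= n" "j <= N" for i j
  using form_fun_coord[OF idx_le[OF that]] .
 consider "f : minor_eqs" | "f : source_eqs" | "f : graph_eqs" using assms by blast
 then show ?thesis
 proof cases
  case 1
  then obtain c c' b b' where "f = (%z. z (idx c b) * z (idx c' b') - z (idx c b') * z (idx c' b))"
    "c <= n" "c' <= n" "b <= N" "b' <= N" unfolding minor_eqs_def by auto
  then show ?thesis using form_fun_diff[OF form_fun_mult[OF co co] form_fun_mult[OF co co], of c b c' b' c b' c' b] by blast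
 next
  case 2
  then obtain g d b where "f = (%z. g (%c. z (idx c b)))" "form_fun n d g" "b <= N"
   unfolding source_eqs_def by auto
  then show ?thesis using form_row by blast
 next
  case 3
  obtain g e Z d F b c i j where f: "f = (%z. g (%c. z (idx c b)) *
    (z (idx c i) * F j (%c. z (idx c b)) - z (idx c j) * F i (%c. z (idx c b))))"
   "local_rep Z d F" "form_fun n e g" "b <= N" "c <= n" "i <= N" "j <= N"
   using 3 unfolding graph_eqs_def mem_Collect_eq by (elim exE conjE) (rule that, assumption+)
  have "form_fun n d (F i)" "form_fun n d (F j)" using f unfolding local_rep_def by blast+
  then have "form_fun K (e + (1 + d)) f" unfolding f(1)
   by (intro form_fun_mult form_fun_diff form_row co f)
  then show ?thesis by blast
 qed
qed

lemma eqs_vanish: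
 assumes "x : X" "f : minor_eqs \<union> source_eqs \<union> graph_eqs" "u : h x"
 shows "f u = 0"
proof -
 obtain v w where v: "v : x" "w : \<phi> x" "v : coord_vectors n" "w : coord_vectors N" "x = proj_pt v" "\<phi> x = proj_pt w"
  using rep_point[OF assms(1)] by blast
 let ?z = "segre_vec n N v w"
 have z: "?z (idx i j) = v i * w j" if "i <= n" "j <= N" for i j using segre_vec_index[OF that] .
 have row: "g (%c. ?z (idx c b)) = w b ^ d * g v" if "form_fun n d g" "b <= N" for g d b
 proof -
  have "g (%c. ?z (idx c b)) = g (%c. w b * v c)"
   by (rule form_fun_depends[OF that(1)]) (use z that in "simp add: mult.commute")
  then show ?thesis using form_fun_homogeneous[OF that(1)] by simp
 qed
 have "f ?z = 0"
 proof -
  consider "f : minor_eqs" | "f : source_eqs" | "f : graph_eqs" using assms by blast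
  then show ?thesis
  proof cases
   case 1
   then obtain c c' b b' where "f = (%z. z (idx c b) * z (idx c' b') - z (idx c b') * z (idx c' b))"
     "c <= n" "c' <= n" "b <= N" "b' <= N" unfolding minor_eqs_def by auto
   then show ?thesis using z by simp
  next
   case 2
   then obtain g d b where "f = (%z. g (%c. z (idx c b)))" "form_fun n d g" "b <= N"
    "ALL x:X. ALL v:x. g v = 0" unfolding source_eqs_def by auto
   then show ?thesis using row[of d g b] assms(1) v(1) by simp
  next
   case 3
   obtain g e Z d F b c i j where f: "f = (%z. g (%c. z (idx c b)) *
     (z (idx c i) * F j (%c. z (idx c b)) - z (idx c j) * F i (%c. z (idx c b))))"
    "local_rep Z d F" "form_fun n e g" "ALL x:Z. ALL v:x. g v = 0" "b <= N" "c <= n" "i <= N" "j <= N"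
    using 3 unfolding graph_eqs_def mem_Collect_eq by (elim exE conjE) (rule that, assumption+)
   have F: "form_fun n d (F i)" "form_fun n d (F j)" using f unfolding local_rep_def by blast+
   show ?thesis
   proof (cases "x : Z")
    case True
    then have "g v = 0" using f v by blast
    then show ?thesis unfolding f(1) using row[OF f(3,5)] by simp
   next
    case False
    then have "\<phi> x = proj_pt (%i. if i <= N then F i v else 0)"
     using f(2) assms(1) v(1) unfolding local_rep_def by blast
    then obtain l where "w = cscale l (%i. if i <= N then F i v else 0)" using v(2) by (auto simp: proj_pt_def)
    then have l: "w k = l * F k v" if "k <= N" for k using that by (simp add: cscale_def)
    show ?thesis unfolding f(1) row[OF F(1) f(5)] row[OF F(2) f(5)] z[OF f(6,7)] z[OF f(6,8)]
     using l[OF f(7)] l[OF f(8)] by simp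
   qed
  qed
 qed
 moreover have hx: "h x : proj_space K" "?z : h x"
  using h_eq[OF assms(1) v(1,2)] proj_pt_self proj_spaceI by auto
 ultimately show ?thesis
  using eqs_form[OF assms(2)] form_fun_vanish_point[OF _ hx(1) hx(2) assms(3)] by blast
qed

lemma h_surj:
 assumes q: "q : proj_space K" "!!f u. f : minor_eqs \<union> source_eqs \<union> graph_eqs ==> u : q ==> f u = 0"
 shows "q : h ` X"
proof -
 obtain u where u: "u : q" using proj_space_nonempty_pt[OF q(1)] by blast
 have u2: "u : coord_vectors K" "q = proj_pt u" using proj_space_point[OF q(1) u] by blast+
 obtain k where k: "k <= K" "u k ~= 0" using coord_vectors_nonzero[OF u2(1)] by blast
 define c0 where "c0 = k div (N + 1)"
 define b0 where "b0 = k mod (N + 1)"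
 have "k < (n + 1) * (N + 1)" using k(1) by simp
 then have cb: "c0 <= n" "b0 <= N" "k = idx c0 b0"
  using segre_index_split[of k n N] unfolding c0_def b0_def by blast+
 \<comment> \<open>The column and the row of the rank one matrix through its nonzero entry at
   \<open>c0\<close>, \<open>b0\<close>; the row is divided by this entry, so that the outer product
   gives back \<open>u\<close>.\<close>
 define v where "v = (%c. if c <= n then u (idx c b0) else 0)"
 define w where "w = (%b. if b <= N then u (idx c0 b) / u k else 0)"
 have vc: "v c0 ~= 0" "w b0 = 1" using cb k by (auto simp: v_def w_def)
 have "v ~= (%_. 0)" "w ~= (%_. 0)" using vc by auto
 then have v: "v : coord_vectors n" and w: "w : coord_vectors N"
  unfolding coord_vectors_def by (simp_all add: v_def w_def)
 have uz: "u (idx c b) = v c * w b" if "c <= n" "b <= N" for c b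
 proof -
  have "(%z. z (idx c b) * z (idx c0 b0) - z (idx c b0) * z (idx c0 b)) : minor_eqs"
   unfolding minor_eqs_def using that cb by blast
  then have "u (idx c b) * u (idx c0 b0) - u (idx c b0) * u (idx c0 b) = 0"
   using q(2)[OF _ u] by blast
  then show ?thesis using that k cb by (simp add: v_def w_def field_simps)
 qed
 have useg: "u = segre_vec n N v w"
 proof
  fix l show "u l = segre_vec n N v w l"
  proof (cases "l < (n + 1) * (N + 1)")
   case True
   then show ?thesis
    using uz[OF segre_index_split(1,2)[OF True]] segre_index_split(3)[OF True] by (simp add: segre_vec_def)
  next
   case False
   then show ?thesis using u2(1) by (auto simp: segre_vec_def coord_vectors_def)
  qed
 qed
 have rowv: "f (%c. u (idx c b0)) = f v" if "form_fun n d f" for f d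
  by (rule form_fun_depends[OF that]) (simp add: v_def)
 have x: "proj_pt v : X"
 proof (rule ccontr)
  assume "proj_pt v \<notin> X"
  then obtain d f where f: "form_fun n d f" "!!q v. q : X ==> v : q ==> f v = 0" "!!u. u : proj_pt v ==> f u ~= 0"
   using zariski_closed_separate[OF X proj_spaceI[OF v]] by blast
  then have "(%z. f (%c. z (idx c b0))) : source_eqs" unfolding source_eqs_def using cb by blast
  then have "f (%c. u (idx c b0)) = 0" using q(2)[OF _ u] by blast
  then show False using rowv[OF f(1)] f(3)[OF proj_pt_self] by simp
 qed
 obtain Z d f where f: "local_rep Z d f" "proj_pt v \<notin> Z" using local_rep_exists[OF x] by blast
 \<comment> \<open>The point found lies outside the exceptional set, so some form vanishing on
   \<open>Z\<close> is nonzero there and can be cancelled from the equations in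
   \<open>graph_eqs\<close>.\<close>
 obtain e g where g: "form_fun n e g" "!!q v. q : Z ==> v : q ==> g v = 0" "!!u. u : proj_pt v ==> g u ~= 0"
  using zariski_closed_separate[OF _ proj_spaceI[OF v] f(2)] f(1) unfolding local_rep_def by blast
 let ?fv = "%i. if i <= N then f i v else 0"
 have fv: "EX i<=N. f i v ~= 0" "\<phi> (proj_pt v) = proj_pt ?fv"
  using f x proj_pt_self[of v] unfolding local_rep_def by blast+
 have fvc: "?fv : coord_vectors N" using fv(1) by (auto simp: coord_vectors_def fun_eq_iff)
 have "w i * f j v = w j * f i v" if ij: "i <= N" "j <= N" for i j
 proof -
  have "(%z. g (%c. z (idx c b0)) *
    (z (idx c0 i) * f j (%c. z (idx c b0)) - z (idx c0 j) * f i (%c. z (idx c b0)))) : graph_eqs"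
   unfolding graph_eqs_def using f(1) g(1,2) cb ij by blast
  then have "g (%c. u (idx c b0)) *
    (u (idx c0 i) * f j (%c. u (idx c b0)) - u (idx c0 j) * f i (%c. u (idx c b0))) = 0"
   using q(2)[OF _ u] by blast
  moreover have F: "form_fun n d (f i)" "form_fun n d (f j)" using f(1) ij unfolding local_rep_def by blast+
  ultimately have "g v * (v c0 * w i * f j v - v c0 * w j * f i v) = 0"
   unfolding rowv[OF g(1)] rowv[OF F(1)] rowv[OF F(2)] uz[OF cb(1) ij(1)] uz[OF cb(1) ij(2)] by -
  moreover have "g v ~= 0" using g(3)[OF proj_pt_self] .
  ultimately have "v c0 * (w i * f j v) = v c0 * (w j * f i v)" by (simp add: algebra_simps)
  then show ?thesis using vc(1) by simp
 qed
 then have "proj_pt w = \<phi> (proj_pt v)" unfolding fv(2) by (subst proj_pt_eq_minors[OF w fvc]) auto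
 then have "h (proj_pt v) = proj_pt u"
  using h_eq(1)[OF x proj_pt_self, of w] proj_pt_self[of w] useg by simp
 then show ?thesis using x u2(2) by blast
qed

lemma h_closed: "zariski_closed K (h ` X)"
proof (rule zariski_closedI[of "minor_eqs \<union> source_eqs \<union> graph_eqs"])
 show "EX d. form_fun K d f" if "f : minor_eqs \<union> source_eqs \<union> graph_eqs" for f using eqs_form[OF that] .
 fix p
 have "h x : proj_space K" if "x : X" for x
  using rep_point[OF that] h_eq[OF that] proj_spaceI by metis
 then show "p : h ` X \<longleftrightarrow> p : proj_space K & (ALL f:minor_eqs \<union> source_eqs \<union> graph_eqs. ALL v:p. f v = 0)"
  using eqs_vanish h_surj by blast
qed

lemma h_morphism: "variety_morphism n X K (h ` X) h"
 unfolding variety_morphism_iff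
proof (intro conjI ballI order_refl)
 fix p assume "p : X"
 then obtain Z d f where f: "local_rep Z d f" "p \<notin> Z" using local_rep_exists by blast
 let ?F = "%k v. v (k div (N + 1)) * f (k mod (N + 1)) v"
 show "EX Z d f. zariski_closed n Z & p \<notin> Z & (ALL i<=K. form_fun n d (f i)) \<and>
   (ALL q:X - Z. ALL v:q. (EX i<=K. f i v ~= 0) & h q = proj_pt (%i. if i <= K then f i v else 0))"
 proof (rule exI[of _ Z], rule exI[of _ "1 + d"], rule exI[of _ ?F], intro conjI allI impI ballI)
  show "zariski_closed n Z" using f(1) by (simp add: local_rep_def)
  show "p \<notin> Z" by fact
  show "form_fun n (1 + d) (?F k)" if "k <= K" for k
  proof -
   have "k < (n + 1) * (N + 1)" using that by simp
   then show ?thesis using f(1) segre_index_split[of k n N] unfolding local_rep_def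
    by (intro form_fun_mult form_fun_coord) blast+
  qed
  fix q v assume qv: "q : X - Z" "v : q"
  let ?fv = "%i. if i <= N then f i v else 0"
  have fv: "\<phi> q = proj_pt ?fv" using f(1) qv unfolding local_rep_def by blast
  then have hq: "h q = proj_pt (segre_vec n N v ?fv)" "segre_vec n N v ?fv : coord_vectors K"
   using h_eq[of q v ?fv] qv proj_pt_self[of ?fv] by auto
  have "segre_vec n N v ?fv i = (if i <= K then ?F i v else 0)" for i
  proof -
   have "i < (n + 1) * (N + 1) \<longleftrightarrow> i <= K" by auto
   then show ?thesis using segre_index_split(2)[of i n N] unfolding segre_vec_def by simp
  qed
  then have eq: "segre_vec n N v ?fv = (%i. if i <= K then ?F i v else 0)" by blast
  show "h q = proj_pt (%i. if i <= K then ?F i v else 0)" using hq(1) unfolding eq .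
  obtain i where "i <= K" "segre_vec n N v ?fv i ~= 0" using coord_vectors_nonzero[OF hq(2)] by blast
  then show "EX i<=K. ?F i v ~= 0" unfolding eq by auto
 qed
qed

text \<open>The inverse is the projection to the first factor. Column \<open>b\<close> of the matrix
  represents the source point wherever it is not zero, and near a given point any \<open>b\<close>
  with nonzero entry of the image point serves.\<close>

lemma h_inverse_morphism: "variety_morphism K (h ` X) n X (inv_into X h)"
 unfolding variety_morphism_iff
proof (intro conjI ballI)
 show "inv_into X h ` h ` X <= X" by (simp add: image_subset_iff inv_into_into)
 fix p assume "p : h ` X"
 then obtain x where x: "x : X" "p = h x" by blast
 obtain v w where v: "v : x" "w : \<phi> x" "v : coord_vectors n" "w : coord_vectors N" "x = proj_pt v" "\<phi> x = proj_pt w"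
  using rep_point[OF x(1)] by blast
 obtain b where b: "b <= N" "w b ~= 0" using coord_vectors_nonzero[OF v(4)] by blast
 obtain c where c: "c <= n" "v c ~= 0" using coord_vectors_nonzero[OF v(3)] by blast
 let ?S = "(%c z. z (idx c b)) ` {..n}"
 let ?Z = "{q : proj_space K. ALL f:?S. ALL z:q. f z = 0}"
 show "EX Z d f. zariski_closed K Z & p \<notin> Z & (ALL i<=n. form_fun K d (f i)) \<and>
   (ALL q:h ` X - Z. ALL v:q. (EX i<=n. f i v ~= 0) & inv_into X h q = proj_pt (%i. if i <= n then f i v else 0))"
 proof (rule exI[of _ ?Z], rule exI[of _ 1], rule exI[of _ "%c z. z (idx c b)"], intro conjI allI impI ballI)
  show "zariski_closed K ?Z"
   by (rule zariski_closedI[of ?S]) (use b form_fun_coord[OF idx_le] in auto)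
  show "form_fun K 1 ((%c z. z (idx c b)) i)" if "i <= n" for i using form_fun_coord[OF idx_le[OF that b(1)]] .
  show "p \<notin> ?Z"
  proof
   assume "p : ?Z"
   then have all: "ALL f:?S. ALL z:p. f z = 0" unfolding mem_Collect_eq by (rule conjunct2)
   have "(%z. z (idx c b)) : ?S" using c(1) by (intro imageI) simp
   then have "ALL z:p. z (idx c b) = 0" by (rule bspec[OF all, of "%z. z (idx c b)"])
   moreover have "segre_vec n N v w : p" using h_eq[OF x(1) v(1,2)] x(2) proj_pt_self by simp
   ultimately have "segre_vec n N v w (idx c b) = 0" by (rule bspec)
   then show False using segre_vec_index[OF c(1) b(1)] b c by simp
  qed
  fix q u assume qu: "q : h ` X - ?Z" "u : q"
  then obtain y where y: "y : X" "q = h y" by blast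
  obtain v' w' where v': "v' : y" "w' : \<phi> y" "v' : coord_vectors n" "w' : coord_vectors N" "y = proj_pt v'" "\<phi> y = proj_pt w'"
   using rep_point[OF y(1)] by blast
  have hy: "h y = proj_pt (segre_vec n N v' w')" "h y : proj_space K"
   using h_eq[OF y(1) v'(1,2)] proj_spaceI by auto
  then obtain l where l: "l ~= 0" "u = cscale l (segre_vec n N v' w')" using qu(2) y(2) by (auto simp: proj_pt_def)
  have ui: "u (idx i b) = l * w' b * v' i" if "i <= n" for i
   using segre_vec_index[OF that b(1)] l(2) by (simp add: cscale_def)
  have "w' b ~= 0"
  proof
   assume w0: "w' b = 0"
   have "z (idx i b) = 0" if "i <= n" "z : q" for i z
   proof -
    obtain l where "z = cscale l (segre_vec n N v' w')" using \<open>z : q\<close> y(2) hy by (auto simp: proj_pt_def)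
    then show ?thesis using segre_vec_index[OF that(1) b(1)] w0 by (simp add: cscale_def)
   qed
   then have "q : ?Z" using hy y by auto
   then show False using qu by blast
  qed
  then have lw: "l * w' b ~= 0" using l(1) by simp
  have eq: "(%i. if i <= n then u (idx i b) else 0) = cscale (l * w' b) v'"
   using ui v'(3) by (auto simp: cscale_def coord_vectors_def fun_eq_iff)
  show "inv_into X h q = proj_pt (%i. if i <= n then (%c z. z (idx c b)) i u else 0)"
   unfolding eq proj_pt_cscale[OF lw] y(2) inv_into_f_f[OF h_inj y(1)] by (rule v'(5))
  obtain i where "i <= n" "v' i ~= 0" using coord_vectors_nonzero[OF v'(3)] by blast
  then show "EX i<=n. (%c z. z (idx c b)) i u ~= 0" using ui lw by auto
 qed
qed

lemma graph_embedding: "biprojective_embedding n X n N (%x. (x, \<phi> x))"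
 unfolding biprojective_embedding_def projective_embedding_def variety_isomorphism_def
  h_def[symmetric]
 using h_closed h_morphism h_inverse_morphism h_inj phi_mem zariski_closed_sub[OF X]
 by (auto simp: bij_betw_def)

end

section \<open>Projecting curves from a product\<close>

lemma mtop_proj_manifold [simp]: "mtop (proj_manifold n) = proj_top n"
 by (simp add: proj_manifold_def)

lemma mtop_prod_manifold [simp]: "mtop (prod_manifold M N) = prod_topology (mtop M) (mtop N)"
 by (simp add: prod_manifold_def)

text \<open>A chart of the product also restricts the first component. To test the second component
  near \<open>z\<close>, a chart of the first factor around \<open>fst (g z)\<close> has to be
  supplied, hence the passage to differentiability at single points.\<close>

lemma holomorphic_into_snd:
 assumes g: "holomorphic_into (prod_manifold (proj_manifold n) (proj_manifold N)) Om g"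
 shows "hol_map N Om (snd \<circ> g)"
proof -
 have op: "open Om" and cont: "continuous_map (top_of_set Om) (prod_topology (proj_top n) (proj_top N)) g"
  using g by (auto simp: holomorphic_into_def)
 have hol: "(d \<circ> snd \<circ> g) holomorphic_on {z : Om. (snd \<circ> g) z : V}"
  if V: "(V, ds) : charts (proj_manifold N)" "d : ds" for V ds d
  unfolding holomorphic_on_def
 proof
  fix z assume z: "z : {z : Om. (snd \<circ> g) z : V}"
  then have "fst (g z) : proj_space n"
   using cont by (auto simp: continuous_map_def topspace_proj_top Pi_iff mem_Times_iff)
  then obtain u where u: "fst (g z) = proj_pt u" "u : coord_vectors n" by (auto simp: proj_space_def)
  then obtain k where k: "k <= n" "u k ~= 0" using coord_vectors_nonzero by blast
  define U where "U = {p : proj_space n. ALL v:p. v k ~= 0}"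
  have gU: "fst (g z) : U" unfolding U_def using u k proj_spaceI chart_point_iff by auto
  have U: "(U, {affine_coord k i | i. i <= n & i ~= k}) : charts (proj_manifold n)"
   unfolding proj_manifold_def U_def using k(1) by auto
  obtain l where "l <= N" "V = {p : proj_space N. ALL v:p. v l ~= 0}"
   using V(1) unfolding proj_manifold_def by auto
  then have opV: "openin (proj_top N) V" using openin_affine_chart by blast
  let ?cs = "(%c. c \<circ> fst) ` {affine_coord k i | i. i <= n & i ~= k} \<union> (%c. c \<circ> snd) ` ds"
  have mem: "(U \<times> V, ?cs) : charts (prod_manifold (proj_manifold n) (proj_manifold N))"
   unfolding prod_manifold_def using U V(1) by auto
  have "ALL (U, cs):charts (prod_manifold (proj_manifold n) (proj_manifold N)).
    ALL c:cs. (c \<circ> g) holomorphic_on {z : Om. g z : U}"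
   using g by (simp add: holomorphic_into_def)
  from bspec[OF this mem]
  have "ALL c:?cs. (c \<circ> g) holomorphic_on {z : Om. g z : U \<times> V}" by (simp only: prod.case)
  then have "(d \<circ> snd \<circ> g) holomorphic_on {z : Om. g z : U \<times> V}" using V(2) by blast
  moreover have "openin (prod_topology (proj_top n) (proj_top N)) (U \<times> V)"
   using openin_affine_chart[OF k(1)] opV unfolding U_def by (simp add: openin_prod_Times_iff)
  then have "openin (top_of_set Om) {z : Om. g z : U \<times> V}"
   using openin_continuous_map_preimage[OF cont] by force
  then have "open {z : Om. g z : U \<times> V}" using op openin_open_trans by blast
  moreover have "z : {z : Om. g z : U \<times> V}" using z gU by (auto simp: mem_Times_iff)
  ultimately have "(d \<circ> snd \<circ> g) field_differentiable at z"
   by (rule holomorphic_on_imp_differentiable_at)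
  then show "(d \<circ> snd \<circ> g) field_differentiable at z within {z : Om. (snd \<circ> g) z : V}"
   by (rule field_differentiable_at_within)
 qed
 have "continuous_map (top_of_set Om) (proj_top N) (snd \<circ> g)"
  using continuous_map_compose[OF cont continuous_map_snd] .
 then show ?thesis
  unfolding holomorphic_into_def using op hol by (auto simp: comp_assoc)
qed

lemma holomorphic_curve_map_snd:
 assumes "holomorphic_curve_map k C (prod_manifold (proj_manifold n) (proj_manifold N)) f"
 shows "holomorphic_curve_map k C (proj_manifold N) (snd \<circ> f)"
proof -
 have cont: "continuous_map (subtopology (proj_top k) C) (prod_topology (proj_top n) (proj_top N)) f"
  using assms by (simp add: holomorphic_curve_map_def)
 have "hol_map N Om (snd \<circ> f \<circ> \<gamma>)" if "inverse_chart k C Om \<gamma>" for Om \<gamma>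
  unfolding comp_assoc using that assms by (intro holomorphic_into_snd) (auto simp: holomorphic_curve_map_def)
 then show ?thesis
  unfolding holomorphic_curve_map_def using continuous_map_compose[OF cont continuous_map_snd] by simp
qed

lemma not_constant_on_image: "x : f ` A ==> y : f ` A ==> x ~= y ==> \<not> f constant_on A"
 unfolding constant_on_def image_iff by metis

lemma rational_curve_snd:
 assumes "rational_curve (prod_manifold (proj_manifold n) (proj_manifold N)) C"
  "x : snd ` C" "y : snd ` C" "x ~= y"
 shows "rational_curve (proj_manifold N) (snd ` C)"
proof -
 obtain f where f: "holomorphic_curve_map 1 (proj_space 1) (prod_manifold (proj_manifold n) (proj_manifold N)) f"
  "C = f ` proj_space 1" using assms(1) unfolding rational_curve_def by blast
 have "snd ` C = (snd \<circ> f) ` proj_space 1" using f(2) by (simp add: image_comp)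
 then show ?thesis unfolding rational_curve_def
  using holomorphic_curve_map_snd[OF f(1)] not_constant_on_image[of x "snd \<circ> f" _ y] assms(2-4)
  by (intro exI[of _ "snd \<circ> f"]) auto
qed

lemma elliptic_curve_snd:
 assumes "elliptic_curve (prod_manifold (proj_manifold n) (proj_manifold N)) C"
  "x : snd ` C" "y : snd ` C" "x ~= y"
 shows "elliptic_curve (proj_manifold N) (snd ` C)"
proof -
 obtain k E f where f: "smooth_projective_curve k E" "curve_has_genus k E 1"
  "holomorphic_curve_map k E (prod_manifold (proj_manifold n) (proj_manifold N)) f"
  "C = f ` E" using assms(1) unfolding elliptic_curve_def by blast
 have "snd ` C = (snd \<circ> f) ` E" using f(4) by (simp add: image_comp)
 then show ?thesis unfolding elliptic_curve_def
  using f(1,2) holomorphic_curve_map_snd[OF f(3)] not_constant_on_image[of x "snd \<circ> f" _ y] assms(2-4)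
  by (intro exI[of _ k] exI[of _ E] exI[of _ "snd \<circ> f"]) auto
qed

text \<open>Induction along the chain, with the point already reached as start. If a member meets
  the next one in the start itself, the member is dropped; otherwise it contains two different
  points and is kept. The condition \<open>x ~= y\<close> ensures that some member remains.\<close>

lemma successively_discard_points:
 assumes "Ds ~= []" "successively (%C D. C \<inter> D ~= {}) Ds" "x : hd Ds" "y : last Ds" "x ~= y"
  and P: "!!D a b. D : set Ds ==> a : D ==> b : D ==> a ~= b ==> P D"
 shows "EX Es. Es ~= [] & set Es <= set Ds & (ALL E:set Es. P E) & successively (%C D. C \<inter> D ~= {}) Es \<and>
   x : hd Es & y : last Es"
 using assms
proof (induction Ds arbitrary: x)
 case Nil
 then show ?case by simp
next
 case (Cons D Ds)
 show ?case
 proof (cases "y : D")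
  case True
  then have "P D" using Cons.prems(3,5) Cons.prems(6)[of D x y] by auto
  then show ?thesis using True Cons.prems(3) by (intro exI[of _ "[D]"]) auto
 next
  case False
  then have ne: "Ds ~= []" using Cons.prems(4) by auto
  then have D: "D \<inter> hd Ds ~= {}" "successively (%C D. C \<inter> D ~= {}) Ds" "y : last Ds"
   using Cons.prems(2,4) by (auto simp: successively_Cons)
  then obtain c where c: "c : D" "c : hd Ds" by blast
  then have "c ~= y" using False by auto
  then obtain Es where Es: "Es ~= []" "set Es <= set Ds" "ALL E:set Es. P E"
   "successively (%C D. C \<inter> D ~= {}) Es" "c : hd Es" "y : last Es"
   using Cons.IH[OF ne D(2) c(2) D(3)] Cons.prems(6) by (metis list.set_intros(2))
  show ?thesis
  proof (cases "c = x")
   case True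
   then show ?thesis using Es by (intro exI[of _ Es]) auto
  next
   case False
   then have "P D" using Cons.prems(3) Cons.prems(6)[of D c x] c by auto
   then show ?thesis using Es Cons.prems(3) c(1)
    by (intro exI[of _ "D # Es"]) (auto simp: successively_Cons)
  qed
 qed
qed

section \<open>Connectedness of the image\<close>

locale surjective_morphism =
 fixes n m N :: nat and X Y :: "ppoint set" and \<phi> i :: "ppoint => ppoint"
 assumes X: "zariski_closed n X" and Y: "zariski_closed m Y"
  and morph: "variety_morphism n X m Y \<phi>" and surj: "\<phi> ` X = Y"
  and emb: "projective_embedding m Y N i" and dim: "variety_dim m Y > 0"
begin

text \<open>The graph is taken for the morphism followed by the embedding \<open>i\<close>, so that
  its second projection lies in the projective space in which neighborhoods of the image are
  considered.\<close>

sublocale graph n N X "i ` Y" "i \<circ> \<phi>"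
proof
 show "zariski_closed n X" by (rule X)
 show "i ` Y <= proj_space N" using emb zariski_closed_sub unfolding projective_embedding_def by blast
 show "variety_morphism n X N (i ` Y) (i \<circ> \<phi>)"
  using variety_morphism_compose[OF zariski_closed_sub[OF X] zariski_closed_sub[OF Y] morph] emb
  unfolding projective_embedding_def variety_isomorphism_def by blast
qed

lemma image_eq: "(%x. (x, (i \<circ> \<phi>) x)) ` X <= proj_space n \<times> (i ` Y)" "(i \<circ> \<phi>) ` X = i ` Y"
 using zariski_closed_sub[OF X] surj by auto

lemma two_points: obtains p q where "p : i ` Y" "q : i ` Y" "p ~= q"
proof -
 obtain p q where "p : Y" "q : Y" "p ~= q" using variety_dim_pos_two_points[OF dim] by blast
 moreover have "inj_on i Y" using emb unfolding projective_embedding_def variety_isomorphism_def bij_betw_def by blast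
 ultimately have "i p ~= i q" by (auto dest: inj_onD)
 then show ?thesis using that \<open>p : Y\<close> \<open>q : Y\<close> by blast
qed

lemma other_point: obtains q where "q : i ` Y" "q ~= p"
 using two_points by metis

lemma prod_neighborhood:
 assumes "openin (proj_top N) U" "i ` Y <= U"
 shows "openin (mtop (prod_manifold (proj_manifold n) (proj_manifold N))) (proj_space n \<times> U)"
  "(%x. (x, (i \<circ> \<phi>) x)) ` X <= proj_space n \<times> U"
proof -
 have "openin (proj_top n) (proj_space n)" using openin_topspace[of "proj_top n"] by (simp add: topspace_proj_top)
 then show "openin (mtop (prod_manifold (proj_manifold n) (proj_manifold N))) (proj_space n \<times> U)"
  using assms(1) by (simp add: openin_prod_Times_iff)
 show "(%x. (x, (i \<circ> \<phi>) x)) ` X <= proj_space n \<times> U" using image_eq(1) assms(2) by blast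
qed

lemma rationally_connected_image:
 assumes "strongly_approx_rationally_connected n X"
 shows "naively_approx_rationally_connected (proj_manifold N) (i ` Y)"
 unfolding naively_approx_rationally_connected_def mtop_proj_manifold
proof (intro allI impI ballI)
 fix U p q assume U: "openin (proj_top N) U & i ` Y <= U" and pq: "p : i ` Y" "q : i ` Y"
 \<comment> \<open>Two different points on the projection guarantee that the projected map is not
   constant. For equal points a second point of the image is brought in afterwards.\<close>
 have distinct: "EX C. rational_curve (proj_manifold N) C & C <= U & p : C & q : C"
  if pq: "p : i ` Y" "q : i ` Y" "p ~= q" for p q
 proof -
  have "p : (i \<circ> \<phi>) ` X" "q : (i \<circ> \<phi>) ` X" using pq(1,2) unfolding image_eq(2) .
  then obtain x y where xy: "x : X" "p = (i \<circ> \<phi>) x" "y : X" "q = (i \<circ> \<phi>) y" by (elim imageE)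
  have "naively_approx_rationally_connected (prod_manifold (proj_manifold n) (proj_manifold N))
    ((%x. (x, (i \<circ> \<phi>) x)) ` X)"
   by (rule assms[unfolded strongly_approx_rationally_connected_def, rule_format, OF graph_embedding])
  then obtain C where C: "rational_curve (prod_manifold (proj_manifold n) (proj_manifold N)) C"
   "C <= proj_space n \<times> U" "(x, p) : C" "(y, q) : C"
   using prod_neighborhood[of U] U xy unfolding naively_approx_rationally_connected_def
   by (metis (no_types, lifting) imageI)
  have "p : snd ` C" "q : snd ` C" using C(3,4) by force+
  moreover have "snd ` C <= U" using C(2) by auto
  ultimately show ?thesis using rational_curve_snd[OF C(1)] pq(3) by blast
 qed
 show "EX C. rational_curve (proj_manifold N) C & C <= U & p : C & q : C"
 proof (cases "p = q")
  case True
  obtain r where "r : i ` Y" "r ~= p" using other_point by blast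
  then show ?thesis using distinct[of p r] pq(1) True by blast
 qed (use distinct pq in blast)
qed

lemma elliptically_connected_image:
 assumes "strongly_approx_elliptically_connected n X"
 shows "naively_approx_elliptically_connected (proj_manifold N) (i ` Y)"
 unfolding naively_approx_elliptically_connected_def mtop_proj_manifold
proof (intro allI impI ballI)
 let ?conn = "%U p q. EX Cs. elliptic_chain (proj_manifold N) Cs & (ALL C:set Cs. C <= U) & p : hd Cs & q : last Cs"
 fix U p q assume U: "openin (proj_top N) U & i ` Y <= U" and pq: "p : i ` Y" "q : i ` Y"
 have distinct: "?conn U p q" if pq: "p : i ` Y" "q : i ` Y" "p ~= q" for p q
 proof -
  have "p : (i \<circ> \<phi>) ` X" "q : (i \<circ> \<phi>) ` X" using pq(1,2) unfolding image_eq(2) .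
  then obtain x y where xy: "x : X" "p = (i \<circ> \<phi>) x" "y : X" "q = (i \<circ> \<phi>) y" by (elim imageE)
  have "naively_approx_elliptically_connected (prod_manifold (proj_manifold n) (proj_manifold N))
    ((%x. (x, (i \<circ> \<phi>) x)) ` X)"
   by (rule assms[unfolded strongly_approx_elliptically_connected_def, rule_format, OF graph_embedding])
  then obtain Cs where Cs: "elliptic_chain (prod_manifold (proj_manifold n) (proj_manifold N)) Cs"
   "ALL C:set Cs. C <= proj_space n \<times> U" "(x, p) : hd Cs" "(y, q) : last Cs"
   using prod_neighborhood[of U] U xy unfolding naively_approx_elliptically_connected_def
   by (metis (no_types, lifting) imageI)
  let ?Ds = "map (image snd) Cs"
  have ne: "Cs ~= []" using Cs(1) by (simp add: elliptic_chain_def)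
  have "successively (%C D. C \<inter> D ~= {}) Cs" using Cs(1) by (simp add: elliptic_chain_def)
  then have suc: "successively (%C D. snd ` C \<inter> snd ` D ~= {}) Cs"
   by (rule successively_mono) blast
  have "EX Es. Es ~= [] & set Es <= set ?Ds & (ALL E:set Es. elliptic_curve (proj_manifold N) E) \<and>
    successively (%C D. C \<inter> D ~= {}) Es & p : hd Es & q : last Es"
  proof (rule successively_discard_points)
   show "?Ds ~= []" using ne by simp
   show "successively (%C D. C \<inter> D ~= {}) ?Ds" using suc by (simp add: successively_map)
   show "p : hd ?Ds" "q : last ?Ds" using ne Cs(3,4) by (force simp: hd_map last_map)+
   show "p ~= q" by fact
   show "elliptic_curve (proj_manifold N) D" if D: "D : set ?Ds" "a : D" "b : D" "a ~= b" for D a b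
   proof -
    obtain C where C: "C : set Cs" "D = snd ` C" using D(1) by auto
    then have "elliptic_curve (prod_manifold (proj_manifold n) (proj_manifold N)) C"
     using Cs(1) unfolding elliptic_chain_def by blast
    then show ?thesis using elliptic_curve_snd D C(2) by blast
   qed
  qed
  then obtain Es where Es: "Es ~= []" "set Es <= set ?Ds" "ALL E:set Es. elliptic_curve (proj_manifold N) E"
    "successively (%C D. C \<inter> D ~= {}) Es" "p : hd Es" "q : last Es" by blast
  have "ALL E:set Es. E <= U" using Es(2) Cs(2) by fastforce
  then show ?thesis using Es unfolding elliptic_chain_def by blast
 qed
 show "?conn U p q"
 proof (cases "p = q")
  case True
  obtain r where "r : i ` Y" "r ~= p" using other_point by blast
  then obtain Cs where Cs: "elliptic_chain (proj_manifold N) Cs" "ALL C:set Cs. C <= U" "p : hd Cs"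
   using distinct[of p r] pq(1) by blast
  \<comment> \<open>For equal points the first curve of a chain leading to some other point is a
    chain of its own.\<close>
  have "hd Cs : set Cs" using Cs(1) by (simp add: elliptic_chain_def)
  then have "elliptic_chain (proj_manifold N) [hd Cs]" "ALL C:set [hd Cs]. C <= U"
   using Cs unfolding elliptic_chain_def by auto
  then show ?thesis using Cs(3) True by (intro exI[of _ "[hd Cs]"]) simp
 qed (use distinct pq in blast)
qed

end

lemma projective_embedding_id:
 assumes "zariski_closed m Y" shows "projective_embedding m Y m id"
proof -
 have morph: "variety_morphism m Y m Y \<psi>" if "!!y. y : Y ==> \<psi> y = y" for \<psi>
  unfolding variety_morphism_iff
 proof (intro conjI ballI)
  show "\<psi> ` Y <= Y" using that by auto
  fix p assume p: "p : Y"
  show "EX Z d f. zariski_closed m Z & p \<notin> Z & (ALL i<=m. form_fun m d (f i)) \<and>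
     (ALL q:Y - Z. ALL v:q. (EX i<=m. f i v ~= 0) & \<psi> q = proj_pt (%i. if i <= m then f i v else 0))"
  proof (rule exI[of _ "{}"], rule exI[of _ 1], rule exI[of _ "%i v. v i"], intro conjI allI impI ballI)
   show "zariski_closed m {}"
    by (rule zariski_closedI[of "{%_. 1}"]) (use form_fun_const[of m 1] proj_space_nonempty_pt in auto)
   show "form_fun m 1 ((%i v. v i) i)" if "i <= m" for i using form_fun_coord[OF that] .
   fix q v assume q: "q : Y - {}" "v : q"
   have v: "q = proj_pt v" "v : coord_vectors m"
    using proj_space_point[of q m v] q zariski_closed_sub[OF assms] by blast+
   have "(%i. if i <= m then v i else 0) = v" using v(2) by (auto simp: coord_vectors_def)
   then show "\<psi> q = proj_pt (%i. if i <= m then (%i v. v i) i v else 0)" using that[of q] q v(1) by simp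
   show "EX i<=m. (%i v. v i) i v ~= 0" using coord_vectors_nonzero[OF v(2)] by simp
  qed simp
 qed
 show ?thesis
  unfolding projective_embedding_def variety_isomorphism_def
  using assms morph[of id] morph[of "inv_into Y id"] by (auto simp: bij_betw_def inv_into_f_eq)
qed

section \<open>Limits of entire curves\<close>

text \<open>Discs of radius 2 in the affine coordinates of chart \<open>k\<close>. The radius leaves
  room: in the chart of its largest entry a point has coordinates of modulus at most 1. So these
  sets form a finite open cover, bounded in each chart and stable under small perturbations.\<close>

definition polydisc :: "nat => nat => ppoint set" where
 "polydisc m k = {p : proj_space m. ALL v:p. ALL i<=m. cmod (v i) < 2 * cmod (v k)}"

definition maps_small :: "nat => (complex => ppoint) => complex => real => bool" where
 "maps_small m g z r \<longleftrightarrow> (EX k<=m. g ` ball z r <= polydisc m k)"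

lemma polydisc_scale:
 "c ~= 0 ==> (ALL i<=m. cmod (cscale c v i) < 2 * cmod (cscale c v k)) \<longleftrightarrow> (ALL i<=m. cmod (v i) < 2 * cmod (v k))"
 by (simp add: cscale_def norm_mult mult.left_commute[of 2])

lemma proj_pt_polydisc_iff:
 assumes "v : coord_vectors m"
 shows "proj_pt v : polydisc m k \<longleftrightarrow> (ALL i<=m. cmod (v i) < 2 * cmod (v k))"
 using proj_pt_self[of v] polydisc_scale[of _ m v k] proj_spaceI[OF assms]
 unfolding polydisc_def proj_pt_def by blast

lemma openin_polydisc: "openin (proj_top m) (polydisc m k)"
 unfolding polydisc_def
proof (rule openin_proj_top_scale_invariant)
 show "(ALL i<=m. cmod (cscale c v i) < 2 * cmod (cscale c v k)) \<longleftrightarrow> (ALL i<=m. cmod (v i) < 2 * cmod (v k))"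
  if "c ~= 0" for c v using polydisc_scale[OF that] .
 have "open (\<Inter>i\<in>{..m}. {v::nat => complex. cmod (v i) < 2 * cmod (v k)})"
  by (intro open_INT ballI open_Collect_less continuous_intros continuous_coord) auto
 moreover have "(\<Inter>i\<in>{..m}. {v::nat => complex. cmod (v i) < 2 * cmod (v k)}) =
   {v. ALL i<=m. cmod (v i) < 2 * cmod (v k)}" by auto
 ultimately show "openin (top_of_set (coord_vectors m)) {v : coord_vectors m. ALL i<=m. cmod (v i) < 2 * cmod (v k)}"
  using openin_coord_vectors[of "%v. ALL i<=m. cmod (v i) < 2 * cmod (v k)"] by simp
qed

lemma polydisc_cover:
 assumes "p : proj_space m"
 obtains v k where "k <= m" "p : polydisc m k" "v : p" "v : unit_vectors m" "cmod (v k) = 1"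
proof -
 obtain v where v: "v : p" "v : unit_vectors m" using unit_vector_of_point[OF assms] by blast
 then obtain k where k: "k <= m" "cmod (v k) = 1" by (auto simp: unit_vectors_def)
 have "p = proj_pt v" using proj_space_point(1)[OF assms v(1)] .
 moreover have "ALL i<=m. cmod (v i) < 2 * cmod (v k)" using v(2) k unfolding unit_vectors_def by force
 ultimately have "p : polydisc m k" using proj_pt_polydisc_iff[OF unit_vectors_coord[OF v(2)]] by simp
 then show ?thesis using that k v by blast
qed

lemma polydisc_chart: "p : polydisc m k ==> k <= m ==> v : p ==> v k ~= 0"
 unfolding polydisc_def by fastforce

lemma polydisc_coordinates:
 assumes g: "hol_map m Om g" and k: "k <= m" and sub: "g ` Om <= polydisc m k"
 obtains v where "!!i. (%z. v z i) holomorphic_on Om" "!!z. z : Om ==> v z : coord_vectors m"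
  "!!z. z : Om ==> v z k = 1" "!!z i. z : Om ==> cmod (v z i) <= 2" "!!z. z : Om ==> g z = proj_pt (v z)"
proof -
 define v where "v = (%z i. if i <= m then affine_coord k i (g z) else 0)"
 have key: "EX e>0. EX w. ball z e <= Om & (ALL i. (%t. w t i) holomorphic_on ball z e) \<and>
   (ALL t:ball z e. w t : coord_vectors m & w t k = 1 & g t = proj_pt (w t) & v t = w t)" if z: "z : Om" for z
 proof -
  obtain e w where w: "e > 0" "ball z e <= Om" "!!i. (%t. w t i) holomorphic_on ball z e"
   "!!t. t : ball z e ==> w t : coord_vectors m" "!!t. t : ball z e ==> w t k = 1"
   "!!t. t : ball z e ==> g t = proj_pt (w t)"
   using holomorphic_into_lift_chart[OF g z k] polydisc_chart[OF _ k] sub z by blast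
  have "v t = w t" if t: "t : ball z e" for t
  proof
   fix i
   have "g t : proj_space m" "w t : g t" using w(4,6)[OF t] proj_spaceI proj_pt_self by auto
   then show "v t i = w t i" unfolding v_def
    using affine_coord_eq[of "g t" m "w t" k i] w(4,5)[OF t] by (auto simp: coord_vectors_def)
  qed
  then show ?thesis using w by blast
 qed
 show ?thesis
 proof (rule that[of v])
  fix i show "(%z. v z i) holomorphic_on Om"
  proof (rule holomorphic_on_locally)
   fix z assume "z : Om"
   then obtain e w where "e > 0" "(%t. w t i) holomorphic_on ball z e" "ALL t:ball z e. v t = w t" using key by blast
   then show "EX e>0. (%z. v z i) holomorphic_on ball z e"
    using holomorphic_transform[of "%t. w t i" "ball z e" "%z. v z i"] by auto
  qed
 next
  fix z assume z: "z : Om"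
  then have *: "v z : coord_vectors m" "v z k = 1" "g z = proj_pt (v z)"
   using key[OF z] centre_in_ball by metis+
  then show "v z : coord_vectors m" "v z k = 1" "g z = proj_pt (v z)" by blast+
  fix i
  have "ALL i<=m. cmod (v z i) < 2 * cmod (v z k)"
   using sub z * proj_pt_polydisc_iff[OF *(1)] by blast
  then show "cmod (v z i) <= 2" using *(2) by (cases "i <= m") (auto simp: v_def)
 qed
qed

text \<open>Liouville's theorem for the bounded affine coordinates.\<close>

lemma entire_in_polydisc_constant:
 assumes g: "hol_map m UNIV g" and k: "k <= m" and sub: "range g <= polydisc m k"
 shows "g a = g b"
proof -
 obtain v where v0: "!!i. (%z. v z i) holomorphic_on UNIV" "!!z. z : UNIV ==> v z : coord_vectors m"
  "!!z. z : UNIV ==> v z k = 1" "!!z i. z : UNIV ==> cmod (v z i) <= 2" "!!z. z : UNIV ==> g z = proj_pt (v z)"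
  by (rule polydisc_coordinates[OF g k sub]) (rule that)
 note v = v0(1) v0(4)[OF UNIV_I] v0(5)[OF UNIV_I]
 have "v a i = v b i" for i
 proof -
  have "bounded (range (%z. v z i))" using v(2) by (auto simp: bounded_iff)
  then have "(%z. v z i) constant_on UNIV" using Liouville_theorem v(1) by blast
  then show ?thesis by (auto simp: constant_on_def)
 qed
 then have "v a = v b" by blast
 then show ?thesis using v(3) by simp
qed

lemma maps_small_mono: "maps_small m g z r ==> ball z' r' <= ball z r ==> maps_small m g z' r'"
 unfolding maps_small_def by (meson image_mono order_trans)

lemma maps_small_exists:
 assumes g: "hol_map m UNIV g"
 obtains r where "r > 0" "maps_small m g z r"
proof -
 have cont: "continuous_map (top_of_set UNIV) (proj_top m) g" using g by (simp add: holomorphic_into_def)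
 obtain k where k: "k <= m" "g z : polydisc m k"
  using polydisc_cover[OF holomorphic_into_proj_space[OF g, of z]] by blast
 have "open {z. g z : polydisc m k}"
  using openin_continuous_map_preimage[OF cont openin_polydisc, of k] by simp
 then have "EX r>0. ball z r <= {z. g z : polydisc m k}" using k(2) unfolding open_contains_ball by blast
 then obtain r where "r > 0" "ball z r <= {z. g z : polydisc m k}" by blast
 then show ?thesis using that[of r] k(1) unfolding maps_small_def by blast
qed

text \<open>A nonconstant entire curve leaves each of the finitely many polydiscs; a disc containing
  one exit point for each of them is not mapped into any.\<close>

lemma maps_small_bounded:
 assumes g: "hol_map m UNIV g" and "g a ~= g b"
 obtains r where "r > 0" "\<not> maps_small m g z r"
proof -
 have "EX w. g w \<notin> polydisc m k" if "k <= m" for k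
  using entire_in_polydisc_constant[OF g that] assms(2) by blast
 then obtain w where w: "!!k. k <= m ==> g (w k) \<notin> polydisc m k" by metis
 obtain r where r: "r > 0" "w ` {..m} <= ball z r"
  using bounded_subset_ballD[OF finite_imp_bounded[of "w ` {..m}"], of z] by blast
 have "\<not> maps_small m g z r"
  unfolding maps_small_def
 proof clarify
  fix k assume "k <= m" "g ` ball z r <= polydisc m k"
  then show False using w[of k] r(2) by auto
 qed
 then show ?thesis using that r(1) by blast
qed

text \<open>Brody's reparametrisation. No metric on projective space is needed: the size of the derivative at
 \<open>z\<close> is replaced by the inverse of the radius \<open>rh z\<close> of the largest disc around \<open>z\<close> that is mapped
 into one of finitely many bounded coordinate charts.\<close>

lemma brody_reparametrisation:
 assumes g: "hol_map m UNIV g" and ne: "g a ~= g b" and R: "R > 0"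
 obtains h where "hol_map m UNIV h" "range h <= range g"
  "\<not> maps_small m h 0 2" "!!w. cmod w < R ==> maps_small m h w (1/4)"
proof -
 define A where "A = (%z. {r. r > 0 & maps_small m g z r})"
 define rh where "rh = (%z. Sup (A z))"
 have A_ne: "A z ~= {}" for z using maps_small_exists[OF g, of z] unfolding A_def by blast
 have A_bdd: "bdd_above (A z)" for z
 proof -
  obtain r where r: "r > 0" "\<not> maps_small m g z r" using maps_small_bounded[OF g ne] by blast
  have "s <= r" if "s : A z" for s
  proof (rule ccontr)
   assume "\<not> s <= r"
   then have "ball z r <= ball z s" by (intro subset_ball) simp
   then show False using that r(2) maps_small_mono[of m g z s z r] unfolding A_def by blast
  qed
  then show ?thesis by (rule bdd_aboveI)
 qed
 have rh_upper: "r <= rh z" if "r > 0" "maps_small m g z r" for r z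
  unfolding rh_def by (rule cSup_upper[OF _ A_bdd]) (use that in "simp add: A_def")
 have rh_small: "maps_small m g z r" if r: "r < rh z" for r z
 proof -
  obtain s where "s : A z" "r < s" using less_cSup_iff[OF A_ne A_bdd] r unfolding rh_def by blast
  then show ?thesis using maps_small_mono[of m g z s z r] subset_ball[of r s z] unfolding A_def by auto
 qed
 have rh_pos: "rh z > 0" for z
 proof -
  obtain r where "r > 0" "maps_small m g z r" using maps_small_exists[OF g, of z] by blast
  then show ?thesis using rh_upper[of r z] by simp
 qed
 \<comment> \<open>Point picking: otherwise every point has within \<open>R * rh\<close> a point
   with less than half of its \<open>rh\<close>. Iteration gives steps bounded by a geometric
   series, hence a convergent sequence along which \<open>rh\<close> tends to 0. At the limit
   \<open>rh\<close> is positive, and a disc around the limit bounds \<open>rh\<close> from below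
   nearby.\<close>
 have "EX z0. ALL z. dist z0 z < R * rh z0 --> rh z >= rh z0 / 2"
 proof (rule ccontr)
  assume "\<not> ?thesis"
  then have "ALL z0. EX z. dist z0 z < R * rh z0 & rh z < rh z0 / 2" by (meson not_le)
  then obtain nxt where nxt: "!!z. dist z (nxt z) < R * rh z" "!!z. rh (nxt z) < rh z / 2" by metis
  define s where "s = (%n. (nxt ^^ n) 0)"
  have s_Suc: "s (Suc n) = nxt (s n)" for n by (simp add: s_def)
  have rhs: "rh (s n) <= rh 0 * (1/2) ^ n" for n
  proof (induction n)
   case 0 then show ?case by (simp add: s_def)
  next
   case (Suc n)
   then show ?case using nxt(2)[of "s n"] unfolding s_Suc by simp
  qed
  have le: "norm (s (Suc n) - s n) <= (R * rh 0) * (1/2) ^ n" for n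
  proof -
   have "norm (s (Suc n) - s n) <= R * rh (s n)"
    using nxt(1)[of "s n"] unfolding s_Suc by (simp add: dist_norm norm_minus_commute)
   also have "\<dots> <= R * (rh 0 * (1/2) ^ n)" using rhs R by (intro mult_left_mono) auto
   finally show ?thesis by simp
  qed
  have "summable (%n. (R * rh 0) * (1/2) ^ n)" by (intro summable_mult summable_geometric) simp
  then have "summable (%n. s (Suc n) - s n)"
   by (rule summable_comparison_test[rotated]) (use le in auto)
  then have "(%n. \<Sum>k<n. s (Suc k) - s k) \<longlonglongrightarrow> suminf (%n. s (Suc n) - s n)" by (rule summable_LIMSEQ)
  then have "(%n. s n - s 0) \<longlonglongrightarrow> suminf (%n. s (Suc n) - s n)" by (simp add: sum_lessThan_telescope)
  then have "(%n. s n - s 0 + s 0) \<longlonglongrightarrow> suminf (%n. s (Suc n) - s n) + s 0" by (intro tendsto_intros)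
  then obtain l where l: "s \<longlonglongrightarrow> l" by auto
  have "(%n. rh 0 * (1/2) ^ n) \<longlonglongrightarrow> rh 0 * 0" by (intro tendsto_intros LIMSEQ_realpow_zero) auto
  then have "\<forall>\<^sub>F n in sequentially. rh 0 * (1/2) ^ n < rh l / 4" 
   by (rule order_tendstoD(2)) (use rh_pos[of l] in simp)
  moreover have "\<forall>\<^sub>F n in sequentially. dist (s n) l < rh l / 4"

   by (rule tendstoD[OF l]) (use rh_pos[of l] in simp)
  ultimately have "\<forall>\<^sub>F n in sequentially. rh 0 * (1/2) ^ n < rh l / 4 & dist (s n) l < rh l / 4"
   by (rule eventually_conj)
  then obtain n where n: "rh 0 * (1/2) ^ n < rh l / 4" "dist (s n) l < rh l / 4"
   by (auto dest: eventually_happens)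
  have "maps_small m g l (rh l / 2)" using rh_small[of "rh l / 2" l] rh_pos[of l] by simp
  moreover have "ball (s n) (rh l / 4) <= ball l (rh l / 2)"
  proof
   fix x assume "x : ball (s n) (rh l / 4)"
   then show "x : ball l (rh l / 2)" using n(2) dist_triangle[of l x "s n"] by (simp add: dist_commute)
  qed
  ultimately have "maps_small m g (s n) (rh l / 4)" by (rule maps_small_mono)
  then have "rh l / 4 <= rh (s n)" by (rule rh_upper[rotated]) (use rh_pos[of l] in simp)
  then show False using rhs[of n] n(1) by linarith
 qed
 then obtain z0 where z0: "!!z. dist z0 z < R * rh z0 ==> rh z >= rh z0 / 2" by blast
 \<comment> \<open>Rescaling by \<open>rh z0\<close> makes the radius equal to 1 at the origin and
   at least 1/2 on the disc of radius \<open>R\<close>. Hence radius 2 fails at the origin and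
   radius 1/4 succeeds on the disc; the slack avoids the question whether the supremum is
   attained.\<close>
 define s where "s = rh z0"
 have s: "s > 0" using rh_pos by (simp add: s_def)
 define h where "h = g \<circ> (%w. z0 + of_real s * w)"
 have img: "(%w. z0 + of_real s * w) ` ball c r = ball (z0 + of_real s * c) (s * r)" for c r
 proof (intro set_eqI iffI)
  fix x assume "x : (%w. z0 + of_real s * w) ` ball c r"
  then obtain w where w: "x = z0 + of_real s * w" "w : ball c r" by blast
  have "dist (z0 + of_real s * c) x = norm (of_real s * (c - w))" unfolding w(1) dist_norm by (simp add: algebra_simps)
  also have "\<dots> < s * r" using w(2) s by (simp add: norm_mult dist_norm)
  finally show "x : ball (z0 + of_real s * c) (s * r)" by simp
 next
  fix x assume x: "x : ball (z0 + of_real s * c) (s * r)"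
  define w where "w = (x - z0) / of_real s"
  have xw: "x = z0 + of_real s * w" using s by (simp add: w_def)
  have "dist (z0 + of_real s * c) x = norm (of_real s * (c - w))" unfolding xw dist_norm by (simp add: algebra_simps)
  then have "s * dist c w < s * r" using x s by (simp add: norm_mult dist_norm)
  then have "w : ball c r" using mult_less_cancel_left_pos[OF s] by simp
  then show "x : (%w. z0 + of_real s * w) ` ball c r" using xw by blast
 qed
 have small_iff: "maps_small m h c r \<longleftrightarrow> maps_small m g (z0 + of_real s * c) (s * r)" for c r
  unfolding maps_small_def h_def image_comp[symmetric] img ..
 show ?thesis
 proof (rule that[of h])
  show "hol_map m UNIV h"
   unfolding h_def by (rule holomorphic_into_compose[OF g]) (auto intro!: holomorphic_intros)
  show "range h <= range g" unfolding h_def by auto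
  show "\<not> maps_small m h 0 2"
  proof
   assume "maps_small m h 0 2"
   then have "maps_small m g z0 (s * 2)" unfolding small_iff by simp
   then have "s * 2 <= rh z0" using rh_upper[of "s * 2" z0] s by simp
   then show False using s by (simp add: s_def)
  qed
  fix w assume "cmod w < R"
  then have "dist z0 (z0 + of_real s * w) < R * s" using s by (simp add: dist_norm norm_mult mult.commute)
  then have "s / 2 <= rh (z0 + of_real s * w)" using z0 unfolding s_def by blast
  then show "maps_small m h w (1/4)" unfolding small_iff using s by (intro rh_small) simp
 qed
qed

section \<open>Normal families and limits of entire curves\<close>

lemma uniform_subsequence:
 fixes c :: "nat => nat => complex => complex"
 assumes op: "!!p. open (S p)" and hol: "!!p n. c p n holomorphic_on S p"
  and bd: "!!p n z. z : S p ==> cmod (c p n z) <= M p"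
 obtains \<sigma> C where "strict_mono (\<sigma> :: nat => nat)" "!!p. C p holomorphic_on S p"
  "!!p K e. compact K ==> K <= S p ==> e > 0 ==> EX N. ALL n>=N. ALL x:K. dist (c p (\<sigma> n) x) (C p x) < e"
proof -
 define P where "P = (%p (s::nat=>nat). EX C. C holomorphic_on S p \<and>
   (ALL K e. compact K --> K <= S p --> e > 0 --> (EX N. ALL n>=N. ALL x:K. dist (c p (s n) x) (C x) < e)))"
 interpret subseqs P
 proof
  fix p and s :: "nat => nat" assume "strict_mono s"
  obtain C r where C: "C holomorphic_on S p" "strict_mono (r :: nat => nat)"
   "!!K. compact K ==> K <= S p ==> uniform_limit K ((%n. c p (s n)) \<circ> r) C sequentially"
  proof (rule Montel[OF op, of "range (%n. c p (s n))" p "%n. c p (s n)"])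
   show "!!h. h : range (%n. c p (s n)) ==> h holomorphic_on S p" using hol by auto
   show "EX B. ALL h:range (%n. c p (s n)). ALL z:K. cmod (h z) <= B" if "K <= S p" for K
    using bd that by (intro exI[of _ "M p"]) auto
  qed auto
  show "EX r'. strict_mono r' & P p (s \<circ> r')"
   using C unfolding P_def uniform_limit_sequentially_iff by (intro exI[of _ r]) (auto simp: o_def)
 qed
 have stable: "P p (s \<circ> r)" if "strict_mono r" "P p s" for r s p
 proof -
  obtain C where C: "C holomorphic_on S p"
   "!!K e. compact K ==> K <= S p ==> e > 0 ==> (EX N. ALL n>=N. ALL x:K. dist (c p (s n) x) (C x) < e)"
   using \<open>P p s\<close> unfolding P_def by blast
  have "EX N. ALL n>=N. ALL x:K. dist (c p ((s \<circ> r) n) x) (C x) < e" if "compact K" "K <= S p" "e > 0" for K e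
  proof -
   obtain N where "ALL n>=N. ALL x:K. dist (c p (s n) x) (C x) < e" using C(2) \<open>compact K\<close> \<open>K <= S p\<close> \<open>e > 0\<close> by blast
   moreover have "r n >= n" for n using seq_suble[OF \<open>strict_mono r\<close>] .
   ultimately show ?thesis by (intro exI[of _ N]) (auto intro: order_trans)
  qed
  then show ?thesis unfolding P_def using C(1) by blast
 qed
 have "P p diagseq" for p
 proof -
  \<comment> \<open>After its first \<open>p + 1\<close> terms the diagonal sequence is a
    subsequence of the one chosen for \<open>p\<close>; the terms left out only shift the bound on
    the index.\<close>
  have "P p (diagseq \<circ> ((+) (Suc p)))" using diagseq_holds[of p] stable by blast
  then obtain C where C: "C holomorphic_on S p"
   "!!K e. compact K ==> K <= S p ==> e > 0 ==> (EX N. ALL n>=N. ALL x:K. dist (c p ((diagseq \<circ> ((+) (Suc p))) n) x) (C x) < e)"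
   unfolding P_def by blast
  have "EX N. ALL n>=N. ALL x:K. dist (c p (diagseq n) x) (C x) < e" if K: "compact K" "K <= S p" "e > 0" for K e
  proof -
   obtain N where N: "!!n x. n >= N ==> x : K ==> dist (c p ((diagseq \<circ> ((+) (Suc p))) n) x) (C x) < e"
    using C(2)[OF K] by blast
   have "dist (c p (diagseq n) x) (C x) < e" if "n >= N + Suc p" "x : K" for n x
    using N[of "n - Suc p" x] that by simp
   then show ?thesis by blast
  qed
  then show ?thesis unfolding P_def using C(1) by blast
 qed
 then have "ALL p. EX C. C holomorphic_on S p \<and>
   (ALL K e. compact K --> K <= S p --> e > 0 --> (EX N. ALL n>=N. ALL x:K. dist (c p (diagseq n) x) (C x) < e))"
  unfolding P_def by blast
 then obtain C where "!!p. C p holomorphic_on S p"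
  "!!p K e. compact K ==> K <= S p ==> e > 0 ==> EX N. ALL n>=N. ALL x:K. dist (c p (diagseq n) x) (C p x) < e"
  by metis
 then show ?thesis using that[of diagseq C] subseq_diagseq by blast
qed

text \<open>A locally uniform limit is described chart by chart: near each point of a countable dense set the
 homogeneous coordinates, normalised by a fixed one, converge uniformly on compact sets.\<close>

lemma local_limits:
 fixes h :: "nat => complex => ppoint" and qs :: "nat => complex"
 assumes h: "!!n. hol_map m UNIV (h n)"
  and small: "!!n w. cmod w < real n ==> maps_small m (h n) w (1/4)"
 obtains \<sigma> where "strict_mono (\<sigma> :: nat => nat)"
  "!!q::complex. q : range qs ==> EX k<=m. EX V v. (ALL i. (%z. V z i) holomorphic_on ball q (1/4)) \<and>
    (ALL z:ball q (1/4). V z : coord_vectors m & V z k = 1) \<and>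
    (ALL K e. compact K --> K <= ball q (1/4) --> e > 0 --> (EX N. ALL n>=N. ALL z:K.
      v n z : coord_vectors m & h (\<sigma> n) z = proj_pt (v n z) & (ALL i<=m. cmod (v n z i - V z i) < e)))"
proof -
 let ?D = "%j::nat. ball (qs j) (1/4) :: complex set"
 have "ALL n j. EX k v. k <= m & (cmod (qs j) < real n --> (ALL i. (%z. v z i) holomorphic_on ?D j) \<and>
   (ALL z:?D j. v z : coord_vectors m & v z k = 1 & (ALL i. cmod (v z i) <= 2) & h n z = proj_pt (v z)))"
 proof (intro allI)
  fix n j
  show "EX k v. k <= m & (cmod (qs j) < real n --> (ALL i. (%z. v z i) holomorphic_on ?D j) \<and>
   (ALL z:?D j. v z : coord_vectors m & v z k = 1 & (ALL i. cmod (v z i) <= 2) & h n z = proj_pt (v z)))"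
  proof (cases "cmod (qs j) < real n")
   case True
   then obtain k where k: "k <= m" "h n ` ?D j <= polydisc m k" using small unfolding maps_small_def by blast
   have "hol_map m (?D j) (h n)" by (rule holomorphic_into_subset[OF h]) auto
   then obtain v where "!!i. (%z. v z i) holomorphic_on ?D j" "!!z. z : ?D j ==> v z : coord_vectors m"
    "!!z. z : ?D j ==> v z k = 1" "!!z i. z : ?D j ==> cmod (v z i) <= 2" "!!z. z : ?D j ==> h n z = proj_pt (v z)"
    by (rule polydisc_coordinates[OF _ k]) (rule that)
   then show ?thesis using k(1) by (intro exI[of _ k] exI[of _ v]) simp
  qed auto
 qed
 then obtain kk v where kv: "!!n j. kk n j <= m"
  "!!n j i. cmod (qs j) < real n ==> (%z. v n j z i) holomorphic_on ?D j"
  "!!n j z. cmod (qs j) < real n ==> z : ?D j ==> v n j z : coord_vectors m & v n j z (kk n j) = 1 \<and>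
    (ALL i. cmod (v n j z i) <= 2) & h n z = proj_pt (v n j z)"
  by metis
 \<comment> \<open>All sequences are put under one index, so that a single diagonal subsequence
   serves. Slot 0 of disc \<open>j\<close> carries the number of the chart as a constant function:
   convergence of integers makes the chart eventually the same. Slot \<open>Suc i\<close> carries
   coordinate \<open>i\<close>; the value 0 stands in while \<open>n\<close> is too small for disc
   \<open>j\<close>.\<close>
 define c where "c = (%p n z. case prod_decode p of (j, i) =>
   if i = 0 then of_nat (kk n j) else if cmod (qs j) < real n then v n j z (i - 1) else 0)"
 have c_simp: "c (prod_encode (j, 0)) n z = of_nat (kk n j)"
  "cmod (qs j) < real n ==> c (prod_encode (j, Suc i)) n z = v n j z i" for j i n z
  by (simp_all add: c_def)
 define S where "S = (%p. ?D (fst (prod_decode p)))"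
 have S_simp: "S (prod_encode (j, i)) = ?D j" for j i by (simp add: S_def)
 obtain \<sigma> C where \<sigma>: "strict_mono (\<sigma> :: nat => nat)" and C: "!!p. C p holomorphic_on S p"
  "!!p K e. compact K ==> K <= S p ==> e > 0 ==> EX N. ALL n>=N. ALL x:K. dist (c p (\<sigma> n) x) (C p x) < e"
 proof (rule uniform_subsequence[of S c "%_. real m + 2"])
  show "open (S p)" for p by (simp add: S_def)
  show "c p n holomorphic_on S p" for p n
  proof -
   obtain j i where p: "prod_decode p = (j, i)" by fastforce
   have Sp: "S p = ?D j" by (simp add: S_def p)
   consider "i = 0" | i' where "i = Suc i'" "cmod (qs j) < real n" | "i ~= 0" "\<not> cmod (qs j) < real n"
    by (cases i) auto
   then show ?thesis
   proof cases
    case 1 then show ?thesis by (simp add: c_def p)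
   next
    case 2
    then have "c p n = (%z. v n j z i')" by (simp add: c_def p)
    then show ?thesis using kv(2)[OF 2(2), of i'] Sp by simp
   next
    case 3 then show ?thesis by (simp add: c_def p)
   qed
  qed
  show "cmod (c p n z) <= real m + 2" if z: "z : S p" for p n z
  proof -
   obtain j i where p: "prod_decode p = (j, i)" by fastforce
   have "cmod (v n j z (i - 1)) <= 2" if "cmod (qs j) < real n"
    using kv(3)[OF that] z by (simp add: S_def p)
   moreover have "real (kk n j) <= real m" using kv(1) by simp
   ultimately show ?thesis by (auto simp: c_def p)
  qed
 qed (rule that)
 have loc: "EX k<=m. EX V v. (ALL i. (%z. V z i) holomorphic_on ?D j) \<and>
    (ALL z:?D j. V z : coord_vectors m & V z k = 1) \<and>
    (ALL K e. compact K --> K <= ?D j --> e > 0 --> (EX N. ALL n>=N. ALL z:K.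
      v n z : coord_vectors m & h (\<sigma> n) z = proj_pt (v n z) & (ALL i<=m. cmod (v n z i - V z i) < e)))" for j
 proof -
  define L where "L = C (prod_encode (j, 0)) (qs j)"
  obtain N0 where N0: "!!n. n >= N0 ==> dist (of_nat (kk (\<sigma> n) j)) L < 1/2"
   using C(2)[of "{qs j}" "prod_encode (j, 0)" "1/2"] unfolding S_simp c_simp L_def by auto
  define k where "k = kk (\<sigma> N0) j"
  have kk: "kk (\<sigma> n) j = k" if "n >= N0" for n
  proof -
   have "dist (of_nat (kk (\<sigma> n) j)) (of_nat k :: complex) < 1/2 + 1/2"
    using N0[OF that] N0[OF order_refl] unfolding k_def
    by (intro dist_triangle_lt[of _ L]) (simp add: dist_commute)
   then have "cmod (of_int (int (kk (\<sigma> n) j) - int k)) < 1" by (simp add: dist_norm)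
   then have "\<bar>int (kk (\<sigma> n) j) - int k\<bar> < 1" unfolding norm_of_int by linarith
   then show ?thesis by linarith
  qed
  obtain N1 where "cmod (qs j) < real N1" using reals_Archimedean2 by blast
  then have N1: "cmod (qs j) < real (\<sigma> n)" if "n >= N1" for n
   using seq_suble[OF \<sigma>, of n] that by (meson less_le_trans of_nat_le_iff)
  define V where "V = (%z i. if i <= m then C (prod_encode (j, Suc i)) z else 0)"
  have conv: "EX N. ALL n>=N. ALL z:K. ALL i<=m. cmod (v (\<sigma> n) j z i - V z i) < e"
   if K: "compact K" "K <= ?D j" "e > 0" for K e
  proof -
   have "ALL i. EX N. ALL n>=N. ALL x:K. dist (c (prod_encode (j, Suc i)) (\<sigma> n) x) (C (prod_encode (j, Suc i)) x) < e"
    using C(2)[OF K(1) _ K(3), of "prod_encode (j, Suc _)"] K(2) unfolding S_simp by blast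
   then obtain NN where NN: "!!i n x. n >= NN i ==> x : K ==>
     dist (c (prod_encode (j, Suc i)) (\<sigma> n) x) (C (prod_encode (j, Suc i)) x) < e" by metis
   define N where "N = Max (insert N1 (NN ` {..m}))"
   have N: "N >= N1" "!!i. i <= m ==> N >= NN i" unfolding N_def by (rule Max_ge; simp)+
   have "cmod (v (\<sigma> n) j z i - V z i) < e" if "n >= N" "z : K" "i <= m" for n z i
    using NN[of i n z] N(1) N(2)[of i] that N1[of n] c_simp(2)[of j "\<sigma> n" i z]
    by (simp add: V_def dist_norm)
   then show ?thesis by blast
  qed
  have V1: "V z k = 1 & V z : coord_vectors m" if z: "z : ?D j" for z
  proof -
   have km: "k <= m" using kv(1) by (simp add: k_def)
   have "cmod (1 - V z k) < e" if e: "e > 0" for e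
   proof -
    obtain N where N: "ALL n>=N. ALL y:{z}. ALL i<=m. cmod (v (\<sigma> n) j y i - V y i) < e"
     using conv[of "{z}" e] z e by auto
    define n where "n = max N (max N0 N1)"
    have n: "n >= N" "n >= N0" "n >= N1" by (auto simp: n_def)
    have "v (\<sigma> n) j z k = 1" using kv(3)[OF N1[OF n(3)] z] kk[OF n(2)] by simp
    then show ?thesis using N n(1) km by force
   qed
   then have "V z k = 1" by (metis eq_iff_diff_eq_0 less_irrefl zero_less_norm_iff)
   moreover from this have "V z ~= (%_. 0)" by auto
   ultimately show ?thesis by (simp add: coord_vectors_def V_def)
  qed
  show ?thesis
  proof (rule exI[of _ k], rule conjI, simp add: kv(1) k_def, rule exI[of _ V],
    rule exI[of _ "%n. v (\<sigma> n) j"], intro conjI allI impI ballI)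
   fix i show "(%z. V z i) holomorphic_on ?D j"
    using C(1)[of "prod_encode (j, Suc i)"] unfolding S_simp V_def by (cases "i <= m") auto
  next
   fix z assume "z : ?D j"
   then show "V z : coord_vectors m" "V z k = 1" using V1 by blast+
  next
   fix K and e :: real assume K: "compact K" "K <= ?D j" "e > 0"
   obtain N where N: "ALL n>=N. ALL z:K. ALL i<=m. cmod (v (\<sigma> n) j z i - V z i) < e" using conv[OF K] by blast
   have "v (\<sigma> n) j z : coord_vectors m & h (\<sigma> n) z = proj_pt (v (\<sigma> n) j z) & (ALL i<=m. cmod (v (\<sigma> n) j z i - V z i) < e)"
    if "n >= max N N1" "z : K" for n z
    using kv(3)[OF N1, of n z] N that K(2) by auto
   then show "EX N. ALL n>=N. ALL z:K. v (\<sigma> n) j z : coord_vectors m & h (\<sigma> n) z = proj_pt (v (\<sigma> n) j z) \<and>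
     (ALL i<=m. cmod (v (\<sigma> n) j z i - V z i) < e)" by blast
  qed
 qed
 show ?thesis using that[OF \<sigma>] loc by blast
qed

lemma dense_sequence:
 obtains qs :: "nat => complex" where "!!z e. e > 0 ==> EX j. z : ball (qs j) e"
proof -
 obtain D :: "complex set" where D: "countable D" "!!X. open X ==> X ~= {} ==> EX d:D. d : X"
  by (rule countable_dense_setE) (rule that)
 have "D ~= {}" using D(2)[of UNIV] by auto
 have "EX j. z : ball (from_nat_into D j) e" if e: "e > 0" for z e
 proof -
  obtain d where d: "d : D" "d : ball z e" using D(2)[of "ball z e"] e by auto
  then obtain j where "from_nat_into D j = d" using from_nat_into_surj[OF D(1)] by blast
  then show ?thesis using d(2) by (intro exI[of _ j]) (simp add: dist_commute)
 qed
 then show ?thesis using that by blast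
qed

text \<open>On overlaps the local limits define the same point, because vanishing minors pass to the
  limit. If the limit curve were constant, finitely many discs of radius 1/8 would cover the closed
  disc of radius 2, and uniform convergence on them would put the whole disc into one polydisc,
  against \<open>large\<close>.\<close>

lemma brody_limit:
 fixes h :: "nat => complex => ppoint"
 assumes h: "!!n. hol_map m UNIV (h n)"
  and small: "!!n w. cmod w < real n ==> maps_small m (h n) w (1/4)"
  and large: "!!n. \<not> maps_small m (h n) 0 2"
 obtains H \<sigma> a b where "hol_map m UNIV H" "H a ~= H b" "strict_mono (\<sigma> :: nat => nat)"
  "!!z. EX v V N. V : coord_vectors m & H z = proj_pt V & (ALL n>=N. v n : coord_vectors m & h (\<sigma> n) z = proj_pt (v n)) \<and>
    (ALL i<=m. (%n. v n i) \<longlonglongrightarrow> V i)"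
proof -
 obtain qs :: "nat => complex" where qs: "!!z e. e > 0 ==> EX j. z : ball (qs j) e"
  using dense_sequence by blast
 let ?D = "%j. ball (qs j) (1/4)"
 obtain \<sigma> where \<sigma>: "strict_mono (\<sigma> :: nat => nat)" and
  loc: "!!q::complex. q : range qs ==> EX k<=m. EX V v. (ALL i. (%z. V z i) holomorphic_on ball q (1/4)) \<and>
    (ALL z:ball q (1/4). V z : coord_vectors m & V z k = 1) \<and>
    (ALL K e. compact K --> K <= ball q (1/4) --> e > 0 --> (EX N. ALL n>=N. ALL z:K.
      v n z : coord_vectors m & h (\<sigma> n) z = proj_pt (v n z) & (ALL i<=m. cmod (v n z i - V z i) < e)))"
 proof (rule local_limits[of m h qs, OF h])
  show "maps_small m (h n) w (1/4)" if "cmod w < real n" for n w using small[OF that] .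
 qed (rule that)
 define Q where "Q = (%j k V v. k <= m & (ALL i. (%z. V z i) holomorphic_on ?D j) \<and>
    (ALL z:?D j. V z : coord_vectors m & V z k = 1) \<and>
    (ALL K e. compact K --> K <= ?D j --> e > 0 --> (EX N. ALL n>=N. ALL z:K.
      v n z : coord_vectors m & h (\<sigma> n) z = proj_pt (v n z) & (ALL i<=m. cmod (v n z i - V z i) < e))))"
 have "ALL j. EX k V v. Q j k V v"
 proof
  fix j
  from loc[OF rangeI[of qs j]] show "EX k V v. Q j k V v"
   unfolding Q_def by (elim exE conjE) (intro exI conjI, assumption+)
 qed
 then obtain k V v where Q: "!!j. Q j (k j) (V j) (v j)" by metis
 have k: "!!j. k j <= m" and V: "!!j i. (%z. V j z i) holomorphic_on ?D j"
  "!!j z. z : ?D j ==> V j z : coord_vectors m & V j z (k j) = 1"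
  and v: "!!j K e. compact K ==> K <= ?D j ==> e > 0 ==> EX N. ALL n>=N. ALL z:K.
     v j n z : coord_vectors m & h (\<sigma> n) z = proj_pt (v j n z) & (ALL i<=m. cmod (v j n z i - V j z i) < e)"
  using Q unfolding Q_def by blast+
 have conv: "EX N. (ALL n>=N. v j n z : coord_vectors m & h (\<sigma> n) z = proj_pt (v j n z)) \<and>
    (ALL i<=m. (%n. v j n z i) \<longlonglongrightarrow> V j z i)" if z: "z : ?D j" for z j
 proof -
  obtain N where N: "ALL n>=N. ALL z:{z}. v j n z : coord_vectors m & h (\<sigma> n) z = proj_pt (v j n z) \<and>
    (ALL i<=m. cmod (v j n z i - V j z i) < 1)" using v[of "{z}" j 1] z by auto
  have "(%n. v j n z i) \<longlonglongrightarrow> V j z i" if i: "i <= m" for i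
  proof (rule LIMSEQ_I)
   fix e :: real assume "e > 0"
   then show "EX no. ALL n>=no. norm (v j n z i - V j z i) < e" using v[of "{z}" j e] z i by force
  qed
  then show ?thesis using N by blast
 qed
 have consistent: "proj_pt (V j z) = proj_pt (V l z)" if z: "z : ?D j" "z : ?D l" for j l z
 proof -
  obtain N where N: "ALL n>=N. v j n z : coord_vectors m & h (\<sigma> n) z = proj_pt (v j n z)"
    "ALL i<=m. (%n. v j n z i) \<longlonglongrightarrow> V j z i" using conv[OF z(1)] by blast
  obtain N' where N': "ALL n>=N'. v l n z : coord_vectors m & h (\<sigma> n) z = proj_pt (v l n z)"
    "ALL i<=m. (%n. v l n z i) \<longlonglongrightarrow> V l z i" using conv[OF z(2)] by blast
  have "V j z a * V l z b = V j z b * V l z a" if ab: "a <= m" "b <= m" for a b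
  proof (rule LIMSEQ_unique)
   show "(%n. v j n z a * v l n z b) \<longlonglongrightarrow> V j z a * V l z b" using N(2) N'(2) ab by (intro tendsto_mult) auto
   have "(%n. v j n z b * v l n z a) \<longlonglongrightarrow> V j z b * V l z a" using N(2) N'(2) ab by (intro tendsto_mult) auto
   moreover have "\<forall>\<^sub>F n in sequentially. v j n z b * v l n z a = v j n z a * v l n z b"
    unfolding eventually_sequentially
   proof (intro exI allI impI)
    fix n assume "n >= max N N'"
    then have "v j n z : coord_vectors m" "v l n z : coord_vectors m" "proj_pt (v j n z) = proj_pt (v l n z)"
     using N(1) N'(1) by auto
    then show "v j n z b * v l n z a = v j n z a * v l n z b" using proj_pt_eq_minors ab by metis
   qed
   ultimately show "(%n. v j n z a * v l n z b) \<longlonglongrightarrow> V j z b * V l z a"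
    by (rule Lim_transform_eventually)
  qed
  then show ?thesis using proj_pt_eq_minors V(2) z by blast
 qed
 have "ALL z. EX j. z : ?D j" using qs[of "1/4"] by simp
 then obtain J where J: "!!z. z : ?D (J z)" by metis
 define H where "H = (%z. proj_pt (V (J z) z))"
 have H: "H z = proj_pt (V j z)" if "z : ?D j" for z j
  unfolding H_def using consistent[OF J that] .
 have Hhol: "hol_map m UNIV H"
 proof (rule holomorphic_intoI)
  fix z :: complex
  obtain e where e: "e > 0" "ball z e <= ?D (J z)" using J[of z] by (meson open_ball open_contains_ball)
  show "EX e>0. EX v. ball z e <= UNIV & (ALL i<=m. (%t. v t i) holomorphic_on ball z e) \<and>
    (ALL t:ball z e. v t : coord_vectors m & H t = proj_pt (v t))"
  proof (rule exI[of _ e], intro conjI e(1), rule exI[of _ "V (J z)"], intro conjI allI impI ballI subset_UNIV)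
   show "(%t. V (J z) t i) holomorphic_on ball z e" for i by (rule holomorphic_on_subset[OF V(1) e(2)])
   fix t assume "t : ball z e"
   then have "t : ?D (J z)" using e(2) by blast
   then show "V (J z) t : coord_vectors m" "H t = proj_pt (V (J z) t)" using V(2) H by blast+
  qed
 qed simp
 have nonconst: "EX a b. H a ~= H b"
 proof (rule ccontr)
  assume "\<not> (EX a b. H a ~= H b)"
  then have const: "H z = H 0" for z by blast
  have p: "H 0 : proj_space m" using holomorphic_into_proj_space[OF Hhol] by blast
  obtain w l where w: "l <= m" "w : H 0" "w : unit_vectors m" "cmod (w l) = 1"
   using polydisc_cover[OF p] by metis
  have le: "cmod (u i) <= cmod (u l)" if u: "u : H 0" "i <= m" for u i
  proof -
   have "H 0 = proj_pt w" using proj_space_point(1)[OF p w(2)] .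
   then obtain c where "u = cscale c w" using u(1) unfolding proj_pt_def by blast
   moreover have "cmod (w i) <= 1" using w(3) u(2) unfolding unit_vectors_def by blast
   ultimately show ?thesis using w(4) by (simp add: cscale_def norm_mult mult_left_le)
  qed
  have "compact (cball (0::complex) 2)" by simp
  moreover have "cball (0::complex) 2 <= (\<Union>j\<in>UNIV. ball (qs j) (1/8))" using qs[of "1/8"] by auto
  ultimately obtain F where F: "finite F" "cball (0::complex) 2 <= (\<Union>j\<in>F. ball (qs j) (1/8))"
   using compactE_image[of "cball (0::complex) 2" UNIV "%j. ball (qs j) (1/8)"] by (metis open_ball)
  have "ALL j. EX N. ALL n>=N. ALL z:cball (qs j) (1/8). v j n z : coord_vectors m & h (\<sigma> n) z = proj_pt (v j n z) \<and>
     (ALL i<=m. cmod (v j n z i - V j z i) < 1/4)"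
  proof
   fix j
   have "cball (qs j) (1/8) <= ?D j" by auto
   then show "EX N. ALL n>=N. ALL z:cball (qs j) (1/8). v j n z : coord_vectors m & h (\<sigma> n) z = proj_pt (v j n z) \<and>
     (ALL i<=m. cmod (v j n z i - V j z i) < 1/4)"
    using v[of "cball (qs j) (1/8)" j "1/4"] by simp
  qed
  then obtain N where N: "!!j n z. n >= N j ==> z : cball (qs j) (1/8) ==> v j n z : coord_vectors m \<and>
    h (\<sigma> n) z = proj_pt (v j n z) & (ALL i<=m. cmod (v j n z i - V j z i) < 1/4)" by metis
  define n where "n = Max (insert 0 (N ` F))"
  have n: "n >= N j" if "j : F" for j using that F(1) unfolding n_def by (intro Max_ge) auto
  have "h (\<sigma> n) z : polydisc m l" if z: "z : ball 0 2" for z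
  proof -
   have "z : cball 0 2" using z by simp
   then obtain j where j: "j : F" "z : ball (qs j) (1/8)" using F(2) by blast
   then have zc: "z : cball (qs j) (1/8)" and zD: "z : ?D j" by auto
   note vn = N[OF n[OF j(1)] zc]
   have Vz: "V j z : H 0" using H[OF zD] const[of z] proj_pt_self by metis
   have V1: "cmod (V j z l) >= 1" using le[OF Vz k[of j]] V(2)[OF zD] by simp
   \<comment> \<open>Errors below 1/4 suffice: entry \<open>l\<close> of the limit is the largest
     one and has modulus at least 1, while 1/4 gained on the left and twice 1/4 lost on the right
     add up to only 3/4.\<close>
   have "cmod (v j n z i) < 2 * cmod (v j n z l)" if i: "i <= m" for i
   proof -
    have "cmod (v j n z i) <= cmod (V j z i) + cmod (v j n z i - V j z i)" by (rule norm_triangle_sub)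
    moreover have "cmod (V j z l) <= cmod (v j n z l) + cmod (V j z l - v j n z l)" by (rule norm_triangle_sub)
    moreover have "cmod (v j n z i - V j z i) < 1/4" "cmod (V j z l - v j n z l) < 1/4"
     using vn i w(1) by (auto simp: norm_minus_commute)
    ultimately show ?thesis using le[OF Vz i] V1 by linarith
   qed
   then show ?thesis using vn proj_pt_polydisc_iff by simp
  qed
  then have "maps_small m (h (\<sigma> n)) 0 2" unfolding maps_small_def using w(1) by blast
  then show False using large by blast
 qed
 then obtain a b where "H a ~= H b" by blast
 then show ?thesis
 proof (rule that[OF Hhol _ \<sigma>])
  fix z
  obtain N where N: "ALL n>=N. v (J z) n z : coord_vectors m & h (\<sigma> n) z = proj_pt (v (J z) n z)"
    "ALL i<=m. (%n. v (J z) n z i) \<longlonglongrightarrow> V (J z) z i" using conv[OF J] by blast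
  show "EX v V N. V : coord_vectors m & H z = proj_pt V & (ALL n>=N. v n : coord_vectors m & h (\<sigma> n) z = proj_pt (v n)) \<and>
    (ALL i<=m. (%n. v n i) \<longlonglongrightarrow> V i)"
   by (rule exI[of _ "%n. v (J z) n z"], rule exI[of _ "V (J z) z"], rule exI[of _ N])
     (use N V(2)[OF J] H[OF J] in auto)
 qed
qed

text \<open>Points whose representatives are within relative distance 1/(n+1) of the cone over
  \<open>Y\<close> in the maximum norm. The condition is invariant under scaling, so it makes sense
  for points, and these neighborhoods shrink to \<open>Y\<close>.\<close>

definition cone_neighborhood :: "nat => ppoint set => nat => ppoint set" where
 "cone_neighborhood m Y n = {p : proj_space m. ALL v:p. EX w:\<Union>Y. EX k<=m. ALL i<=m. real (Suc n) * cmod (v i - w i) < cmod (v k)}"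

lemma cone_scale:
 assumes "Y <= proj_space m" "w : \<Union>Y" "c ~= 0" shows "cscale c w : \<Union>Y"
proof -
 obtain q where q: "q : Y" "w : q" using assms by blast
 then have "q = proj_pt w" using proj_space_point assms(1) by blast
 then have "cscale c w : q" using assms(3) by (auto simp: proj_pt_def)
 then show ?thesis using q by blast
qed

lemma cone_neighborhood_scale:
 fixes v :: "nat => complex"
 assumes Y: "Y <= proj_space m" and c: "c ~= 0"
  and "EX w:\<Union>Y. EX k<=m. ALL i<=m. real (Suc n) * cmod (v i - w i) < cmod (v k)"
 shows "EX w:\<Union>Y. EX k<=m. ALL i<=m. real (Suc n) * cmod (cscale c v i - w i) < cmod (cscale c v k)"
proof -
 obtain w k where w: "w : \<Union>Y" "k <= m" "ALL i<=m. real (Suc n) * cmod (v i - w i) < cmod (v k)" using assms(3) by blast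
 have "real (Suc n) * cmod (cscale c v i - cscale c w i) < cmod (cscale c v k)" if i: "i <= m" for i
 proof -
  have "real (Suc n) * cmod (cscale c v i - cscale c w i) = cmod c * (real (Suc n) * cmod (v i - w i))"
   by (simp add: cscale_def right_diff_distrib[symmetric] norm_mult)
  also have "\<dots> < cmod c * cmod (v k)" using w(3) i c by (intro mult_strict_left_mono) auto
  finally show ?thesis by (simp add: cscale_def norm_mult)
 qed
 then show ?thesis using cone_scale[OF Y w(1) c] w(2) by blast
qed

lemma openin_cone_neighborhood:
 assumes Y: "Y <= proj_space m"
 shows "openin (proj_top m) (cone_neighborhood m Y n)"
 unfolding cone_neighborhood_def
proof (rule openin_proj_top_scale_invariant)
 fix c :: complex and v :: "nat => complex" assume c: "c ~= 0"
 have "cscale (1 / c) (cscale c v) = v" using c by (simp add: cscale_def)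
 then show "(EX w:\<Union>Y. EX k<=m. ALL i<=m. real (Suc n) * cmod (cscale c v i - w i) < cmod (cscale c v k)) \<longleftrightarrow>
   (EX w:\<Union>Y. EX k<=m. ALL i<=m. real (Suc n) * cmod (v i - w i) < cmod (v k))" (is "?L \<longleftrightarrow> ?R")
 proof -
  have "1 / c ~= 0" using c by simp
  then have "?L ==> ?R"
   using cone_neighborhood_scale[OF Y, of "1 / c" n "cscale c v"] unfolding \<open>cscale (1 / c) (cscale c v) = v\<close> by blast
  then show ?thesis using cone_neighborhood_scale[OF Y c, of n v] by blast
 qed
next
 have "open {v::nat => complex. ALL i<=m. real (Suc n) * cmod (v i - w i) < cmod (v k)}" for w k
 proof -
  have "open (\<Inter>i\<in>{..m}. {v::nat => complex. real (Suc n) * cmod (v i - w i) < cmod (v k)})"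
   by (intro open_INT ballI open_Collect_less continuous_intros continuous_coord) auto
  moreover have "(\<Inter>i\<in>{..m}. {v::nat => complex. real (Suc n) * cmod (v i - w i) < cmod (v k)}) =
    {v. ALL i<=m. real (Suc n) * cmod (v i - w i) < cmod (v k)}" by auto
  ultimately show ?thesis by simp
 qed
 then have "open (\<Union>w\<in>\<Union>Y. \<Union>k\<in>{..m}. {v::nat => complex. ALL i<=m. real (Suc n) * cmod (v i - w i) < cmod (v k)})"
  by (intro open_UN ballI)
 moreover have "(\<Union>w\<in>\<Union>Y. \<Union>k\<in>{..m}. {v::nat => complex. ALL i<=m. real (Suc n) * cmod (v i - w i) < cmod (v k)}) =
   {v. EX w:\<Union>Y. EX k<=m. ALL i<=m. real (Suc n) * cmod (v i - w i) < cmod (v k)}" by auto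
 ultimately have "open {v. EX w:\<Union>Y. EX k<=m. ALL i<=m. real (Suc n) * cmod (v i - w i) < cmod (v k)}" by simp
 then show "openin (top_of_set (coord_vectors m))
   {v : coord_vectors m. EX w:\<Union>Y. EX k<=m. ALL i<=m. real (Suc n) * cmod (v i - w i) < cmod (v k)}"
  by (rule openin_coord_vectors)
qed

lemma cone_neighborhood_contains:
 assumes "Y <= proj_space m" shows "Y <= cone_neighborhood m Y n"
proof
 fix p assume p: "p : Y"
 have "EX w:\<Union>Y. EX k<=m. ALL i<=m. real (Suc n) * cmod (v i - w i) < cmod (v k)" if v: "v : p" for v
 proof -
  obtain k where "k <= m" "v k ~= 0"
   using coord_vectors_nonzero proj_space_point(2)[of p m v] p v assms by blast
  then show ?thesis using p v by (intro bexI[of _ v] exI[of _ k]) auto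
 qed
 then show "p : cone_neighborhood m Y n" unfolding cone_neighborhood_def using p assms by blast
qed

text \<open>The nearby cone vectors have the same limit as the \<open>v n\<close>, because their
  distance is at most the sum of the moduli of the entries of \<open>v n\<close> divided by n+1. A
  form vanishing on \<open>Y\<close> vanishes at all of them, hence at \<open>V\<close>.\<close>

lemma cone_neighborhood_limit:
 assumes Y: "zariski_closed m Y" and V: "V : coord_vectors m"
  and v: "!!n. n >= N ==> proj_pt (v n) : cone_neighborhood m Y (\<sigma> n)" and \<sigma>: "strict_mono (\<sigma> :: nat => nat)"
  and lim: "!!i. i <= m ==> (%n. v n i) \<longlonglongrightarrow> V i"
 shows "proj_pt V : Y"
proof (rule ccontr)
 assume nV: "proj_pt V \<notin> Y"
 obtain d f where f: "form_fun m d f" "!!q v. q : Y ==> v : q ==> f v = 0" "!!v. v : proj_pt V ==> f v ~= 0"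
  using zariski_closed_separate[OF Y proj_spaceI[OF V] nV] by blast
 have "ALL n. EX w. n >= N --> w : \<Union>Y & (EX k<=m. ALL i<=m. real (Suc (\<sigma> n)) * cmod (v n i - w i) < cmod (v n k))"
 proof
  fix n
  show "EX w. n >= N --> w : \<Union>Y & (EX k<=m. ALL i<=m. real (Suc (\<sigma> n)) * cmod (v n i - w i) < cmod (v n k))"
  proof (cases "n >= N")
   case True
   then have "ALL u:proj_pt (v n). EX w:\<Union>Y. EX k<=m. ALL i<=m. real (Suc (\<sigma> n)) * cmod (u i - w i) < cmod (u k)"
    using v unfolding cone_neighborhood_def by simp
   from bspec[OF this proj_pt_self] show ?thesis by blast
  qed simp
 qed
 then obtain w where w: "!!n. n >= N ==> w n : \<Union>Y"
  "!!n. n >= N ==> EX k<=m. ALL i<=m. real (Suc (\<sigma> n)) * cmod (v n i - w n i) < cmod (v n k)" by metis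
 define B where "B = (%n. \<Sum>k\<le>m. cmod (v n k))"
 have B: "B \<longlonglongrightarrow> (\<Sum>k\<le>m. cmod (V k))" unfolding B_def by (intro tendsto_sum tendsto_norm lim) simp
 have bound: "cmod (w n i - v n i) <= B n * inverse (real (Suc n))" if n: "n >= N" and i: "i <= m" for n i
 proof -
  obtain k where k: "k <= m" "real (Suc (\<sigma> n)) * cmod (v n i - w n i) < cmod (v n k)" using w(2)[OF n] i by blast
  have "real (Suc n) * cmod (v n i - w n i) <= real (Suc (\<sigma> n)) * cmod (v n i - w n i)"
   using seq_suble[OF \<sigma>, of n] by (intro mult_right_mono) auto
  also have "\<dots> <= cmod (v n k)" using k(2) by simp
  also have "\<dots> <= B n" unfolding B_def using k(1) by (intro member_le_sum) auto
  finally show ?thesis by (simp add: norm_minus_commute field_simps)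
 qed
 have "(%n. w n i) \<longlonglongrightarrow> V i" if i: "i <= m" for i
 proof -
  have "(%n. B n * inverse (real (Suc n))) \<longlonglongrightarrow> (\<Sum>k\<le>m. cmod (V k)) * 0"
   by (intro tendsto_mult B LIMSEQ_inverse_real_of_nat)
  then have "(%n. w n i - v n i) \<longlonglongrightarrow> 0"
   using bound[OF _ i] by (intro Lim_null_comparison[of "%n. w n i - v n i" "%n. B n * inverse (real (Suc n))"])
    (auto simp: eventually_sequentially)
  then have "(%n. (w n i - v n i) + v n i) \<longlonglongrightarrow> 0 + V i" by (intro tendsto_add lim i)
  then show ?thesis by simp
 qed
 then have "(%n. f (w n)) \<longlonglongrightarrow> f V" by (rule poly_fun_tendsto[OF form_fun_poly_fun[OF f(1)]])
 moreover have "\<forall>\<^sub>F n in sequentially. f (w n) = 0" using w(1) f(2) by (auto simp: eventually_sequentially)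
 then have "(%n. f (w n)) \<longlonglongrightarrow> 0" by (rule tendsto_eventually)
 ultimately have "f V = 0" by (rule LIMSEQ_unique)
 then show False using f(3)[OF proj_pt_self] by blast
qed

section \<open>Entire curves and hyperbolicity\<close>

lemma poincare_dist_nonneg:
 assumes "a : ball 0 1" "b : ball 0 1" shows "poincare_dist a b >= 0"
proof -
 have "cmod (Moebius_function 0 a b) < 1" using assms by (intro Moebius_function_norm_lt_1) auto
 moreover have "cmod (Moebius_function 0 a b) = cmod ((a - b) / (1 - cnj a * b))"
  unfolding Moebius_function_def by (simp add: norm_divide norm_minus_commute)
 ultimately have x: "cmod ((a - b) / (1 - cnj a * b)) < 1" by simp
 define x where "x = cmod ((a - b) / (1 - cnj a * b))"
 have "0 <= x" "x < 1" using x by (simp_all add: x_def)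
 then have "ln ((1 + x) / (1 - x)) >= 0" by (intro ln_ge_zero) (simp add: field_simps)
 then show ?thesis unfolding poincare_dist_def x_def[symmetric] artanh_def by simp
qed

text \<open>A single disc joins \<open>H a\<close> to \<open>H b\<close>: the entire curve on a disc
  of radius \<open>R n\<close>, rescaled to the unit disc. The marked parameters
  \<open>a / R n\<close> and \<open>b / R n\<close> tend to 0, and so does their Poincare
  distance.\<close>

lemma entire_curve_not_hyperbolic:
 assumes H: "hol_map m UNIV H" and Y: "range H <= Y" and ne: "H a ~= H b"
 shows "\<not> kobayashi_hyperbolic m Y"
proof
 assume "kobayashi_hyperbolic m Y"
 then interpret Metric_space Y "kobayashi_pseudodist m Y" by (simp add: kobayashi_hyperbolic_def)
 let ?S = "{(\<Sum>(f, a, b)\<leftarrow>L. poincare_dist a b) | L. disc_chain m Y (H a) (H b) L}"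
 have nonneg_sum: "x >= 0" if x: "x : ?S" for x
 proof -
  obtain L where L: "x = (\<Sum>(f, a, b)\<leftarrow>L. poincare_dist a b)" "disc_chain m Y (H a) (H b) L" using x by blast
  have L': "ALL (f, a, b):set L. a : ball 0 1 & b : ball 0 1" using L(2) unfolding disc_chain_def by auto
  have "0 <= (case t of (f, a, b) => poincare_dist a b)" if t: "t : set L" for t
   using bspec[OF L' t] by (cases t) (auto intro: poincare_dist_nonneg)
  then show ?thesis unfolding L(1) by (intro sum_list_nonneg) auto
 qed
 have bdd: "bdd_below ?S" using nonneg_sum by (rule bdd_belowI)
 define R where "R = (%n. real (Suc n) + cmod a + cmod b)"
 have R: "R n > 0" "cmod a < R n" "cmod b < R n" for n
 proof -
  have "real (Suc n) > 0" by simp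
  then show "R n > 0" "cmod a < R n" "cmod b < R n"
   unfolding R_def using norm_ge_zero[of a] norm_ge_zero[of b] by linarith+
 qed
 define da where "da = (%n. a / of_real (R n))"
 define db where "db = (%n. b / of_real (R n))"
 have mem: "poincare_dist (da n) (db n) : ?S" for n
 proof -
  let ?f = "H \<circ> (%z. of_real (R n) * z)"
  have "hol_map m (ball 0 1) ?f"
   by (rule holomorphic_into_compose[OF H]) (auto intro!: holomorphic_intros)
  moreover have "?f ` ball 0 1 <= Y" using Y by auto
  moreover have "da n : ball 0 1" "db n : ball 0 1"
   using R[of n] by (simp_all add: da_def db_def norm_divide)
  moreover have "?f (da n) = H a" "?f (db n) = H b" using R(1)[of n] by (simp_all add: da_def db_def)
  ultimately have "disc_chain m Y (H a) (H b) [(?f, da n, db n)]" unfolding disc_chain_def by simp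
  then show ?thesis by (intro CollectI exI[of _ "[(?f, da n, db n)]"]) simp
 qed
 have Rinf: "(%n. inverse (R n)) \<longlonglongrightarrow> 0"
 proof (rule tendsto_sandwich[OF _ _ tendsto_const LIMSEQ_inverse_real_of_nat])
  show "\<forall>\<^sub>F n in sequentially. 0 <= inverse (R n)" using R(1) by (simp add: less_imp_le)
  have "inverse (R n) <= inverse (real (Suc n))" for n unfolding R_def by (intro le_imp_inverse_le) auto
  then show "\<forall>\<^sub>F n in sequentially. inverse (R n) <= inverse (real (Suc n))" by simp
 qed
 have "(%n. complex_of_real (inverse (R n))) \<longlonglongrightarrow> of_real 0" by (intro tendsto_of_real Rinf)
 then have "(%n. a * of_real (inverse (R n))) \<longlonglongrightarrow> a * of_real 0" "(%n. b * of_real (inverse (R n))) \<longlonglongrightarrow> b * of_real 0"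
  by (intro tendsto_mult tendsto_const; assumption)+
 then have lim: "da \<longlonglongrightarrow> 0" "db \<longlonglongrightarrow> 0" unfolding da_def db_def by (simp_all add: divide_inverse)
 have "(%n. cmod ((da n - db n) / (1 - cnj (da n) * db n))) \<longlonglongrightarrow> cmod ((0 - 0) / (1 - cnj 0 * 0))"
  by (intro tendsto_intros lim) auto
 then have "(%n. poincare_dist (da n) (db n)) \<longlonglongrightarrow> 2 * artanh (cmod ((0 - 0) / (1 - cnj 0 * 0)))"
  unfolding poincare_dist_def by (intro tendsto_mult tendsto_const tendsto_artanh) auto
 then have "(%n. poincare_dist (da n) (db n)) \<longlonglongrightarrow> 0" by simp
 moreover have "Inf ?S <= poincare_dist (da n) (db n)" for n by (rule cInf_lower[OF mem bdd])
 ultimately have "Inf ?S <= 0" by (intro LIMSEQ_le_const[of "%n. poincare_dist (da n) (db n)"]) auto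
 moreover have "Inf ?S >= 0" by (rule cInf_greatest) (use mem nonneg_sum in blast)+
 ultimately have "Inf ?S = 0" by simp
 moreover have "H a : Y" "H b : Y" using Y by auto
 ultimately have "kobayashi_pseudodist m Y (H a) (H b) = 0" unfolding kobayashi_pseudodist_def by simp
 then show False using zero[OF \<open>H a : Y\<close> \<open>H b : Y\<close>] ne by blast
qed

theorem not_hyperbolic_if_entire_curves_nearby:
 assumes Y: "zariski_closed m Y"
  and curves: "!!U. openin (proj_top m) U ==> Y <= U ==>
   EX g a b. hol_map m UNIV g & range g <= U & g a ~= g b"
 shows "\<not> kobayashi_hyperbolic m Y"
proof -
 have Ysub: "Y <= proj_space m" using zariski_closed_sub[OF Y] .
 have "ALL n. EX h. hol_map m UNIV h & range h <= cone_neighborhood m Y n \<and>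
   \<not> maps_small m h 0 2 & (ALL w. cmod w < real n --> maps_small m h w (1/4))"
 proof
  fix n
  have "EX g a b. hol_map m UNIV g & range g <= cone_neighborhood m Y n & g a ~= g b"
   by (rule curves[OF openin_cone_neighborhood[OF Ysub] cone_neighborhood_contains[OF Ysub]])
  then obtain g a b where g: "hol_map m UNIV g" "range g <= cone_neighborhood m Y n" "g a ~= g b"
   by blast
  have "real n + 1 > 0" by simp
  then obtain h where h: "hol_map m UNIV h" "range h <= range g"
   "\<not> maps_small m h 0 2" "!!w. cmod w < real n + 1 ==> maps_small m h w (1/4)"
   by (rule brody_reparametrisation[OF g(1,3)]) (rule that)
  show "EX h. hol_map m UNIV h & range h <= cone_neighborhood m Y n \<and>
   \<not> maps_small m h 0 2 & (ALL w. cmod w < real n --> maps_small m h w (1/4))"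
   using h g(2) by (intro exI[of _ h]) auto
 qed
 then obtain h where h: "!!n. hol_map m UNIV (h n)"
  "!!n. range (h n) <= cone_neighborhood m Y n" "!!n. \<not> maps_small m (h n) 0 2"
  "!!n w. cmod w < real n ==> maps_small m (h n) w (1/4)" by metis
 obtain H \<sigma> a b where H: "hol_map m UNIV H" "H a ~= H b" "strict_mono (\<sigma> :: nat => nat)"
  and lim: "!!z. EX v V N. V : coord_vectors m & H z = proj_pt V & (ALL n>=N. v n : coord_vectors m & h (\<sigma> n) z = proj_pt (v n)) \<and>
    (ALL i<=m. (%n. v n i) \<longlonglongrightarrow> V i)"
  by (rule brody_limit[OF h(1,4,3)]) (assumption | rule that)+
 have "H z : Y" for z
 proof -
  obtain v V N where v: "V : coord_vectors m" "H z = proj_pt V"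
   "!!n. n >= N ==> v n : coord_vectors m & h (\<sigma> n) z = proj_pt (v n)" "!!i. i <= m ==> (%n. v n i) \<longlonglongrightarrow> V i"
   using lim[of z] by blast
  have "proj_pt (v n) : cone_neighborhood m Y (\<sigma> n)" if "n >= N" for n
   using v(3)[OF that] h(2)[of "\<sigma> n"] by (metis rangeI subsetD)
  then show ?thesis unfolding v(2) by (rule cone_neighborhood_limit[OF Y v(1) _ H(3) v(4)])
 qed
 then show ?thesis using entire_curve_not_hyperbolic[OF H(1) _ H(2)] by blast
qed

section \<open>Charts of projective curves\<close>

lemma openin_affine_preimage:
 assumes "k <= n" "open T"
 shows "openin (proj_top n) {p : proj_space n. ALL v:p. v k ~= 0 & v i / v k : T}"
proof (rule openin_proj_top_scale_invariant)
 show "(cscale c v k ~= 0 & cscale c v i / cscale c v k : T) = (v k ~= 0 & v i / v k : T)" if "c ~= 0" for c :: complex and v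
  using that by (simp add: cscale_def)
 have "open {v::nat => complex. v k ~= 0}"
  by (intro open_Collect_neq continuous_coord continuous_intros)
 moreover have "continuous_on {v::nat => complex. v k ~= 0} (%v. v i / v k)"
  by (intro continuous_intros continuous_coord) auto
 ultimately have "open ({v::nat => complex. v k ~= 0} \<inter> (%v. v i / v k) -` T)"
  using assms(2) continuous_open_preimage by blast
 moreover have "{v::nat => complex. v k ~= 0} \<inter> (%v. v i / v k) -` T = {v. v k ~= 0 & v i / v k : T}" by auto
 ultimately show "openin (top_of_set (coord_vectors n)) {v : coord_vectors n. v k ~= 0 & v i / v k : T}"
  using openin_coord_vectors[of "%v. v k ~= 0 & v i / v k : T"] by simp
qed

lemma continuous_map_affine_coord:
 assumes "k <= n" "A <= {p : proj_space n. ALL v:p. v k ~= 0}"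
 shows "continuous_map (subtopology (proj_top n) A) euclidean (affine_coord k i)"
 unfolding continuous_map_def
proof (intro conjI allI impI)
 fix U :: "complex set" assume "openin euclidean U"
 then have U: "open U" by simp
 have A: "topspace (subtopology (proj_top n) A) = A" using assms(2) by (auto simp: topspace_proj_top)
 have "affine_coord k i p : U \<longleftrightarrow> p : {p : proj_space n. ALL v:p. v k ~= 0 & v i / v k : U}" if p: "p : A" for p
 proof -
  have pn: "p : proj_space n" "ALL v:p. v k ~= 0" using p assms(2) by auto
  obtain w where "w : p" using proj_space_nonempty_pt[OF pn(1)] by blast
  moreover have "v i / v k = affine_coord k i p" if "v : p" for v
   using affine_coord_eq[OF pn(1) that, of k i] pn(2) that by simp
  ultimately show ?thesis using pn by auto
 qed
 then have "{x : A. affine_coord k i x : U} = {p : proj_space n. ALL v:p. v k ~= 0 & v i / v k : U} \<inter> A" by blast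
 then show "openin (subtopology (proj_top n) A) {x : topspace (subtopology (proj_top n) A). affine_coord k i x : U}"
  unfolding A openin_subtopology using openin_affine_preimage[OF assms(1) U] by blast
qed simp

text \<open>One entry of the normalised lift is affine in the parameter, so an affine coordinate of
  the point recovers the parameter continuously; this is the inverse of the homeomorphism.\<close>

lemma inverse_chartI:
 assumes "open Om" and k: "k <= n" and hol: "!!i. i <= n ==> (%t. Gm t i) holomorphic_on Om"
  and coord: "!!t. t : Om ==> Gm t : coord_vectors n" "!!t. t : Om ==> Gm t k = 1"
  and param: "r ~= 0" "!!t. t : Om ==> Gm t i0 = c + r * t"
  and op: "openin (subtopology (proj_top n) C) ((%t. proj_pt (Gm t)) ` Om)"
 shows "inverse_chart n C Om (%t. proj_pt (Gm t))"
proof -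
 let ?\<gamma> = "%t. proj_pt (Gm t)"
 let ?inv = "%p. (affine_coord k i0 p - c) / r"
 have hol': "hol_map n Om ?\<gamma>"
 proof (rule holomorphic_intoI[OF assms(1)])
  fix z assume "z : Om"
  then obtain e where "e > 0" "ball z e <= Om" using assms(1) by (auto simp: open_contains_ball)
  then show "EX e>0. EX v. ball z e <= Om & (ALL i<=n. (%t. v t i) holomorphic_on ball z e) \<and>
    (ALL t:ball z e. v t : coord_vectors n & ?\<gamma> t = proj_pt (v t))"
   using hol coord(1) by (intro exI[of _ e] conjI exI[of _ Gm]) (auto intro: holomorphic_on_subset)
 qed
 have cont: "continuous_map (top_of_set Om) (proj_top n) ?\<gamma>" using hol' by (simp add: holomorphic_into_def)
 have sub: "?\<gamma> ` Om <= {p : proj_space n. ALL v:p. v k ~= 0}"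
 proof
  fix p assume "p : ?\<gamma> ` Om"
  then obtain t where t: "t : Om" "p = ?\<gamma> t" by blast
  then show "p : {p : proj_space n. ALL v:p. v k ~= 0}"
   using proj_spaceI[OF coord(1)[OF t(1)]] chart_point_iff[of "Gm t" k] coord(2)[OF t(1)] by simp
 qed
 have inv: "?inv (?\<gamma> t) = t" if "t : Om" for t
  using affine_coord_eq[of "?\<gamma> t" n "Gm t" k i0] coord[OF that] param(1) param(2)[OF that] proj_pt_self proj_spaceI
  by simp
 have "homeomorphic_maps (top_of_set Om) (subtopology (proj_top n) (?\<gamma> ` Om)) ?\<gamma> ?inv"
  unfolding homeomorphic_maps_def
 proof (intro conjI ballI)
  show "continuous_map (top_of_set Om) (subtopology (proj_top n) (?\<gamma> ` Om)) ?\<gamma>"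
   using cont by (auto simp: continuous_map_in_subtopology)
  have "continuous_map (subtopology (proj_top n) (?\<gamma> ` Om)) euclidean ?inv"
   using continuous_map_affine_coord[OF k sub, of i0] param(1)
   unfolding continuous_map_atin by (auto intro!: tendsto_intros)
  moreover have "?inv : topspace (subtopology (proj_top n) (?\<gamma> ` Om)) \<rightarrow> Om" using inv by auto
  ultimately show "continuous_map (subtopology (proj_top n) (?\<gamma> ` Om)) (top_of_set Om) ?inv"
   by (simp add: continuous_map_in_subtopology image_subset_iff_funcset)
 qed (use inv in auto)
 then have "homeomorphic_map (top_of_set Om) (subtopology (proj_top n) (?\<gamma> ` Om)) ?\<gamma>"
  using homeomorphic_map_maps by blast
 then show ?thesis unfolding inverse_chart_def using hol' op by simp
qed

lemma proj_point_separated: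
 assumes "p : proj_space n" "q : proj_space n" "p ~= q"
 obtains U where "openin (proj_top n) U" "p : U" "q \<notin> U"
proof -
 have "closedin (proj_top n) {q}" using zariski_closed_closedin zariski_closed_singleton assms by blast
 then have "openin (proj_top n) (proj_space n - {q})" unfolding closedin_def topspace_proj_top by blast
 then show ?thesis using that[of "proj_space n - {q}"] assms by blast
qed

text \<open>The curve is restricted to the affine line of points (1 : t). It cannot be constant
  there: the remaining point of the projective line is a limit of the affine line, and constancy
  would extend to it by continuity.\<close>

lemma rational_curve_entire:
 assumes "rational_curve (proj_manifold N) C"
 obtains g a b where "hol_map N UNIV g" "range g <= C" "g a ~= g b"
proof -
 obtain f where f: "holomorphic_curve_map 1 (proj_space 1) (proj_manifold N) f"
  "\<not> f constant_on proj_space 1" "C = f ` proj_space 1" using assms unfolding rational_curve_def by blast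
 define Gm where "Gm = (%(t::complex) (i::nat). if i = 0 then 1 else if i = 1 then t else (0::complex))"
 let ?\<gamma> = "%t. proj_pt (Gm t)"
 have Gmc: "Gm t : coord_vectors 1" for t
 proof -
  have "Gm t 0 ~= 0" by (simp add: Gm_def)
  then have "Gm t ~= (%_. 0)" by auto
  then show ?thesis by (simp add: coord_vectors_def Gm_def)
 qed
 have mem: "p : range ?\<gamma>" if p: "p : proj_space 1" "v : p" "v 0 ~= 0" for p v
 proof -
  have v: "v : coord_vectors 1" "p = proj_pt v" using proj_space_point[OF p(1,2)] by blast+
  have "proj_pt v = proj_pt (Gm (v 1 / v 0))"
   unfolding proj_pt_eq_minors[OF v(1) Gmc]
  proof (intro allI impI)
   fix i j :: nat assume "i <= 1" "j <= 1"
   then have "i = 0 | i = 1" "j = 0 | j = 1" by auto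
   then show "v i * Gm (v 1 / v 0) j = v j * Gm (v 1 / v 0) i" using p(3) by (auto simp: Gm_def)
  qed
  then show ?thesis using v(2) by blast
 qed
 have ran: "range ?\<gamma> = {p : proj_space 1. ALL v:p. v 0 ~= 0}"
 proof (intro set_eqI iffI)
  fix p assume "p : range ?\<gamma>"
  then obtain t where "p = ?\<gamma> t" by blast
  then show "p : {p : proj_space 1. ALL v:p. v 0 ~= 0}"
   using proj_spaceI[OF Gmc] chart_point_iff[of "Gm t" 0] by (simp add: Gm_def)
 next
  fix p assume p: "p : {p : proj_space 1. ALL v:p. v 0 ~= 0}"
  then obtain v where "v : p" using proj_space_nonempty_pt by blast
  then show "p : range ?\<gamma>" using mem p by blast
 qed
 have "inverse_chart 1 (proj_space 1) UNIV ?\<gamma>"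
 proof (rule inverse_chartI[of UNIV 0 1 Gm 1 1 0])
  show "(%t. Gm t i) holomorphic_on UNIV" for i
   by (cases "i = 0"; cases "i = 1") (auto simp: Gm_def intro: holomorphic_intros)
  show "openin (subtopology (proj_top 1) (proj_space 1)) (range ?\<gamma>)"
   using openin_affine_chart[of 0 1] unfolding ran by (simp add: openin_subtopology) blast
 qed (use Gmc in "auto simp: Gm_def")
 then have g: "hol_map N UNIV (f \<circ> ?\<gamma>)"
  using f(1) unfolding holomorphic_curve_map_def by blast
 have sub: "range (f \<circ> ?\<gamma>) <= C" unfolding f(3) using proj_spaceI[OF Gmc] by auto
 have "EX a b. (f \<circ> ?\<gamma>) a ~= (f \<circ> ?\<gamma>) b"
 proof (rule ccontr)
  assume "\<not> ?thesis"
  then have const: "f (?\<gamma> t) = f (?\<gamma> 0)" for t by auto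
  have cont: "continuous_map (subtopology (proj_top 1) (proj_space 1)) (proj_top N) f"
   using f(1) by (simp add: holomorphic_curve_map_def)
  have fP: "f p : proj_space N" if "p : proj_space 1" for p
   using cont that by (auto simp: continuous_map_def topspace_proj_top)
  have "f p = f (?\<gamma> 0)" if p: "p : proj_space 1" for p
  proof (rule ccontr)
   assume ne: "f p ~= f (?\<gamma> 0)"
   obtain U where U: "openin (proj_top N) U" "f p : U" "f (?\<gamma> 0) \<notin> U"
    using proj_point_separated[OF fP[OF p] fP[OF proj_spaceI[OF Gmc]] ne] by blast
   have "openin (proj_top 1) {q : proj_space 1. f q : U}"
    using openin_continuous_map_preimage[OF cont U(1)] openin_topspace[of "proj_top 1"]
    by (simp add: topspace_proj_top openin_open_subtopology)
   then have op: "openin (top_of_set (coord_vectors 1)) {v : coord_vectors 1. proj_pt v : {q : proj_space 1. f q : U}}"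
    by (simp add: openin_proj_top)
   obtain v where v: "v : p" using proj_space_nonempty_pt[OF p] by blast
   have v0: "v 0 = 0"
   proof (rule ccontr)
    assume "v 0 ~= 0"
    then obtain t where "p = ?\<gamma> t" using mem[OF p v] by blast
    then show False using const[of t] ne by simp
   qed
   have vc: "v : coord_vectors 1" "p = proj_pt v" using proj_space_point[OF p v] by blast+
   obtain T where T: "open T" "{v : coord_vectors 1. proj_pt v : {q : proj_space 1. f q : U}} = coord_vectors 1 \<inter> T"
    using op unfolding openin_open by blast
   \<comment> \<open>A point outside the affine line has first entry 0; replacing this entry by a
     small real number moves the point into the affine line.\<close>
   define w where "w = (%s i. if i = 0 then complex_of_real s else v i)"
   have "continuous_on UNIV w" 
   proof (rule continuous_on_coordinatewise_then_product)
    show "continuous_on UNIV (%s. w s i)" for i by (cases "i = 0") (auto simp: w_def intro!: continuous_intros)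
   qed
   then have "open (w -` T)" using T(1) by (rule open_vimage[rotated])
   moreover have "w 0 = v" using v0 by (auto simp: w_def)
   then have "0 : w -` T" using T(2) vc p U(2) by auto
   ultimately have "EX d>0. ball 0 d <= w -` T" unfolding open_contains_ball by blast
   then obtain d where d: "d > 0" "ball 0 d <= w -` T" by blast
   define s where "s = d / 2"
   have s: "s ~= 0" "s : ball 0 d" using d(1) by (auto simp: s_def)
   have "w s 0 ~= 0" using s by (simp add: w_def)
   then have "w s ~= (%_. 0)" by auto
   then have ws: "w s : coord_vectors 1" using vc(1) by (auto simp: coord_vectors_def w_def)
   then have "f (proj_pt (w s)) : U" using T(2) d(2) s(2) by auto
   moreover obtain t where "proj_pt (w s) = ?\<gamma> t"
    using mem[OF proj_spaceI[OF ws] proj_pt_self \<open>w s 0 ~= 0\<close>] by blast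
   ultimately show False using const[of t] U(3) by simp
  qed
  then show False using f(2) unfolding constant_on_def by blast
 qed
 then show ?thesis using that g sub by blast
qed

section \<open>Polynomial equations near a point\<close>

text \<open>Two vectors with indices up to \<open>n\<close> are laid side by side, so that
  polynomials in a pair of vectors are again covered by \<open>poly_fun\<close>, now in 2n + 2
  variables.\<close>

definition join_vec :: "nat => (nat => complex) => (nat => complex) => nat => complex" where
 "join_vec n x y = (%i. if i <= n then x i else y (i - Suc n))"

lemma poly_fun_compose:
 assumes "poly_fun n f" "!!i. i <= n ==> poly_fun N (g i)"
 shows "poly_fun N (%v. f (%i. g i v))"
 using assms by (induction rule: poly_fun.induct) (auto intro: poly_fun.intros)

lemma poly_fun_join1: "poly_fun n f ==> poly_fun (2 * n + 1) f"
proof -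
 assume "poly_fun n f"
 then have "poly_fun (2 * n + 1) (%v. f (%i. v i))" by (rule poly_fun_compose) (auto intro: poly_fun.coord)
 then show ?thesis by simp
qed

lemma poly_fun_join2: "poly_fun n f ==> poly_fun (2 * n + 1) (%v. f (%i. v (i + Suc n)))"
 by (rule poly_fun_compose) (auto intro: poly_fun.coord)

text \<open>\<open>f x - f y\<close> lies in the ideal generated by the differences of the
  coordinates, and on the diagonal the quotients are the partial derivatives. They serve below as
  gradients, as Lipschitz bounds and for algebraic division.\<close>

lemma hadamard_quotients:
 assumes "poly_fun n f"
 obtains q where "!!j. poly_fun (2 * n + 1) (q j)"
  "!!x y. f x - f y = (\<Sum>j\<le>n. (x j - y j) * q j (join_vec n x y))"
proof -
 from assms have "EX q. (ALL j. poly_fun (2 * n + 1) (q j)) \<and>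
   (ALL x y. f x - f y = (\<Sum>j\<le>n. (x j - y j) * q j (join_vec n x y)))"
 proof (induction rule: poly_fun.induct)
  case (const c)
  then show ?case by (intro exI[of _ "%_ _. 0"]) (auto intro: poly_fun.const)
 next
  case (coord i)
  have "(\<Sum>j\<le>n. (x j - y j) * (if j = i then 1 else 0)) = x i - y i" for x y :: "nat => complex"
  proof -
   have "(\<Sum>j\<le>n. (x j - y j) * (if j = i then 1 else 0)) = (\<Sum>j\<le>n. if j = i then x j - y j else 0)"
    by (intro sum.cong) auto
   then show ?thesis using coord by simp
  qed
  then show ?case by (intro exI[of _ "%j _. if j = i then 1 else 0"]) (auto intro: poly_fun.const)
 next
  case (add f g)
  then obtain q r where "ALL j. poly_fun (2 * n + 1) (q j)" "ALL j. poly_fun (2 * n + 1) (r j)"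
   "ALL x y. f x - f y = (\<Sum>j\<le>n. (x j - y j) * q j (join_vec n x y))"
   "ALL x y. g x - g y = (\<Sum>j\<le>n. (x j - y j) * r j (join_vec n x y))" by blast
  then show ?case
   by (intro exI[of _ "%j v. q j v + r j v"])
    (auto intro: poly_fun.add simp: distrib_left sum.distrib add_diff_add)
 next
  case (mult f g)
  then obtain q r where q: "ALL j. poly_fun (2 * n + 1) (q j)" "ALL j. poly_fun (2 * n + 1) (r j)"
   "ALL x y. f x - f y = (\<Sum>j\<le>n. (x j - y j) * q j (join_vec n x y))"
   "ALL x y. g x - g y = (\<Sum>j\<le>n. (x j - y j) * r j (join_vec n x y))" by blast
  let ?q = "%j v. f v * r j v + g (%i. v (i + Suc n)) * q j v"
  have fj: "f (join_vec n x y) = f x" for x y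
   by (rule poly_fun_depends[OF mult(1)]) (simp add: join_vec_def)
  have gj: "g (%i. join_vec n x y (i + Suc n)) = g y" for x y by (simp add: join_vec_def)
  have "f x * g x - f y * g y = (\<Sum>j\<le>n. (x j - y j) * ?q j (join_vec n x y))" for x y
  proof -
   have "f x * g x - f y * g y = f x * (g x - g y) + g y * (f x - f y)" by (simp add: algebra_simps)
   also have "\<dots> = f x * (\<Sum>j\<le>n. (x j - y j) * r j (join_vec n x y)) + g y * (\<Sum>j\<le>n. (x j - y j) * q j (join_vec n x y))"
    using q by simp
   also have "\<dots> = (\<Sum>j\<le>n. (x j - y j) * ?q j (join_vec n x y))"
    unfolding fj gj sum_distrib_left sum.distrib[symmetric] by (intro sum.cong refl) (simp add: algebra_simps)
   finally show ?thesis .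
  qed
  moreover have "poly_fun (2 * n + 1) (?q j)" for j
   using poly_fun_join1[OF mult(1)] poly_fun_join2[OF mult(2)] q by (intro poly_fun.add poly_fun.mult) auto
  ultimately show ?case by (intro exI[of _ ?q] conjI allI)
 qed
 then show ?thesis using that by blast
qed

lemma poly_fun_delta:
 assumes f: "poly_fun n f" and "ep > 0"
 obtains r where "r > 0" "!!x. (!!i. i <= n ==> cmod (x i - e i) <= r) ==> cmod (f x - f e) < ep"
proof -
 have "EX r>0. ALL x. (ALL i<=n. cmod (x i - e i) <= r) --> cmod (f x - f e) < ep"
 proof (rule ccontr)
  assume "\<not> ?thesis"
  then have "ALL m. EX x. (ALL i<=n. cmod (x i - e i) <= inverse (real (Suc m))) & \<not> cmod (f x - f e) < ep"
   by (metis inverse_positive_iff_positive of_nat_0_less_iff zero_less_Suc)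
  then obtain x where x: "!!m i. i <= n ==> cmod (x m i - e i) <= inverse (real (Suc m))"
   "!!m. \<not> cmod (f (x m) - f e) < ep" by metis
  have "(%m. x m i) \<longlonglongrightarrow> e i" if "i <= n" for i
  proof -
   have "(%m. x m i - e i) \<longlonglongrightarrow> 0"
    by (rule Lim_null_comparison[OF _ LIMSEQ_inverse_real_of_nat]) (use x(1)[OF that] in simp)
   then show ?thesis by (simp add: LIM_zero_iff)
  qed
  then have "(%m. f (x m)) \<longlonglongrightarrow> f e" by (rule poly_fun_tendsto[OF f])
  then have "\<forall>\<^sub>F m in sequentially. dist (f (x m)) (f e) < ep" using \<open>ep > 0\<close> by (rule tendstoD)
  then show False using x(2) by (auto simp: dist_norm dest: eventually_happens)
 qed
 then show ?thesis using that by metis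
qed

text \<open>Duality in finite dimension: a vector that agrees on \<open>S\<close> with no element of
  the subspace \<open>D\<close> is separated from \<open>D\<close> by a linear functional. Elements
  of \<open>D\<close> are functions on all indices but are compared on \<open>S\<close> only, which
  lets the induction remove one coordinate at a time.\<close>

lemma annihilator_separates:
 fixes D :: "(nat => complex) set"
 assumes "finite S" and sub: "!!a b d d'. d : D ==> d' : D ==> (%i. a * d i + b * d' i) : D" and ne: "D ~= {}"
  and g: "!!d. d : D ==> EX i:S. d i ~= g i"
 shows "EX w. (ALL d:D. (\<Sum>i\<in>S. d i * w i) = 0) & (\<Sum>i\<in>S. g i * w i) ~= 0"
 using assms
proof (induction S arbitrary: D g rule: finite_induct)
 case empty
 then show ?case by blast
next
 case (insert a S)
 show ?case
 proof (cases "ALL d:D. d a = 0")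
  case True
  show ?thesis
  proof (cases "g a = 0")
   case False
   define w where "w = (%i. if i = a then 1 else (0::complex))"
   have "(\<Sum>i\<in>insert a S. d i * w i) = d a" for d
    using insert.hyps by (simp add: w_def if_distrib[of "%z. _ * z"] sum.delta cong: if_cong)
   then show ?thesis using True False by (intro exI[of _ w]) auto
  next
   case ga: True
   have "EX i:S. d i ~= g i" if "d : D" for d
    using insert.prems(3)[OF that] True that ga by auto
   then obtain w where "ALL d:D. (\<Sum>i\<in>S. d i * w i) = 0" "(\<Sum>i\<in>S. g i * w i) ~= 0"
    using insert.IH[OF insert.prems(1,2)] by blast
   then show ?thesis using True ga insert.hyps by (intro exI[of _ w]) auto
  qed
 next
  case False
  then obtain d1 where d1: "d1 : D" "d1 a ~= 0" by blast
  define d0 where "d0 = (%i. (1 / d1 a) * d1 i + 0 * d1 i)"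
  have d0: "d0 : D" "d0 a = 1"
   unfolding d0_def by (rule insert.prems(1)[OF d1(1) d1(1)]) (simp add: d1(2))
  define D' where "D' = {d : D. d a = 0}"
  define g' where "g' = (%i. g i - g a * d0 i)"
  have "EX w. (ALL d:D'. (\<Sum>i\<in>S. d i * w i) = 0) & (\<Sum>i\<in>S. g' i * w i) ~= 0"
  proof (rule insert.IH)
   show "(%i. x * d i + y * d' i) : D'" if "d : D'" "d' : D'" for x y d d'
    using that insert.prems(1) unfolding D'_def by auto
   have "(%i. 1 * d0 i + (-1) * d0 i) : D" by (rule insert.prems(1)[OF d0(1) d0(1)])
   then show "D' ~= {}" unfolding D'_def by force
   fix d assume d: "d : D'"
   then have "(%i. 1 * d i + g a * d0 i) : D" using insert.prems(1) d0(1) unfolding D'_def by blast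
   then obtain i where i: "i : insert a S" "1 * d i + g a * d0 i ~= g i" using insert.prems(3) by meson
   then have "i ~= a" using d d0(2) unfolding D'_def by auto
   then show "EX i:S. d i ~= g' i" using i unfolding g'_def by (auto intro!: bexI[of _ i])
  qed
  then obtain w where w: "!!d. d : D' ==> (\<Sum>i\<in>S. d i * w i) = 0" "(\<Sum>i\<in>S. g' i * w i) ~= 0" by blast
  define w' where "w' = (%i. if i = a then - (\<Sum>i\<in>S. d0 i * w i) else w i)"
  have w': "(\<Sum>i\<in>insert a S. d i * w' i) = (\<Sum>i\<in>S. (d i - d a * d0 i) * w i)" for d
  proof -
   have "(\<Sum>i\<in>insert a S. d i * w' i) = d a * w' a + (\<Sum>i\<in>S. d i * w' i)"
    using insert.hyps by simp
   also have "(\<Sum>i\<in>S. d i * w' i) = (\<Sum>i\<in>S. d i * w i)"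
    using insert.hyps by (intro sum.cong) (auto simp: w'_def)
   also have "d a * w' a = - (\<Sum>i\<in>S. d a * d0 i * w i)" by (simp add: w'_def sum_distrib_left mult.assoc)
   finally show ?thesis by (simp add: left_diff_distrib sum_subtractf)
  qed
  have "(\<Sum>i\<in>insert a S. d i * w' i) = 0" if d: "d : D" for d
  proof -
   have "(%i. 1 * d i + (- d a) * d0 i) : D" using insert.prems(1)[OF d d0(1)] .
   moreover have "(%i. 1 * d i + (- d a) * d0 i) = (%i. d i - d a * d0 i)" by auto
   ultimately have "(%i. d i - d a * d0 i) : D'" unfolding D'_def using d0(2) by simp
   then show ?thesis unfolding w' by (rule w(1))
  qed
  moreover have "(\<Sum>i\<in>insert a S. g i * w' i) ~= 0" using w(2) unfolding w' g'_def .
  ultimately show ?thesis by blast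
 qed
qed

text \<open>Newton iteration \<open>x\<^sub>i \<mapsto> x\<^sub>i - f\<^sub>i(x)\<close> in the variables \<open>S\<close>, with \<open>i0\<close> as parameter.\<close>

lemma implicit_curve:
 fixes f :: "nat => (nat => complex) => complex"
 assumes S: "S <= {..n}" "i0 \<notin> S" and f: "!!i. i : S ==> poly_fun n (f i)" "!!i. i : S ==> f i e = 0"
  and q: "!!i j. i : S ==> poly_fun (2 * n + 1) (q i j)"
   "!!i x y. i : S ==> f i x - f i y = (\<Sum>j\<le>n. (x j - y j) * q i j (join_vec n x y))"
   "!!i j. i : S ==> j : S ==> q i j (join_vec n e e) = (if i = j then 1 else 0)"
 obtains rh r Gm where "rh > 0" "r > 0" "!!i. (%u. Gm u i) holomorphic_on ball 0 rh" "Gm 0 = e"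
  "!!u i. u : ball 0 rh ==> i \<notin> S ==> Gm u i = (if i = i0 then e i0 + u else e i)"
  "!!u i. u : ball 0 rh ==> cmod (Gm u i - e i) < r"
  "!!u i. u : ball 0 rh ==> i : S ==> f i (Gm u) = 0"
  "!!x u. u : ball 0 rh ==> (!!i. i \<notin> S ==> x i = Gm u i) ==> (!!i. i <= n ==> cmod (x i - e i) < r) ==>
    (!!i. i : S ==> f i x = 0) ==> x = Gm u"
proof -
 have finS: "finite S" using S(1) finite_subset by blast
 \<comment> \<open>There are at most \<open>n + 1\<close> unknowns, each contributing
   \<open>ep\<close> to the Lipschitz constant; this yields the contraction factor 1/2.\<close>
 define ep where "ep = 1 / (2 * (real n + 1))"
 have ep: "ep > 0" by (simp add: ep_def)
 have "ALL i j. EX r>0. i : S --> j : S --> (ALL v. (ALL l<=2*n+1. cmod (v l - join_vec n e e l) <= r) --> cmod (q i j v - q i j (join_vec n e e)) < ep)"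
 proof (intro allI)
  fix i j
  show "EX r>0. i : S --> j : S --> (ALL v. (ALL l<=2*n+1. cmod (v l - join_vec n e e l) <= r) --> cmod (q i j v - q i j (join_vec n e e)) < ep)"
  proof (cases "i : S")
   case True
   obtain r where "r > 0" "!!x. (!!l. l <= 2*n+1 ==> cmod (x l - join_vec n e e l) <= r) ==> cmod (q i j x - q i j (join_vec n e e)) < ep"
    using poly_fun_delta[OF q(1)[OF True] ep] by blast
   then show ?thesis by blast
  qed (auto intro: exI[of _ 1])
 qed
 then obtain rr where rr: "!!i j. rr i j > (0::real)"
  "!!i j v. i : S ==> j : S ==> (!!l. l <= 2*n+1 ==> cmod (v l - join_vec n e e l) <= rr i j) ==>
    cmod (q i j v - q i j (join_vec n e e)) < ep" by metis
 define r where "r = Min (insert 1 ((%(i, j). rr i j) ` (S \<times> S)))"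
 have r: "r > 0" "!!i j. i : S ==> j : S ==> r <= rr i j"
 proof -
  show "r > 0" unfolding r_def using finS rr(1) by (subst Min_gr_iff) auto
  show "r <= rr i j" if "i : S" "j : S" for i j unfolding r_def using finS that by (intro Min_le) auto
 qed
 \<comment> \<open>At \<open>e\<close> the quotients form the identity matrix, so
   \<open>x i - f i x\<close> has derivative zero in the unknowns and is contracting near
   \<open>e\<close>.\<close>
 have contr: "cmod ((x i - f i x) - (y i - f i y)) <= M / 2"
  if i: "i : S" and x: "!!l. l <= n ==> cmod (x l - e l) <= r" and y: "!!l. l <= n ==> cmod (y l - e l) <= r"
   and eq: "!!l. l \<notin> S ==> x l = y l" and M: "!!l. l : S ==> cmod (x l - y l) <= M" "M >= 0" for i x y M
 proof -
  have "(\<Sum>j\<le>n. (x j - y j) * q i j (join_vec n x y)) = (\<Sum>j\<in>S. (x j - y j) * q i j (join_vec n x y))"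
   by (rule sum.mono_neutral_right) (use S(1) eq in auto)
  moreover have "x i - y i = (\<Sum>j\<in>S. (x j - y j) * (if i = j then 1 else 0))"
   using finS i by (simp add: if_distrib[of "%z. _ * z"] sum.delta' cong: if_cong)
  ultimately have "(x i - f i x) - (y i - f i y) =
    (\<Sum>j\<in>S. (x j - y j) * (if i = j then 1 else 0)) - (\<Sum>j\<in>S. (x j - y j) * q i j (join_vec n x y))"
   using q(2)[OF i, of x y] by (simp add: algebra_simps)
  also have "\<dots> = (\<Sum>j\<in>S. (x j - y j) * ((if i = j then 1 else 0) - q i j (join_vec n x y)))"
   by (simp only: right_diff_distrib sum_subtractf)
  also have "cmod \<dots> <= (\<Sum>j\<in>S. M * ep)"
  proof (rule sum_norm_le)
   fix j assume j: "j : S"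
   have "cmod (join_vec n x y l - join_vec n e e l) <= rr i j" if "l <= 2*n+1" for l
   proof (cases "l <= n")
    case True
    then show ?thesis using x[OF True] r(2)[OF i j] by (simp add: join_vec_def)
   next
    case False
    then have "l - Suc n <= n" using that by linarith
    then show ?thesis using y r(2)[OF i j] False by (force simp: join_vec_def)
   qed
   then have "cmod (q i j (join_vec n x y) - q i j (join_vec n e e)) < ep" by (rule rr(2)[OF i j])
   then have "cmod ((if i = j then 1 else 0) - q i j (join_vec n x y)) <= ep"
    using q(3)[OF i j] by (simp add: norm_minus_commute)
   then show "cmod ((x j - y j) * ((if i = j then 1 else 0) - q i j (join_vec n x y))) <= M * ep"
    unfolding norm_mult using M(1)[OF j] M(2) by (intro mult_mono) auto
  qed
  also have "\<dots> <= M / 2"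
  proof -
   have "card S <= n + 1" using card_mono[OF _ S(1)] by simp
   then have "real (card S) <= real n + 1" by linarith
   then have "real (card S) * ep <= 1 / 2" by (simp add: ep_def field_simps)
   then have "M * (real (card S) * ep) <= M * (1/2)" using M(2) by (rule mult_left_mono)
   then show ?thesis by (simp add: mult.left_commute)
  qed
  finally show ?thesis .
 qed
 define y0 where "y0 = (%u i. if i = i0 then e i0 + u else e i)"
 have "ALL i. EX d>0. i : S --> (ALL x. (ALL l<=n. cmod (x l - e l) <= d) --> cmod (f i x - f i e) < r / 4)"
 proof
  fix i
  show "EX d>0. i : S --> (ALL x. (ALL l<=n. cmod (x l - e l) <= d) --> cmod (f i x - f i e) < r / 4)"
  proof (cases "i : S")
   case True
   have "r / 4 > 0" using r(1) by simp
   then obtain d where "d > 0" "!!x. (!!l. l <= n ==> cmod (x l - e l) <= d) ==> cmod (f i x - f i e) < r / 4"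
    using poly_fun_delta[OF f(1)[OF True]] by blast
   then show ?thesis by blast
  qed (auto intro: exI[of _ 1])
 qed
 then obtain dd where dd: "!!i. dd i > (0::real)"
  "!!i x. i : S ==> (!!l. l <= n ==> cmod (x l - e l) <= dd i) ==> cmod (f i x - f i e) < r / 4" by metis
 \<comment> \<open>The parameter is kept so small that the first correction is at most r/4.
   Contraction from radius r/2 contributes another r/4, so all iterates stay within r/2, strictly
   inside the region of contraction.\<close>
 define rh where "rh = Min (insert (r / 2) (dd ` S))"
 have rh: "rh > 0" "rh <= r / 2" "!!i. i : S ==> rh <= dd i"
 proof -
  show "rh > 0" unfolding rh_def using finS dd(1) r(1) by (subst Min_gr_iff) auto
  show "rh <= r / 2" unfolding rh_def using finS by (intro Min_le) auto
  show "rh <= dd i" if "i : S" for i unfolding rh_def using finS that by (intro Min_le) auto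
 qed
 have fy0: "cmod (f i (y0 u)) <= r / 4" if u: "u : ball 0 rh" and i: "i : S" for u i
 proof -
  have "cmod (y0 u l - e l) <= dd i" for l using u rh(3)[OF i] dd(1)[of i] by (auto simp: y0_def)
  then show ?thesis using dd(2)[OF i, of "y0 u"] f(2)[OF i] by simp
 qed
 define Y where "Y = rec_nat y0 (%_ y u i. if i : S then y u i - f i (y u) else y u i)"
 have Y0: "Y 0 = y0" and YS: "Y (Suc m) u i = (if i : S then Y m u i - f i (Y m u) else Y m u i)" for m u i
  by (simp_all add: Y_def)
 have Yout: "Y m u i = y0 u i" if "i \<notin> S" for m u i
  by (induction m) (use that in "auto simp: Y0 YS")
 have y0r: "cmod (y0 u i - e i) <= r / 2" if "u : ball 0 rh" for u i
  using that rh r by (auto simp: y0_def)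
 have y0S: "y0 u i = e i" if "i : S" for u i using that S(2) by (auto simp: y0_def)
 have Yr: "cmod (Y m u i - e i) <= r / 2" if u: "u : ball 0 rh" for m u i
 proof (induction m arbitrary: i)
  case 0
  then show ?case using y0r[OF u] by (simp add: Y0)
 next
  case (Suc m)
  show ?case
  proof (cases "i : S")
   case False
   then show ?thesis using y0r[OF u] by (simp add: Yout)
  next
   case True
   have "cmod ((Y m u i - f i (Y m u)) - (y0 u i - f i (y0 u))) <= (r / 2) / 2"
   proof (rule contr[OF True])
    show "cmod (Y m u l - e l) <= r" "cmod (y0 u l - e l) <= r" for l using Suc.IH[of l] y0r[OF u, of l] r(1) by linarith+
    show "cmod (Y m u l - y0 u l) <= r / 2" if "l : S" for l using Suc.IH[of l] y0S[OF that] by simp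
   qed (use Yout r in auto)
   then have "cmod (Y (Suc m) u i - e i + f i (y0 u)) <= r / 4" using True y0S[OF True] by (simp add: YS algebra_simps)
   then show ?thesis using fy0[OF u True] norm_triangle_ineq4[of "Y (Suc m) u i - e i + f i (y0 u)" "f i (y0 u)"] by simp
  qed
 qed
 have Yr': "cmod (Y m u i - e i) <= r" if "u : ball 0 rh" for m u i using Yr[OF that, of m i] r(1) by linarith
 have Ydiff: "cmod (Y (Suc m) u i - Y m u i) <= r * (1/2) ^ m" if u: "u : ball 0 rh" for m u i
 proof (induction m arbitrary: i)
  case 0
  then show ?case using fy0[OF u] r(1) by (cases "i : S") (force simp: Y0 YS)+
 next
  case (Suc m)
  show ?case
  proof (cases "i : S")
   case True
   have "cmod ((Y (Suc m) u i - f i (Y (Suc m) u)) - (Y m u i - f i (Y m u))) <= (r * (1/2) ^ m) / 2"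
    by (rule contr[OF True]) (use Suc.IH Yr'[OF u] Yout r in auto)
   then show ?thesis using True by (simp add: YS)
  qed (use r in "simp add: Yout")
 qed
 have Yhol: "(%u. Y m u i) holomorphic_on ball 0 rh" for m i
 proof (induction m arbitrary: i)
  case 0
  then show ?case by (cases "i = i0") (auto simp: Y0 y0_def intro!: holomorphic_intros)
 next
  case (Suc m)
  then show ?case
   by (cases "i : S") (auto simp: YS intro!: holomorphic_intros poly_fun_holomorphic[OF f(1)])
 qed
 define Gm where "Gm = (%u i. y0 u i + (suminf (%m. Y (Suc m) u i - Y m u i)))"
 have unif: "uniform_limit (ball 0 rh) (%m u. Y m u i) (%u. Gm u i) sequentially" for i
 proof -
  have "uniform_limit (ball 0 rh) (%m u. \<Sum>k<m. Y (Suc k) u i - Y k u i) (%u. suminf (%m. Y (Suc m) u i - Y m u i)) sequentially"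
   by (rule Weierstrass_m_test[OF Ydiff]) (auto intro!: summable_mult summable_geometric)
  then have "uniform_limit (ball 0 rh) (%m u. y0 u i + (\<Sum>k<m. Y (Suc k) u i - Y k u i)) (%u. Gm u i) sequentially"
   unfolding Gm_def by (intro uniform_limit_add uniform_limit_const)
  moreover have "(\<Sum>k<m. Y (Suc k) u i - Y k u i) = Y m u i - y0 u i" for m u
   using sum_lessThan_telescope[of "%k. Y k u i" m] by (simp add: Y0)
  ultimately show ?thesis by simp
 qed
 have lim: "(%m. Y m u i) \<longlonglongrightarrow> Gm u i" if "u : ball 0 rh" for u i
  using tendsto_uniform_limitI[OF unif that] .
 have Gmout: "Gm u i = y0 u i" if "u : ball 0 rh" "i \<notin> S" for u i
  using lim[OF that(1), of i] Yout[OF that(2)] by (simp add: LIMSEQ_const_iff)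
 have Gmr: "cmod (Gm u i - e i) <= r / 2" if "u : ball 0 rh" for u i
 proof (rule LIMSEQ_le_const2)
  show "(%m. cmod (Y m u i - e i)) \<longlonglongrightarrow> cmod (Gm u i - e i)" by (intro tendsto_intros lim that)
 qed (use Yr[OF that] in auto)
 have Gmf: "f i (Gm u) = 0" if u: "u : ball 0 rh" and i: "i : S" for u i
 proof (rule LIMSEQ_unique)
  show "(%m. f i (Y m u)) \<longlonglongrightarrow> f i (Gm u)" by (rule poly_fun_tendsto[OF f(1)[OF i]]) (rule lim[OF u])
  have "(%m. Y m u i - Y (Suc m) u i) \<longlonglongrightarrow> Gm u i - Gm u i"
   by (intro tendsto_diff lim[OF u] LIMSEQ_Suc[OF lim[OF u]])
  then show "(%m. f i (Y m u)) \<longlonglongrightarrow> 0" using i by (simp add: YS)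
 qed
 show ?thesis
 proof (rule that[OF rh(1) r(1), of Gm])
  show "(%u. Gm u i) holomorphic_on ball 0 rh" for i
  proof (rule holomorphic_uniform_sequence[OF open_ball Yhol])
   fix x :: complex assume "x : ball 0 rh"
   then obtain d where "d > 0" "cball x d <= ball 0 rh" by (meson open_ball open_contains_cball)
   then show "EX d>0. cball x d <= ball 0 rh & uniform_limit (cball x d) (%m u. Y m u i) (%u. Gm u i) sequentially"
    using uniform_limit_on_subset[OF unif] by blast
  qed
  have "Y m 0 = e" for m
  proof (induction m)
   case 0
   then show ?case by (auto simp: Y0 y0_def)
  next
   case (Suc m)
   show ?case
   proof
    fix i show "Y (Suc m) 0 i = e i" using f(2) by (simp add: YS Suc)
   qed
  qed
  then show "Gm 0 = e" using lim[of 0] rh(1) by (auto simp: LIMSEQ_const_iff)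
  show "Gm u i = (if i = i0 then e i0 + u else e i)" if "u : ball 0 rh" "i \<notin> S" for u i
   using Gmout[OF that] by (simp add: y0_def)
  show "cmod (Gm u i - e i) < r" if "u : ball 0 rh" for u i using Gmr[OF that, of i] r(1) by linarith
  show "f i (Gm u) = 0" if "u : ball 0 rh" "i : S" for u i using Gmf[OF that] .
  fix x u assume u: "u : ball 0 rh" and x: "!!i. i \<notin> S ==> x i = Gm u i" "!!i. i <= n ==> cmod (x i - e i) < r"
   "!!i. i : S ==> f i x = 0"
  define M where "M = Max (insert 0 ((%i. cmod (x i - Gm u i)) ` S))"
  have M: "M >= 0" "!!i. i : S ==> cmod (x i - Gm u i) <= M" unfolding M_def using finS by auto
  have "cmod (x i - Gm u i) <= M / 2" if i: "i : S" for i
  proof -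
   have "cmod ((x i - f i x) - (Gm u i - f i (Gm u))) <= M / 2"
   proof (rule contr[OF i])
    show "cmod (Gm u l - e l) <= r" for l using Gmr[OF u, of l] r(1) by linarith
   qed (use x(1,2) M in "auto intro: less_imp_le")
   then show ?thesis using x(3)[OF i] Gmf[OF u i] by simp
  qed
  then have "M <= M / 2" using M(1) finS unfolding M_def by (subst Max_le_iff) auto
  then have "M = 0" using M(1) by simp
  then have "x i = Gm u i" if "i : S" for i using M(2)[OF that] by simp
  then show "x = Gm u" using x(1) by blast
 qed
qed

text \<open>Gaussian elimination without division: a row is multiplied by the pivot
  \<open>Q p p\<close> before the pivot row is subtracted, so all coefficients stay polynomial. The
  common denominator \<open>s\<close> is 1 at \<open>e\<close>, because the matrix is the identity
  there and remains so after each elimination.\<close>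

lemma cramer:
 assumes "finite S"
  and "!!i j. i : S ==> j : S ==> poly_fun n (Q i j)" "!!i. i : S ==> poly_fun n (a i)"
  and "!!i j. i : S ==> j : S ==> Q i j e = (if i = j then 1 else 0)"
 shows "EX s b. poly_fun n s & (ALL j:S. poly_fun n (b j)) & s e = 1 \<and>
  (ALL x l u. (ALL i:S. (\<Sum>j\<in>S. Q i j x * l j) = a i x * u) --> (ALL j:S. s x * l j = b j x * u))"
 using assms
proof (induction S arbitrary: Q a rule: finite_induct)
 case empty
 then show ?case by (intro exI[of _ "%_. 1"]) (auto intro: poly_fun.const)
next
 case (insert p S)
 let ?Q = "%i j v. Q p p v * Q i j v - Q i p v * Q p j v"
 let ?a = "%i v. Q p p v * a i v - Q i p v * a p v"
 have "EX s b. poly_fun n s & (ALL j:S. poly_fun n (b j)) & s e = 1 \<and>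
  (ALL x l u. (ALL i:S. (\<Sum>j\<in>S. ?Q i j x * l j) = ?a i x * u) --> (ALL j:S. s x * l j = b j x * u))"
 proof (rule insert.IH)
  show "poly_fun n (?Q i j)" if "i : S" "j : S" for i j
   using that by (intro poly_fun_diff poly_fun.mult insert.prems(1)) auto
  show "poly_fun n (?a i)" if "i : S" for i
   using that by (intro poly_fun_diff poly_fun.mult insert.prems(1,2)) auto
  show "?Q i j e = (if i = j then 1 else 0)" if "i : S" "j : S" for i j
   using that insert.prems(3) insert.hyps by auto
 qed
 then obtain s b where s: "poly_fun n s" "!!j. j : S ==> poly_fun n (b j)" "s e = 1" and
  sol: "!!x l u. ALL i:S. (\<Sum>j\<in>S. ?Q i j x * l j) = ?a i x * u ==> ALL j:S. s x * l j = b j x * u" by blast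
 let ?b = "%j v. if j = p then s v * a p v - (\<Sum>i\<in>S. Q p i v * b i v) else Q p p v * b j v"
 show ?case
 proof (intro exI conjI ballI allI impI)
  show "poly_fun n (%v. s v * Q p p v)" by (intro poly_fun.mult s insert.prems) auto
  show "s e * Q p p e = 1" using s(3) insert.prems(3)[of p p] by simp
  show "poly_fun n (?b j)" if "j : insert p S" for j
   using that by (cases "j = p") (auto intro!: poly_fun_diff poly_fun.mult poly_fun_sum s insert.prems)
  fix x l u j assume eq: "ALL i:insert p S. (\<Sum>j\<in>insert p S. Q i j x * l j) = a i x * u" and j: "j : insert p S"
  have row: "Q i p x * l p + (\<Sum>j\<in>S. Q i j x * l j) = a i x * u" if "i : insert p S" for i
   using bspec[OF eq that] insert.hyps by simp
  have "(\<Sum>j\<in>S. ?Q i j x * l j) = ?a i x * u" if "i : S" for i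
  proof -
   have "(\<Sum>j\<in>S. ?Q i j x * l j) = (\<Sum>j\<in>S. Q p p x * (Q i j x * l j) - Q i p x * (Q p j x * l j))"
    by (intro sum.cong refl) (simp add: algebra_simps)
   also have "\<dots> = Q p p x * (\<Sum>j\<in>S. Q i j x * l j) - Q i p x * (\<Sum>j\<in>S. Q p j x * l j)"
    by (simp add: sum_subtractf sum_distrib_left)
   also have "(\<Sum>j\<in>S. Q i j x * l j) = a i x * u - Q i p x * l p" using row[of i] that by (simp add: algebra_simps)
   also have "(\<Sum>j\<in>S. Q p j x * l j) = a p x * u - Q p p x * l p" using row[of p] by (simp add: algebra_simps)
   finally show ?thesis by (simp add: algebra_simps)
  qed
  then have IH: "ALL j:S. s x * l j = b j x * u" by (intro sol ballI)
  show "s x * Q p p x * l j = ?b j x * u"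
  proof (cases "j = p")
   case False
   then show ?thesis using j IH by simp
  next
   case True
   have "s x * (\<Sum>j\<in>S. Q p j x * l j) = (\<Sum>j\<in>S. Q p j x * b j x) * u"
    unfolding sum_distrib_left sum_distrib_right
    by (intro sum.cong refl) (use IH in "simp add: mult.left_commute mult.assoc")
   moreover have "s x * (Q p p x * l p + (\<Sum>j\<in>S. Q p j x * l j)) = s x * (a p x * u)" using row[of p] by simp
   ultimately show ?thesis using True by (simp add: algebra_simps)
  qed
 qed
qed

text \<open>On the diagonal the Hadamard quotients become partial derivatives. Through this identity
  the tangent space, defined by derivatives along lines, is compared with algebraic
  gradients.\<close>

lemma directional_derivative:
 assumes "!!j. poly_fun (2 * n + 1) (q j)" "!!x y. f x - f y = (\<Sum>j\<le>n. (x j - y j) * q j (join_vec n x y))"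
 shows "((%t. f (%i. e i + t * w i)) has_field_derivative (\<Sum>j\<le>n. w j * q j (join_vec n e e))) (at 0)"
proof -
 have e0: "(%i. e i + 0 * w i) = e" by simp
 have lim: "((%h. q j (join_vec n (%i. e i + h * w i) e)) \<longlongrightarrow> q j (join_vec n e e)) (at 0)" for j
 proof (rule poly_fun_tendsto[OF assms(1)])
  fix l
  have "((%h. e l + h * w l) \<longlongrightarrow> e l + 0 * w l) (at 0)" by (intro tendsto_intros)
  then show "((%h. join_vec n (%i. e i + h * w i) e l) \<longlongrightarrow> join_vec n e e l) (at 0)"
   by (auto simp: join_vec_def)
 qed
 have "((%h. \<Sum>j\<le>n. w j * q j (join_vec n (%i. e i + h * w i) e)) \<longlongrightarrow> (\<Sum>j\<le>n. w j * q j (join_vec n e e))) (at 0)"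
  by (intro tendsto_sum tendsto_mult tendsto_const lim)
 moreover have "\<forall>\<^sub>F h in at 0. (\<Sum>j\<le>n. w j * q j (join_vec n (%i. e i + h * w i) e)) =
   (f (%i. e i + (0 + h) * w i) - f (%i. e i + 0 * w i)) / h"
  unfolding eventually_at_filter
 proof (rule always_eventually, intro allI impI)
  fix h :: complex assume h: "h ~= 0"
  have "f (%i. e i + h * w i) - f e = (\<Sum>j\<le>n. (e j + h * w j - e j) * q j (join_vec n (%i. e i + h * w i) e))"
   by (rule assms(2))
  also have "\<dots> = h * (\<Sum>j\<le>n. w j * q j (join_vec n (%i. e i + h * w i) e))"
   by (simp add: sum_distrib_left mult.assoc)
  finally show "(\<Sum>j\<le>n. w j * q j (join_vec n (%i. e i + h * w i) e)) =
   (f (%i. e i + (0 + h) * w i) - f (%i. e i + 0 * w i)) / h" unfolding e0 using h by simp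
 qed
 ultimately show ?thesis unfolding DERIV_def by (rule Lim_transform_eventually)
qed

section \<open>Smooth projective curves\<close>

locale curve =
 fixes n :: nat and E :: "ppoint set"
 assumes curve: "smooth_projective_curve n E"
begin

lemma variety: "projective_variety n E" and dim: "variety_dim n E = 1"
 and tangent_dim: "p : E ==> v : p ==> cfun.dim (cone_tangent_space n E v) = 2"
proof -
 show "projective_variety n E" "variety_dim n E = 1"
  using curve unfolding smooth_projective_curve_def smooth_projective_variety_def by blast+
 show "cfun.dim (cone_tangent_space n E v) = 2" if "p : E" "v : p"
 proof -
  have "enat (cfun.dim (cone_tangent_space n E v)) = 1 + 1"
   using curve that unfolding smooth_projective_curve_def smooth_projective_variety_def by metis
  then show ?thesis by (simp add: one_enat_def)
 qed
qed

lemma closed: "zariski_closed n E" and sub: "E <= proj_space n"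
proof -
 show "zariski_closed n E" using variety by (simp add: projective_variety_def)
 then show "E <= proj_space n" by (rule zariski_closed_sub)
qed

lemma cone_point:
 assumes "v : \<Union>E" shows "proj_pt v : E" "v : coord_vectors n"
proof -
 obtain p where "p : E" "v : p" using assms by blast
 then show "proj_pt v : E" "v : coord_vectors n" using proj_space_point[of p n v] sub by auto
qed

lemma cone_mem: "proj_pt v : E ==> v : \<Union>E"
 using proj_pt_self by blast

lemma two_points: obtains p q where "p : E" "q : E" "p ~= q"
proof -
 have "variety_dim n E > 0" using dim by simp
 then show ?thesis using variety_dim_pos_two_points that by blast
qed

text \<open>A product vanishing on \<open>E\<close> writes \<open>E\<close> as the union of the zero
  sets of the two factors, and \<open>E\<close> is irreducible.\<close>

lemma prime:
 assumes f: "form_fun n d f" and g: "form_fun n d' g" and 0: "!!v. v : \<Union>E ==> f v * g v = 0"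
 shows "(ALL v:\<Union>E. f v = 0) | (ALL v:\<Union>E. g v = 0)"
proof -
 let ?A = "{p : E. ALL v:p. f v = 0}" and ?B = "{p : E. ALL v:p. g v = 0}"
 have "p : ?A \<union> ?B" if p: "p : E" for p
 proof (rule ccontr)
  assume "p \<notin> ?A \<union> ?B"
  then obtain v w where *: "v : p" "f v ~= 0" "w : p" "g w ~= 0" using p by blast
  have "p : proj_space n" using p sub by blast
  then have "g v ~= 0" using form_fun_vanish_point[OF g] * by blast
  moreover have "f v * g v = 0" by (rule 0) (use p * in blast)
  ultimately show False using *(2) by simp
 qed
 then have "E = ?A \<union> ?B" by blast
 moreover have "zariski_closed n ?A" "zariski_closed n ?B"
  using zariski_closed_zeros closed f g by blast+
 ultimately have "E = ?A | E = ?B" using variety unfolding projective_variety_def by blast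
 then show ?thesis by blast
qed

text \<open>Otherwise a point, \<open>A\<close> and \<open>E\<close> form a chain of length two in a
  variety of dimension one.\<close>

lemma dense_subvariety:
 assumes A: "projective_variety n A" "A <= E" and pq: "p : A" "q : A" "p ~= q"
 shows "A = E"
proof (rule ccontr)
 assume "A ~= E"
 define Z where "Z = (%i::nat. if i = 0 then {p} else if i = 1 then A else E)"
 have "enat 2 <= variety_dim n E"
 proof (rule variety_dim_ge[of 2 n Z])
  fix i :: nat assume "i <= 2"
  then show "projective_variety n (Z i) & Z i <= E"
   using A variety pq sub projective_variety_singleton unfolding Z_def by auto
 next
  fix i :: nat assume "i < 2"
  then have "i = 0 | i = 1" by auto
  then show "Z i \<subset> Z (Suc i)" using pq A(2) \<open>A ~= E\<close> unfolding Z_def by auto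
 qed
 then show False using dim by (simp add: one_enat_def)
qed

lemma tangent_iff:
 "w : cone_tangent_space n E v \<longleftrightarrow> (ALL i>n. w i = 0) \<and>
   (ALL d f. form_fun n d f --> (ALL u:\<Union>E. f u = 0) --> deriv (%t. f (%i. v i + t * w i)) 0 = 0)"
proof -
 have "(ALL d. ALL F:forms n d. (ALL p:E. vanishes_at F p) --> deriv (%t. mpoly_eval F (%i. v i + t * w i)) 0 = 0)
   \<longleftrightarrow> (ALL d f. form_fun n d f --> (ALL u:\<Union>E. f u = 0) --> deriv (%t. f (%i. v i + t * w i)) 0 = 0)"
  unfolding form_fun_def vanishes_at_def by auto
 then show ?thesis unfolding cone_tangent_space_def by simp
qed

end

section \<open>Tangent line and local parametrisation at one point of the cone\<close>

locale curve_point = curve +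
 fixes e :: "nat => complex" and k :: nat
 assumes e: "e : \<Union>E" and k: "k <= n" "e k = 1"
begin

abbreviation "T \<equiv> cone_tangent_space n E e"

definition grads :: "(nat => complex) set" where
 "grads = {d. EX f q. poly_fun n f & (ALL v:\<Union>E. v k = 1 --> f v = 0) & (ALL j. poly_fun (2 * n + 1) (q j)) \<and>
   (ALL x y. f x - f y = (\<Sum>j\<le>n. (x j - y j) * q j (join_vec n x y))) & d = (%j. q j (join_vec n e e))}"

lemma tangent_grad:
 assumes "w : T" "poly_fun n f" "form_fun n d f" "ALL v:\<Union>E. f v = 0" "!!j. poly_fun (2 * n + 1) (q j)"
  "!!x y. f x - f y = (\<Sum>j\<le>n. (x j - y j) * q j (join_vec n x y))"
 shows "(\<Sum>j\<le>n. w j * q j (join_vec n e e)) = 0"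
proof -
 have "deriv (%t. f (%i. e i + t * w i)) 0 = 0" using assms(1,3,4) unfolding tangent_iff by blast
 then show ?thesis using DERIV_imp_deriv[OF directional_derivative[OF assms(5,6), of e w]] by simp
qed

lemma orthogonal_tangent:
 assumes w: "ALL i>n. w i = 0" and orth: "!!d. d : grads ==> (\<Sum>j\<le>n. w j * d j) = 0"
 shows "w : T"
 unfolding tangent_iff
proof (intro conjI allI impI w)
 fix d f assume f: "form_fun n d f" "ALL u:\<Union>E. f u = 0"
 obtain q where q: "!!j. poly_fun (2 * n + 1) (q j)"
  "!!x y. f x - f y = (\<Sum>j\<le>n. (x j - y j) * q j (join_vec n x y))"
  using hadamard_quotients[OF form_fun_poly_fun[OF f(1)]] by blast
 have "(%j. q j (join_vec n e e)) : grads"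
  unfolding grads_def using form_fun_poly_fun[OF f(1)] f(2) q
  by (intro CollectI exI[of _ f] exI[of _ q]) blast
 then have "(\<Sum>j\<le>n. w j * q j (join_vec n e e)) = 0" using orth by blast
 then show "deriv (%t. f (%i. e i + t * w i)) 0 = 0"
  using DERIV_imp_deriv[OF directional_derivative[OF q, of e w]] by simp
qed (use w in blast)

lemma tangent_combination:
 assumes "w : T" "w' : T" shows "(%i. a * w i + b * w' i) : T"
 unfolding tangent_iff
proof (intro conjI allI impI)
 show "a * w i + b * w' i = 0" if "i > n" for i using assms that unfolding tangent_iff by simp
 fix d f assume f: "form_fun n d f" "ALL u:\<Union>E. f u = 0"
 obtain q where q: "!!j. poly_fun (2 * n + 1) (q j)"
  "!!x y. f x - f y = (\<Sum>j\<le>n. (x j - y j) * q j (join_vec n x y))"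
  using hadamard_quotients[OF form_fun_poly_fun[OF f(1)]] by blast
 note g = tangent_grad[OF _ form_fun_poly_fun[OF f(1)] f q]
 have "(\<Sum>j\<le>n. (a * w j + b * w' j) * q j (join_vec n e e)) =
   a * (\<Sum>j\<le>n. w j * q j (join_vec n e e)) + b * (\<Sum>j\<le>n. w' j * q j (join_vec n e e))"
  by (simp add: sum_distrib_left sum.distrib[symmetric] algebra_simps)
 also have "\<dots> = 0" using g[OF assms(1)] g[OF assms(2)] by simp
 finally show "deriv (%t. f (%i. e i + t * (a * w i + b * w' i))) 0 = 0"
  using DERIV_imp_deriv[OF directional_derivative[OF q, of e "%i. a * w i + b * w' i"]] by simp
qed

lemma e_tangent: "e : T"
 unfolding tangent_iff
proof (intro conjI allI impI)
 show "e i = 0" if "i > n" for i using cone_point(2)[OF e] that by (simp add: coord_vectors_def)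
 fix d f assume f: "form_fun n d f" "ALL u:\<Union>E. f u = 0"
 have "f (%i. e i + t * e i) = 0" for t
 proof -
  have "(%i. e i + t * e i) = (%i. (1 + t) * e i)" by (simp add: distrib_right)
  moreover have "f e = 0" using f(2) e by blast
  ultimately show ?thesis using form_fun_homogeneous[OF f(1), of "1 + t" e] by simp
 qed
 then show "deriv (%t. f (%i. e i + t * e i)) 0 = 0" by simp
qed

text \<open>By smoothness the cone has a tangent plane at \<open>e\<close>. The plane contains
  \<open>e\<close> itself, whose entry \<open>k\<close> is 1, so the slice \<open>w k = 0\<close> is
  a line.\<close>

lemma tangent_line:
 obtains \<tau> where "\<tau> : T" "\<tau> k = 0" "\<tau> ~= (%_. 0)" "!!w. w : T ==> w k = 0 ==> EX c. ALL i. w i = c * \<tau> i"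
proof -
 have d2: "cfun.dim T = 2" using tangent_dim e by blast
 obtain B where B: "B <= T" "cfun.independent B" "T <= cfun.span B" "card B = 2"
  using cfun.basis_exists[of T] d2 by metis
 have finB: "finite B" using B(4) card.infinite by fastforce
 have "EX \<tau>:T. \<tau> k = 0 & \<tau> ~= (%_. 0)"
 proof (rule ccontr)
  assume no: "\<not> ?thesis"
  have "T <= cfun.span {e}"
  proof
   fix w assume w: "w : T"
   have "(%i. 1 * w i + (- w k) * e i) : T" using tangent_combination[OF w e_tangent] .
   then have *: "(%i. 1 * w i + (- w k) * e i) = (%_. 0)" using no k(2) by auto
   have "w = cscale (w k) e"
   proof
    fix i show "w i = cscale (w k) e i" using fun_cong[OF *, of i] by (simp add: cscale_def)
   qed
   then show "w : cfun.span {e}" by (metis cfun.span_base cfun.span_scale singletonI)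
  qed
  then have "cfun.dim T <= card {e}" by (rule cfun.dim_le_card) simp
  then show False using d2 by simp
 qed
 then obtain \<tau> where \<tau>: "\<tau> : T" "\<tau> k = 0" "\<tau> ~= (%_. 0)" by blast
 have "EX c. ALL i. w i = c * \<tau> i" if w: "w : T" "w k = 0" for w
 proof (rule ccontr)
  assume no: "\<not> ?thesis"
  have \<tau>0: "\<tau> ~= 0" using \<tau>(3) by (simp add: zero_fun_def)
  have "w \<notin> cfun.span {\<tau>}"
  proof
   assume "w : cfun.span {\<tau>}"
   then obtain c where "w = cscale c \<tau>" using cfun.span_breakdown_eq[of w \<tau> "{}"] by (auto simp: eq_neg_iff_add_eq_0)
   then show False using no by (auto simp: cscale_def)
  qed
  moreover have "cfun.independent {\<tau>}" using \<tau>0 by (simp add: cfun.dependent_single)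
  ultimately have ind2: "cfun.independent {w, \<tau>}" by (rule cfun.independent_insertI)
  have "cfun.subspace {v. v k = 0}" by (auto simp: cfun.subspace_def zero_fun_def plus_fun_def cscale_def)
  then have "cfun.span {w, \<tau>} <= {v. v k = 0}" using w(2) \<tau>(2) by (intro cfun.span_minimal) auto
  then have "e \<notin> cfun.span {w, \<tau>}" using k(2) by auto
  then have ind3: "cfun.independent {e, w, \<tau>}" using ind2 by (rule cfun.independent_insertI)
  have "{e, w, \<tau>} <= cfun.span B" using B(3) e_tangent w(1) \<tau>(1) by blast
  then have "card {e, w, \<tau>} <= card B" using cfun.independent_span_bound[OF finB ind3] by blast
  moreover have "w ~= \<tau>" using no by (metis mult_1)
  moreover have "e ~= w" "e ~= \<tau>" using k(2) w(2) \<tau>(2) by auto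
  ultimately show False using B(4) by simp
 qed
 then show ?thesis using that \<tau> by blast
qed

lemma grads_nonempty: "grads ~= {}"
proof -
 obtain q where "!!j. poly_fun (2 * n + 1) (q j)"
  "!!x y. (%_. 0) x - (%_. 0) y = (\<Sum>j\<le>n. (x j - y j) * q j (join_vec n x y))"
  using hadamard_quotients[OF poly_fun.const[of n 0]] by blast
 then have "(%j. q j (join_vec n e e)) : grads" unfolding grads_def
  by (intro CollectI exI[of _ "%_. 0"] exI[of _ q] conjI allI poly_fun.const) auto
 then show ?thesis by blast
qed

lemma grads_combination:
 assumes "d : grads" "d' : grads" shows "(%j. a * d j + b * d' j) : grads"
proof -
 obtain f q where f: "poly_fun n f" "ALL v:\<Union>E. v k = 1 --> f v = 0" "ALL j. poly_fun (2 * n + 1) (q j)"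
   "ALL x y. f x - f y = (\<Sum>j\<le>n. (x j - y j) * q j (join_vec n x y))" "d = (%j. q j (join_vec n e e))"
  using assms(1) unfolding grads_def by blast
 obtain g r where g: "poly_fun n g" "ALL v:\<Union>E. v k = 1 --> g v = 0" "ALL j. poly_fun (2 * n + 1) (r j)"
   "ALL x y. g x - g y = (\<Sum>j\<le>n. (x j - y j) * r j (join_vec n x y))" "d' = (%j. r j (join_vec n e e))"
  using assms(2) unfolding grads_def by blast
 have "(a * f x + b * g x) - (a * f y + b * g y) = (\<Sum>j\<le>n. (x j - y j) * (a * q j (join_vec n x y) + b * r j (join_vec n x y)))" for x y
 proof -
  have "(a * f x + b * g x) - (a * f y + b * g y) = a * (f x - f y) + b * (g x - g y)" by (simp add: algebra_simps)
  then show ?thesis unfolding f(4)[rule_format] g(4)[rule_format]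
   by (simp add: sum_distrib_left sum.distrib[symmetric] algebra_simps)
 qed
 then show ?thesis unfolding grads_def
  using f g by (intro CollectI exI[of _ "%v. a * f v + b * g v"] exI[of _ "%j v. a * q j v + b * r j v"])
   (auto intro!: poly_fun.add poly_fun_cmult)
qed

text \<open>By duality the gradients contain, apart from their entry \<open>k\<close>, every
  covector annihilating the tangent vector \<tau>. For \<open>i\<close> other than \<open>k\<close>
  and \<open>i0\<close> one of them has entry 1 at \<open>i\<close>, entry 0 at the other unknowns,
  and the entry at \<open>i0\<close> that \<tau> forces. The chosen equations thus have the identity
  as Jacobian matrix in the unknowns, and Newton iteration runs without inverting a matrix.\<close>

lemma square_system:
 obtains i0 c f q where "i0 <= n" "i0 ~= k" "!!i. i : {..n} - {k, i0} ==> poly_fun n (f i)"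
  "!!i v. i : {..n} - {k, i0} ==> v : \<Union>E ==> v k = 1 ==> f i v = 0"
  "!!i j. i : {..n} - {k, i0} ==> poly_fun (2 * n + 1) (q i j)"
  "!!i x y. i : {..n} - {k, i0} ==> f i x - f i y = (\<Sum>j\<le>n. (x j - y j) * q i j (join_vec n x y))"
  "!!i j. i : {..n} - {k, i0} ==> j : {..n} - {k, i0} ==> q i j (join_vec n e e) = (if i = j then 1 else 0)"
proof -
 obtain \<tau> where \<tau>: "\<tau> : T" "\<tau> k = 0" "\<tau> ~= (%_. 0)" "!!w. w : T ==> w k = 0 ==> EX c. ALL i. w i = c * \<tau> i"
  using tangent_line by blast
 obtain i0 where i0: "\<tau> i0 ~= 0" using \<tau>(3) by auto
 have i0n: "i0 <= n" "i0 ~= k" using i0 \<tau>(1,2) unfolding tangent_iff by (auto simp: not_le[symmetric])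
 let ?S = "{..n} - {k}"
 have "EX d:grads. ALL j:?S. d j = (if j = i then 1 else if j = i0 then - \<tau> i / \<tau> i0 else 0)"
  if i: "i : {..n} - {k, i0}" for i
 proof (rule ccontr)
  assume no: "\<not> ?thesis"
  define g where "g = (%j. if j = i then 1 else if j = i0 then - \<tau> i / \<tau> i0 else (0::complex))"
  have "EX w. (ALL d:grads. (\<Sum>j\<in>?S. d j * w j) = 0) & (\<Sum>j\<in>?S. g j * w j) ~= 0"
   by (rule annihilator_separates) (use grads_combination grads_nonempty no in "auto simp: g_def")
  then obtain w where w: "!!d. d : grads ==> (\<Sum>j\<in>?S. d j * w j) = 0" "(\<Sum>j\<in>?S. g j * w j) ~= 0" by blast
  define w' where "w' = (%j. if j : ?S then w j else 0)"
  have w'sum: "(\<Sum>j\<le>n. w' j * d j) = (\<Sum>j\<in>?S. d j * w j)" for d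
  proof -
   have "(\<Sum>j\<le>n. w' j * d j) = (\<Sum>j\<in>?S. w' j * d j)"
    by (rule sum.mono_neutral_right) (auto simp: w'_def)
   also have "\<dots> = (\<Sum>j\<in>?S. d j * w j)" by (intro sum.cong) (auto simp: w'_def)
   finally show ?thesis .
  qed
  have "w' : T" by (rule orthogonal_tangent) (use w(1) w'sum in "auto simp: w'_def")
  moreover have "w' k = 0" by (simp add: w'_def)
  ultimately obtain c where c: "!!j. w' j = c * \<tau> j" using \<tau>(4) by blast
  have "(\<Sum>j\<le>n. w' j * g j) = (\<Sum>j\<in>{i, i0}. w' j * g j)"
   by (rule sum.mono_neutral_right) (use i i0n in "auto simp: g_def")
  also have "\<dots> = 0" using i i0 c by (simp add: g_def)
  finally show False using w(2) w'sum by simp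
 qed
 then have d: "EX d:grads. ALL j:?S. d j = (if j = i then 1 else if j = i0 then - \<tau> i / \<tau> i0 else 0)"
  if "i : {..n} - {k, i0}" for i using that by blast
 define P where "P = (%i f q. poly_fun n f & (ALL v:\<Union>E. v k = 1 --> f v = 0) & (ALL j. poly_fun (2 * n + 1) (q j)) \<and>
   (ALL x y. f x - f y = (\<Sum>j\<le>n. (x j - y j) * q j (join_vec n x y))) \<and>
   (ALL j:?S. q j (join_vec n e e) = (if j = i then 1 else if j = i0 then - \<tau> i / \<tau> i0 else 0)))"
 have "EX f q. P i f q" if i: "i : {..n} - {k, i0}" for i
 proof -
  obtain f q where "poly_fun n f" "ALL v:\<Union>E. v k = 1 --> f v = 0" "ALL j. poly_fun (2 * n + 1) (q j)"
   "ALL x y. f x - f y = (\<Sum>j\<le>n. (x j - y j) * q j (join_vec n x y))"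
   "ALL j:?S. q j (join_vec n e e) = (if j = i then 1 else if j = i0 then - \<tau> i / \<tau> i0 else 0)"
   using d[OF i] unfolding grads_def by auto
  then show ?thesis unfolding P_def by (intro exI[of _ f] exI[of _ q] conjI)
 qed
 then obtain f q where fq: "!!i. i : {..n} - {k, i0} ==> P i (f i) (q i)" by metis
 note fq = fq[unfolded P_def]
 show ?thesis by (rule that[OF i0n, of f q]) (use fq in auto)
qed

text \<open>Primality for inhomogeneous polynomials. After homogenising, the extra factor
  \<open>v k\<close> takes care of the points with \<open>v k = 0\<close>, where nothing is known
  about the product.\<close>

lemma affine_vanishing:
 assumes f: "poly_fun n f" "!!v. v : \<Union>E ==> v k = 1 ==> f v * g v = 0" and g: "poly_fun n g"
 shows "(ALL v:\<Union>E. v k = 1 --> f v = 0) | (ALL v:\<Union>E. v k = 1 --> g v = 0)"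
proof -
 obtain d F where F: "form_fun n d F" "!!v. v k ~= 0 ==> F v = v k ^ d * f (%i. v i / v k)"
  using poly_fun_homogenize[OF f(1) k(1)] by blast
 obtain d' G where G: "form_fun n d' G" "!!v. v k ~= 0 ==> G v = v k ^ d' * g (%i. v i / v k)"
  using poly_fun_homogenize[OF g k(1)] by blast
 have ev: "(F v = f v) & (G v = g v)" if "v k = 1" for v using F(2)[of v] G(2)[of v] that by simp
 have "(v k * F v) * G v = 0" if v: "v : \<Union>E" for v
 proof (cases "v k = 0")
  case False
  then have "cscale (1 / v k) v : \<Union>E" using cone_scale[OF sub v] by simp
  then have "f (%i. v i / v k) * g (%i. v i / v k) = 0"
   using f(2)[of "%i. v i / v k"] False by (simp add: cscale_def)
  then show ?thesis using F(2)[of v] G(2)[of v] False by auto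
 qed simp
 then have "(ALL v:\<Union>E. v k * F v = 0) | (ALL v:\<Union>E. G v = 0)"
  by (rule prime[OF form_fun_mult[OF form_fun_coord[OF k(1)] F(1)] G(1)])
 then show ?thesis using ev by (metis mult_1)
qed

text \<open>Newton iteration solves only the n - 1 equations of the square system, so the arc lies
  in their zero set \<open>Z\<close>, which could be larger than \<open>E\<close>. Suppose that a
  form \<open>F\<close> vanishing on \<open>E\<close> is nonzero somewhere on the arc. It has a
  finite order m along the arc at \<open>e\<close>, and on \<open>Z\<close> it is the power
  \<open>(x i0 - e i0) ^ m\<close> up to factors that do not vanish at \<open>e\<close>. As
  \<open>F\<close> vanishes on \<open>E\<close>, primality makes \<open>x i0\<close> constant on the
  part \<open>v k = 1\<close> of the cone, then all other coordinates, and \<open>E\<close> would be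
  a point.\<close>

lemma local_chart:
 obtains i0 rh r Gm where "i0 <= n" "rh > 0" "r > 0" "!!i. (%u. Gm u i) holomorphic_on ball 0 rh" "Gm 0 = e"
  "!!u. u : ball 0 rh ==> Gm u : \<Union>E & Gm u k = 1 & Gm u i0 = e i0 + u"
  "!!u i. u : ball 0 rh ==> cmod (Gm u i - e i) < r"
  "!!x. x : \<Union>E ==> x k = 1 ==> (!!i. i <= n ==> cmod (x i - e i) < r) ==> x i0 - e i0 : ball 0 rh ==> x = Gm (x i0 - e i0)"
proof -
 obtain i0 f q where i0: "i0 <= n" "i0 ~= k" and f: "!!i. i : {..n} - {k, i0} ==> poly_fun n (f i)"
  "!!i v. i : {..n} - {k, i0} ==> v : \<Union>E ==> v k = 1 ==> f i v = 0" and
  q: "!!i j. i : {..n} - {k, i0} ==> poly_fun (2 * n + 1) (q i j)"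
  "!!i x y. i : {..n} - {k, i0} ==> f i x - f i y = (\<Sum>j\<le>n. (x j - y j) * q i j (join_vec n x y))"
  "!!i j. i : {..n} - {k, i0} ==> j : {..n} - {k, i0} ==> q i j (join_vec n e e) = (if i = j then 1 else 0)"
  by (rule square_system) (rule that)
 define S where "S = {..n} - {k, i0}"
 note f = f[folded S_def] and q = q[folded S_def]
 have S: "S <= {..n}" "i0 \<notin> S" "k \<notin> S" "finite S" by (auto simp: S_def)
 have fe: "f i e = 0" if "i : S" for i using f(2)[OF that e k(2)] .
 have en: "e i = 0" if "i > n" for i using cone_point(2)[OF e] that by (simp add: coord_vectors_def)
 obtain rh r Gm where rh: "rh > 0" "r > 0" and Gm: "!!i. (%u. Gm u i) holomorphic_on ball 0 rh" "Gm 0 = e"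
  "!!u i. u : ball 0 rh ==> i \<notin> S ==> Gm u i = (if i = i0 then e i0 + u else e i)"
  "!!u i. u : ball 0 rh ==> cmod (Gm u i - e i) < r"
  "!!u i. u : ball 0 rh ==> i : S ==> f i (Gm u) = 0" and
  unique: "!!x u. u : ball 0 rh ==> (!!i. i \<notin> S ==> x i = Gm u i) ==> (!!i. i <= n ==> cmod (x i - e i) < r) ==>
    (!!i. i : S ==> f i x = 0) ==> x = Gm u"
 proof (rule implicit_curve[of S n i0 f e q, OF S(1,2)], goal_cases)
  case (6 rh r Gm)
  show ?case by (rule 6(1)[OF 6(2-9)])
 qed (erule f(1) fe q(1,2) | (rule q(3); assumption))+
 define Z where "Z = {x. x k = 1 & (ALL i:S. f i x = 0)}"
 have ZE: "x : Z" if "x : \<Union>E" "x k = 1" for x unfolding Z_def using that f(2) by blast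
 have ZGm: "Gm u : Z" if "u : ball 0 rh" for u
  unfolding Z_def using Gm(3)[OF that S(3)] Gm(5)[OF that] i0(2) k(2) by auto
 have split_sum: "(\<Sum>j\<le>n. (x j - e j) * p j) = (\<Sum>j\<in>S. (x j - e j) * p j) + (x i0 - e i0) * p i0" if "x k = 1" for x p
 proof -
  have "(\<Sum>j\<le>n. (x j - e j) * p j) = (\<Sum>j\<in>insert i0 S. (x j - e j) * p j)"
   by (rule sum.mono_neutral_right) (use that k i0 in "auto simp: S_def")
  then show ?thesis using S(2,4) by simp
 qed
 define Q where "Q = (%i j x. q i j (join_vec n x e))"
 have Qp: "poly_fun n (Q i j)" if "i : S" for i j
 proof -
  have "poly_fun n (%v. q i j (%l. (if l <= n then v l else e (l - Suc n))))"
  proof (rule poly_fun_compose[OF q(1)[OF that]])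
   show "poly_fun n (%v. if l <= n then v l else e (l - Suc n))" for l
    by (cases "l <= n") (auto intro: poly_fun.intros)
  qed
  then show ?thesis unfolding Q_def join_vec_def .
 qed
 have "EX s b. poly_fun n s & (ALL j:S. poly_fun n (b j)) & s e = 1 \<and>
  (ALL x l u. (ALL i:S. (\<Sum>j\<in>S. Q i j x * l j) = (- Q i i0 x) * u) --> (ALL j:S. s x * l j = b j x * u))"
 proof (rule cramer[OF S(4)])
  show "poly_fun n (%x. - Q i i0 x)" if "i : S" for i
   using poly_fun_cmult[OF Qp[OF that, of i0], of "-1"] by simp
 qed (use Qp q(3) in "auto simp: Q_def")
 then obtain s b where s: "poly_fun n s" "!!j. j : S ==> poly_fun n (b j)" "s e = 1" and
  sol: "!!x l u. ALL i:S. (\<Sum>j\<in>S. Q i j x * l j) = (- Q i i0 x) * u ==> ALL j:S. s x * l j = b j x * u" by blast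
 \<comment> \<open>With difference quotients based at \<open>e\<close>, the equations of
   \<open>Z\<close> are linear in \<open>x - e\<close>. Solving them expresses every coordinate
   difference through the one at \<open>i0\<close>, with a denominator \<open>s\<close> that is 1 at
   \<open>e\<close>.\<close>
 have sb: "s x * (x j - e j) = b j x * (x i0 - e i0)" if x: "x : Z" and j: "j : S" for x j
 proof -
  have "ALL i:S. (\<Sum>j\<in>S. Q i j x * (x j - e j)) = (- Q i i0 x) * (x i0 - e i0)"
  proof
   fix i assume i: "i : S"
   have "0 = f i x - f i e" using x i fe by (simp add: Z_def)
   also have "\<dots> = (\<Sum>j\<le>n. (x j - e j) * Q i j x)" unfolding Q_def by (rule q(2)[OF i])
   also have "\<dots> = (\<Sum>j\<in>S. (x j - e j) * Q i j x) + (x i0 - e i0) * Q i i0 x"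
    using x by (intro split_sum) (simp add: Z_def)
   finally have "(\<Sum>j\<in>S. (x j - e j) * Q i j x) = - ((x i0 - e i0) * Q i i0 x)"
    by (simp add: eq_neg_iff_add_eq_0)
   then show "(\<Sum>j\<in>S. Q i j x * (x j - e j)) = (- Q i i0 x) * (x i0 - e i0)"
    by (simp add: mult.commute)
  qed
  then show ?thesis using sol[of x "%j. x j - e j"] j by blast
 qed
 \<comment> \<open>Hence on \<open>Z\<close> every polynomial vanishing at \<open>e\<close> is
   divisible by \<open>x i0 - e i0\<close>, up to the factor \<open>s\<close>, which is a unit near
   \<open>e\<close>.\<close>
 have divide: "EX p. poly_fun n p & (ALL x:Z. s x * g x = (x i0 - e i0) * p x)" if g: "poly_fun n g" "g e = 0" for g
 proof -
  obtain p where p: "!!j. poly_fun (2 * n + 1) (p j)" "!!x y. g x - g y = (\<Sum>j\<le>n. (x j - y j) * p j (join_vec n x y))"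
   using hadamard_quotients[OF g(1)] by blast
  define P where "P = (%j x. p j (join_vec n x e))"
  have Pp: "poly_fun n (P j)" for j
  proof -
   have "poly_fun n (%v. p j (%l. (if l <= n then v l else e (l - Suc n))))"
   proof (rule poly_fun_compose[OF p(1)])
    show "poly_fun n (%v. if l <= n then v l else e (l - Suc n))" for l
     by (cases "l <= n") (auto intro: poly_fun.intros)
   qed
   then show ?thesis unfolding P_def join_vec_def .
  qed
  have "s x * g x = (x i0 - e i0) * ((\<Sum>j\<in>S. b j x * P j x) + s x * P i0 x)" if x: "x : Z" for x
  proof -
   have "g x = (\<Sum>j\<le>n. (x j - e j) * P j x)" using p(2)[of x e] g(2) unfolding P_def by simp
   also have "\<dots> = (\<Sum>j\<in>S. (x j - e j) * P j x) + (x i0 - e i0) * P i0 x"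
    using x by (intro split_sum) (simp add: Z_def)
   finally have "s x * g x = (\<Sum>j\<in>S. (s x * (x j - e j)) * P j x) + s x * ((x i0 - e i0) * P i0 x)"
    by (simp add: distrib_left sum_distrib_left mult.assoc)
   also have "(\<Sum>j\<in>S. (s x * (x j - e j)) * P j x) = (\<Sum>j\<in>S. (b j x * (x i0 - e i0)) * P j x)"
    using sb[OF x] by (intro sum.cong) auto
   finally show ?thesis by (simp add: distrib_left sum_distrib_left algebra_simps)
  qed
  moreover have "poly_fun n (%x. (\<Sum>j\<in>S. b j x * P j x) + s x * P i0 x)"
   by (intro poly_fun.add poly_fun_sum poly_fun.mult s Pp)
  ultimately show ?thesis by blast
 qed
 \<comment> \<open>The division is repeated as often as \<open>g\<close> vanishes along the arc,
   which leaves a polynomial \<open>h\<close> with nonzero value at \<open>e\<close>. The quotient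
   is followed along \<open>Gm\<close>; cancelling the parameter fails at 0 itself, and the identity
   theorem fills this point in.\<close>
 have order: "EX t h. poly_fun n t & poly_fun n h & t e ~= 0 & h e ~= 0 & (ALL x:Z. t x * g x = (x i0 - e i0) ^ m * h x)"
  if "poly_fun n g" "\<sigma> > 0" "\<sigma> <= rh" "\<phi> holomorphic_on ball 0 \<sigma>" "\<phi> 0 ~= 0" "!!u. u : ball 0 \<sigma> ==> g (Gm u) = u ^ m * \<phi> u"
  for g \<phi> \<sigma> m
  using that
 proof (induction m arbitrary: g \<phi>)
  case 0
  have "g e ~= 0" using 0(6)[of 0] 0(2,5) Gm(2) by simp
  then show ?case using 0(1) by (intro exI[of _ "%_. 1"] exI[of _ g]) (auto intro: poly_fun.const)
 next
  case (Suc m)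
  have "g e = 0" using Suc.prems(6)[of 0] Suc.prems(2) Gm(2) by simp
  then obtain p where p: "poly_fun n p" "!!x. x : Z ==> s x * g x = (x i0 - e i0) * p x" using divide[OF Suc.prems(1)] by blast
  have subb: "ball 0 \<sigma> <= ball 0 rh" using Suc.prems(3) by auto
  have Gmhol: "(%u. h (Gm u)) holomorphic_on ball 0 \<sigma>" if "poly_fun n h" for h
   by (rule poly_fun_holomorphic[OF that]) (rule holomorphic_on_subset[OF Gm(1) subb])
  have "p (Gm u) - u ^ m * (s (Gm u) * \<phi> u) = 0" if u: "u : ball 0 \<sigma>" for u
  proof (rule holomorphic_zero_spread[of "%u. p (Gm u) - u ^ m * (s (Gm u) * \<phi> u)" 0 \<sigma> "ball 0 \<sigma> - {0}"])
   show "(%u. p (Gm u) - u ^ m * (s (Gm u) * \<phi> u)) holomorphic_on ball 0 \<sigma>"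
    by (intro holomorphic_intros Gmhol p(1) s(1) Suc.prems(4))
   have "of_real (\<sigma> / 2) : ball 0 \<sigma> - {0 :: complex}" using Suc.prems(2) by simp
   then show "ball 0 \<sigma> - {0 :: complex} ~= {}" by blast
   fix t assume t: "t : ball 0 \<sigma> - {0::complex}"
   then have tb: "t : ball 0 rh" using subb by blast
   have "s (Gm t) * (t ^ Suc m * \<phi> t) = t * p (Gm t)"
    using p(2)[OF ZGm[OF tb]] Suc.prems(6)[of t] t Gm(3)[OF tb S(2)] by simp
   then have "t * (p (Gm t) - t ^ m * (s (Gm t) * \<phi> t)) = 0" by (auto simp: algebra_simps)
   then show "p (Gm t) - t ^ m * (s (Gm t) * \<phi> t) = 0" using t by simp
  qed (use u in auto)
  then have eq: "p (Gm u) = u ^ m * (s (Gm u) * \<phi> u)" if "u : ball 0 \<sigma>" for u using that by simp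
  have "EX t h. poly_fun n t & poly_fun n h & t e ~= 0 & h e ~= 0 & (ALL x:Z. t x * p x = (x i0 - e i0) ^ m * h x)"
  proof (rule Suc.IH[OF p(1) Suc.prems(2,3)])
   show "(%u. s (Gm u) * \<phi> u) holomorphic_on ball 0 \<sigma>" by (intro holomorphic_intros Gmhol s(1) Suc.prems(4))
   show "s (Gm 0) * \<phi> 0 ~= 0" using s(3) Suc.prems(5) Gm(2) by simp
  qed (rule eq)
  then obtain t h where t: "poly_fun n t" "poly_fun n h" "t e ~= 0" "h e ~= 0"
    "!!x. x : Z ==> t x * p x = (x i0 - e i0) ^ m * h x" by blast
  have "(t x * s x) * g x = (x i0 - e i0) ^ Suc m * h x" if "x : Z" for x
  proof -
   have "(t x * s x) * g x = (x i0 - e i0) * (t x * p x)" using p(2)[OF that] by (simp add: mult.left_commute mult.assoc)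
   then show ?thesis using t(5)[OF that] by simp
  qed
  then show ?case using t s by (intro exI[of _ "%x. t x * s x"] exI[of _ h]) (auto intro: poly_fun.mult)
 qed
 have in_E: "Gm u : \<Union>E" if u: "u : ball 0 rh" for u
 proof (rule ccontr)
  assume nE: "Gm u \<notin> \<Union>E"
  have "Gm u k = 1" using ZGm[OF u] by (simp add: Z_def)
  then have "Gm u ~= (%_. 0)" by auto
  moreover have "Gm u i = 0" if i: "i > n" for i
  proof -
   have "i \<notin> S" "i ~= i0" using i i0(1) by (auto simp: S_def)
   then show ?thesis using Gm(3)[OF u] en[OF i] by simp
  qed
  ultimately have "Gm u : coord_vectors n" by (simp add: coord_vectors_def)
  then obtain d F where F: "form_fun n d F" "!!q v. q : E ==> v : q ==> F v = 0" "!!v. v : proj_pt (Gm u) ==> F v ~= 0"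
   using zariski_closed_separate[OF closed proj_spaceI, of "Gm u"] nE cone_mem by blast
  have Fp: "poly_fun n F" by (rule form_fun_poly_fun[OF F(1)])
  have FGm: "(%u. F (Gm u)) holomorphic_on ball 0 rh" by (rule poly_fun_holomorphic[OF Fp Gm(1)])
  have F0: "F (Gm 0) = 0" using F(2) e Gm(2) by blast
  have "\<not> (%u. F (Gm u)) constant_on ball 0 rh"
  proof
   assume "(%u. F (Gm u)) constant_on ball 0 rh"
   then have "F (Gm u) = F (Gm 0)" using u rh(1) unfolding constant_on_def by (metis centre_in_ball)
   then show False using F0 F(3)[OF proj_pt_self] by simp
  qed
  note nonconst = this
  have z0: "0 : ball 0 rh" using rh(1) by simp
  obtain \<phi> \<sigma> m where \<phi>: "0 < m" "0 < \<sigma>" "ball (0::complex) \<sigma> <= ball 0 rh" "\<phi> holomorphic_on ball 0 \<sigma>"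
   "!!w. w : ball 0 \<sigma> ==> F (Gm w) = (w - 0) ^ m * \<phi> w" "!!w. w : ball 0 \<sigma> ==> \<phi> w ~= 0"
   by (rule holomorphic_factor_zero_nonconstant[OF FGm open_ball connected_ball z0 F0 nonconst]) (rule that)
  have "\<sigma> <= rh" using \<phi>(2,3) rh(1) by (simp add: ball_subset_ball_iff)
  then have "EX t h. poly_fun n t & poly_fun n h & t e ~= 0 & h e ~= 0 & (ALL x:Z. t x * F x = (x i0 - e i0) ^ m * h x)"
   using \<phi> by (intro order[OF Fp \<phi>(2) _ \<phi>(4)]) auto
  then obtain t h where t: "poly_fun n h" "h e ~= 0"
    "!!x. x : Z ==> t x * F x = (x i0 - e i0) ^ m * h x" by blast
  have "(ALL v:\<Union>E. v k = 1 --> (v i0 - e i0) ^ m = 0) | (ALL v:\<Union>E. v k = 1 --> h v = 0)"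
  proof (rule affine_vanishing)
   show "poly_fun n (%v. (v i0 - e i0) ^ m)" by (intro poly_fun_power poly_fun_diff poly_fun.const poly_fun.coord i0)
   show "poly_fun n h" by (rule t(1))
   fix v assume v: "v : \<Union>E" "v k = 1"
   then have "F v = 0" using F(2) by blast
   then show "(v i0 - e i0) ^ m * h v = 0" using t(3)[OF ZE[OF v]] by simp
  qed
  then have u0: "v i0 = e i0" if "v : \<Union>E" "v k = 1" for v using that t(2) e k(2) by auto
  have all: "v j = e j" if v: "v : \<Union>E" "v k = 1" and j: "j : S" for v j
  proof -
   have "(ALL v:\<Union>E. v k = 1 --> s v = 0) | (ALL v:\<Union>E. v k = 1 --> v j - e j = 0)"
   proof (rule affine_vanishing[OF s(1)])
    show "poly_fun n (%v. v j - e j)" using j S(1) by (intro poly_fun_diff poly_fun.const poly_fun.coord) auto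
    show "s v * (v j - e j) = 0" if "v : \<Union>E" "v k = 1" for v
     using sb[OF ZE[OF that] j] u0[OF that] by simp
   qed
   then show ?thesis using s(3) e k(2) v by auto
  qed
  have aff: "v = e" if v: "v : \<Union>E" "v k = 1" for v
  proof
   fix i
   have vn: "v i = 0" if "i > n" using cone_point(2)[OF v(1)] that by (simp add: coord_vectors_def)
   show "v i = e i"
    using all[OF v, of i] u0[OF v] v(2) k(2) vn en[of i]
    by (cases "i <= n"; cases "i = k"; cases "i = i0") (auto simp: S_def)
  qed
  \<comment> \<open>In the chart \<open>v k = 1\<close> only one point would be left; primality with
    the factor \<open>v k\<close> excludes further points at infinity.\<close>
  have "(ALL v:\<Union>E. v k = 0) | (ALL v:\<Union>E. v j - e j * v k = 0)" if j: "j <= n" for j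
  proof (rule prime[OF form_fun_coord[OF k(1)]])
   show "form_fun n 1 (%v. v j - e j * v k)"
    by (intro form_fun_diff form_fun_cmult form_fun_coord j k(1))
   fix v assume v: "v : \<Union>E"
   show "v k * (v j - e j * v k) = 0"
   proof (cases "v k = 0")
    case False
    then have "cscale (1 / v k) v : \<Union>E" using cone_scale[OF sub v] by simp
    then have "cscale (1 / v k) v = e" using False by (intro aff) (auto simp: cscale_def)
    then have "e j = v j / v k" by (auto simp: cscale_def)
    then show ?thesis using False by simp
   qed simp
  qed
  moreover have "\<not> (ALL v:\<Union>E. v k = 0)" using e k(2) by force
  ultimately have eq: "v j = e j * v k" if "v : \<Union>E" "j <= n" for v j using that by force
  have "p = proj_pt e" if p: "p : E" for p
  proof -
   obtain v where v: "v : p" using proj_space_nonempty_pt p sub by blast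
   then have vE: "v : \<Union>E" using p by blast
   have "proj_pt v = proj_pt e"
    unfolding proj_pt_eq_minors[OF cone_point(2)[OF vE] cone_point(2)[OF e]] using eq[OF vE] by simp
   then show ?thesis using proj_space_point(1)[of p n v] p sub v by auto
  qed
  then show False using two_points by metis
 qed
 show ?thesis
 proof (rule that[OF i0(1) rh Gm(1,2)])
  show "Gm u : \<Union>E & Gm u k = 1 & Gm u i0 = e i0 + u" if "u : ball 0 rh" for u
   using in_E[OF that] ZGm[OF that] Gm(3)[OF that S(2)] by (simp add: Z_def)
  show "cmod (Gm u i - e i) < r" if "u : ball 0 rh" for u i using Gm(4)[OF that] .
  fix x assume x: "x : \<Union>E" "x k = 1" "!!i. i <= n ==> cmod (x i - e i) < r" "x i0 - e i0 : ball 0 rh"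
  show "x = Gm (x i0 - e i0)"
  proof (rule unique[OF x(4)])
   show "f i x = 0" if "i : S" for i using f(2)[OF that x(1,2)] .
   fix i assume i: "i \<notin> S"
   have xn: "x i = 0" if "i > n" using cone_point(2)[OF x(1)] that by (simp add: coord_vectors_def)
   show "x i = Gm (x i0 - e i0) i"
    unfolding Gm(3)[OF x(4) i] using i xn en[of i] x(2) k(2)
    by (cases "i <= n"; cases "i = k"; cases "i = i0") (auto simp: S_def)
  qed (use x(3) in blast)
 qed
qed

end

section \<open>Charts of a smooth curve, its components and the maximum principle\<close>

context curve
begin

text \<open>A chart on the unit disc, centred at \<open>q\<close> and given by a bounded lift
  normalised at position \<open>k\<close>. The parameter is the value of a linear form \<alpha> on
  the lift, so as a function of the point it is the quotient of \<alpha> by the \<open>k\<close>-th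
  coordinate; changes of charts become quotients of linear forms.\<close>

definition is_chart :: "ppoint => nat => ((nat => complex) => complex) => (complex => nat => complex) => bool" where
 "is_chart q k \<alpha> Gm \<longleftrightarrow> k <= n & form_fun n 1 \<alpha> & (ALL i. (%t. Gm t i) holomorphic_on ball 0 1) \<and>
   (ALL t:ball 0 1. Gm t : \<Union>E & Gm t k = 1 & \<alpha> (Gm t) = t) & Gm 0 : q \<and>
   (EX B. ALL t:ball 0 1. ALL i. cmod (Gm t i) <= B) \<and>
   (ALL Om. open Om --> Om <= ball 0 1 --> openin (subtopology (proj_top n) E) ((%t. proj_pt (Gm t)) ` Om) \<and>
    inverse_chart n E Om (%t. proj_pt (Gm t)))"

lemma chart_exists:
 assumes q: "q : E" shows "EX k \<alpha> Gm. is_chart q k \<alpha> Gm"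
proof -
 obtain w where w: "w : q" using proj_space_nonempty_pt q sub by blast
 have wc: "w : \<Union>E" using w q by blast
 obtain k where k: "k <= n" "w k ~= 0" using coord_vectors_nonzero cone_point(2)[OF wc] by blast
 define e where "e = cscale (1 / w k) w"
 have e: "e : \<Union>E" unfolding e_def by (rule cone_scale[OF sub wc]) (use k(2) in simp)
 have ek: "e k = 1" unfolding e_def using k(2) by (simp add: cscale_def)
 have "q = proj_pt w" using proj_space_point(1)[of q n w] q w sub by blast
 then have eq: "e : q" using k(2) unfolding e_def proj_pt_def by auto
 interpret cp: curve_point n E e k by unfold_locales (rule e, rule k(1), rule ek)
 obtain i0 rh r Gm where i0: "i0 <= n" and rh: "rh > 0" "r > 0" and Gm: "!!i. (%u. Gm u i) holomorphic_on ball 0 rh" "Gm 0 = e"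
  "!!u. u : ball 0 rh ==> Gm u : \<Union>E & Gm u k = 1 & Gm u i0 = e i0 + u"
  "!!u i. u : ball 0 rh ==> cmod (Gm u i - e i) < r"
  "!!x. x : \<Union>E ==> x k = 1 ==> (!!i. i <= n ==> cmod (x i - e i) < r) ==> x i0 - e i0 : ball 0 rh ==> x = Gm (x i0 - e i0)"
 proof (rule cp.local_chart, goal_cases)
  case (1 i0 rh r Gm)
  show ?case by (rule 1(1)[OF 1(2-9)])
 qed
 \<comment> \<open>Rescaling to the unit disc; the linear form that follows inverts the affine entry
   \<open>i0\<close> of the rescaled lift.\<close>
 define G where "G = (%t. Gm (of_real rh * t))"
 define \<alpha> where "\<alpha> = (%v::nat => complex. (1 / of_real rh) * (v i0 - e i0 * v k))"
 have scale: "of_real rh * t : ball 0 rh" if "t : ball (0::complex) 1" for t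
  using that rh(1) by (simp add: norm_mult)
 have G: "G t : \<Union>E" "G t k = 1" "G t i0 = e i0 + of_real rh * t" "cmod (G t i - e i) < r" if "t : ball 0 1" for t i
  using Gm(3)[OF scale[OF that]] Gm(4)[OF scale[OF that], of i] unfolding G_def by auto
 have Ghol: "(%t. G t i) holomorphic_on ball 0 1" for i
 proof -
  have "((%u. Gm u i) \<circ> (%t. of_real rh * t)) holomorphic_on ball 0 1"
   by (rule holomorphic_on_compose_gen[OF _ Gm(1)]) (auto intro!: holomorphic_intros scale simp del: mem_ball)
  then show ?thesis by (simp add: G_def o_def)
 qed
 have bound: "EX B. ALL t:ball 0 1. ALL i. cmod (G t i) <= B"
 proof (intro exI ballI allI)
  fix t :: complex and i assume t: "t : ball 0 1"
  show "cmod (G t i) <= (\<Sum>i\<le>n. cmod (e i)) + r"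
  proof (cases "i <= n")
   case True
   have "cmod (G t i) <= cmod (e i) + cmod (G t i - e i)" by (rule norm_triangle_sub)
   moreover have "cmod (e i) <= (\<Sum>i\<le>n. cmod (e i))" using True by (intro member_le_sum) auto
   ultimately show ?thesis using G(4)[OF t, of i] by simp
  next
   case False
   then have "G t i = 0" using cone_point(2)[OF G(1)[OF t]] by (simp add: coord_vectors_def)
   then show ?thesis using rh(2) by (simp add: sum_nonneg add_nonneg_nonneg)
  qed
 qed
 have op: "openin (subtopology (proj_top n) E) ((%t. proj_pt (G t)) ` Om)" if Om: "open Om" "Om <= ball 0 1" for Om
 proof -
  define T where "T = (%z. (z - e i0) / of_real rh) -` Om"
  have T: "open T" unfolding T_def using rh(1) by (intro open_vimage[OF Om(1)] continuous_intros) auto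
  \<comment> \<open>Points in the box of radius \<open>r\<close> whose coordinate \<open>i0\<close>
    corresponds to a parameter in \<open>Om\<close>. By the uniqueness part of
    \<open>local_chart\<close> those on \<open>E\<close> are exactly the points of the arc.\<close>
  define N where "N = {p : proj_space n. ALL v:p. v k ~= 0 & v i0 / v k : T} \<inter>
    (\<Inter>i\<in>{..n}. {p : proj_space n. ALL v:p. v k ~= 0 & v i / v k : ball (e i) r})"
  have "openin (proj_top n) N" unfolding N_def
   by (intro openin_Int openin_INT2 openin_affine_preimage k T) auto
  moreover have "(%t. proj_pt (G t)) ` Om = N \<inter> E"
  proof (intro set_eqI iffI)
   fix p assume "p : (%t. proj_pt (G t)) ` Om"
   then obtain t where t: "t : Om" "p = proj_pt (G t)" by blast
   then have tb: "t : ball 0 1" using Om(2) by blast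
   have pE: "p : E" using cone_point(1)[OF G(1)[OF tb]] t(2) by simp
   have "v k ~= 0 & v i / v k = G t i" if v: "v : p" for v i
   proof -
    obtain c where "c ~= 0" "v = cscale c (G t)" using v unfolding t(2) proj_pt_def by blast
    then show ?thesis using G(2)[OF tb] by (simp add: cscale_def)
   qed
   moreover have "G t i0 : T" using G(3)[OF tb] t(1) rh(1) by (simp add: T_def)
   moreover have "G t i : ball (e i) r" for i using G(4)[OF tb, of i] by (simp add: dist_norm norm_minus_commute)
   ultimately have "p : N" unfolding N_def using pE sub by auto
   then show "p : N \<inter> E" using pE by blast
  next
   fix p assume p: "p : N \<inter> E"
   then have pP: "p : proj_space n" using sub by blast
   obtain v where v: "v : p" using proj_space_nonempty_pt[OF pP] by blast
   have vk: "v k ~= 0" "v i0 / v k : T" using p v unfolding N_def by blast+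
   have vb: "v i / v k : ball (e i) r" if "i <= n" for i using p v that unfolding N_def by blast
   define x where "x = cscale (1 / v k) v"
   have vE: "v : \<Union>E" using p v by blast
   have xE: "x : \<Union>E" unfolding x_def by (rule cone_scale[OF sub vE]) (use vk(1) in simp)
   have x1: "x k = 1" unfolding x_def using vk(1) by (simp add: cscale_def)
   note x = xE x1
   have xi: "x i = v i / v k" for i by (simp add: x_def cscale_def)
   define t where "t = (x i0 - e i0) / of_real rh"
   have t: "t : Om" using vk(2) unfolding T_def t_def xi by simp
   have tx: "x i0 - e i0 = of_real rh * t" using rh(1) by (simp add: t_def)
   have "x = Gm (x i0 - e i0)"
   proof (rule Gm(5)[OF x])
    show "cmod (x i - e i) < r" if "i <= n" for i using vb[OF that] unfolding xi by (simp add: dist_norm norm_minus_commute)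
    show "x i0 - e i0 : ball 0 rh" unfolding tx using t Om(2) scale by blast
   qed
   then have "x = G t" unfolding tx G_def .
   moreover have "p = proj_pt x" using proj_space_point(1)[OF pP v] proj_pt_cscale[of "1 / v k" v] vk(1) by (simp add: x_def)
   ultimately show "p : (%t. proj_pt (G t)) ` Om" using t by blast
  qed
  ultimately show ?thesis unfolding openin_subtopology by blast
 qed
 have inv: "inverse_chart n E Om (%t. proj_pt (G t))" if Om: "open Om" "Om <= ball 0 1" for Om
 proof (rule inverse_chartI[OF Om(1) k(1), of _ "of_real rh" i0 "e i0"])
  show "openin (subtopology (proj_top n) E) ((%t. proj_pt (G t)) ` Om)" by (rule op[OF Om])
  show "(%t. G t i) holomorphic_on Om" for i by (rule holomorphic_on_subset[OF Ghol Om(2)])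
  show "complex_of_real rh ~= 0" using rh(1) by simp
  fix t assume "t : Om"
  then have "t : ball 0 1" using Om(2) by blast
  then show "G t : coord_vectors n" "G t k = 1" "G t i0 = e i0 + of_real rh * t" using G cone_point(2) by blast+
 qed
 have \<alpha>: "form_fun n 1 \<alpha>" unfolding \<alpha>_def
  by (intro form_fun_cmult form_fun_diff form_fun_coord i0 k(1))
 have \<alpha>G: "\<alpha> (G t) = t" if "t : ball 0 1" for t using G(2,3)[OF that] rh(1) by (simp add: \<alpha>_def)
 have "is_chart q k \<alpha> G"
  unfolding is_chart_def using k(1) \<alpha> Ghol G(1,2) \<alpha>G eq bound op inv Gm(2) by (auto simp: G_def)
 then show ?thesis by blast
qed

definition "chart_data q = (SOME (k, \<alpha>, Gm). is_chart q k \<alpha> Gm)"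
definition "chart_index q = fst (chart_data q)"
definition "chart_form q = fst (snd (chart_data q))"
definition "lift q = snd (snd (chart_data q))"
definition "disc q t = proj_pt (lift q t)"

lemma is_chart_lift:
 assumes "q : E" shows "is_chart q (chart_index q) (chart_form q) (lift q)"
proof -
 have "EX x. case x of (k, \<alpha>, Gm) => is_chart q k \<alpha> Gm" using chart_exists[OF assms] by auto
 then have "case chart_data q of (k, \<alpha>, Gm) => is_chart q k \<alpha> Gm"
  unfolding chart_data_def by (rule someI_ex)
 then show ?thesis by (simp add: chart_index_def chart_form_def lift_def split: prod.splits)
qed

lemma lift_hol: "q : E ==> (%t. lift q t i) holomorphic_on ball 0 1"
 and lift_cone: "q : E ==> t : ball 0 1 ==> lift q t : \<Union>E"
 and lift_index: "q : E ==> t : ball 0 1 ==> lift q t (chart_index q) = 1"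
 and chart_index_le: "q : E ==> chart_index q <= n"
 and chart_form: "q : E ==> form_fun n 1 (chart_form q)"
 and chart_form_lift: "q : E ==> t : ball 0 1 ==> chart_form q (lift q t) = t"
 and lift_zero: "q : E ==> lift q 0 : q"
 and disc_open: "q : E ==> open Om ==> Om <= ball 0 1 ==> openin (subtopology (proj_top n) E) (disc q ` Om)"
 and disc_inverse_chart: "q : E ==> open Om ==> Om <= ball 0 1 ==> inverse_chart n E Om (disc q)"
 using is_chart_lift[of q] unfolding is_chart_def disc_def[abs_def] by blast+

lemma disc_zero: "q : E ==> disc q 0 = q"
 unfolding disc_def using proj_space_point(1)[of q n "lift q 0"] lift_zero sub by auto

lemma disc_mem: "q : E ==> t : ball 0 1 ==> disc q t : E"
 unfolding disc_def using cone_point(1) lift_cone by blast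

lemma lift_mem_disc: "lift q t : disc q t"
 unfolding disc_def by (rule proj_pt_self)

lemma disc_inj:
 assumes "q : E" shows "inj_on (disc q) (ball 0 1)"
proof (rule inj_onI)
 fix s t :: complex assume st: "s : ball 0 1" "t : ball 0 1" "disc q s = disc q t"
 then obtain c where c: "lift q s = cscale c (lift q t)" unfolding disc_def by (auto simp: proj_pt_eq)
 then have "c = 1" using lift_index[OF assms st(1)] lift_index[OF assms st(2)] by (simp add: cscale_def)
 then have "lift q s = lift q t" using c by (simp add: cscale_def)
 then show "s = t" using chart_form_lift[OF assms st(1)] chart_form_lift[OF assms st(2)] by metis
qed

lemma form_lift_hol:
 assumes "q : E" "form_fun n d f" shows "(%t. f (lift q t)) holomorphic_on ball 0 1"
 by (rule poly_fun_holomorphic[OF form_fun_poly_fun[OF assms(2)] lift_hol[OF assms(1)]])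

abbreviation "TE \<equiv> subtopology (proj_top n) E"

lemma topspace_TE: "topspace TE = E"
 using sub by (auto simp: topspace_proj_top)

lemma compact_TE: "compact_space TE"
 using zariski_closed_compactin[OF closed] by (simp add: compact_space_subtopology)

lemma disc_continuous:
 assumes "q : E" shows "continuous_map (top_of_set (ball 0 1)) TE (disc q)"
proof -
 have "inverse_chart n E (ball 0 1) (disc q)" using disc_inverse_chart[OF assms, of "ball 0 1"] by simp
 then have "continuous_map (top_of_set (ball 0 1)) (proj_top n) (disc q)"
  by (simp add: inverse_chart_def holomorphic_into_def)
 then show ?thesis using disc_mem[OF assms] by (auto simp: continuous_map_in_subtopology)
qed

text \<open>Connectedness of \<open>E\<close> in the Euclidean topology becomes available only after
  zeros have been counted; until then one component takes the place of \<open>E\<close>.\<close>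

definition "component q = connected_component_of_set TE q"

lemma disc_connected: "q : E ==> connectedin TE (disc q ` ball 0 1)"
 by (rule connectedin_continuous_map_image[OF disc_continuous]) (simp_all add: connectedin_subtopology)

lemma component_sub: "component q <= E"
 unfolding component_def using connected_component_of_subset_topspace[of TE q] topspace_TE by simp

lemma component_refl: "q : E ==> q : component q"
 unfolding component_def using topspace_TE by (simp add: connected_component_of_refl)

lemma connected_component: "connectedin TE (component q)"
 unfolding component_def by (rule connectedin_connected_component_of)

lemma disc_component:
 assumes "p : component q" "t : ball 0 1" shows "disc p t : component q"
proof -
 have p: "p : E" using assms component_sub by blast
 have pd: "p : disc p ` ball 0 1" by (rule image_eqI[of _ _ 0]) (simp_all add: disc_zero[OF p])
 have "connected_component_of TE q p" using assms(1) unfolding component_def by simp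
 then have q: "q : E" using connected_component_in_topspace[of TE q p] topspace_TE by simp
 have "connectedin TE (component q \<union> disc p ` ball 0 1)"
  by (rule connectedin_Un[OF connected_component disc_connected[OF p]]) (use pd assms(1) in blast)
 then have "component q \<union> disc p ` ball 0 1 <= connected_component_of_set TE q"
  by (rule connected_component_of_maximal) (use component_refl[OF q] in blast)
 then show ?thesis using assms(2) unfolding component_def by blast
qed

lemma compact_component: "compactin TE (component q)"
 unfolding component_def by (rule closedin_compact_space[OF compact_TE closedin_connected_component_of])

text \<open>The identity principle on a component: \<open>P\<close> spreads over a disc around
  \<open>p\<close> as soon as it holds on an open part of it, so the interior of the set where
  \<open>P\<close> holds is also closed in the component.\<close>

lemma component_spread:
 assumes step: "!!p. p : component q0 ==> EX d>0. d <= 1 \<and>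
   (ALL Om. open Om --> Om <= ball 0 d --> Om ~= {} --> (ALL t:Om. P (disc p t)) --> (ALL t:ball 0 d. P (disc p t)))"
  and start: "p0 : component q0" "open Om" "Om <= ball 0 1" "Om ~= {}" "!!t. t : Om ==> P (disc p0 t)"
  and x: "x : component q0"
 shows "P x"
proof -
 let ?C = "component q0"
 define A where "A = \<Union>{W. openin TE W & W <= ?C & (ALL y:W. P y)}"
 have opA: "openin TE A" unfolding A_def by (intro openin_Union) auto
 have AC: "A <= ?C" and AP: "!!y. y : A ==> P y" unfolding A_def by blast+
 have inA: "W <= A" if "openin TE W" "W <= ?C" "!!y. y : W ==> P y" for W unfolding A_def using that by blast
 have p0E: "p0 : E" using start(1) component_sub by blast
 have "disc p0 ` Om <= A"
  by (rule inA[OF disc_open[OF p0E start(2,3)]]) (use disc_component[OF start(1)] start(3,5) in auto)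
 then have Ane: "A ~= {}" using start(4) by blast
 have "openin TE (?C - A)"
 proof (subst openin_subopen, intro ballI)
  fix p assume p: "p : ?C - A"
  then have pE: "p : E" using component_sub by blast
  obtain d where d: "d > 0" "d <= 1" "!!Om. open Om ==> Om <= ball 0 d ==> Om ~= {} ==> (ALL t:Om. P (disc p t)) ==> (ALL t:ball 0 d. P (disc p t))"
   using step[of p] p by blast
  have b: "ball (0::complex) d <= ball 0 1" using d(2) by (rule subset_ball)
  have opD: "openin TE (disc p ` ball 0 d)" by (rule disc_open[OF pE open_ball b])
  have pD: "p : disc p ` ball 0 d" by (rule image_eqI[of _ _ 0]) (simp_all add: disc_zero[OF pE] d(1))
  have DC: "disc p ` ball 0 d <= ?C" using disc_component[of p q0] p b by blast
  have "disc p ` ball 0 d \<inter> A = {}"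
  proof (rule ccontr)
   assume ne: "disc p ` ball 0 d \<inter> A ~= {}"
   define Om' where "Om' = {t : ball 0 1. disc p t : A} \<inter> ball 0 d"
   have "openin (top_of_set (ball 0 1)) {t : ball 0 1. disc p t : A}"
    using openin_continuous_map_preimage[OF disc_continuous[OF pE] opA] by simp
   then have "open {t : ball 0 1. disc p t : A}" using openin_open_trans open_ball by blast
   then have "open Om'" unfolding Om'_def by blast
   moreover have "Om' ~= {}" using ne b unfolding Om'_def by blast
   moreover have "ALL t:Om'. P (disc p t)" using AP unfolding Om'_def by blast
   moreover have "Om' <= ball 0 d" unfolding Om'_def by blast
   ultimately have "ALL t:ball 0 d. P (disc p t)" using d(3) by blast
   then have "disc p ` ball 0 d <= A" using inA[OF opD DC] by blast
   then show False using pD p by blast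
  qed
  then show "EX T. openin TE T & p : T & T <= ?C - A" using opD pD DC by blast
 qed
 then have opB: "openin TE (?C - A)" .
 have "\<not> (EX E1 E2. openin TE E1 & openin TE E2 & ?C <= E1 \<union> E2 & E1 \<inter> E2 \<inter> ?C = {} & E1 \<inter> ?C ~= {} & E2 \<inter> ?C ~= {})"
  using connected_component[of q0] unfolding connectedin by (rule conjunct2)
 then have "\<not> (?C <= A \<union> (?C - A) & A \<inter> (?C - A) \<inter> ?C = {} & A \<inter> ?C ~= {} & (?C - A) \<inter> ?C ~= {})"
  using opA opB by blast
 then have "A = ?C" using Ane AC by blast
 then show ?thesis using x AP by blast
qed

lemma component_form_identity:
 assumes f: "form_fun n d f" and start: "p0 : component q0" "open Om" "Om <= ball 0 1" "Om ~= {}"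
  "!!t. t : Om ==> f (lift p0 t) = 0"
  and x: "x : component q0" "v : x"
 shows "f v = 0"
proof -
 have iff: "(ALL v:disc p t. f v = 0) \<longleftrightarrow> f (lift p t) = 0" if "p : E" "t : ball 0 1" for p t
 proof -
  have "disc p t : proj_space n" using disc_mem[OF that] sub by blast
  then show ?thesis using form_fun_vanish_point[OF f] lift_mem_disc by blast
 qed
 have "ALL v:x. f v = 0"
 proof (rule component_spread[OF _ start(1-4) _ x(1)])
  fix p assume p: "p : component q0"
  then have pE: "p : E" using component_sub by blast
  show "EX d>0. d <= 1 & (ALL Om. open Om --> Om <= ball 0 d --> Om ~= {} --> (ALL t:Om. ALL v:disc p t. f v = 0) -->
    (ALL t:ball 0 d. ALL v:disc p t. f v = 0))"
  proof (rule exI[of _ 1], intro conjI allI impI)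
   fix Om :: "complex set" assume Om: "open Om" "Om <= ball 0 1" "Om ~= {}" "ALL t:Om. ALL v:disc p t. f v = 0"
   show "ALL t:ball 0 1. ALL v:disc p t. f v = 0"
   proof
    fix t :: complex assume t: "t : ball 0 1"
    have "f (lift p t) = 0"
     by (rule holomorphic_zero_spread[OF form_lift_hol[OF pE f] Om(1-3) _ t]) (use Om(4) lift_mem_disc in blast)
    then show "ALL v:disc p t. f v = 0" using iff[OF pE t] by blast
   qed
  qed auto
 next
  fix t assume t: "t : Om"
  have "p0 : E" using start(1) component_sub by blast
  then show "ALL v:disc p0 t. f v = 0" using iff[of p0 t] start(5)[OF t] start(3) t by blast
 qed
 then show ?thesis using x(2) by blast
qed

text \<open>The Zariski closure of a component is irreducible: if a product of forms vanishes on the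
  component and one factor is nonzero at some point, the other vanishes on a small disc there and
  hence everywhere. The closure contains two points, so it is \<open>E\<close> by dimension.\<close>

lemma component_dense:
 assumes q0: "q0 : E" and f: "form_fun n d f" and 0: "!!x v. x : component q0 ==> v : x ==> f v = 0"
  and v: "v : \<Union>E"
 shows "f v = 0"
proof -
 let ?C = "component q0"
 define S where "S = {f. (EX d. form_fun n d f) & (ALL x:?C. ALL v:x. f v = 0)}"
 define A where "A = {p : proj_space n. ALL f:S. ALL v:p. f v = 0}"
 have Acl: "zariski_closed n A" by (rule zariski_closedI[of S]) (auto simp: S_def A_def)
 have CA: "?C <= A" using component_sub sub by (auto simp: A_def S_def)
 have Amin: "A <= B" if B: "zariski_closed n B" "?C <= B" for B
 proof
  fix p assume p: "p : A"
  show "p : B"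
  proof (rule ccontr)
   assume "p \<notin> B"
   then obtain d f where f: "form_fun n d f" "!!q v. q : B ==> v : q ==> f v = 0" "!!v. v : p ==> f v ~= 0"
    using zariski_closed_separate[OF B(1), of p] p unfolding A_def by blast
   then have "f : S" unfolding S_def using B(2) by blast
   moreover obtain v where "v : p" using proj_space_nonempty_pt p unfolding A_def by blast
   ultimately show False using p f(3) unfolding A_def by blast
  qed
 qed
 have AE: "A <= E" using Amin[OF closed component_sub] .
 have q0C: "q0 : ?C" by (rule component_refl[OF q0])
 have irr: "A = A1 | A = A2" if A12: "zariski_closed n A1" "zariski_closed n A2" "A = A1 \<union> A2" for A1 A2
 proof (rule ccontr)
  assume no: "\<not> (A = A1 | A = A2)"
  then have "\<not> ?C <= A1" "\<not> ?C <= A2" using Amin A12 by blast+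
  then obtain p1 p2 where p: "p1 : ?C" "p1 \<notin> A1" "p2 : ?C" "p2 \<notin> A2" by blast
  then have pn: "p1 : proj_space n" "p2 : proj_space n" using component_sub sub by blast+
  obtain d1 f1 where f1: "form_fun n d1 f1" "!!q v. q : A1 ==> v : q ==> f1 v = 0" "!!v. v : p1 ==> f1 v ~= 0"
   using zariski_closed_separate[OF A12(1) pn(1) p(2)] by blast
  obtain d2 f2 where f2: "form_fun n d2 f2" "!!q v. q : A2 ==> v : q ==> f2 v = 0" "!!v. v : p2 ==> f2 v ~= 0"
   using zariski_closed_separate[OF A12(2) pn(2) p(4)] by blast
  have p1E: "p1 : E" using p(1) component_sub by blast
  have "f1 (lift p1 0) ~= 0" using f1(3) lift_zero[OF p1E] by blast
  moreover have "continuous_on (ball 0 1) (%t. f1 (lift p1 t))"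
   using form_lift_hol[OF p1E f1(1)] by (rule holomorphic_on_imp_continuous_on)
  ultimately obtain r where r: "r > 0" "!!t. t : ball 0 1 ==> dist 0 t < r ==> f1 (lift p1 t) ~= 0"
   using continuous_on_avoid[of "ball 0 1" "%t. f1 (lift p1 t)" 0 0] by auto
  have f12: "f1 v * f2 v = 0" if "x : ?C" "v : x" for x v
   using that CA A12(3) f1(2) f2(2) by (metis UnE mult_eq_0_iff subsetD)
  obtain w where w: "w : p2" using proj_space_nonempty_pt[OF pn(2)] by blast
  have "f2 w = 0"
  proof (rule component_form_identity[OF f2(1) p(1) open_ball, of 0 "min r 1" p2 w])
   fix t :: complex assume t: "t : ball 0 (min r 1)"
   have "disc p1 t : ?C" using disc_component[OF p(1)] t by auto
   then have "f1 (lift p1 t) * f2 (lift p1 t) = 0" using f12 lift_mem_disc by blast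
   then show "f2 (lift p1 t) = 0" using r(2)[of t] t by auto
  qed (use r(1) p(3) w in auto)
  then show False using f2(3)[OF w] by blast
 qed
 have Avar: "projective_variety n A"
  unfolding projective_variety_def using Acl irr q0C CA by blast
 have half: "(1/2::complex) : ball 0 1" by simp
 have "disc q0 0 ~= disc q0 (1/2)" using inj_onD[OF disc_inj[OF q0], of 0 "1/2"] half by auto
 moreover have "disc q0 0 : A" "disc q0 (1/2) : A"
  using disc_component[OF q0C, of 0] disc_component[OF q0C half] CA by auto
 ultimately have "A = E" using dense_subvariety[OF Avar AE] by blast
 then show ?thesis using f 0 v unfolding A_def S_def by blast
qed

definition "holo_at q \<Phi> \<longleftrightarrow> (EX ep>0. ep <= 1 & (%t. \<Phi> (disc q t)) holomorphic_on ball 0 ep)"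

text \<open>The component is compact, so the modulus attains its maximum; \<Phi> is constant on a
  disc there, and constancy spreads over the component.\<close>

lemma maximum_principle:
 fixes \<Phi> :: "ppoint => complex"
 assumes q0: "q0 : E" and hol: "!!p. p : component q0 ==> holo_at p \<Phi>"
 obtains c where "!!x. x : component q0 ==> \<Phi> x = c"
proof -
 let ?C = "component q0"
 have hol': "EX ep>0. ep <= 1 & (%t. \<Phi> (disc p t)) holomorphic_on ball 0 ep" if "p : ?C" for p
  using hol[OF that] unfolding holo_at_def .
 have "continuous_map (subtopology TE ?C) euclideanreal (%x. cmod (\<Phi> x))"
  unfolding continuous_map_def
 proof (intro conjI allI impI)
  fix U :: "real set" assume "openin euclideanreal U"
  then have U: "open U" by simp
  have top: "topspace (subtopology TE ?C) = ?C" using component_sub topspace_TE by auto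
  have "openin TE {x : ?C. cmod (\<Phi> x) : U}"
  proof (subst openin_subopen, intro ballI)
   fix x assume x: "x : {x : ?C. cmod (\<Phi> x) : U}"
   then have xE: "x : E" using component_sub by blast
   obtain ep where ep: "ep > 0" "ep <= 1" "(%t. \<Phi> (disc x t)) holomorphic_on ball 0 ep" using hol' x by blast
   have "continuous_on (ball 0 ep) (%t. cmod (\<Phi> (disc x t)))"
    by (intro continuous_on_norm holomorphic_on_imp_continuous_on ep(3))
   then have op: "open (ball 0 ep \<inter> (%t. cmod (\<Phi> (disc x t))) -` U)" by (rule continuous_open_preimage[OF _ open_ball U])
   let ?Om = "ball 0 ep \<inter> (%t. cmod (\<Phi> (disc x t))) -` U"
   have b: "ball (0::complex) ep <= ball 0 1" using ep(2) by (rule subset_ball)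
   have "openin TE (disc x ` ?Om)" by (rule disc_open[OF xE op]) (use b in blast)
   moreover have "x : disc x ` ?Om"
    by (rule image_eqI[of _ _ 0]) (use disc_zero[OF xE] x ep(1) in auto)
   moreover have "disc x ` ?Om <= {x : ?C. cmod (\<Phi> x) : U}" using disc_component[of x q0] x b by blast
   ultimately show "EX T. openin TE T & x : T & T <= {x : ?C. cmod (\<Phi> x) : U}" by blast
  qed
  then show "openin (subtopology TE ?C) {x : topspace (subtopology TE ?C). cmod (\<Phi> x) : U}"
   unfolding top openin_subtopology by blast
 qed simp
 moreover have "compactin (subtopology TE ?C) ?C" using compact_component by (simp add: compactin_subtopology)
 ultimately have "compactin euclideanreal ((%x. cmod (\<Phi> x)) ` ?C)" by (intro image_compactin)
 then have "compact ((%x. cmod (\<Phi> x)) ` ?C)" by simp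
 moreover have "(%x. cmod (\<Phi> x)) ` ?C ~= {}" using component_refl[OF q0] by blast
 ultimately obtain x0 where x0: "x0 : ?C" "!!x. x : ?C ==> cmod (\<Phi> x) <= cmod (\<Phi> x0)"
  using compact_attains_sup[of "(%x. cmod (\<Phi> x)) ` ?C"] by blast
 have x0E: "x0 : E" using x0(1) component_sub by blast
 obtain ep where ep: "ep > 0" "ep <= 1" "(%t. \<Phi> (disc x0 t)) holomorphic_on ball 0 ep" using hol'[OF x0(1)] by blast
 have b: "ball (0::complex) ep <= ball 0 1" using ep(2) by (rule subset_ball)
 have "(%t. \<Phi> (disc x0 t)) constant_on ball 0 ep"
  by (rule maximum_modulus_principle[OF ep(3) open_ball connected_ball open_ball subset_refl, of 0])
    (use ep(1) x0(2) disc_component[OF x0(1)] b disc_zero[OF x0E] in auto)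
 then have const: "\<Phi> (disc x0 t) = \<Phi> x0" if "t : ball 0 ep" for t
  using that ep(1) disc_zero[OF x0E] unfolding constant_on_def by (metis centre_in_ball)
 have "\<Phi> x = \<Phi> x0" if x: "x : ?C" for x
 proof (rule component_spread[where P = "%x. \<Phi> x = \<Phi> x0", OF _ x0(1) open_ball b _ const x])
  show "ball (0::complex) ep ~= {}" using ep(1) by simp
  fix p assume p: "p : ?C"
  obtain d where d: "d > 0" "d <= 1" "(%t. \<Phi> (disc p t)) holomorphic_on ball 0 d" using hol'[OF p] by blast
  show "EX d>0. d <= 1 & (ALL Om. open Om --> Om <= ball 0 d --> Om ~= {} --> (ALL t:Om. \<Phi> (disc p t) = \<Phi> x0) -->
    (ALL t:ball 0 d. \<Phi> (disc p t) = \<Phi> x0))"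
  proof (rule exI[of _ d], intro conjI d(1,2) allI impI ballI)
   fix Om :: "complex set" and t :: complex
   assume Om: "open Om" "Om <= ball 0 d" "Om ~= {}" "ALL t:Om. \<Phi> (disc p t) = \<Phi> x0" and t: "t : ball 0 d"
   have "(%t. \<Phi> (disc p t) - \<Phi> x0) holomorphic_on ball 0 d" by (intro holomorphic_intros d(3))
   from holomorphic_zero_spread[OF this Om(1-3) _ t] Om(4)
   show "\<Phi> (disc p t) = \<Phi> x0" by simp
  qed
 qed
 then show ?thesis using that by blast
qed

end

section \<open>Orders of vanishing of forms\<close>

definition has_order :: "(complex => complex) => nat => bool" where
 "has_order f m \<longleftrightarrow> (EX r>0. r <= 1 & (EX h. h holomorphic_on ball 0 r \<and>
   (ALL t:ball 0 r. h t ~= 0) & (ALL t:ball 0 r. f t = t ^ m * h t)))"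

text \<open>There is no condition on \<open>h\<close> at 0: the zero function qualifies for every
  \<open>m\<close>, and the functions of order at least \<open>m\<close> form a linear space.
  \<open>has_order\<close> is the exact version.\<close>

definition order_ge :: "(complex => complex) => nat => bool" where
 "order_ge f m \<longleftrightarrow> (EX r>0. r <= 1 & (EX h. h holomorphic_on ball 0 r & (ALL t:ball 0 r. f t = t ^ m * h t)))"

lemma has_orderE:
 assumes "has_order f m"
 obtains r h where "r > 0" "r <= 1" "h holomorphic_on ball 0 r" "!!t. t : ball 0 r ==> h t ~= 0"
  "!!t. t : ball 0 r ==> f t = t ^ m * h t"
 using assms unfolding has_order_def by blast

lemma order_geE:
 assumes "order_ge f m"
 obtains r h where "r > 0" "r <= 1" "h holomorphic_on ball 0 r" "!!t. t : ball 0 r ==> f t = t ^ m * h t"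
 using assms unfolding order_ge_def by blast

lemma order_geI:
 "r > 0 ==> r <= 1 ==> h holomorphic_on ball 0 r ==> (!!t. t : ball 0 r ==> f t = t ^ m * h t) ==> order_ge f m"
 unfolding order_ge_def by blast

lemma has_orderI:
 assumes "r > 0" "r <= 1" "h holomorphic_on ball 0 r" "h 0 ~= 0" "!!t. t : ball 0 r ==> f t = t ^ m * h t"
 shows "has_order f m"
proof -
 have "continuous_on (ball 0 r) h" using assms(3) by (rule holomorphic_on_imp_continuous_on)
 then obtain e where e: "e > 0" "!!t. t : ball 0 r ==> dist 0 t < e ==> h t ~= 0"
  using continuous_on_avoid[of "ball 0 r" h 0 0] assms(1,4) by auto
 have *: "ball (0::complex) (min e r) <= ball 0 r" by auto
 show ?thesis unfolding has_order_def
  by (rule exI[of _ "min e r"], intro conjI exI[of _ h])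
    (use assms e holomorphic_on_subset[OF assms(3) *] in auto)
qed

lemma has_order_ge: "has_order f m ==> order_ge f m"
 unfolding has_order_def order_ge_def by blast

lemma order_ge_mono:
 assumes "order_ge f m" "k <= m" shows "order_ge f k"
proof -
 obtain r h where r: "r > 0" "r <= 1" "h holomorphic_on ball 0 r" "!!t. t : ball 0 r ==> f t = t ^ m * h t"
  using order_geE[OF assms(1)] by metis
 show ?thesis
  by (rule order_geI[OF r(1,2), of "%t. t ^ (m - k) * h t"])
    (use r assms(2) in "auto intro!: holomorphic_intros simp: mult.assoc[symmetric] power_add[symmetric]")
qed

lemma order_ge_le:
 assumes "order_ge f a" "has_order f b" shows "a <= b"
proof (rule ccontr)
 assume "\<not> a <= b"
 obtain r h where r: "r > 0" "h holomorphic_on ball 0 r" "!!t. t : ball 0 r ==> f t = t ^ a * h t"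
  using order_geE[OF assms(1)] by metis
 obtain s k where s: "s > 0" "k holomorphic_on ball 0 s" "!!t. t : ball 0 s ==> k t ~= 0" "!!t. t : ball 0 s ==> f t = t ^ b * k t"
  using has_orderE[OF assms(2)] by metis
 define u where "u = min r s"
 have u: "u > 0" "ball (0::complex) u <= ball 0 r" "ball (0::complex) u <= ball 0 s" using r s by (auto simp: u_def)
 have "t ^ (a - b) * h t - k t = 0" if t: "t : ball 0 u" "t ~= 0" for t
 proof -
  have "t ^ a * h t = t ^ b * k t" using r(3)[of t] s(4)[of t] t(1) u by (metis subsetD)
  moreover have "t ^ a = t ^ b * t ^ (a - b)" using \<open>\<not> a <= b\<close> by (simp add: power_add[symmetric])
  ultimately have "t ^ b * (t ^ (a - b) * h t) = t ^ b * k t" by (simp only: mult.assoc)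
  then have "t ^ (a - b) * h t = k t" using t(2) by (simp only: mult_cancel_left power_eq_0_iff) simp
  then show ?thesis by simp
 qed
 note zero = this
 have "0 ^ (a - b) * h 0 - k 0 = 0"
 proof (rule holomorphic_zero_spread[where f = "%t. t ^ (a - b) * h t - k t" and z = 0 and e = u and W = "ball 0 u - {0}"])
  show "(%t. t ^ (a - b) * h t - k t) holomorphic_on ball 0 u"
   by (intro holomorphic_on_diff holomorphic_on_mult holomorphic_on_power holomorphic_on_ident
    holomorphic_on_subset[OF r(2) u(2)] holomorphic_on_subset[OF s(2) u(3)])
  have "of_real (u/2) : ball (0::complex) u - {0}" using u(1) by auto
  then show "ball (0::complex) u - {0} ~= {}" by blast
 qed (use u(1) zero in "auto intro: open_delete")
 then show False using s(1) s(3)[of 0] \<open>\<not> a <= b\<close> by (auto simp: power_0_left)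
qed

lemma has_order_unique: "has_order f a ==> has_order f b ==> a = b"
 by (meson order_ge_le has_order_ge antisym)

lemma order_ge_0: "f holomorphic_on ball 0 1 ==> order_ge f 0"
 by (rule order_geI[of 1 f]) auto

lemma has_order_mult:
 assumes "has_order f a" "has_order g b" shows "has_order (%t. f t * g t) (a + b)"
proof -
 obtain r h where r: "r > 0" "r <= 1" "h holomorphic_on ball 0 r" "!!t. t : ball 0 r ==> h t ~= 0" "!!t. t : ball 0 r ==> f t = t ^ a * h t"
  using has_orderE[OF assms(1)] by metis
 obtain s k where s: "s > 0" "k holomorphic_on ball 0 s" "!!t. t : ball 0 s ==> k t ~= 0" "!!t. t : ball 0 s ==> g t = t ^ b * k t"
  using has_orderE[OF assms(2)] by metis
 have u: "ball (0::complex) (min r s) <= ball 0 r" "ball (0::complex) (min r s) <= ball 0 s" by auto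
 show ?thesis
  by (rule has_orderI[of "min r s" "%t. h t * k t"])
    (use r s holomorphic_on_subset[OF r(3) u(1)] holomorphic_on_subset[OF s(2) u(2)] in
     \<open>auto intro!: holomorphic_intros simp: power_add\<close>)
qed

lemma order_ge_mult:
 assumes "order_ge f a" "order_ge g b" shows "order_ge (%t. f t * g t) (a + b)"
proof -
 obtain r h where r: "r > 0" "r <= 1" "h holomorphic_on ball 0 r" "!!t. t : ball 0 r ==> f t = t ^ a * h t"
  using order_geE[OF assms(1)] by metis
 obtain s k where s: "s > 0" "k holomorphic_on ball 0 s" "!!t. t : ball 0 s ==> g t = t ^ b * k t"
  using order_geE[OF assms(2)] by metis
 have u: "ball (0::complex) (min r s) <= ball 0 r" "ball (0::complex) (min r s) <= ball 0 s" by auto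
 show ?thesis
  by (rule order_geI[of "min r s" "%t. h t * k t"])
    (use r s holomorphic_on_subset[OF r(3) u(1)] holomorphic_on_subset[OF s(2) u(2)] in
     \<open>auto intro!: holomorphic_intros simp: power_add\<close>)
qed

lemma order_ge_add:
 assumes "order_ge f a" "order_ge g a" shows "order_ge (%t. f t + c * g t) a"
proof -
 obtain r h where r: "r > 0" "r <= 1" "h holomorphic_on ball 0 r" "!!t. t : ball 0 r ==> f t = t ^ a * h t"
  using order_geE[OF assms(1)] by metis
 obtain s k where s: "s > 0" "k holomorphic_on ball 0 s" "!!t. t : ball 0 s ==> g t = t ^ a * k t"
  using order_geE[OF assms(2)] by metis
 have u: "ball (0::complex) (min r s) <= ball 0 r" "ball (0::complex) (min r s) <= ball 0 s" by auto
 show ?thesis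
  by (rule order_geI[of "min r s" "%t. h t + c * k t"])
    (use r s holomorphic_on_subset[OF r(3) u(1)] holomorphic_on_subset[OF s(2) u(2)] in
     \<open>auto intro!: holomorphic_intros simp: algebra_simps\<close>)
qed

lemma has_order_power: "has_order f a ==> has_order (%t. f t ^ j) (j * a)"
proof (induction j)
 case 0 show ?case by (rule has_orderI[of 1 "%_. 1"]) auto
next
 case (Suc j) then show ?case using has_order_mult[OF Suc.prems] by simp
qed

text \<open>Either some Taylor coefficient at 0 is nonzero, and the first such coefficient gives the
  order, or the function vanishes on the disc.\<close>

lemma has_order_cases:
 assumes "f holomorphic_on ball 0 1"
 shows "(EX j. has_order f j & (deriv ^^ j) f 0 ~= 0 & (ALL i<j. (deriv ^^ i) f 0 = 0)) | (ALL t:ball 0 1. f t = 0)"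
proof (cases "EX j. (deriv ^^ j) f 0 ~= 0")
 case True
 define j where "j = (LEAST j. (deriv ^^ j) f 0 ~= 0)"
 have j: "(deriv ^^ j) f 0 ~= 0" using True unfolding j_def by (rule LeastI_ex)
 have i: "(deriv ^^ i) f 0 = 0" if "i < j" for i using not_less_Least that unfolding j_def by blast
 have "has_order f j"
 proof (cases "j = 0")
  case True
  then show ?thesis using j by (intro has_orderI[of 1 f]) (use assms in auto)
 next
  case False
  then have f0: "f 0 = 0" using i[of 0] by simp
  have "0 : ball (0::complex) 1" "0 < j" using False by auto
  note b = this
  obtain g r where g: "0 < r" "g holomorphic_on ball 0 r"
    "!!w. w : ball 0 r ==> f w - f 0 = (w - 0) ^ j * g w" "!!w. w : ball 0 r ==> g w ~= 0"
   by (rule holomorphic_factor_order_of_zero[OF assms open_ball b j]) (erule i, rule that, assumption+)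
  have "ball (0::complex) (min r 1) <= ball 0 r" by auto
  then show ?thesis using g f0 by (intro has_orderI[of "min r 1" g]) (auto intro: holomorphic_on_subset)
 qed
 then show ?thesis using j i by blast
next
 case False
 have "f t = 0" if t: "t : ball 0 1" for t
  by (rule holomorphic_fun_eq_0_on_connected[OF assms open_ball connected_ball, of 0]) (use False t in auto)
 then show ?thesis by blast
qed

lemma order_ge_iff_deriv:
 assumes "f holomorphic_on ball 0 1"
 shows "order_ge f m \<longleftrightarrow> (ALL j<m. (deriv ^^ j) f 0 = 0)"
 using has_order_cases[OF assms]
proof (elim disjE exE conjE)
 fix j assume j: "has_order f j" "(deriv ^^ j) f 0 ~= 0" "ALL i<j. (deriv ^^ i) f 0 = 0"
 have "order_ge f m \<longleftrightarrow> m <= j" using order_ge_le[OF _ j(1)] order_ge_mono[OF has_order_ge[OF j(1)]] by blast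
 also have "\<dots> \<longleftrightarrow> (ALL i<m. (deriv ^^ i) f 0 = 0)" using j(2,3) by (meson leI less_le_trans)
 finally show ?thesis .
next
 assume z: "ALL t:ball 0 1. f t = 0"
 have "order_ge f m" by (rule order_geI[of 1 "%_. 0"]) (use z in auto)
 moreover have "(deriv ^^ j) f 0 = 0" for j
 proof -
  have "(deriv ^^ j) f 0 = (deriv ^^ j) (%_. 0) 0"
   by (rule higher_deriv_cong_ev) (use z in \<open>auto simp: eventually_nhds intro!: exI[of _ "ball 0 1"]\<close>)
  then show ?thesis by simp
 qed
 ultimately show ?thesis by blast
qed

text \<open>Eliminating one unknown by means of one equation preserves the inequality of the
  cardinalities.\<close>

lemma kernel_vector:
 fixes a :: "'i => 's => complex"
 assumes "finite I" "finite S" "card I < card S"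
 shows "EX c. (EX s:S. c s ~= 0) & (ALL i:I. (\<Sum>s\<in>S. c s * a i s) = 0)"
 using assms
proof (induction I arbitrary: S a rule: finite_induct)
 case empty
 then have "S ~= {}" by auto
 then show ?case by (intro exI[of _ "%_. 1"]) auto
next
 case (insert i I)
 show ?case
 proof (cases "ALL s:S. a i s = 0")
  case True
  have "card I < card S" using insert.prems insert.hyps by simp
  then obtain c where "EX s:S. c s ~= 0" "ALL i:I. (\<Sum>s\<in>S. c s * a i s) = 0" using insert.IH[OF insert.prems(1)] by blast
  then show ?thesis using True by (intro exI[of _ c]) simp
 next
  case False
  then obtain s0 where s0: "s0 : S" "a i s0 ~= 0" by blast
  define b where "b = (%j s. a j s - a j s0 * a i s / a i s0)"
  have "card I < card (S - {s0})" using insert.prems insert.hyps s0 by simp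
  then obtain c where c: "EX s:S-{s0}. c s ~= 0" "!!j. j : I ==> (\<Sum>s\<in>S-{s0}. c s * b j s) = 0"
   using insert.IH[of "S - {s0}" b] insert.prems(1) by auto
  define d where "d = (%s. if s = s0 then - (\<Sum>s\<in>S-{s0}. c s * a i s) / a i s0 else c s)"
  have split: "(\<Sum>s\<in>S. d s * a j s) = (\<Sum>s\<in>S-{s0}. c s * a j s) - a j s0 * (\<Sum>s\<in>S-{s0}. c s * a i s) / a i s0" for j
  proof -
   have "(\<Sum>s\<in>S. d s * a j s) = d s0 * a j s0 + (\<Sum>s\<in>S-{s0}. d s * a j s)"
    by (rule sum.remove[OF insert.prems(1) s0(1)])
   also have "(\<Sum>s\<in>S-{s0}. d s * a j s) = (\<Sum>s\<in>S-{s0}. c s * a j s)" by (intro sum.cong) (auto simp: d_def)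
   finally show ?thesis by (simp add: d_def)
  qed
  have "(\<Sum>s\<in>S. d s * a j s) = 0" if "j : I" for j
  proof -
   have "(\<Sum>s\<in>S-{s0}. c s * b j s) = (\<Sum>s\<in>S-{s0}. c s * a j s) - a j s0 * (\<Sum>s\<in>S-{s0}. c s * a i s) / a i s0"
    unfolding b_def by (simp add: right_diff_distrib sum_subtractf sum_distrib_left sum_divide_distrib mult.left_commute)
   then show ?thesis using c(2)[OF that] split[of j] by simp
  qed
  moreover have "(\<Sum>s\<in>S. d s * a i s) = 0" using split[of i] s0(2) by simp
  moreover have "EX s:S. d s ~= 0" using c(1) by (auto simp: d_def)
  ultimately show ?thesis by (intro exI[of _ d]) auto
 qed
qed

section \<open>Linear conditions on forms, and quotients of forms\<close>

context curve
begin

text \<open>\<open>nzf l f\<close> means that \<open>f\<close> is a nonzero element of degree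
  \<open>l\<close> in the homogeneous coordinate ring. \<open>cf q j\<close> is, up to the factor
  j!, a Taylor coefficient in the chart at \<open>q\<close> and depends linearly on the form.
  \<open>zord\<close> is the order of vanishing and is meaningful for nonzero elements only.\<close>

definition "nzf l f \<longleftrightarrow> form_fun n l f & (EX v:\<Union>E. f v ~= 0)"
definition "lin d \<psi> \<longleftrightarrow> (ALL f g c. form_fun n d f --> form_fun n d g --> \<psi> (%v. f v + c * g v) = \<psi> f + c * (\<psi> g :: complex))"
definition "cf q j f = (deriv ^^ j) (%t. f (lift q t)) 0"
definition "ordge q f m \<longleftrightarrow> order_ge (%t. f (lift q t)) m"
definition "zord q f = (THE m. has_order (%t. f (lift q t)) m)"
definition "res f = (%v. if v : \<Union>E then f v else (0::complex))"
abbreviation "V \<equiv> coordinate_ring_part n E"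

lemma nzf_form: "nzf l f ==> form_fun n l f" by (simp add: nzf_def)

lemma V_res: "V l = {res f | f. form_fun n l f}"
 unfolding coordinate_ring_part_def res_def form_fun_def by auto

lemma form_fun_lincomb: "form_fun n d f ==> form_fun n d g ==> form_fun n d (%v. f v + c * g v)"
 by (intro form_fun_add form_fun_cmult)

lemma lin_eval: "lin d (%f. f v)" by (simp add: lin_def)

lemma lin_cf:
 assumes "q : E" shows "lin d (cf q j)"
 unfolding lin_def
proof (intro allI impI)
 fix f g c assume f: "form_fun n d f" "form_fun n d g"
 note hol = form_lift_hol[OF assms f(1)] form_lift_hol[OF assms f(2)]
 have "(deriv ^^ j) (%t. f (lift q t) + c * g (lift q t)) 0 =
  (deriv ^^ j) (%t. f (lift q t)) 0 + (deriv ^^ j) (%t. c * g (lift q t)) 0"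
  by (rule higher_deriv_add[OF hol(1) _ open_ball]) (use hol(2) in "auto intro: holomorphic_intros")
 also have "(deriv ^^ j) (%t. c * g (lift q t)) 0 = c * (deriv ^^ j) (%t. g (lift q t)) 0"
  by (rule higher_deriv_cmult[OF hol(2) _ open_ball]) simp
 finally show "cf q j (%v. f v + c * g v) = cf q j f + c * cf q j g" by (simp add: cf_def)
qed

lemma lin_sum:
 assumes "lin d \<psi>" "finite S" "!!s. s : S ==> form_fun n d (f s)"
 shows "\<psi> (%v. \<Sum>s\<in>S. c s * f s v) = (\<Sum>s\<in>S. c s * \<psi> (f s))"
 using assms(2,3)
proof (induction S rule: finite_induct)
 case empty
 have "\<psi> (%v. (%_. 0) v + (-1) * (%_. 0) v) = \<psi> (%_. 0) + (-1) * \<psi> (%_. 0)"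
  using assms(1) form_fun_zero unfolding lin_def by blast
 then show ?case by simp
next
 case (insert x S)
 have "form_fun n d (%v. \<Sum>s\<in>S. c s * f s v)" using insert.prems by (intro form_fun_sum form_fun_cmult) auto
 moreover have "form_fun n d (f x)" using insert.prems by simp
 ultimately have "\<psi> (%v. (%v. \<Sum>s\<in>S. c s * f s v) v + c x * f x v) = \<psi> (%v. \<Sum>s\<in>S. c s * f s v) + c x * \<psi> (f x)"
  using assms(1) unfolding lin_def by blast
 then show ?case using insert by (simp add: add.commute)
qed

text \<open>Fewer conditions than independent elements leave a nontrivial combination that satisfies
  them. Independence is that of restrictions to the cone, so the combination is nonzero on
  \<open>E\<close> and not only as a polynomial.\<close>

lemma impose:
 assumes S: "finite S" "S <= V l" "cfun.independent S" and \<Psi>: "finite \<Psi>" "card \<Psi> < card S" "!!\<psi>. \<psi> : \<Psi> ==> lin l \<psi>"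
 obtains f where "nzf l f" "!!\<psi>. \<psi> : \<Psi> ==> \<psi> f = 0"
proof -
 have "ALL s:S. EX f. form_fun n l f & res f = s" using S(2) unfolding V_res by blast
 then obtain F where F: "!!s. s : S ==> form_fun n l (F s)" "!!s. s : S ==> res (F s) = s" by metis
 have "EX c. (EX s:S. c s ~= 0) & (ALL \<psi>:\<Psi>. (\<Sum>s\<in>S. c s * \<psi> (F s)) = 0)"
  by (rule kernel_vector[OF \<Psi>(1) S(1) \<Psi>(2)])
 then obtain c where c0: "(EX s:S. c s ~= 0) & (ALL \<psi>:\<Psi>. (\<Sum>s\<in>S. c s * \<psi> (F s)) = 0)" ..
 note c = conjunct1[OF c0] bspec[OF conjunct2[OF c0]]
 define f where "f = (%v. \<Sum>s\<in>S. c s * F s v)"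
 have form: "form_fun n l f" unfolding f_def using F(1) by (intro form_fun_sum form_fun_cmult) auto
 have "EX v:\<Union>E. f v ~= 0"
 proof (rule ccontr)
  assume "\<not> ?thesis"
  then have z: "f v = 0" if "v : \<Union>E" for v using that by blast
  have "(\<Sum>s\<in>S. cscale (c s) s) = 0"
  proof
   fix v
   have "(\<Sum>s\<in>S. cscale (c s) s) v = (\<Sum>s\<in>S. c s * s v)"
    using S(1) by (induction S rule: finite_induct) (auto simp: cscale_def)
   also have "\<dots> = (\<Sum>s\<in>S. c s * res (F s) v)" using F(2) by (intro sum.cong) auto
   also have "\<dots> = (if v : \<Union>E then f v else 0)" unfolding f_def res_def by (cases "v : \<Union>E") auto
   finally show "(\<Sum>s\<in>S. cscale (c s) s) v = 0 v" using z by simp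
  qed
  then show False using c(1) cfun.independentD[OF S(3,1) subset_refl] by blast
 qed
 then have "nzf l f" using form unfolding nzf_def by blast
 moreover have "\<psi> f = 0" if "\<psi> : \<Psi>" for \<psi>
  unfolding f_def by (rule trans[OF lin_sum[OF \<Psi>(3)[OF that] S(1) F(1)] c(2)[OF that]])
 ultimately show ?thesis by (rule that)
qed

text \<open>Vanishing on one disc spreads over its component, which is Zariski dense.\<close>

lemma nzf_lift:
 assumes "nzf l f" "q : E" shows "\<not> (ALL t:ball 0 1. f (lift q t) = 0)"
proof
 assume z: "ALL t:ball 0 1. f (lift q t) = 0"
 have "f v = 0" if "x : component q" "v : x" for x v
  by (rule component_form_identity[OF nzf_form[OF assms(1)] component_refl[OF assms(2)] open_ball subset_refl])
    (use z that in auto)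
 then have "f v = 0" if "v : \<Union>E" for v using component_dense[OF assms(2) nzf_form[OF assms(1)]] that by blast
 then show False using assms(1) unfolding nzf_def by blast
qed

lemma zord: assumes "nzf l f" "q : E" shows "has_order (%t. f (lift q t)) (zord q f)"
proof -
 have "EX m. has_order (%t. f (lift q t)) m"
  using has_order_cases[OF form_lift_hol[OF assms(2) nzf_form[OF assms(1)]]] nzf_lift[OF assms] by blast
 then show ?thesis unfolding zord_def using has_order_unique by (metis theI)
qed

lemma zord_eqI: "has_order (%t. f (lift q t)) m ==> zord q f = m"
 unfolding zord_def using has_order_unique by blast

lemma ordge_iff: "nzf l f ==> q : E ==> ordge q f m \<longleftrightarrow> m <= zord q f"
 unfolding ordge_def using order_ge_le[OF _ zord] order_ge_mono[OF has_order_ge[OF zord]] by blast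

lemma ordge_cf: "form_fun n l f ==> q : E ==> ordge q f m \<longleftrightarrow> (ALL j<m. cf q j f = 0)"
 unfolding ordge_def cf_def by (rule order_ge_iff_deriv[OF form_lift_hol])

lemma cf_zord:
 assumes "nzf l f" "q : E" shows "cf q (zord q f) f ~= 0"
 using ordge_cf[OF nzf_form[OF assms(1)] assms(2), of "Suc (zord q f)"] ordge_iff[OF assms, of "Suc (zord q f)"]
  ordge_cf[OF nzf_form[OF assms(1)] assms(2), of "zord q f"] ordge_iff[OF assms, of "zord q f"]
 by (auto simp: less_Suc_eq)

lemma nzf_mult:
 assumes "nzf l f" "nzf m g" shows "nzf (l + m) (%v. f v * g v)"
 unfolding nzf_def
proof
 show "form_fun n (l + m) (%v. f v * g v)" using assms unfolding nzf_def by (intro form_fun_mult) auto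
 show "EX v:\<Union>E. f v * g v ~= 0" using assms prime[of l f m g] unfolding nzf_def by meson
qed

lemma zord_mult: "nzf l f ==> nzf m g ==> q : E ==> zord q (%v. f v * g v) = zord q f + zord q g"
 by (rule zord_eqI) (rule has_order_mult[OF zord zord])

lemma nzf_power: "nzf l f ==> nzf (j * l) (%v. f v ^ j)"
 unfolding nzf_def using form_fun_power by (metis power_not_zero)

lemma zord_power: "nzf l f ==> q : E ==> zord q (%v. f v ^ j) = j * zord q f"
 by (rule zord_eqI) (rule has_order_power[OF zord])

lemma zord_pos_iff:
 assumes "nzf l f" "q : E" shows "zord q f = 0 \<longleftrightarrow> f (lift q 0) ~= 0"
proof -
 obtain r h where r: "r > 0" "h holomorphic_on ball 0 r" "!!t. t : ball 0 r ==> h t ~= 0"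
  "!!t. t : ball 0 r ==> f (lift q t) = t ^ zord q f * h t" using has_orderE[OF zord[OF assms]] by metis
 then show ?thesis using r(3,4)[of 0] by (cases "zord q f") auto
qed

lemma lift_proportional:
 assumes "q : E" "t : ball 0 1" "v : disc q t"
 obtains c where "c ~= 0" "v = cscale c (lift q t)"
 using assms(3) unfolding disc_def proj_pt_def by blast

text \<open>Zeros are isolated in every chart disc, and \<open>E\<close> is compact.\<close>

lemma zeros_finite:
 assumes f: "nzf l f" shows "finite {q : E. zord q f ~= 0}"
proof -
 define N where "N = {W. openin TE W & finite {q : W. zord q f ~= 0}}"
 have "EX W:N. q : W" if q: "q : E" for q
 proof -
  obtain r h where r: "r > 0" "r <= 1" "!!t. t : ball 0 r ==> h t ~= 0"
   "!!t. t : ball 0 r ==> f (lift q t) = t ^ zord q f * h t" using has_orderE[OF zord[OF f q]] by metis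
  have b: "ball (0::complex) r <= ball 0 1" using r(2) by (rule subset_ball)
  have "x = q" if x: "x : disc q ` ball 0 r" "zord x f ~= 0" for x
  proof -
   obtain t where t: "t : ball 0 r" "x = disc q t" using x(1) by blast
   then have xE: "x : E" using disc_mem[OF q] b by blast
   have "f (lift x 0) = 0" using zord_pos_iff[OF f xE] x(2) by blast
   moreover have "lift x 0 : disc q t" using lift_zero[OF xE] t(2) by simp
   ultimately have "f (lift q t) = 0"
    using form_fun_vanish_point[OF nzf_form[OF f]] lift_mem_disc t(2) xE sub by blast
   then have "t = 0" using r(3,4)[OF t(1)] by auto
   then show ?thesis using t(2) disc_zero[OF q] by simp
  qed
  then have "{x : disc q ` ball 0 r. zord x f ~= 0} <= {q}" by blast
  then have "finite {x : disc q ` ball 0 r. zord x f ~= 0}" using finite_subset by blast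
  moreover have "openin TE (disc q ` ball 0 r)" by (rule disc_open[OF q open_ball b])
  moreover have "q : disc q ` ball 0 r" by (rule image_eqI[of _ _ 0]) (simp_all add: disc_zero[OF q] r(1))
  ultimately show ?thesis unfolding N_def by blast
 qed
 then have "topspace TE <= \<Union>N" using topspace_TE by blast
 moreover have "ALL W:N. openin TE W" unfolding N_def by blast
 ultimately obtain N' where N': "finite N'" "N' <= N" "topspace TE <= \<Union>N'"
  using compact_TE unfolding compact_space_alt by metis
 have "{q : E. zord q f ~= 0} <= (\<Union>W\<in>N'. {q : W. zord q f ~= 0})" using N'(3) topspace_TE by blast
 moreover have "finite (\<Union>W\<in>N'. {q : W. zord q f ~= 0})" using N'(1,2) unfolding N_def by blast
 ultimately show ?thesis by (rule finite_subset)
qed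

text \<open>The quotient of two forms of equal degree as a function of the point. The limit supplies
  the value at removable singularities, where numerator and denominator both vanish.\<close>

definition "mero G F x = Lim (at 0) (%t. (G (lift x t) :: complex) / F (lift x t))"

lemma mero_regular:
 assumes F: "nzf l F" and G: "form_fun n l G" and q: "q : E" and v: "v : q" "F v ~= 0"
 shows "mero G F q = G v / F v"
proof -
 have qP: "q : proj_space n" using q sub by blast
 have F0: "F (lift q 0) ~= 0"
  using form_fun_vanish_point[OF nzf_form[OF F] qP v(1) lift_zero[OF q]] v(2) by blast
 have "((%t. G (lift q t) / F (lift q t)) \<longlongrightarrow> G (lift q 0) / F (lift q 0)) (at 0)"
 proof (intro tendsto_divide F0)
  show "((%t. G (lift q t)) \<longlongrightarrow> G (lift q 0)) (at 0)" "((%t. F (lift q t)) \<longlongrightarrow> F (lift q 0)) (at 0)"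
   using holomorphic_on_imp_continuous_on[OF form_lift_hol[OF q G]] holomorphic_on_imp_continuous_on[OF form_lift_hol[OF q nzf_form[OF F]]]
   by (auto simp: continuous_on_eq_continuous_at isCont_def)
 qed
 then have "mero G F q = G (lift q 0) / F (lift q 0)" unfolding mero_def by (intro tendsto_Lim) auto
 moreover obtain c where c: "c ~= 0" "v = cscale c (lift q 0)"
  using lift_proportional[OF q, of 0 v] v(1) disc_zero[OF q] by auto
 ultimately show ?thesis using form_fun_cscale[OF G, of c] form_fun_cscale[OF nzf_form[OF F], of c] by simp
qed

lemma mero_local:
 assumes F: "nzf l F" and G: "form_fun n l G" and q: "q : E" and ge: "ordge q G (zord q F)"
 obtains r h where "r > 0" "r <= 1" "h holomorphic_on ball 0 r" "!!t. t : ball 0 r ==> mero G F (disc q t) = h t"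
  "!!t. t : ball 0 r ==> G (lift q t) = h t * F (lift q t)"
  "!!t. t : ball 0 r ==> t ~= 0 ==> F (lift q t) ~= 0"
proof -
 obtain r1 k where r1: "r1 > 0" "r1 <= 1" "k holomorphic_on ball 0 r1" "!!t. t : ball 0 r1 ==> k t ~= 0"
  "!!t. t : ball 0 r1 ==> F (lift q t) = t ^ zord q F * k t" using has_orderE[OF zord[OF F q]] by metis
 obtain r2 g where r2: "r2 > 0" "g holomorphic_on ball 0 r2"
  "!!t. t : ball 0 r2 ==> G (lift q t) = t ^ zord q F * g t" using order_geE[OF ge[unfolded ordge_def]] by metis
 define r where "r = min r1 r2"
 have r: "r > 0" "r <= 1" "ball (0::complex) r <= ball 0 r1" "ball (0::complex) r <= ball 0 r2" "ball (0::complex) r <= ball 0 1"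
  using r1(1,2) r2(1) by (auto simp: r_def)
 define h where "h = (%t. g t / k t)"
 have hol: "h holomorphic_on ball 0 r"
  unfolding h_def using holomorphic_on_subset[OF r1(3) r(3)] holomorphic_on_subset[OF r2(2) r(4)] r1(4) r(3)
  by (intro holomorphic_on_divide) auto
 have Gh: "G (lift q t) = h t * F (lift q t)" if "t : ball 0 r" for t
  using r1(4,5)[OF subsetD[OF r(3) that]] r2(3)[OF subsetD[OF r(4) that]] by (simp add: h_def)
 have F0: "F (lift q t) ~= 0" if "t : ball 0 r" "t ~= 0" for t
  using r1(4,5)[OF subsetD[OF r(3) that(1)]] that(2) by simp
 have "mero G F (disc q t) = h t" if t: "t : ball 0 r" for t
 proof (cases "t = 0")
  case False
  have "mero G F (disc q t) = G (lift q t) / F (lift q t)"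
   by (rule mero_regular[OF F G disc_mem[OF q] lift_mem_disc F0[OF t False]]) (use t r(5) in blast)
  then show ?thesis using Gh[OF t] F0[OF t False] by simp
 next
  case True
  have "isCont h 0" using holomorphic_on_imp_continuous_on[OF hol] r(1) by (auto simp: continuous_on_eq_continuous_at)
  then have lim: "(h \<longlongrightarrow> h 0) (at 0)" by (simp add: isCont_def)
  have "\<forall>\<^sub>F t in at 0. h t = G (lift q t) / F (lift q t)"
   unfolding eventually_at using r(1) Gh F0 by (intro exI[of _ r]) (auto simp: dist_norm)
  then have "((%t. G (lift q t) / F (lift q t)) \<longlongrightarrow> h 0) (at 0)"
   by (rule Lim_transform_eventually[OF lim])
  then have "mero G F q = h 0" unfolding mero_def by (intro tendsto_Lim) auto
  then show ?thesis using True disc_zero[OF q] by simp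
 qed
 then show ?thesis using that[OF r(1,2) hol] Gh F0 by blast
qed

text \<open>The quotient is holomorphic on the component, hence constant by the maximum principle;
  the resulting linear relation holds on all of \<open>E\<close> by density.\<close>

lemma ratio_const:
 assumes F: "nzf l F" and G: "form_fun n l G" and q0: "q0 : E"
  and ge: "!!q. q : component q0 ==> ordge q G (zord q F)"
 obtains c where "!!v. v : \<Union>E ==> G v = c * F v"
proof -
 have hol: "holo_at p (mero G F)" if p: "p : component q0" for p
 proof -
  have pE: "p : E" using p component_sub by blast
  obtain r h where r: "r > 0" "r <= 1" "h holomorphic_on ball 0 r" "!!t. t : ball 0 r ==> mero G F (disc p t) = h t"
   using mero_local[OF F G pE ge[OF p]] by metis
  have "(%t. mero G F (disc p t)) holomorphic_on ball 0 r"
   using r(3) by (subst holomorphic_cong[OF refl r(4)])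
  then show ?thesis unfolding holo_at_def using r(1,2) by blast
 qed
 obtain c where c: "!!x. x : component q0 ==> mero G F x = c" using maximum_principle[OF q0 hol] by metis
 have q0c: "q0 : component q0" by (rule component_refl[OF q0])
 obtain r h where r: "r > 0" "r <= 1" "!!t. t : ball 0 r ==> mero G F (disc q0 t) = h t"
  "!!t. t : ball 0 r ==> G (lift q0 t) = h t * F (lift q0 t)"
  using mero_local[OF F G q0 ge[OF q0c]] by metis
 have form: "form_fun n l (%v. G v - c * F v)" by (intro form_fun_diff form_fun_cmult G nzf_form[OF F])
 have b: "ball (0::complex) r <= ball 0 1" using r(2) by (rule subset_ball)
 have "G v - c * F v = 0" if "x : component q0" "v : x" for x v
 proof (rule component_form_identity[OF form q0c open_ball b _ _ that])
  fix t :: complex assume t: "t : ball 0 r"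
  have "h t = c" using r(3)[OF t] c[OF disc_component[OF q0c]] t b by auto
  then show "G (lift q0 t) - c * F (lift q0 t) = 0" using r(4)[OF t] by simp
 qed (use r(1) in auto)
 then have "G v - c * F v = 0" if "v : \<Union>E" for v using component_dense[OF q0 form _ that] by blast
 then show ?thesis by (intro that[of c]) simp
qed

end

lemma poly_map_of_rat: "poly (map_poly of_rat p) (of_rat x) = (of_rat (poly p x) :: complex)"
 by (induction p) (auto simp: map_poly_pCons of_rat_add of_rat_mult)

section \<open>Counting zeros against the Hilbert function\<close>

context curve
begin

text \<open>The linear conditions that express order at least \<open>m q\<close> at each
  \<open>q\<close> in \<open>T\<close>. Their number is at most the sum of the \<open>m q\<close>,
  which is what a dimension count needs.\<close>

definition "jets T m = (%(q, j). cf q j) ` (SIGMA q:T. {..<m q})"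

lemma jets:
 assumes T: "finite T" "T <= E"
 shows "finite (jets T m)" "card (jets T m) <= (\<Sum>q\<in>T. m q)" "\<psi> : jets T m ==> lin l \<psi>"
  "form_fun n l G ==> (!!\<psi>. \<psi> : jets T m ==> \<psi> G = 0) ==> q : T ==> ordge q G (m q)"
proof -
 have fin: "finite (SIGMA q:T. {..<m q})" using T(1) by (intro finite_SigmaI) auto
 show "finite (jets T m)" unfolding jets_def using fin by (rule finite_imageI)
 have "card (jets T m) <= card (SIGMA q:T. {..<m q})" unfolding jets_def by (rule card_image_le[OF fin])
 then show "card (jets T m) <= (\<Sum>q\<in>T. m q)" using card_SigmaI[OF T(1), of "%q. {..<m q}"] by simp
 show "lin l \<psi>" if "\<psi> : jets T m" using that lin_cf T(2) unfolding jets_def by auto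
 show "ordge q G (m q)" if G: "form_fun n l G" "!!\<psi>. \<psi> : jets T m ==> \<psi> G = 0" "q : T"
 proof -
  have "cf q j G = 0" if j: "j < m q" for j
  proof (rule G(2))
   show "cf q j : jets T m" unfolding jets_def by (rule rev_image_eqI[of "(q, j)"]) (use j \<open>q : T\<close> in auto)
  qed
  then show ?thesis using ordge_cf[OF G(1)] G(3) T(2) by blast
 qed
qed

abbreviation "zset C f \<equiv> {q : C. zord q f ~= 0}"
definition "zeros C f = (\<Sum>q\<in>zset C f. zord q f)"

lemma zset_finite: "nzf l f ==> C <= E ==> finite (zset C f)"
 by (rule finite_subset[OF _ zeros_finite]) auto

lemma ordge_0: "form_fun n l G ==> q : E ==> ordge q G 0"
 using ordge_cf by blast

lemma nzf_linear: obtains F where "nzf 1 F"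
proof -
 obtain q where q: "q : E" using two_points by blast
 have "nzf 1 (%v. v (chart_index q))" unfolding nzf_def
  using form_fun_coord[OF chart_index_le[OF q]] lift_cone[OF q, of 0] lift_index[OF q, of 0]
  by (intro conjI bexI[of _ "lift q 0"]) auto
 then show ?thesis by (rule that)
qed

lemma nzf_exists: obtains F where "nzf l F"
 using nzf_linear nzf_power[of 1 _ l] by (metis mult.right_neutral)

text \<open>The bound of a dimension by degree plus one. With more independent forms one could
  prescribe the zeros of \<open>F\<close> on the component and in addition a zero at
  \<open>v0\<close>, where \<open>F\<close> does not vanish. Such a form is a multiple of
  \<open>F\<close> by \<open>ratio_const\<close>, hence zero.\<close>

lemma divisor_dominates:
 assumes F: "nzf l F" and S: "finite S" "S <= V l" "cfun.independent S" and q0: "q0 : E"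
  and m: "!!q. q : component q0 ==> m q = zord q F"
 shows "card S <= (\<Sum>q\<in>zset (component q0) F. m q) + 1"
proof (rule ccontr)
 let ?T = "zset (component q0) F"
 have T: "finite ?T" "?T <= E" using zset_finite[OF F component_sub] component_sub by blast+
 assume big: "\<not> card S <= (\<Sum>q\<in>?T. m q) + 1"
 obtain v0 where v0: "v0 : \<Union>E" "F v0 ~= 0" using F unfolding nzf_def by blast
 define \<Psi> where "\<Psi> = insert (%f. f v0) (jets ?T m)"
 have "card \<Psi> <= Suc (card (jets ?T m))" unfolding \<Psi>_def by (rule card_insert_le_m1) simp_all
 then have c: "card \<Psi> < card S" using big jets(2)[OF T, of m] by simp
 have fin: "finite \<Psi>" unfolding \<Psi>_def using jets(1)[OF T] by simp
 have lin: "lin l \<psi>" if "\<psi> : \<Psi>" for \<psi> using that jets(3)[OF T] lin_eval unfolding \<Psi>_def by blast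
 obtain G where G: "nzf l G" "!!\<psi>. \<psi> : \<Psi> ==> \<psi> G = 0" by (rule impose[OF S fin c lin]) (assumption, rule that)
 have "ordge q G (zord q F)" if q: "q : component q0" for q
 proof (cases "zord q F = 0")
  case True
  then show ?thesis using ordge_0[OF nzf_form[OF G(1)]] q component_sub by auto
 next
  case False
  have "ordge q G (m q)" by (rule jets(4)[OF T nzf_form[OF G(1)]]) (use G(2) q False in "auto simp: \<Psi>_def")
  then show ?thesis using m[OF q] by simp
 qed
 then obtain c where c: "!!v. v : \<Union>E ==> G v = c * F v" using ratio_const[OF F nzf_form[OF G(1)] q0] by blast
 have "G v0 = 0" using G(2)[of "%f. f v0"] unfolding \<Psi>_def by simp
 then have "c = 0" using c[OF v0(1)] v0(2) by simp
 then show False using c G(1) unfolding nzf_def by auto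
qed

text \<open>The bound is applied to \<open>F ^ j\<close>, which has the zeros of \<open>F\<close>
  with multiplicity \<open>j\<close>. The error term remains 1 for every \<open>j\<close>, so its
  relative weight can be lowered.\<close>

lemma independent_bound:
 assumes F: "nzf k F" and S: "finite S" "S <= V (j * k)" "cfun.independent S" and q0: "q0 : E"
 shows "card S <= j * zeros (component q0) F + 1"
proof -
 let ?C = "component q0"
 have z: "zord q (%v. F v ^ j) = j * zord q F" if "q : ?C" for q using zord_power[OF F] that component_sub by blast
 have "card S <= (\<Sum>q\<in>zset ?C (%v. F v ^ j). j * zord q F) + 1"
  by (rule divisor_dominates[OF nzf_power[OF F] S q0]) (simp add: z)
 also have "(\<Sum>q\<in>zset ?C (%v. F v ^ j). j * zord q F) <= (\<Sum>q\<in>zset ?C F. j * zord q F)"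
  by (rule sum_mono2[OF zset_finite[OF F component_sub]]) (use z in auto)
 finally show ?thesis by (simp add: zeros_def sum_distrib_left)
qed

lemma V_bound: "EX z. ALL l S. finite S --> S <= V l --> cfun.independent S --> card S <= l * z + 1"
proof -
 obtain F where F: "nzf 1 F" by (rule nzf_linear)
 obtain q0 where q0: "q0 : E" using two_points by blast
 show ?thesis using independent_bound[OF F _ _ _ q0] by (metis mult.right_neutral)
qed

lemma independent_finite:
 assumes "S <= V l" "cfun.independent S" shows "finite S"
proof (rule ccontr)
 obtain z where z: "!!l S. finite S ==> S <= V l ==> cfun.independent S ==> card S <= l * z + 1" using V_bound by blast
 assume "infinite S"
 then obtain S' where S': "finite S'" "card S' = l * z + 2" "S' <= S" using infinite_arbitrarily_large by metis
 moreover have "cfun.independent S'" using assms(2) S'(3) cfun.dependent_mono by blast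
 ultimately show False using z[of S' l] assms(1) by auto
qed

lemma V_basis:
 obtains B where "B <= V l" "cfun.independent B" "V l <= cfun.span B" "card B = hilbert_function n E l" "finite B"
proof -
 obtain B where B: "B <= V l" "cfun.independent B" "V l <= cfun.span B" "card B = cfun.dim (V l)"
  by (rule cfun.basis_exists)
 then show ?thesis using that[of B] independent_finite[OF B(1,2)] unfolding hilbert_function_def by blast
qed

lemma independent_card:
 assumes "S <= V l" "cfun.independent S" shows "card S <= hilbert_function n E l"
proof -
 obtain B where "V l <= cfun.span B" "card B = hilbert_function n E l" "finite B" using V_basis by metis
 then show ?thesis using cfun.independent_span_bound[of B S] assms by auto
qed

lemma impose_dim:
 assumes "finite \<Psi>" "card \<Psi> < hilbert_function n E l" "!!\<psi>. \<psi> : \<Psi> ==> lin l \<psi>"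
 obtains f where "nzf l f" "!!\<psi>. \<psi> : \<Psi> ==> \<psi> f = 0"
proof -
 obtain B where B: "B <= V l" "cfun.independent B" "card B = hilbert_function n E l" "finite B" using V_basis by metis
 have c: "card \<Psi> < card B" using assms(2) B(3) by simp
 show ?thesis by (rule impose[OF B(4,1,2) assms(1) c assms(3)]) (assumption, rule that)
qed

lemma hilbert_pos: "hilbert_function n E l > 0"
proof -
 obtain F where F: "nzf l F" by (rule nzf_exists)
 then obtain v where v: "v : \<Union>E" "F v ~= 0" unfolding nzf_def by blast
 have "res F ~= 0"
 proof
  assume "res F = 0"
  then have "res F v = 0" by simp
  then show False using v by (auto simp: res_def)
 qed
 then have "cfun.independent {res F}" by simp
 moreover have "{res F} <= V l" using nzf_form[OF F] unfolding V_res by blast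
 ultimately show ?thesis using independent_card[of "{res F}" l] by simp
qed

text \<open>Genus one removes the constant term of the Hilbert polynomial, and the bound
  \<open>V_bound\<close>, linear in the degree, removes everything above degree one. The slope is an
  integer as the difference of two consecutive values, and it is positive because nonzero forms
  exist.\<close>

lemma hilbert_linear:
 assumes "curve_has_genus n E 1"
 obtains d K where "d > 0" "!!k. k >= K ==> hilbert_function n E k = d * k"
proof -
 obtain P :: "rat poly" where P: "\<forall>\<^sub>F k in sequentially. of_nat (hilbert_function n E k) = poly P (of_nat k)" "poly P 0 = 0"
  using assms unfolding curve_has_genus_def by auto
 obtain K where K: "!!k. k >= K ==> of_nat (hilbert_function n E k) = poly P (of_nat k)"
  using P(1) unfolding eventually_sequentially by blast
 obtain z where z: "!!l S. finite S ==> S <= V l ==> cfun.independent S ==> card S <= l * z + 1" using V_bound by blast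
 have hz: "hilbert_function n E l <= l * z + 1" for l using V_basis[of l] z by metis
 obtain b Q where "P = pCons b Q" by (cases P)
 then have PQ: "P = pCons 0 Q" using P(2) by simp
 obtain a R where QR: "Q = pCons a R" by (cases Q)
 \<comment> \<open>The Hilbert polynomial is x Q with Q = a + x R. If \<open>R\<close> is not zero,
   Q is unbounded at the integers, whereas its value at k is at most z + 1/k; this is why z + 2 is
   used. The coefficients are moved to the complex numbers for the growth of polynomials at
   infinity.\<close>
 have "R = 0"
 proof (rule ccontr)
  assume R: "R ~= 0"
  define R' :: "complex poly" where "R' = map_poly of_rat R"
  have "R' ~= 0" unfolding R'_def using R by (simp add: map_poly_eq_0_iff)
  define p where "p = pCons (of_rat a) R'"
  have "degree p ~= 0" "p ~= 0" using \<open>R' ~= 0\<close> by (auto simp: p_def)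
  then have "EX k. k ~= 0 & k <= degree p & coeff p k ~= 0" by (intro exI[of _ "degree p"]) simp
  from polyfun_extremal[OF this, of "real z + 2"]
  obtain r where "!!w. r <= norm w ==> real z + 2 <= norm (\<Sum>i\<le>degree p. coeff p i * w ^ i)"
   unfolding eventually_at_infinity by blast
  then have r: "r <= norm w ==> real z + 2 <= norm (poly (pCons (of_rat a) R') w)" for w
   unfolding p_def[symmetric] poly_altdef by blast
  define k where "k = Suc (K + nat \<lceil>r\<rceil>)"
  have "r <= real k" unfolding k_def by linarith
  then have "real z + 2 <= norm (poly (pCons (of_rat a) R') (of_nat k))" using r[of "of_nat k"] by simp
  moreover have "poly (pCons (of_rat a) R') (of_nat k) = of_rat (poly Q (of_nat k))"
   using poly_map_of_rat[of Q "of_nat k"] by (simp add: QR R'_def map_poly_pCons)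
  moreover have "poly Q (of_nat k) = of_nat (hilbert_function n E k) / of_nat k"
   using K[of k] unfolding PQ by (simp add: k_def field_simps del: of_nat_Suc)
  ultimately have "real z + 2 <= norm (of_nat (hilbert_function n E k) / of_nat k :: complex)"
   by (simp add: of_rat_divide)
  then have "real z + 2 <= real (hilbert_function n E k) / real k" by (simp add: norm_divide)
  then have "(real z + 2) * real k <= real (hilbert_function n E k)" by (simp add: k_def field_simps del: of_nat_Suc)
  also have "\<dots> <= real (k * z + 1)" using hz[of k] by linarith
  finally have "2 * real k <= 1" by (simp add: algebra_simps)
  then show False unfolding k_def by simp
 qed
 then have hk: "of_nat (hilbert_function n E k) = of_nat k * a" if "k >= K" for k using K[OF that] unfolding PQ QR by simp
 have a: "a = of_nat (hilbert_function n E (Suc K)) - of_nat (hilbert_function n E K)"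
  using hk[of K] hk[of "Suc K"] by (simp add: algebra_simps)
 have "of_nat (hilbert_function n E (Suc K)) > (0::rat)" using hilbert_pos by simp
 then have "a > 0" using hk[of "Suc K"] by (simp add: zero_less_mult_iff del: of_nat_Suc)
 define d where "d = hilbert_function n E (Suc K) - hilbert_function n E K"
 have "hilbert_function n E (Suc K) > hilbert_function n E K" using \<open>a > 0\<close> a by simp
 then have ad: "a = of_nat d" "d > 0" using a by (simp_all add: d_def of_nat_diff)
 have "hilbert_function n E k = d * k" if "k >= K" for k
 proof -
  have "(of_nat (hilbert_function n E k) :: rat) = of_nat (d * k)" using hk[OF that] ad(1) by simp
  then show ?thesis by (simp only: of_nat_eq_iff)
 qed
 then show ?thesis using that ad(2) by blast
qed

lemma nzf_prod:
 assumes "finite T" "!!q. q : T ==> nzf 1 (H q)"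
 shows "nzf (\<Sum>q\<in>T. m q) (%v. \<Prod>q\<in>T. H q v ^ m q) \<and>
  (ALL p:E. zord p (%v. \<Prod>q\<in>T. H q v ^ m q) = (\<Sum>q\<in>T. m q * zord p (H q)))"
 using assms
proof (induction T rule: finite_induct)
 case empty
 have "nzf 0 (%_. 1)" using nzf_linear nzf_power[of 1 _ 0] by auto
 moreover have "zord p (%_. 1) = 0" for p by (rule zord_eqI, rule has_orderI[of 1 "%_. 1"]) auto
 ultimately show ?case by simp
next
 case (insert x T)
 have 1: "nzf (m x) (%v. H x v ^ m x)" using nzf_power[of 1 "H x" "m x"] insert.prems by simp
 have 2: "nzf (\<Sum>q\<in>T. m q) (%v. \<Prod>q\<in>T. H q v ^ m q)"
  "ALL p:E. zord p (%v. \<Prod>q\<in>T. H q v ^ m q) = (\<Sum>q\<in>T. m q * zord p (H q))" using insert by auto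
 show ?case using nzf_mult[OF 1 2(1)] zord_mult[OF 1 2(1)] 2(2) zord_power[of 1 "H x" _ "m x"] insert by simp
qed

text \<open>A minor that distinguishes the two points, with the representative of \<open>q\<close>
  inserted, is a linear form vanishing at \<open>q\<close> but not at \<open>q0\<close>.\<close>

lemma linear_separate:
 assumes "q : E" "q0 : E" "q ~= q0"
 obtains H where "nzf 1 H" "zord q H > 0" "zord q0 H = 0"
proof -
 let ?v = "lift q 0" and ?w = "lift q0 0"
 have c: "?v : coord_vectors n" "?w : coord_vectors n" using lift_cone assms cone_point(2) by auto
 have "proj_pt ?v ~= proj_pt ?w" using disc_zero assms unfolding disc_def by metis
 then obtain i j where ij: "i <= n" "j <= n" "?v i * ?w j ~= ?v j * ?w i" unfolding proj_pt_eq_minors[OF c] by blast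
 define H where "H = (%x::nat => complex. ?v i * x j - ?v j * x i)"
 have "form_fun n 1 H" unfolding H_def by (intro form_fun_diff form_fun_cmult form_fun_coord ij)
 moreover have "H ?w ~= 0" "H ?v = 0" using ij(3) by (auto simp: H_def)
 moreover have "?w : \<Union>E" using lift_cone assms(2) by simp
 ultimately have H: "nzf 1 H" unfolding nzf_def by blast
 show ?thesis
  by (rule that[OF H]) (use zord_pos_iff[OF H assms(1)] zord_pos_iff[OF H assms(2)] \<open>H ?w ~= 0\<close> \<open>H ?v = 0\<close> in auto)
qed

text \<open>The form is a product of three factors: the power \<open>e\<close> of the chart form at
  \<open>q0\<close>, which has a simple zero there; powers of linear forms through the other points
  that avoid \<open>q0\<close>; and a power of a coordinate that is nonzero at \<open>q0\<close>,
  which fills up the degree.\<close>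

lemma jet_form:
 assumes T: "finite T" "T <= E" "q0 : T" and l: "e + (\<Sum>q\<in>T-{q0}. m q) <= l"
 obtains J where "nzf l J" "zord q0 J = e" "!!q. q : T - {q0} ==> m q <= zord q J"
proof -
 have q0: "q0 : E" using T by blast
 have "ALL q:T-{q0}. EX H. nzf 1 H & zord q H > 0 & zord q0 H = 0" using linear_separate q0 T(2) by (metis Diff_iff insertI1 subsetD)
 then obtain H where H: "!!q. q : T - {q0} ==> nzf 1 (H q) & zord q (H q) > 0 & zord q0 (H q) = 0" by metis
 let ?P = "%v. \<Prod>q\<in>T-{q0}. H q v ^ m q"
 have P: "nzf (\<Sum>q\<in>T-{q0}. m q) ?P" "!!p. p : E ==> zord p ?P = (\<Sum>q\<in>T-{q0}. m q * zord p (H q))"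
  using nzf_prod[of "T - {q0}" H m] T(1) H by auto
 have P0: "zord q0 ?P = 0" using P(2)[OF q0] H by simp
 have Pq: "m q <= zord q ?P" if q: "q : T - {q0}" for q
 proof -
  have "m q * 1 <= m q * zord q (H q)" using H[OF q] by (intro mult_le_mono2) auto
  also have "\<dots> <= (\<Sum>p\<in>T-{q0}. m p * zord q (H p))" by (rule member_le_sum[OF q]) (use T(1) in auto)
  finally show ?thesis using P(2)[of q] q T(2) by auto
 qed
 let ?A = "%v. chart_form q0 v ^ e"
 have a: "nzf 1 (chart_form q0)" unfolding nzf_def
  using chart_form[OF q0] chart_form_lift[OF q0, of "1/2"] lift_cone[OF q0, of "1/2"]
  by (intro conjI bexI[of _ "lift q0 (1/2)"]) auto
 have a1: "zord q0 (chart_form q0) = 1"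
  by (rule zord_eqI, rule has_orderI[of 1 "%_. 1"]) (use chart_form_lift[OF q0] in auto)
 have A: "nzf e ?A" "zord q0 ?A = e" using nzf_power[OF a, of e] zord_power[OF a q0, of e] a1 by auto
 let ?x = "%v::nat => complex. v (chart_index q0)"
 have x: "nzf 1 ?x" unfolding nzf_def
  using form_fun_coord[OF chart_index_le[OF q0]] lift_cone[OF q0, of 0] lift_index[OF q0, of 0]
  by (intro conjI bexI[of _ "lift q0 0"]) auto
 have x0: "zord q0 ?x = 0" using zord_pos_iff[OF x q0] lift_index[OF q0, of 0] by simp
 define d where "d = l - (e + (\<Sum>q\<in>T-{q0}. m q))"
 have X: "nzf d (%v. ?x v ^ d)" "zord q0 (%v. ?x v ^ d) = 0" using nzf_power[OF x, of d] zord_power[OF x q0, of d] x0 by auto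
 note AP = nzf_mult[OF A(1) P(1)]
 note J = nzf_mult[OF AP X(1)]
 show ?thesis
 proof (rule that)
  show "nzf l (%v. chart_form q0 v ^ e * ?P v * ?x v ^ d)" using J l by (simp add: d_def)
  show "zord q0 (%v. chart_form q0 v ^ e * ?P v * ?x v ^ d) = e"
   using zord_mult[OF AP X(1) q0] zord_mult[OF A(1) P(1) q0] P0 A(2) X(2) by simp
  show "m q <= zord q (%v. chart_form q0 v ^ e * ?P v * ?x v ^ d)" if q: "q : T - {q0}" for q
  proof -
   have "q : E" using q T(2) by blast
   then show ?thesis using zord_mult[OF AP X(1)] zord_mult[OF A(1) P(1)] Pq[OF q] by simp
  qed
 qed
qed

lemma cf_cong:
 assumes "q : E" "!!v. v : \<Union>E ==> f v = g v" shows "cf q j f = cf q j g"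
 unfolding cf_def
proof (rule higher_deriv_cong_ev)
 show "\<forall>\<^sub>F t in nhds 0. f (lift q t) = g (lift q t)"
  unfolding eventually_nhds using assms(2) lift_cone[OF assms(1)] by (intro exI[of _ "ball 0 1"]) auto
qed simp

text \<open>All elements of the span of \<open>S\<close> have a representative whose coefficient
  \<open>cf q e\<close> vanishes, which \<open>J\<close> does not share.\<close>

lemma independent_jet:
 assumes S: "S <= V l" "cfun.independent S" and q: "q : E" and J: "form_fun n l J" "cf q e J ~= 0"
  and 0: "!!s. s : S ==> EX f. form_fun n l f & res f = s & cf q e f = 0"
 shows "res J \<notin> S" "cfun.independent (insert (res J) S)"
proof -
 let ?U = "{s. EX f. form_fun n l f & res f = s & cf q e f = 0}"
 have lc: "cf q e (%v. f v + c * g v) = cf q e f + c * cf q e g" if "form_fun n l f" "form_fun n l g" for f g c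
  using lin_cf[OF q, of l e] that unfolding lin_def by blast
 have "cfun.subspace ?U"
 proof (rule cfun.subspaceI)
  have "cf q e (%_. 0) = 0" using lc[OF form_fun_zero form_fun_zero, of "-1"] by simp
  then show "0 : ?U" using form_fun_zero by (intro CollectI exI[of _ "%_. 0"]) (auto simp: res_def)
  fix x c assume "x : ?U"
  then obtain f where f: "form_fun n l f" "res f = x" "cf q e f = 0" by blast
  show "cscale c x : ?U"
   using lc[OF form_fun_zero f(1), of c] \<open>cf q e (%_. 0) = 0\<close> f form_fun_cmult[OF f(1), of c]
   by (intro CollectI exI[of _ "%v. c * f v"]) (auto simp: res_def cscale_def)
  fix y assume "y : ?U"
  then obtain g where g: "form_fun n l g" "res g = y" "cf q e g = 0" by blast
  show "x + y : ?U" using lc[OF f(1) g(1), of 1] f g form_fun_add[OF f(1) g(1)]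
   by (intro CollectI exI[of _ "%v. f v + g v"]) (auto simp: res_def)
 qed
 moreover have "S <= ?U" using 0 by blast
 ultimately have span: "cfun.span S <= ?U" by (rule cfun.span_minimal[rotated])
 have J': "res J \<notin> cfun.span S"
 proof
  assume "res J : cfun.span S"
  then obtain f where f: "res f = res J" "cf q e f = 0" using span by blast
  have "f v = J v" if "v : \<Union>E" for v using fun_cong[OF f(1), of v] that by (simp add: res_def split: if_splits)
  then show False using cf_cong[OF q, of f J e] f(2) J(2) by simp
 qed
 show "res J \<notin> S" using J' cfun.span_superset by blast
 show "cfun.independent (insert (res J) S)" by (rule cfun.independent_insertI[OF J' S(2)])
qed

text \<open>Multiplication by a nonzero form is injective on the coordinate ring, by
  primality.\<close>

lemma multiples_independent:
 assumes F: "nzf k F" and B: "finite B" "B <= V l" "cfun.independent B"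
 obtains S where "finite S" "card S = card B" "cfun.independent S"
  "!!s. s : S ==> EX f. form_fun n l f & s = res (%v. F v * f v)"
proof -
 have "ALL b:B. EX f. form_fun n l f & res f = b" using B(2) unfolding V_res by blast
 then obtain g where g: "!!b. b : B ==> form_fun n l (g b)" "!!b. b : B ==> res (g b) = b" by metis
 define M where "M = (%b. res (%v. F v * g b v))"
 have cancel: "h v = 0" if h: "form_fun n l h" "!!v. v : \<Union>E ==> F v * h v = 0" "v : \<Union>E" for h v
  using prime[OF nzf_form[OF F] h(1) h(2)] F h(3) unfolding nzf_def by blast
 have inj: "inj_on M B"
 proof (rule inj_onI)
  fix b c assume bc: "b : B" "c : B" "M b = M c"
  have "g b v - g c v = 0" if v: "v : \<Union>E" for v
  proof (rule cancel[OF form_fun_diff[OF g(1)[OF bc(1)] g(1)[OF bc(2)]] _ v])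
   fix w assume w: "w : \<Union>E"
   show "F w * (g b w - g c w) = 0" using fun_cong[OF bc(3), of w] w by (simp add: M_def res_def algebra_simps split: if_splits)
  qed
  then have "res (g b) = res (g c)" by (auto simp: res_def)
  then show "b = c" using g(2) bc by simp
 qed
 have ind: "cfun.independent (M ` B)"
 proof
  assume "cfun.dependent (M ` B)"
  then have "EX u. (EX x:M ` B. u x ~= 0) & (\<Sum>x\<in>M ` B. cscale (u x) x) = 0"
   by (simp only: cfun.dependent_finite[OF finite_imageI[OF B(1)]])
  then obtain u where u0: "(EX x:M ` B. u x ~= 0) & (\<Sum>x\<in>M ` B. cscale (u x) x) = 0" ..
  note u = conjunct1[OF u0] conjunct2[OF u0]
  define h where "h = (%v. \<Sum>b\<in>B. u (M b) * g b v)"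
  have sumv: "(\<Sum>b\<in>A. cscale (c b) (f b)) v = (\<Sum>b\<in>A. c b * f b v)" for A :: "((nat => complex) => complex) set" and c f v
   by (induction A rule: infinite_finite_induct) (auto simp: cscale_def)
  have "form_fun n l h" unfolding h_def using g(1) by (intro form_fun_sum form_fun_cmult) auto
  moreover have "F v * h v = 0" if v: "v : \<Union>E" for v
  proof -
   have "(\<Sum>b\<in>B. cscale (u (M b)) (M b)) v = 0" using u(2) inj by (simp add: sum.reindex o_def)
   then have "(\<Sum>b\<in>B. u (M b) * M b v) = 0" unfolding sumv .
   moreover have "u (M b) * M b v = F v * (u (M b) * g b v)" for b using v unfolding M_def res_def by simp
   ultimately show ?thesis unfolding h_def sum_distrib_left by simp
  qed
  ultimately have h0: "h v = 0" if "v : \<Union>E" for v using cancel that by blast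
  have "(\<Sum>b\<in>B. cscale (u (M b)) b) = 0"
  proof
   fix v
   have "(\<Sum>b\<in>B. cscale (u (M b)) b) v = (\<Sum>b\<in>B. u (M b) * b v)" by (rule sumv)
   also have "\<dots> = (\<Sum>b\<in>B. u (M b) * res (g b) v)" using g(2) by (intro sum.cong) auto
   also have "\<dots> = 0" using h0[of v] by (cases "v : \<Union>E") (auto simp: res_def h_def)
   finally show "(\<Sum>b\<in>B. cscale (u (M b)) b) v = 0 v" by simp
  qed
  then have "u (M b) = 0" if "b : B" for b
   using cfun.independentD[OF B(3,1) subset_refl, of "%b. u (M b)"] that by simp
  then show False using u(1) by blast
 qed
 show ?thesis
  by (rule that[OF finite_imageI[OF B(1)] card_image[OF inj] ind]) (use g(1) in "auto simp: M_def")
qed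

text \<open>The multiples of \<open>F\<close> in degree \<open>l\<close> form a space of the
  dimension belonging to degree \<open>l - k\<close>, and they vanish at the points of
  \<open>T\<close> to the orders of \<open>F\<close>. When these orders are relaxed by one, at one
  point at a time, \<open>jet_form\<close> supplies each time a form independent of the previous
  ones. In total the dimension grows by the number of zeros of \<open>F\<close> in
  \<open>T\<close>.\<close>

lemma hilbert_zeros:
 assumes F: "nzf k F" and T: "finite T" "T <= E" and l: "l >= k + (\<Sum>q\<in>T. zord q F)"
 shows "hilbert_function n E (l - k) + (\<Sum>q\<in>T. zord q F) <= hilbert_function n E l"
proof -
 let ?m = "%q. zord q F" and ?a = "hilbert_function n E (l - k)"
 \<comment> \<open>Invariant of the descent: \<mu> is the order still imposed on the family, and the
   family has grown by the total amount by which \<mu> lies below the orders of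
   \<open>F\<close>.\<close>
 define Q where "Q = (%\<mu>. EX S. finite S & cfun.independent S & ?a + (\<Sum>q\<in>T. ?m q - \<mu> q) <= card S \<and>
   (ALL s:S. EX f. form_fun n l f & res f = s & (ALL q:T. ALL j<\<mu> q. cf q j f = 0)))"
 have start: "Q ?m"
 proof -
  obtain B where B: "B <= V (l - k)" "cfun.independent B" "card B = ?a" "finite B" using V_basis by metis
  obtain S where S: "finite S" "card S = card B" "cfun.independent S"
   "!!s. s : S ==> EX f. form_fun n (l - k) f & s = res (%v. F v * f v)"
   by (rule multiples_independent[OF F B(4,1,2)]) (rule that)
  have "EX f. form_fun n l f & res f = s & (ALL q:T. ALL j<?m q. cf q j f = 0)" if s: "s : S" for s
  proof -
   obtain f where f: "form_fun n (l - k) f" "s = res (%v. F v * f v)" using S(4)[OF s] by blast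
   have form: "form_fun n l (%v. F v * f v)" using form_fun_mult[OF nzf_form[OF F] f(1)] l by simp
   have "ALL j<?m q. cf q j (%v. F v * f v) = 0" if q: "q : T" for q
   proof -
    have qE: "q : E" using q T(2) by blast
    have "order_ge (%t. F (lift q t) * f (lift q t)) (?m q + 0)"
     by (rule order_ge_mult[OF has_order_ge[OF zord[OF F qE]] order_ge_0[OF form_lift_hol[OF qE f(1)]]])
    then have "ordge q (%v. F v * f v) (?m q)" by (simp add: ordge_def)
    then show ?thesis using ordge_cf[OF form qE] by blast
   qed
   then show ?thesis using f(2) form by blast
  qed
  then show ?thesis unfolding Q_def using S(1-3) B(3) by (intro exI[of _ S]) auto
 qed
 have step: "Q (\<mu>(q := e))" if \<mu>: "Q \<mu>" "q : T" "\<mu> q = Suc e" "!!q. q : T ==> \<mu> q <= ?m q" for \<mu> q e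
 proof -
  have qE: "q : E" using \<mu>(2) T(2) by blast
  from \<mu>(1)[unfolded Q_def] obtain S where S0: "finite S & cfun.independent S & ?a + (\<Sum>q\<in>T. ?m q - \<mu> q) <= card S \<and>
   (ALL s:S. EX f. form_fun n l f & res f = s & (ALL q:T. ALL j<\<mu> q. cf q j f = 0))" ..
  note S = conjunct1[OF S0] conjunct1[OF conjunct2[OF S0]] conjunct1[OF conjunct2[OF conjunct2[OF S0]]]
   bspec[OF conjunct2[OF conjunct2[OF conjunct2[OF S0]]]]
  have "e + (\<Sum>p\<in>T-{q}. ?m p) <= (\<Sum>p\<in>T. ?m p)" using \<mu>(3) \<mu>(4)[OF \<mu>(2)] sum.remove[OF T(1) \<mu>(2), of ?m] by simp
  then have "e + (\<Sum>p\<in>T-{q}. ?m p) <= l" using l by simp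
  then obtain J where J: "nzf l J" "zord q J = e" "!!p. p : T - {q} ==> ?m p <= zord p J"
   using jet_form[OF T \<mu>(2)] by metis
  have cfJ: "cf q e J ~= 0" using cf_zord[OF J(1) qE] J(2) by simp
  have SV: "S <= V l" using S(4) unfolding V_res by blast
  have new: "res J \<notin> S" "cfun.independent (insert (res J) S)"
   by (rule independent_jet[OF SV S(2) qE nzf_form[OF J(1)] cfJ]; use S(4) \<mu>(2,3) in fastforce)+
  have Jz: "ALL p:T. ALL j<(\<mu>(q := e)) p. cf p j J = 0"
  proof (intro ballI)
   fix p assume p: "p : T"
   then have pE: "p : E" using T(2) by blast
   have "(\<mu>(q := e)) p <= zord p J"
   proof (cases "p = q")
    case False
    then show ?thesis using J(3)[of p] \<mu>(4)[OF p] p by simp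
   qed (use J(2) in simp)
   then show "ALL j<(\<mu>(q := e)) p. cf p j J = 0" using ordge_iff[OF J(1) pE] ordge_cf[OF nzf_form[OF J(1)] pE] by blast
  qed
  have cnt: "(\<Sum>p\<in>T. ?m p - (\<mu>(q := e)) p) = Suc (\<Sum>p\<in>T. ?m p - \<mu> p)"
  proof -
   have "(\<Sum>p\<in>T. ?m p - (\<mu>(q := e)) p) = (?m q - e) + (\<Sum>p\<in>T-{q}. ?m p - (\<mu>(q := e)) p)"
    using sum.remove[OF T(1) \<mu>(2), of "%p. ?m p - (\<mu>(q := e)) p"] by simp
   also have "(\<Sum>p\<in>T-{q}. ?m p - (\<mu>(q := e)) p) = (\<Sum>p\<in>T-{q}. ?m p - \<mu> p)" by (intro sum.cong) auto
   also have "?m q - e = Suc (?m q - \<mu> q)" using \<mu>(3) \<mu>(4)[OF \<mu>(2)] by simp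
   finally show ?thesis using sum.remove[OF T(1) \<mu>(2), of "%p. ?m p - \<mu> p"] by simp
  qed
  show ?thesis unfolding Q_def
  proof (rule exI[of _ "insert (res J) S"], intro conjI ballI)
   show "?a + (\<Sum>p\<in>T. ?m p - (\<mu>(q := e)) p) <= card (insert (res J) S)" using S(1,3) new(1) unfolding cnt by simp
   fix s assume "s : insert (res J) S"
   then show "EX f. form_fun n l f & res f = s & (ALL p:T. ALL j<(\<mu>(q := e)) p. cf p j f = 0)"
   proof
    assume "s = res J"
    then show ?thesis using nzf_form[OF J(1)] Jz by blast
   next
    assume "s : S"
    then obtain f where f: "form_fun n l f" "res f = s" "ALL q:T. ALL j<\<mu> q. cf q j f = 0" using S(4) by blast
    have "ALL p:T. ALL j<(\<mu>(q := e)) p. cf p j f = 0" using f(3) \<mu>(3) by auto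
    then show ?thesis using f(1,2) by blast
   qed
  qed (use S(1) new(2) in auto)
 qed
 have desc: "Q \<mu> ==> (!!q. q : T ==> \<mu> q <= ?m q) ==> (\<Sum>q\<in>T. \<mu> q) = N ==> EX \<nu>. Q \<nu> & (ALL q:T. \<nu> q = 0)" for N \<mu>
 proof (induction N arbitrary: \<mu>)
  case 0
  then show ?case using T(1) by auto
 next
  case (Suc N)
  have "EX q:T. \<mu> q ~= 0"
  proof (rule ccontr)
   assume "\<not> ?thesis"
   then show False using Suc.prems(3) by simp
  qed
  then obtain q e where q: "q : T" "\<mu> q = Suc e" using not0_implies_Suc by blast
  have "(\<Sum>p\<in>T. (\<mu>(q := e)) p) = N"
   using Suc.prems(3) sum.remove[OF T(1) q(1), of \<mu>] sum.remove[OF T(1) q(1), of "\<mu>(q := e)"] q(2) by simp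
  moreover have "(\<mu>(q := e)) p <= ?m p" if "p : T" for p using Suc.prems(2)[OF that] q(2) by auto
  ultimately show ?case using Suc.IH[OF step[OF Suc.prems(1) q Suc.prems(2)]] by blast
 qed
 obtain \<nu> where \<nu>: "Q \<nu>" "ALL q:T. \<nu> q = 0" using desc[OF start] by blast
 from \<nu>(1)[unfolded Q_def] obtain S where S0: "finite S & cfun.independent S & ?a + (\<Sum>q\<in>T. ?m q - \<nu> q) <= card S \<and>
   (ALL s:S. EX f. form_fun n l f & res f = s & (ALL q:T. ALL j<\<nu> q. cf q j f = 0))" ..
 note S = conjunct1[OF conjunct2[OF S0]] conjunct1[OF conjunct2[OF conjunct2[OF S0]]]
   bspec[OF conjunct2[OF conjunct2[OF conjunct2[OF S0]]]]
 have "S <= V l" using S(3) unfolding V_res by blast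
 then have "card S <= hilbert_function n E l" using independent_card S(1) by blast
 moreover have "(\<Sum>q\<in>T. ?m q - \<nu> q) = (\<Sum>q\<in>T. ?m q)" using \<nu>(2) by (intro sum.cong) auto
 ultimately show ?thesis using S(2) by simp
qed

text \<open>Upper bound: \<open>hilbert_zeros\<close> says that d (l - k) plus the number of zeros
  is at most d l. Lower bound on a single component: \<open>independent_bound\<close> for the square
  of a form says that 2 d k is at most twice the number of zeros plus one, and by parity the one
  disappears. Two components would then have at least 2 d k zeros in total, against the upper
  bound.\<close>

theorem degree:
 assumes "curve_has_genus n E 1"
 obtains d K where "d > 0" "!!l. l >= K ==> hilbert_function n E l = d * l"
  "!!l F. l >= K ==> nzf l F ==> zeros E F = d * l" "!!q. q : E ==> component q = E"
proof -
 obtain d K where d: "d > 0" "!!k. k >= K ==> hilbert_function n E k = d * k" using hilbert_linear[OF assms] by metis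
 have upper: "zeros E F <= d * k" if F: "nzf k F" for k F
 proof -
  define l where "l = K + k + zeros E F"
  have "hilbert_function n E (l - k) + zeros E F <= hilbert_function n E l"
   unfolding zeros_def by (rule hilbert_zeros[OF F zset_finite[OF F subset_refl]]) (auto simp: l_def zeros_def)
  then have "d * (l - k) + zeros E F <= d * l" using d(2)[of l] d(2)[of "l - k"] by (simp add: l_def)
  then show ?thesis by (simp add: l_def algebra_simps)
 qed
 have lower: "d * k <= zeros (component q) F" if F: "nzf k F" "k >= K" "q : E" for k F q
 proof -
  obtain B where B: "B <= V (2 * k)" "cfun.independent B" "card B = hilbert_function n E (2 * k)" "finite B" using V_basis by metis
  have "hilbert_function n E (2 * k) <= 2 * zeros (component q) F + 1"
   using independent_bound[OF F(1) B(4) B(1,2) F(3)] B(3) by simp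
  then have "d * (2 * k) <= 2 * zeros (component q) F + 1" using d(2)[of "2 * k"] F(2) by simp
  then show ?thesis by linarith
 qed
 have conn: "component q = E" if q: "q : E" for q
 proof (rule ccontr)
  assume "component q ~= E"
  then obtain p where p: "p : E" "p \<notin> component q" using component_sub by blast
  have disj: "component p \<inter> component q = {}"
   using p(2) component_refl[OF p(1)] unfolding component_def
   using connected_component_of_disjoint[of TE p q] by (auto simp: disjnt_def connected_component_of_eq connected_component_of_sym)
  define k where "k = Suc K"
  obtain F where F: "nzf k F" by (rule nzf_exists)
  have k: "k >= K" by (simp add: k_def)
  have "zeros (component p) F + zeros (component q) F = (\<Sum>r\<in>zset (component p) F \<union> zset (component q) F. zord r F)"
   unfolding zeros_def using disj by (intro sum.union_disjoint[symmetric] zset_finite[OF F] component_sub) auto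
  also have "\<dots> <= zeros E F" unfolding zeros_def
   by (rule sum_mono2[OF zset_finite[OF F subset_refl]]) (use component_sub in auto)
  also have "\<dots> <= d * k" by (rule upper[OF F])
  finally have "d * k + d * k <= d * k" using lower[OF F k p(1)] lower[OF F k q] by linarith
  then show False using d(1) by (simp add: k_def)
 qed
 have "zeros E F = d * l" if "l >= K" "nzf l F" for l F
 proof -
  obtain q where q: "q : E" using two_points by blast
  show ?thesis using upper[OF that(2)] lower[OF that(2,1) q] conn[OF q] by simp
 qed
 then show ?thesis using that[OF d(1,2)] conn by blast
qed

end

section \<open>Orders of zeros and local inverses of functions on a disc\<close>

lemma has_order_cong:
 assumes "has_order f m" "r > 0" "!!t. t : ball 0 r ==> g t = f t" shows "has_order g m"
proof -
 obtain s h where s: "s > 0" "s <= 1" "h holomorphic_on ball 0 s" "!!t. t : ball 0 s ==> h t ~= 0" "!!t. t : ball 0 s ==> f t = t ^ m * h t"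
  using has_orderE[OF assms(1)] by metis
 have "ball (0::complex) (min r s) <= ball 0 s" by auto
 then show ?thesis by (intro has_orderI[of "min r s" h]) (use assms s in "auto intro: holomorphic_on_subset")
qed

lemma has_order_cases_ball:
 assumes "f holomorphic_on ball 0 r" "r > 0"
 shows "(EX j. has_order f j) | (ALL t:ball 0 r. f t = 0)"
proof -
 define g where "g = (%t. f (of_real r * t))"
 have rt: "of_real r * t : ball 0 r" if "t : ball (0::complex) 1" for t using that assms(2) by (simp add: norm_mult)
 have "(f \<circ> (%t. of_real r * t)) holomorphic_on ball 0 1"
  by (rule holomorphic_on_compose_gen[OF _ assms(1)]) (auto intro!: holomorphic_intros rt simp del: mem_ball)
 then have "g holomorphic_on ball 0 1" by (simp add: g_def o_def)
 then consider j where "has_order g j" | "ALL t:ball 0 1. g t = 0" using has_order_cases by blast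
 then show ?thesis
 proof cases
  case 1
  obtain s h where s: "s > 0" "s <= 1" "h holomorphic_on ball 0 s" "!!t. t : ball 0 s ==> h t ~= 0" "!!t. t : ball 0 s ==> g t = t ^ j * h t"
   using has_orderE[OF 1] by metis
  define u where "u = min (s * r) 1"
  have tr: "t / of_real r : ball 0 s" if t: "t : ball (0::complex) u" for t
  proof -
   have "cmod t < s * r" using t by (simp add: u_def)
   then have "cmod t / r < s" using assms(2) by (simp add: pos_divide_less_eq)
   then show ?thesis using assms(2) by (simp add: norm_divide)
  qed
  have "(h \<circ> (%t. t / of_real r)) holomorphic_on ball 0 u"
   by (rule holomorphic_on_compose_gen[OF _ s(3)]) (use assms(2) in "auto intro!: holomorphic_intros tr simp del: mem_ball")
  then have hol: "(%t. h (t / of_real r)) holomorphic_on ball 0 u" by (simp add: o_def)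
  have "has_order f j"
  proof (rule has_orderI[of u "%t. h (t / of_real r) / of_real r ^ j"])
   show "u > 0" "u <= 1" using s assms(2) by (auto simp: u_def)
   show "(%t. h (t / of_real r) / of_real r ^ j) holomorphic_on ball 0 u"
    by (rule holomorphic_on_divide[OF hol]) (use assms(2) in auto)
   show "h (0 / of_real r) / of_real r ^ j ~= 0" using s(1) s(4)[of 0] assms(2) by simp
   fix t :: complex assume t: "t : ball 0 u"
   show "f t = t ^ j * (h (t / of_real r) / of_real r ^ j)"
    using s(5)[OF tr[OF t]] assms(2) by (simp add: g_def power_divide)
  qed
  then show ?thesis by blast
 next
  case 2
  have "f t = 0" if t: "t : ball 0 r" for t
  proof -
   have "t / of_real r : ball 0 1" using t assms(2) by (simp add: norm_divide)
   then have "g (t / of_real r) = 0" using 2 by blast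
   then show ?thesis using assms(2) by (simp add: g_def)
  qed
  then show ?thesis by blast
 qed
qed

lemma local_inverse:
 assumes h: "h holomorphic_on ball 0 r" "r > 0" and 0: "deriv h 0 ~= 0"
 obtains ep T where "ep > 0" "T holomorphic_on ball (h 0) ep" "!!s. s : ball (h 0) ep ==> T s : ball 0 r"
  "!!s. s : ball (h 0) ep ==> h (T s) = s" "T (h 0) = 0" "open (T ` ball (h 0) ep)"
  "inj_on h (T ` ball (h 0) ep)"
proof -
 obtain rh where rh: "rh > 0" "ball (0::complex) rh <= ball 0 r" "inj_on h (ball 0 rh)"
 proof (rule has_complex_derivative_locally_injective[OF h(1) _ open_ball 0])
  show "0 : ball (0::complex) r" using h(2) by simp
 qed (rule that, assumption+)
 have hrh: "h holomorphic_on ball 0 rh" using h(1) rh(2) by (rule holomorphic_on_subset)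
 obtain g where g: "g holomorphic_on h ` ball 0 rh" "!!z. z : ball 0 rh ==> g (h z) = z"
  by (rule holomorphic_has_inverse[OF hrh open_ball rh(3)]) (rule that, assumption+)
 have "open (h ` ball 0 rh)" by (rule open_mapping_thm3[OF hrh open_ball rh(3)])
 moreover have "h 0 : h ` ball 0 rh" using rh(1) by simp
 ultimately obtain ep where ep: "ep > 0" "ball (h 0) ep <= h ` ball 0 rh" using open_contains_ball by blast
 have inv: "g s : ball 0 rh" "h (g s) = s" if s: "s : ball (h 0) ep" for s
 proof -
  obtain z where "z : ball 0 rh" "s = h z" using s ep(2) by blast
  then show "g s : ball 0 rh" "h (g s) = s" using g(2) by auto
 qed
 have "g ` ball (h 0) ep = ball 0 rh \<inter> h -` ball (h 0) ep"
 proof (intro set_eqI iffI)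
  fix w assume "w : g ` ball (h 0) ep"
  then obtain s where s: "s : ball (h 0) ep" "w = g s" by blast
  show "w : ball 0 rh \<inter> h -` ball (h 0) ep" using inv[OF s(1)] s by simp
 next
  fix w assume w: "w : ball 0 rh \<inter> h -` ball (h 0) ep"
  then show "w : g ` ball (h 0) ep" by (intro image_eqI[of _ _ "h w"]) (use g(2)[of w] in auto)
 qed
 moreover have "open (ball 0 rh \<inter> h -` ball (h 0) ep)"
  by (rule continuous_open_preimage[OF holomorphic_on_imp_continuous_on[OF hrh]]) auto
 ultimately have op: "open (g ` ball (h 0) ep)" by simp
 show ?thesis
 proof (rule that[of ep g])
  show "g holomorphic_on ball (h 0) ep" using g(1) ep(2) by (rule holomorphic_on_subset)
  show "g (h 0) = 0" using g(2) rh(1) by simp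
  show "g s : ball 0 r" if "s : ball (h 0) ep" for s using inv(1)[OF that] rh(2) by blast
  show "inj_on h (g ` ball (h 0) ep)" using rh(3) by (rule inj_on_subset) (use inv in auto)
 qed (use ep inv op in auto)
qed

lemma has_order_deriv:
 assumes "h holomorphic_on ball 0 r" "r > 0" "has_order (%t. h t - c) 1"
 shows "deriv h 0 ~= 0"
proof -
 obtain s k where s: "s > 0" "k holomorphic_on ball 0 s" "!!t. t : ball 0 s ==> k t ~= 0" "!!t. t : ball 0 s ==> h t - c = t ^ 1 * k t"
  using has_orderE[OF assms(3)] by metis
 have k: "(k has_field_derivative deriv k 0) (at 0)" using holomorphic_derivI[OF s(2) open_ball, of 0] s(1) by simp
 have "((%t. c + t * k t) has_field_derivative (0 + (1 * k 0 + deriv k 0 * 0))) (at 0)"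
  by (rule DERIV_add[OF DERIV_const DERIV_mult[OF DERIV_ident k]])
 then have d: "((%t. c + t * k t) has_field_derivative k 0) (at 0)" by simp
 have "(h has_field_derivative k 0) (at 0)"
  by (rule has_field_derivative_transform_within_open[OF d open_ball[of 0 s]])
    (use s(1,4) in "auto simp: algebra_simps")
 then show ?thesis using DERIV_imp_deriv s(3)[of 0] s(1) by fastforce
qed

context curve
begin

lemma disc_holomorphic: "q : E ==> hol_map n (ball 0 1) (disc q)"
 using disc_inverse_chart[of q "ball 0 1"] by (simp add: inverse_chart_def)

lemma ordge_lincomb: "ordge q f m ==> ordge q g m ==> ordge q (%v. f v + c * g v) m"
 unfolding ordge_def by (rule order_ge_add)

lemma ordge_mono: "ordge q f m ==> k <= m ==> ordge q f k"
 unfolding ordge_def by (rule order_ge_mono)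

lemma ordge_zord: "nzf l f ==> q : E ==> ordge q f (zord q f)"
 unfolding ordge_def by (rule has_order_ge[OF zord])

lemma zord_perturb:
 assumes f: "nzf l f" and g: "form_fun n l g" and q: "q : E" and ge: "ordge q g (Suc (zord q f))"
 shows "nzf l (%v. f v + c * g v)" "zord q (%v. f v + c * g v) = zord q f"
proof -
 let ?s = "%v. f v + c * g v"
 have form: "form_fun n l ?s" by (rule form_fun_lincomb[OF nzf_form[OF f] g])
 have "cf q (zord q f) ?s = cf q (zord q f) f + c * cf q (zord q f) g"
  using lin_cf[OF q] nzf_form[OF f] g unfolding lin_def by blast
 moreover have "cf q (zord q f) g = 0" using ge ordge_cf[OF g q] by blast
 ultimately have c: "cf q (zord q f) ?s ~= 0" using cf_zord[OF f q] by simp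
 show nz: "nzf l ?s"
 proof (rule ccontr)
  assume "\<not> nzf l ?s"
  then have "?s v = 0" if "v : \<Union>E" for v using form that unfolding nzf_def by blast
  then have "cf q (zord q f) ?s = cf q (zord q f) (%_. 0)" by (intro cf_cong[OF q]) auto
  then show False using c by (simp add: cf_def)
 qed
 have "ordge q ?s (zord q f)" by (rule ordge_lincomb[OF ordge_zord[OF f q] ordge_mono[OF ge]]) simp
 then have "zord q f <= zord q ?s" using ordge_iff[OF nz q] by blast
 moreover have "\<not> Suc (zord q f) <= zord q ?s" using c ordge_iff[OF nz q] ordge_cf[OF form q] by (meson lessI)
 ultimately show "zord q ?s = zord q f" by simp
qed

text \<open>The multiple of \<open>H\<close> is chosen to cancel the leading coefficient, which
  raises the order by one. Iterated, this removes a pole step by step.\<close>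

lemma subtract:
 assumes G: "form_fun n l G" and H: "nzf l H" and q: "q : E" and ge: "ordge q G (zord q H)"
 obtains c where "ordge q (%v. G v + c * H v) (Suc (zord q H))"
proof -
 define c where "c = - cf q (zord q H) G / cf q (zord q H) H"
 have form: "form_fun n l (%v. G v + c * H v)" by (rule form_fun_lincomb[OF G nzf_form[OF H]])
 have lc: "cf q j (%v. G v + c * H v) = cf q j G + c * cf q j H" for j
  using lin_cf[OF q] G nzf_form[OF H] unfolding lin_def by blast
 have "cf q j (%v. G v + c * H v) = 0" if "j < Suc (zord q H)" for j
 proof (cases "j = zord q H")
  case True
  then show ?thesis using lc[of j] cf_zord[OF H q] by (simp add: c_def)
 next
  case False
  then have "j < zord q H" using that by simp
  then show ?thesis using lc[of j] ge ordge_zord[OF H q] ordge_cf[OF G q] ordge_cf[OF nzf_form[OF H] q] by simp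
 qed
 then show ?thesis using that ordge_cf[OF form q] by blast
qed

lemma subtract':
 assumes "form_fun n l G" "nzf l H" "q : E" "ordge q G m" "zord q H = m"
 shows "EX c. ordge q (%v. G v + c * H v) (m + 1)"
 using subtract[OF assms(1-3)] assms(4,5) by (metis Suc_eq_plus1)

lemma mero_order:
 assumes F: "nzf l F" and q: "q : E" and G: "nzf l (%v. G v - c * F v)"
  and r: "r > 0" "r <= 1" "h holomorphic_on ball 0 r" "!!t. t : ball 0 r ==> G (lift q t) = h t * F (lift q t)"
 obtains j where "has_order (%t. h t - c) j" "zord q (%v. G v - c * F v) = j + zord q F"
proof -
 have eq: "G (lift q t) - c * F (lift q t) = (h t - c) * F (lift q t)" if "t : ball 0 r" for t
  using r(4)[OF that] by (simp add: algebra_simps)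
 have "(%t. h t - c) holomorphic_on ball 0 r" using r(3) by (intro holomorphic_intros)
 from has_order_cases_ball[OF this r(1)] show ?thesis
 proof (elim disjE exE)
  fix j assume j: "has_order (%t. h t - c) j"
  have "has_order (%t. G (lift q t) - c * F (lift q t)) (j + zord q F)"
   by (rule has_order_cong[OF has_order_mult[OF j zord[OF F q]] r(1) eq])
  then have "zord q (%v. G v - c * F v) = j + zord q F" by (rule zord_eqI[of "%v. G v - c * F v"])
  then show ?thesis by (rule that[OF j])
 next
  assume "ALL t:ball 0 r. h t - c = 0"
  then have z: "G (lift q t) - c * F (lift q t) = 0" if "t : ball 0 r" for t using eq[OF that] that by simp
  have "G (lift q t) - c * F (lift q t) = 0" if "t : ball 0 1" for t
   by (rule holomorphic_zero_spread[OF form_lift_hol[OF q nzf_form[OF G]] open_ball subset_ball[OF r(2)] _ z that]) (use r(1) in auto)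
  then show ?thesis using nzf_lift[OF G q] by blast
 qed
qed

text \<open>The entire curve covers an open piece of \<open>E\<close>. This is stronger than not
  being constant, and it allows the conclusion that the composition with a nonconstant map on
  \<open>E\<close> is not constant either.\<close>

definition "entire_image \<longleftrightarrow> (EX g p Om. hol_map n UNIV g & range g <= E \<and>
 p : E & open Om & Om ~= {} & Om <= ball 0 1 & disc p ` Om <= range g)"

end

section \<open>Curves on which the Hilbert function and the number of zeros are both d l\<close>

locale genus_one = curve +
 fixes d K :: nat
 assumes d_pos: "d > 0" and hilbert: "!!l. l >= K ==> hilbert_function n E l = d * l"
  and degree: "!!l F. l >= K ==> nzf l F ==> zeros E F = d * l" and connected: "!!q. q : E ==> component q = E"
begin

text \<open>\<open>G\<close> and \<open>H\<close> have the same number of zeros. As \<open>H\<close>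
  vanishes \<open>j\<close> times more than \<open>G\<close> at \<open>P\<close>, the zeros of
  \<open>G\<close> in excess of those of \<open>H\<close> elsewhere number \<open>j\<close> in
  total: the quotient has as many zeros as poles.\<close>

lemma excess:
 assumes G: "nzf l G" and H: "nzf l H" and l: "l >= K" and P: "P : E" "zord P H = zord P G + j"
  and ge: "!!q. q : E ==> q ~= P ==> zord q H <= zord q G" and T: "finite T" "T <= E" "P \<notin> T"
 shows "(\<Sum>q\<in>T. zord q G - zord q H) <= j"
  "j > 0 ==> EX q:E. q ~= P & zord q G > zord q H"
proof -
 let ?S = "insert P (zset E G \<union> zset E H \<union> T)"
 have fin: "finite ?S" using zset_finite[OF G subset_refl] zset_finite[OF H subset_refl] T(1) by simp
 have tot: "(\<Sum>q\<in>?S. zord q f) = d * l" if f: "nzf l f" "zset E f <= ?S" for f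
 proof -
  have "(\<Sum>q\<in>?S. zord q f) = zeros E f" unfolding zeros_def
   by (rule sum.mono_neutral_right[OF fin f(2)]) (use P(1) T(2) in auto)
  then show ?thesis using degree[OF l f(1)] by simp
 qed
 let ?R = "?S - {P}"
 have "zord P G + (\<Sum>q\<in>?R. zord q G) = zord P H + (\<Sum>q\<in>?R. zord q H)"
 proof -
  have "(\<Sum>q\<in>?S. zord q G) = d * l" by (rule tot[OF G]) auto
  moreover have "(\<Sum>q\<in>?S. zord q H) = d * l" by (rule tot[OF H]) auto
  moreover have "(\<Sum>q\<in>?S. zord q f) = zord P f + (\<Sum>q\<in>?R. zord q f)" for f by (rule sum.remove[OF fin]) simp
  ultimately show ?thesis by simp
 qed
 moreover have "(\<Sum>q\<in>?R. zord q G) = (\<Sum>q\<in>?R. zord q H) + (\<Sum>q\<in>?R. zord q G - zord q H)"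
  unfolding sum.distrib[symmetric]
 proof (rule sum.cong[OF refl])
  fix q assume "q : ?R"
  then have "zord q H <= zord q G" using ge T(2) by auto
  then show "zord q G = zord q H + (zord q G - zord q H)" by simp
 qed
 ultimately have j: "(\<Sum>q\<in>?R. zord q G - zord q H) = j" using P(2) by linarith
 have "(\<Sum>q\<in>T. zord q G - zord q H) <= (\<Sum>q\<in>?R. zord q G - zord q H)"
  by (rule sum_mono2) (use fin T(3) in auto)
 then show "(\<Sum>q\<in>T. zord q G - zord q H) <= j" using j by simp
 show "EX q:E. q ~= P & zord q G > zord q H" if "j > 0"
 proof (rule ccontr)
  assume no: "\<not> ?thesis"
  have "(\<Sum>q\<in>?R. zord q G - zord q H) = 0"
   by (rule sum.neutral) (use no T(2) in "auto simp: not_less")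
  then show False using j that by simp
 qed
qed

definition "simple_pole P l G H \<longleftrightarrow> P : E & l >= K & nzf l G & nzf l H \<and>
 (ALL q:E. q ~= P --> zord q H <= zord q G) & zord P H = Suc (zord P G)"

text \<open>A function with a single simple pole is bijective onto the Riemann sphere, and its inverse
 is an entire curve.\<close>

lemma simple_pole_entire:
 assumes "simple_pole P l G H" shows "entire_image"
proof -
 have P: "P : E" and l: "l >= K" and G: "nzf l G" and H: "nzf l H"
  and ge: "!!q. q : E ==> q ~= P ==> zord q H <= zord q G" and HO: "zord P H = zord P G + 1"
  using assms unfolding simple_pole_def by auto
 have geo: "ordge q G (zord q H)" if "q : E" "q ~= P" for q using ordge_iff[OF G that(1)] ge[OF that] by blast
 \<comment> \<open>The zeros of \<open>G - c * H\<close> beyond those of \<open>H\<close> are the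
   points where the quotient takes the value \<open>c\<close>; by \<open>excess\<close> there is
   exactly one of them, with multiplicity one.\<close>
 let ?D = "%c v. G v - c * H v"
 have D: "nzf l (?D c)" "zord P H = zord P (?D c) + 1" for c
 proof -
  have "ordge P H (Suc (zord P G))" using ordge_zord[OF H P] HO by simp
  from zord_perturb[OF G nzf_form[OF H] P this, of "- c"] show "nzf l (?D c)" "zord P H = zord P (?D c) + 1" using HO by simp_all
 qed
 have Dge: "zord q H <= zord q (?D c)" if "q : E" "q ~= P" for q c
 proof -
  have "ordge q (%v. G v + (- c) * H v) (zord q H)" by (rule ordge_lincomb[OF geo[OF that] ordge_zord[OF H that(1)]])
  then show ?thesis using ordge_iff[OF D(1)[of c] that(1)] by simp
 qed
 define z where "z = mero G H"
 have avoid: "EX r>0. r <= 1 & P \<notin> disc p ` ball 0 r" if p: "p : E" "p ~= P" for p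
 proof (cases "P : disc p ` ball 0 1")
  case True
  then obtain t1 where t1: "t1 : ball 0 1" "P = disc p t1" by blast
  then have "t1 ~= 0" using disc_zero[OF p(1)] p(2) by auto
  have "P ~= disc p t" if t: "t : ball 0 (cmod t1)" for t
  proof
   assume "P = disc p t"
   then have "disc p t1 = disc p t" by (simp only: t1(2)[symmetric])
   moreover have "t : ball 0 1" using t t1(1) by simp
   ultimately have "t1 = t" using inj_onD[OF disc_inj[OF p(1)] _ t1(1)] by blast
   then show False using t by simp
  qed
  then have "P \<notin> disc p ` ball 0 (cmod t1)" by blast
  then show ?thesis using \<open>t1 ~= 0\<close> t1(1) by (intro exI[of _ "cmod t1"]) (simp only: zero_less_norm_iff mem_ball_0 less_imp_le not_False_eq_True simp_thms)
 qed (auto intro: exI[of _ 1])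
 have loc: "EX r h. r > 0 & r <= 1 & h holomorphic_on ball 0 r & (ALL t:ball 0 r. z (disc p t) = h t & disc p t ~= P) \<and>
   (zord p (?D (z p)) = zord p H + 1 --> deriv h 0 ~= 0) & zord p (?D (z p)) > zord p H \<and>
   (ALL c. c ~= z p --> zord p (?D c) = zord p H)" if p: "p : E" "p ~= P" for p
 proof -
  obtain r1 h where r1: "r1 > 0" "r1 <= 1" "h holomorphic_on ball 0 r1" "!!t. t : ball 0 r1 ==> mero G H (disc p t) = h t"
   "!!t. t : ball 0 r1 ==> G (lift p t) = h t * H (lift p t)"
   using mero_local[OF H nzf_form[OF G] p(1) geo[OF p]] by metis
  obtain r2 where r2: "r2 > 0" "r2 <= 1" "P \<notin> disc p ` ball 0 r2" using avoid[OF p] by blast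
  have b: "ball (0::complex) (min r1 r2) <= ball 0 r1" by auto
  have h0: "h 0 = z p" using r1(4)[of 0] r1(1) disc_zero[OF p(1)] by (simp add: z_def)
  have ord: "EX j. has_order (%t. h t - c) j & zord p (?D c) = j + zord p H" for c
   using mero_order[OF H p(1) D(1)[of c] r1(1-3,5)] by metis
  have ord0: "j > 0" if "has_order (%t. h t - z p) j" for j
  proof (rule ccontr)
   assume "\<not> j > 0"
   obtain s k where "s > 0" "!!t. t : ball 0 s ==> k t ~= 0" "!!t. t : ball 0 s ==> h t - z p = t ^ j * k t"
    using has_orderE[OF \<open>has_order (%t. h t - z p) j\<close>] by metis
   then show False using \<open>\<not> j > 0\<close> h0 by (metis centre_in_ball diff_self mult_eq_0_iff not_gr_zero power_0 zero_neq_one)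
  qed
  have ordc: "has_order (%t. h t - c) 0" if "c ~= z p" for c
   by (rule has_orderI[of r1 "%t. h t - c"]) (use r1(1-3) h0 that in "auto intro!: holomorphic_intros")
  show ?thesis
  proof (rule exI[of _ "min r1 r2"], rule exI[of _ h], intro conjI allI impI ballI)
   show "h holomorphic_on ball 0 (min r1 r2)" using r1(3) b by (rule holomorphic_on_subset)
   show "z (disc p t) = h t" if "t : ball 0 (min r1 r2)" for t using r1(4) that unfolding z_def by auto
   show "disc p t ~= P" if "t : ball 0 (min r1 r2)" for t using r2(3) that by auto
   show "deriv h 0 ~= 0" if "zord p (?D (z p)) = zord p H + 1"
   proof -
    have "has_order (%t. h t - z p) 1" using ord[of "z p"] that by auto
    then show ?thesis by (rule has_order_deriv[OF r1(3,1)])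
   qed
   show "zord p (?D (z p)) > zord p H" using ord[of "z p"] ord0 by auto
   show "zord p (?D c) = zord p H" if "c ~= z p" for c using ord[of c] ordc[OF that] has_order_unique by auto
  qed (use r1(1,2) r2(1) in auto)
 qed
 have E1: "(\<Sum>q\<in>T. zord q (?D c) - zord q H) <= 1" if T: "finite T" "T <= E" "P \<notin> T" for T c
  by (rule excess(1)[OF D(1) H l P D(2) _ T]) (rule Dge)
 have E2: "EX q:E. q ~= P & zord q (?D c) > zord q H" for c
  by (rule excess(2)[OF D(1) H l P D(2), where T = "{}"]) (use Dge in auto)
 have ex: "EX p:E. p ~= P & z p = c" for c
 proof -
  obtain p where p: "p : E" "p ~= P" "zord p (?D c) > zord p H"
   using E2[of c] by blast
  then have "z p = c" using loc[OF p(1,2)] by (metis less_irrefl)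
  then show ?thesis using p by blast
 qed
 have simple: "zord p (?D (z p)) = zord p H + 1" if p: "p : E" "p ~= P" for p
  using E1[of "{p}" "z p"] loc[OF p] p by auto
 have inj: "p = q" if "p : E" "p ~= P" "q : E" "q ~= P" "z p = z q" for p q
 proof (rule ccontr)
  assume "p ~= q"
  then show False
   using E1[of "{p, q}" "z p"] simple[OF that(1,2)] simple[OF that(3,4)] that by auto
 qed
 define g where "g = (%c. SOME p. p : E & p ~= P & z p = c)"
 have g: "g c : E" "g c ~= P" "z (g c) = c" for c
  using someI_ex[of "%p. p : E & p ~= P & z p = c"] ex[of c] unfolding g_def by blast+
 have gz: "g (z p) = p" if "p : E" "p ~= P" for p using inj[OF g(1,2)[of "z p"] that] g(3) by simp
 \<comment> \<open>Multiplicity one means a nonzero derivative, so the inverse is locally a chart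
   disc composed with a holomorphic local inverse.\<close>
 have hol: "hol_map n UNIV g"
 proof (rule holomorphic_into_local)
  fix s0 :: complex
  let ?p = "g s0"
  obtain r h where r: "r > 0" "r <= 1" "h holomorphic_on ball 0 r" "!!t. t : ball 0 r ==> z (disc ?p t) = h t & disc ?p t ~= P"
   "deriv h 0 ~= 0" using loc[OF g(1,2)[of s0]] simple[OF g(1,2)[of s0]] by blast
  obtain ep T where T: "ep > 0" "T holomorphic_on ball (h 0) ep" "!!s. s : ball (h 0) ep ==> T s : ball 0 r"
   "!!s. s : ball (h 0) ep ==> h (T s) = s" using local_inverse[OF r(3,1,5)] by metis
  have h0: "h 0 = s0" using r(4)[of 0] r(1) disc_zero[OF g(1)] g(3) by simp
  have b: "ball (0::complex) r <= ball 0 1" using r(2) by (rule subset_ball)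
  have "hol_map n (ball s0 ep) (disc ?p \<circ> T)"
   by (rule holomorphic_into_compose[OF disc_holomorphic[OF g(1)]]) (use T(2,3) b h0 in auto)
  then have "hol_map n (ball s0 ep) g"
  proof (rule holomorphic_into_cong)
   fix s assume "s : ball s0 ep"
   then have s: "s : ball (h 0) ep" using h0 by simp
   have "z (disc ?p (T s)) = s" "disc ?p (T s) ~= P" using r(4)[OF T(3)[OF s]] T(4)[OF s] by auto
   moreover have "disc ?p (T s) : E" by (rule disc_mem[OF g(1)]) (use T(3)[OF s] b in blast)
   ultimately show "g s = (disc ?p \<circ> T) s" using gz by fastforce
  qed
  then show "EX e>0. ball s0 e <= UNIV & hol_map n (ball s0 e) g" using T(1) by blast
 qed simp
 obtain r where r: "r > 0" "r <= 1" "P \<notin> disc (g 0) ` ball 0 r" using avoid[OF g(1,2)] by blast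
 have "disc (g 0) ` ball 0 r <= range g"
 proof
  fix x assume x: "x : disc (g 0) ` ball 0 r"
  then obtain t where t: "t : ball 0 r" "x = disc (g 0) t" by blast
  have "t : ball 0 1" using t(1) r(2) by simp
  then have "x : E" using disc_mem[OF g(1)] t(2) by blast
  then have "g (z x) = x" using gz x r(3) by blast
  then show "x : range g" by (metis rangeI)
 qed
 moreover have "ball (0::complex) r <= ball 0 1" using r(2) by (rule subset_ball)
 moreover have "ball (0::complex) r ~= {}" using r(1) by simp
 ultimately show ?thesis unfolding entire_image_def
  by (intro exI[of _ g] exI[of _ "g 0"] exI[of _ "ball 0 r"] conjI) (use hol g(1) in auto)
qed

text \<open>A quotient with at most a simple pole at \<open>P\<close> and no other pole has none at
  all, since a simple pole is excluded, and is then constant.\<close>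

lemma no_simple_pole:
 assumes no: "!!P l G H. \<not> simple_pole P l G H" and F: "nzf l F" "l >= K" and G: "form_fun n l G" and P: "P : E" "zord P F > 0"
  and ge: "!!q. q : E ==> q ~= P ==> ordge q G (zord q F)" "ordge P G (zord P F - 1)"
 obtains c where "!!v. v : \<Union>E ==> G v = c * F v"
proof (cases "EX v:\<Union>E. G v ~= 0")
 case False
 then show ?thesis by (intro that[of 0]) auto
next
 case True
 then have nz: "nzf l G" using G unfolding nzf_def by blast
 have "zord P G ~= zord P F - 1"
 proof
  assume "zord P G = zord P F - 1"
  then have "simple_pole P l G F" unfolding simple_pole_def using P F nz ge(1) ordge_iff[OF nz] by auto
  then show False using no by blast
 qed
 then have "ordge P G (zord P F)" using ge(2) ordge_iff[OF nz P(1)] by simp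
 then have "ordge q G (zord q F)" if "q : component P" for q using ge(1) that component_sub by blast
 then show ?thesis using ratio_const[OF F(1) G P(1)] that by blast
qed

lemma triple:
 assumes "nzf k f" "nzf k g" "nzf k h"
 shows "nzf (3 * k) (%v. f v * g v * h v)" "q : E ==> zord q (%v. f v * g v * h v) = zord q f + zord q g + zord q h"
proof -
 note fg = nzf_mult[OF assms(1,2)]
 have e: "3 * k = k + k + k" by simp
 show "nzf (3 * k) (%v. f v * g v * h v)" unfolding e by (rule nzf_mult[OF fg assms(3)])
 show "zord q (%v. f v * g v * h v) = zord q f + zord q g + zord q h" if "q : E"
  using zord_mult[OF fg assms(3) that] zord_mult[OF assms(1,2) that] by simp
qed

text \<open>Over the common denominator \<open>F\<close>, the quotients \<open>X/F\<close> and
  \<open>Y/F\<close> have poles of exact orders 2 and 3 at \<open>P\<close> and no others, like the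
  Weierstrass function and its derivative at a lattice point.\<close>

definition "weierstrass P k F X Y \<longleftrightarrow> P : E & k >= K & nzf k F & nzf k X & nzf k Y \<and>
 zord P F = zord P X + 2 & zord P F = zord P Y + 3 \<and>
 (ALL q:E. q ~= P --> zord q F <= zord q X & zord q F <= zord q Y)"

text \<open>The forms of degree \<open>k\<close> have dimension \<open>D\<close>, which is also the
  number of zeros of \<open>F\<close>. Asking for all zeros of \<open>F\<close> except
  \<open>j\<close> of those at \<open>P\<close> costs at most \<open>D - j\<close> conditions.
  Vanishing at \<open>v0\<close> excludes the multiples of \<open>F\<close>; for \<open>Y\<close> a
  further condition kills the coefficient of the double pole. So \<open>j = 2\<close> and
  \<open>j = 3\<close> still leave a nonzero form, and the pole orders are exact because simple
  poles do not occur.\<close>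

lemma weierstrass_functions:
 assumes no: "!!P l G H. \<not> simple_pole P l G H"
 obtains P k F X Y where "weierstrass P k F X Y"
proof -
 obtain P where P: "P : E" using two_points by blast
 \<comment> \<open>At least \<open>K\<close> for the linear Hilbert function, and large enough that
   \<open>D >= 4\<close> leaves a form after three conditions at \<open>P\<close>.\<close>
 define k where "k = K + 4"
 define D where "D = d * k"
 have kK: "k >= K" by (simp add: k_def)
 have "1 * 4 <= d * k" using d_pos by (intro mult_le_mono) (auto simp: k_def)
 then have D4: "4 <= D" by (simp add: D_def)
 have hD: "hilbert_function n E k = D" using hilbert[OF kK] by (simp add: D_def)
 have O1: "finite {P}" "{P} <= E" using P by auto
 have c3: "card (jets {P} (%_. 3)) < hilbert_function n E k" using jets(2)[OF O1, of "%_. 3"] D4 hD by simp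
 have lin3: "lin k \<psi>" if "\<psi> : jets {P} (%_. 3)" for \<psi> by (rule jets(3)[OF O1 that])
 obtain F where F: "nzf k F" "!!\<psi>. \<psi> : jets {P} (%_. 3) ==> \<psi> F = 0"
  by (rule impose_dim[OF jets(1)[OF O1] c3 lin3]) (assumption, rule that)
 have "ordge P F 3" by (rule jets(4)[OF O1, where m = "%_. 3", OF nzf_form[OF F(1)]]) (rule F(2), assumption, simp)
 then have f3: "3 <= zord P F" using ordge_iff[OF F(1) P] by blast
 let ?T = "zset E F"
 have T: "finite ?T" "?T <= E" using zset_finite[OF F(1) subset_refl] by auto
 have OT: "P : ?T" using f3 P by auto
 have sumT: "(\<Sum>q\<in>?T. zord q F) = D" using degree[OF kK F(1)] by (simp add: zeros_def D_def)
 obtain v0 where v0: "v0 : \<Union>E" "F v0 ~= 0" using F(1) unfolding nzf_def by blast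
 define m where "m = (%j. (%q. zord q F)(P := zord P F - j))"
 have summ: "(\<Sum>q\<in>?T. m j q) + j = D" if "j <= 3" for j
 proof -
  have "(\<Sum>q\<in>?T. m j q) = (zord P F - j) + (\<Sum>q\<in>?T-{P}. m j q)" using sum.remove[OF T(1) OT, of "m j"] by (simp add: m_def)
  also have "(\<Sum>q\<in>?T-{P}. m j q) = (\<Sum>q\<in>?T-{P}. zord q F)" by (intro sum.cong) (auto simp: m_def)
  finally show ?thesis using sum.remove[OF T(1) OT, of "%q. zord q F"] sumT that f3 by simp
 qed
 have get: "EX G. nzf k G & (ALL \<psi>:\<Phi>. \<psi> G = 0) & G v0 = 0 & ordge P G (zord P F - j) & (ALL q:E. q ~= P --> ordge q G (zord q F))"
  if \<Phi>: "finite \<Phi>" "Suc (card \<Phi>) < j" "j <= 3" "!!\<psi>. \<psi> : \<Phi> ==> lin k \<psi>" for \<Phi> j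
 proof -
  define \<Psi> where "\<Psi> = insert (%f. f v0) (\<Phi> \<union> jets ?T (m j))"
  have fin: "finite \<Psi>" unfolding \<Psi>_def using \<Phi>(1) jets(1)[OF T] by simp
  have "card \<Psi> <= Suc (card \<Phi> + card (jets ?T (m j)))" unfolding \<Psi>_def
   using card_insert_le_m1[of "Suc (card \<Phi> + card (jets ?T (m j)))"] card_Un_le[of \<Phi> "jets ?T (m j)"] by simp
  also have "\<dots> < D" using jets(2)[OF T, of "m j"] summ[OF \<Phi>(3)] \<Phi>(2) by simp
  finally have c: "card \<Psi> < hilbert_function n E k" using hD by simp
  have lin: "lin k \<psi>" if "\<psi> : \<Psi>" for \<psi> using that \<Phi>(4) jets(3)[OF T] lin_eval unfolding \<Psi>_def by blast
  obtain G where G: "nzf k G" "!!\<psi>. \<psi> : \<Psi> ==> \<psi> G = 0"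
   by (rule impose_dim[OF fin c lin]) (assumption, rule that)
  have og: "ordge q G (m j q)" if "q : ?T" for q
   by (rule jets(4)[OF T, where m = "m j", OF nzf_form[OF G(1)] _ that]) (use G(2) in "auto simp: \<Psi>_def")
  have "ordge q G (zord q F)" if "q : E" "q ~= P" for q
  proof (cases "zord q F = 0")
   case True
   then show ?thesis using ordge_0[OF nzf_form[OF G(1)] that(1)] by simp
  next
   case False
   then show ?thesis using og[of q] that by (simp add: m_def)
  qed
  moreover have "ordge P G (zord P F - j)" using og[OF OT] by (simp add: m_def)
  moreover have "G v0 = 0" using G(2)[of "%f. f v0"] by (simp add: \<Psi>_def)
  moreover have "ALL \<psi>:\<Phi>. \<psi> G = 0" using G(2) by (simp add: \<Psi>_def)
  ultimately show ?thesis using G(1) by (intro exI[of _ G]) blast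
 qed
 have absurd: "\<not> ordge P G (zord P F - 1)" if G: "nzf k G" "G v0 = 0" "!!q. q : E ==> q ~= P ==> ordge q G (zord q F)" for G
 proof
  assume "ordge P G (zord P F - 1)"
  then obtain c where c: "!!v. v : \<Union>E ==> G v = c * F v"
   using no_simple_pole[OF no F(1) kK nzf_form[OF G(1)] P _ G(3)] f3 by auto
  then have "c = 0" using v0 G(2) by (metis mult_eq_0_iff)
  then show False using c G(1) unfolding nzf_def by auto
 qed
 obtain X where X: "nzf k X" "X v0 = 0" "ordge P X (zord P F - 2)" "!!q. q : E ==> q ~= P ==> ordge q X (zord q F)"
  using get[of "{}" 2] by auto
 have XO: "zord P X = zord P F - 2" using absurd[OF X(1,2,4)] X(3) ordge_iff[OF X(1) P] by fastforce
 obtain Y where Y: "nzf k Y" "cf P (zord P F - 2) Y = 0" "Y v0 = 0" "ordge P Y (zord P F - 3)" "!!q. q : E ==> q ~= P ==> ordge q Y (zord q F)"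
  using get[of "{cf P (zord P F - 2)}" 3] lin_cf[OF P] by auto
 have "zord P Y = zord P F - 3"
 proof (rule ccontr)
  assume "zord P Y ~= zord P F - 3"
  then have "ordge P Y (zord P F - 2)" using Y(4) f3 ordge_iff[OF Y(1) P] by auto
  then have "cf P j Y = 0" if "j < zord P F - 1" for j
   using ordge_cf[OF nzf_form[OF Y(1)] P] Y(2) that by (cases "j = zord P F - 2") auto
  then have "ordge P Y (zord P F - 1)" using ordge_cf[OF nzf_form[OF Y(1)] P] by blast
  then show False using absurd[OF Y(1,3,5)] by blast
 qed
 then have "weierstrass P k F X Y" unfolding weierstrass_def
  using P kK F(1) X(1) Y(1) XO f3 X(4) Y(5) ordge_iff[OF X(1)] ordge_iff[OF Y(1)] by auto
 then show ?thesis by (rule that)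
qed

text \<open>With x = \<open>X/F\<close> and y = \<open>Y/F\<close>, the pole of order 6 of y^2 is
  removed step by step with x^3, x y, x^2, y and x, whose poles have the orders 6, 5, 4, 3 and 2.
  The rest has at most a simple pole and is constant. Completing the square absorbs the terms x y
  and y.\<close>

lemma weierstrass_equation:
 assumes no: "!!P l G H. \<not> simple_pole P l G H"
 obtains P k F X Y a b c e where "weierstrass P k F X Y" "a ~= 0"
  "!!v. v : \<Union>E ==> Y v ^ 2 * F v = a * X v ^ 3 + b * X v ^ 2 * F v + c * X v * F v ^ 2 + e * F v ^ 3"
proof -
 obtain P k F X Y where W: "weierstrass P k F X Y" using weierstrass_functions[OF no] by metis
 have P: "P : E" and kK: "k >= K" and F: "nzf k F" and X: "nzf k X" and Y: "nzf k Y"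
  and FX: "zord P F = zord P X + 2" and FY: "zord P F = zord P Y + 3"
  and gX: "!!q. q : E ==> q ~= P ==> zord q F <= zord q X" and gY: "!!q. q : E ==> q ~= P ==> zord q F <= zord q Y"
  using W unfolding weierstrass_def by auto
 define y where "y = zord P Y"
 have ord: "zord P Y = y" "zord P X = y + 1" "zord P F = y + 3" using FX FY by (auto simp: y_def)
 note A = triple[OF Y Y F] and B = triple[OF X X X] and A5 = triple[OF X Y F] and A4 = triple[OF X X F]
  and A3 = triple[OF Y F F] and A2 = triple[OF X F F] and A0 = triple[OF F F F]
 let ?G0 = "%v. Y v * Y v * F v"
 have g0: "form_fun n (3 * k) ?G0" "ordge P ?G0 (3 * y + 3)"
  using nzf_form[OF A(1)] ordge_zord[OF A(1) P] A(2)[OF P] ord by (auto simp: algebra_simps)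
 have zc1: "zord P (%v. X v * X v * X v) = 3 * y + 3" using B(2)[OF P] ord by simp
 from subtract'[OF g0(1) B(1) P g0(2) zc1] obtain c1 where c1: "ordge P (%v. ?G0 v + c1 * (X v * X v * X v)) (3 * y + 3 + 1)" ..
 let ?G1 = "%v. ?G0 v + c1 * (X v * X v * X v)"
 have g1: "form_fun n (3 * k) ?G1" by (rule form_fun_lincomb[OF g0(1) nzf_form[OF B(1)]])
 have zc2: "zord P (%v. X v * Y v * F v) = 3 * y + 3 + 1" using A5(2)[OF P] ord by simp
 from subtract'[OF g1 A5(1) P c1 zc2] obtain c2 where c2: "ordge P (%v. ?G1 v + c2 * (X v * Y v * F v)) (3 * y + 3 + 1 + 1)" ..
 let ?G2 = "%v. ?G1 v + c2 * (X v * Y v * F v)"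
 have g2: "form_fun n (3 * k) ?G2" by (rule form_fun_lincomb[OF g1 nzf_form[OF A5(1)]])
 have zc3: "zord P (%v. X v * X v * F v) = 3 * y + 3 + 1 + 1" using A4(2)[OF P] ord by simp
 from subtract'[OF g2 A4(1) P c2 zc3] obtain c3 where c3: "ordge P (%v. ?G2 v + c3 * (X v * X v * F v)) (3 * y + 3 + 1 + 1 + 1)" ..
 let ?G3 = "%v. ?G2 v + c3 * (X v * X v * F v)"
 have g3: "form_fun n (3 * k) ?G3" by (rule form_fun_lincomb[OF g2 nzf_form[OF A4(1)]])
 have zc4: "zord P (%v. Y v * F v * F v) = 3 * y + 3 + 1 + 1 + 1" using A3(2)[OF P] ord by simp
 from subtract'[OF g3 A3(1) P c3 zc4] obtain c4 where c4: "ordge P (%v. ?G3 v + c4 * (Y v * F v * F v)) (3 * y + 3 + 1 + 1 + 1 + 1)" ..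
 let ?G4 = "%v. ?G3 v + c4 * (Y v * F v * F v)"
 have g4: "form_fun n (3 * k) ?G4" by (rule form_fun_lincomb[OF g3 nzf_form[OF A3(1)]])
 have zc5: "zord P (%v. X v * F v * F v) = 3 * y + 3 + 1 + 1 + 1 + 1" using A2(2)[OF P] ord by simp
 from subtract'[OF g4 A2(1) P c4 zc5] obtain c5 where c5: "ordge P (%v. ?G4 v + c5 * (X v * F v * F v)) (3 * y + 3 + 1 + 1 + 1 + 1 + 1)" ..
 let ?G5 = "%v. ?G4 v + c5 * (X v * F v * F v)"
 have g5: "form_fun n (3 * k) ?G5" by (rule form_fun_lincomb[OF g4 nzf_form[OF A2(1)]])
 have reg: "ordge q f (zord q (%v. F v * F v * F v))" if "nzf (3 * k) f" "zord q f >= 3 * zord q F" "q : E" for q f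
  using ordge_iff[OF that(1,3)] A0(2)[OF that(3)] that(2) by simp
 have "ordge q ?G5 (zord q (%v. F v * F v * F v))" if q: "q : E" "q ~= P" for q
  by (intro ordge_lincomb reg A(1) B(1) A5(1) A4(1) A3(1) A2(1) q(1);
    use A(2) B(2) A5(2) A4(2) A3(2) A2(2) gX[OF q] gY[OF q] q(1) in simp)
 moreover have "zord P (%v. F v * F v * F v) = 3 * y + 9" using A0(2)[OF P] ord by simp
 moreover have "3 * k >= K" using kK by simp
 ultimately obtain c0 where c0: "!!v. v : \<Union>E ==> ?G5 v = c0 * (F v * F v * F v)"
  using no_simple_pole[OF no A0(1) _ g5 P] c5 by auto
 \<comment> \<open>Without the cubic term the pole of order 6 would remain.\<close>
 have c1n: "c1 ~= 0"
 proof
  assume "c1 = 0"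
  then have "ordge P ?G0 (3 * y + 3 + 1)" using c1 by simp
  then show False using ordge_iff[OF A(1) P] A(2)[OF P] ord by simp
 qed
 \<comment> \<open>Completing the square. The added terms have a pole of order at most 2, so the
   triple pole of the ordinate stays exact.\<close>
 define L where "L = (%v. c2 / 2 * X v + c4 / 2 * F v)"
 have Lf: "form_fun n k L" unfolding L_def by (intro form_fun_add form_fun_cmult nzf_form[OF X] nzf_form[OF F])
 define Z where "Z = (%v. Y v + 1 * L v)"
 have Lc: "ordge q L j" if "ordge q X j" "ordge q F j" for q j
 proof -
  have "ordge q (%v. (%_. 0) v + c2 / 2 * X v) j"
   by (rule ordge_lincomb[OF _ that(1)]) (auto simp: ordge_def intro: order_geI[of 1 "%_. 0"])
  from ordge_lincomb[OF this that(2), of "c4 / 2"] show ?thesis by (simp add: L_def)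
 qed
 have LO: "ordge P L (Suc (zord P Y))" by (rule Lc) (use ordge_iff[OF X P] ordge_iff[OF F P] ord in auto)
 have Z: "nzf k Z" "zord P Z = y" using zord_perturb[OF Y Lf P LO, of 1] ord by (auto simp: Z_def)
 have "zord q F <= zord q Z" if q: "q : E" "q ~= P" for q
 proof -
  have "ordge q L (zord q F)" by (rule Lc) (use ordge_iff[OF X q(1)] gX[OF q] ordge_zord[OF F q(1)] in auto)
  then have "ordge q Z (zord q F)" unfolding Z_def using ordge_iff[OF Y q(1)] gY[OF q] by (intro ordge_lincomb) auto
  then show ?thesis using ordge_iff[OF Z(1) q(1)] by blast
 qed
 then have "weierstrass P k F X Z" unfolding weierstrass_def using P kK F X Z ord gX by auto
 moreover have "Z v ^ 2 * F v = - c1 * X v ^ 3 + (c2 ^ 2 / 4 - c3) * X v ^ 2 * F v + (c2 * c4 / 2 - c5) * X v * F v ^ 2 +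
   (c0 + c4 ^ 2 / 4) * F v ^ 3" if "v : \<Union>E" for v
 proof -
  have "Z v ^ 2 * F v = (?G5 v - c0 * (F v * F v * F v)) +
   (- c1 * X v ^ 3 + (c2 ^ 2 / 4 - c3) * X v ^ 2 * F v + (c2 * c4 / 2 - c5) * X v * F v ^ 2 + (c0 + c4 ^ 2 / 4) * F v ^ 3)"
   by (simp add: Z_def L_def power2_eq_square power3_eq_cube field_simps)
  then show ?thesis using c0[OF that] by simp
 qed
 ultimately show ?thesis using that[of P k F X Z "- c1"] c1n by simp
qed

end

text \<open>This is the numerator of the derivative of \<open>x / f\<close>. Multiplication by
  \<open>t\<close> turns the derivative into the Euler operator, which reproduces
  \<open>t ^ m\<close> with the factor \<open>m\<close> and covers \<open>m = 0\<close> as well. The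
  leading coefficient is then \<open>c - a\<close> times a nonzero number; dividing the factor
  \<open>t\<close> out again explains the order one less than \<open>a + c\<close>.\<close>

lemma wronskian_order:
 assumes hol: "f holomorphic_on ball 0 1" "x holomorphic_on ball 0 1" and ord: "has_order f a" "has_order x c" and ac: "a ~= c"
 shows "has_order (%t. deriv x t * f t - x t * deriv f t) (a + c - 1)"
proof -
 obtain r k where r: "r > 0" "r <= 1" "k holomorphic_on ball 0 r" "!!t. t : ball 0 r ==> k t ~= 0" "!!t. t : ball 0 r ==> f t = t ^ a * k t"
  using has_orderE[OF ord(1)] by metis
 obtain s u where s: "s > 0" "s <= 1" "u holomorphic_on ball 0 s" "!!t. t : ball 0 s ==> u t ~= 0" "!!t. t : ball 0 s ==> x t = t ^ c * u t"
  using has_orderE[OF ord(2)] by metis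
 define rh where "rh = min r s"
 have rh: "rh > 0" "rh <= 1" "ball (0::complex) rh <= ball 0 r" "ball (0::complex) rh <= ball 0 s" "ball (0::complex) rh <= ball 0 1"
  using r(1,2) s(1,2) by (auto simp: rh_def)
 have euler: "t * deriv g t = t ^ m * (of_nat m * h t + t * deriv h t)"
  if h: "h holomorphic_on ball 0 rh" and g: "!!t. t : ball 0 rh ==> g t = t ^ m * h t" and t: "t : ball 0 rh" for g h m t
 proof -
  have pow: "((%t::complex. t ^ m) has_field_derivative of_nat m * t ^ (m - Suc 0)) (at t)"
   by (auto intro!: derivative_eq_intros)
  have "((%t. t ^ m * h t) has_field_derivative (of_nat m * t ^ (m - Suc 0) * h t + deriv h t * t ^ m)) (at t)"
   by (rule DERIV_mult[OF pow holomorphic_derivI[OF h open_ball t]])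
  then have "(g has_field_derivative (of_nat m * t ^ (m - Suc 0) * h t + deriv h t * t ^ m)) (at t)"
   by (rule has_field_derivative_transform_within_open[OF _ open_ball t]) (simp add: g)
  then have "deriv g t = of_nat m * t ^ (m - Suc 0) * h t + deriv h t * t ^ m" by (rule DERIV_imp_deriv)
  moreover have "t * (of_nat m * t ^ (m - Suc 0)) = of_nat m * t ^ m" by (cases m) auto
  ultimately show ?thesis by (auto simp: algebra_simps)
 qed
 have k: "k holomorphic_on ball 0 rh" and u: "u holomorphic_on ball 0 rh"
  using holomorphic_on_subset[OF r(3) rh(3)] holomorphic_on_subset[OF s(3) rh(4)] by auto
 have ff: "f t = t ^ a * k t" "x t = t ^ c * u t" if "t : ball 0 rh" for t
  using r(5) s(5) rh(3,4) that by (meson subsetD)+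
 define M where "M = (%t. (of_nat c * u t + t * deriv u t) * k t - u t * (of_nat a * k t + t * deriv k t))"
 define N where "N = (%t. deriv x t * f t - x t * deriv f t)"
 have dk: "deriv k holomorphic_on ball 0 rh" "deriv u holomorphic_on ball 0 rh"
  "deriv f holomorphic_on ball 0 rh" "deriv x holomorphic_on ball 0 rh"
  using holomorphic_deriv[OF k open_ball] holomorphic_deriv[OF u open_ball]
   holomorphic_deriv[OF holomorphic_on_subset[OF hol(1) rh(5)] open_ball] holomorphic_deriv[OF holomorphic_on_subset[OF hol(2) rh(5)] open_ball] by auto
 have Mhol: "M holomorphic_on ball 0 rh" unfolding M_def
  by (intro holomorphic_on_diff holomorphic_on_mult holomorphic_on_add holomorphic_on_const holomorphic_on_ident k u dk)
 have Nhol: "N holomorphic_on ball 0 rh" unfolding N_def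
  by (intro holomorphic_on_diff holomorphic_on_mult dk holomorphic_on_subset[OF hol(1) rh(5)] holomorphic_on_subset[OF hol(2) rh(5)])
 have eq: "N t - t ^ (a + c - 1) * M t = 0" if t: "t : ball 0 rh - {0}" for t
 proof -
  have t': "t : ball 0 rh" using t by blast
  have ef: "t * deriv f t = t ^ a * (of_nat a * k t + t * deriv k t)" by (rule euler[OF k _ t']) (rule ff(1))
  have ex: "t * deriv x t = t ^ c * (of_nat c * u t + t * deriv u t)" by (rule euler[OF u _ t']) (rule ff(2))
  have "t * N t = (t * deriv x t) * f t - x t * (t * deriv f t)" by (simp add: N_def algebra_simps)
  also have "\<dots> = t ^ (a + c) * M t"
   unfolding ef ex ff[OF t'] M_def by (simp add: algebra_simps power_add)
  also have "t ^ (a + c) = t * t ^ (a + c - 1)" using ac by (cases "a + c") auto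
  finally have "t * N t = t * (t ^ (a + c - 1) * M t)" by (simp only: mult.assoc)
  then show ?thesis using t by simp
 qed
 have Dhol: "(%t. N t - t ^ (a + c - 1) * M t) holomorphic_on ball 0 rh"
  by (intro holomorphic_on_diff holomorphic_on_mult holomorphic_on_power holomorphic_on_ident Nhol Mhol)
 have "of_real (rh / 2) : ball (0::complex) rh - {0}" using rh(1) by auto
 then have ne: "ball (0::complex) rh - {0} ~= {}" by blast
 have "N t - t ^ (a + c - 1) * M t = 0" if "t : ball 0 rh" for t
  by (rule holomorphic_zero_spread[OF Dhol open_delete[OF open_ball] _ ne eq that]) auto
 then have N: "N t = t ^ (a + c - 1) * M t" if "t : ball 0 rh" for t using that by simp
 have "M 0 = (of_nat c - of_nat a) * (u 0 * k 0)" by (simp add: M_def algebra_simps)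
 moreover have "(of_nat c - of_nat a :: complex) ~= 0" using ac by simp
 ultimately have "M 0 ~= 0" using r(1) s(1) r(4)[of 0] s(4)[of 0] by simp
 from has_orderI[OF rh(1,2) Mhol this N] show ?thesis by (simp add: N_def)
qed

lemma has_order_quotient:
 assumes "has_order f a" "has_order g a"
 obtains r w where "r > 0" "r <= 1" "w holomorphic_on ball 0 r" "!!t. t : ball 0 r ==> w t ~= 0"
  "!!t. t : ball 0 r ==> f t = w t * g t" "!!t. t : ball 0 r ==> t ~= 0 ==> g t ~= 0"
proof -
 obtain r h where r: "r > 0" "r <= 1" "h holomorphic_on ball 0 r" "!!t. t : ball 0 r ==> h t ~= 0" "!!t. t : ball 0 r ==> f t = t ^ a * h t"
  using has_orderE[OF assms(1)] by metis
 obtain s k where s: "s > 0" "k holomorphic_on ball 0 s" "!!t. t : ball 0 s ==> k t ~= 0" "!!t. t : ball 0 s ==> g t = t ^ a * k t"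
  using has_orderE[OF assms(2)] by metis
 have u: "ball (0::complex) (min r s) <= ball 0 r" "ball (0::complex) (min r s) <= ball 0 s" by auto
 show ?thesis
 proof (rule that[of "min r s" "%t. h t / k t"])
  show "(%t. h t / k t) holomorphic_on ball 0 (min r s)"
   by (intro holomorphic_on_divide holomorphic_on_subset[OF r(3) u(1)] holomorphic_on_subset[OF s(2) u(2)])
     (use s(3) u(2) in blast)
 qed (use r s in auto)
qed

context curve
begin

lemma ordge_cong:
 assumes "q : E" "!!v. v : \<Union>E ==> f v = g v" "ordge q f m" shows "ordge q g m"
proof -
 obtain r h where r: "r > 0" "r <= 1" "h holomorphic_on ball 0 r" "!!t. t : ball 0 r ==> f (lift q t) = t ^ m * h t"
  using order_geE[OF assms(3)[unfolded ordge_def]] by metis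
 show ?thesis unfolding ordge_def
  by (rule order_geI[OF r(1-3)]) (use r(2,4) assms(2) lift_cone[OF assms(1)] in force)
qed

text \<open>Comparison of leading terms: a nonzero multiple of \<open>H\<close> cannot agree on
  \<open>E\<close> with a form of higher order at \<open>q\<close>.\<close>

lemma leading_zero:
 assumes H: "nzf l H" and q: "q : E" and m: "zord q H = m" and G: "ordge q G (Suc m)" and eq: "!!v. v : \<Union>E ==> s * H v = G v"
 shows "s = 0"
proof (rule ccontr)
 assume s: "s ~= 0"
 have z: "ordge q (%_. 0) (Suc m)" unfolding ordge_def by (rule order_geI[of 1 "%_. 0"]) auto
 have "ordge q (%v. 0 + (1 / s) * G v) (Suc m)" by (rule ordge_lincomb[OF z G])
 then have "ordge q H (Suc m)" by (rule ordge_cong[OF q, rotated]) (use eq s in "auto simp: field_simps")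
 then show False using ordge_iff[OF H q] m by simp
qed

end

section \<open>The invariant differential of the Weierstrass cubic\<close>

context genus_one
begin

text \<open>At a finite point where the abscissa \<open>A\<close> vanishes, either \<open>A\<close> is a local coordinate and the
 ordinate does not vanish, or \<open>A\<close> has a double zero and the ordinate a simple one: otherwise the
 cubic is singular and there is a function with a simple pole.\<close>

lemma ramification:
 assumes no: "!!O' l G H. \<not> simple_pole O' l G H" and W: "weierstrass P k F A Y" and a: "a ~= 0"
  and eq: "!!v. v : \<Union>E ==> Y v * Y v * F v =
   a * (A v * A v * A v) + b * (A v * A v * F v) + c * (A v * F v * F v) + e * (F v * F v * F v)"
  and p: "p : E" "p ~= P" "zord p F < zord p A"
 shows "(zord p A = zord p F + 1 & zord p Y = zord p F) | (zord p A = zord p F + 2 & zord p Y = zord p F + 1)"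
proof -
 have P: "P : E" and kK: "k >= K" and F: "nzf k F" and A: "nzf k A" and Y: "nzf k Y"
  and FA: "zord P F = zord P A + 2" and FY: "zord P F = zord P Y + 3"
  and gA: "!!q. q : E ==> q ~= P ==> zord q F <= zord q A" and gY: "!!q. q : E ==> q ~= P ==> zord q F <= zord q Y"
  using W unfolding weierstrass_def by auto
 \<comment> \<open>The abscissa \<open>A/F\<close> has a double pole at \<open>P\<close> and no
   other pole, hence at most two zeros, counted with multiplicity.\<close>
 have ex: "(\<Sum>q\<in>T. zord q A - zord q F) <= 2" if T: "finite T" "T <= E" "P \<notin> T" for T
  by (rule excess(1)[OF A F kK P FA _ T]) (rule gA)
 define m where "m = zord p F"
 define i where "i = zord p A - m"
 define j where "j = zord p Y - m"
 have "i <= 2" using ex[of "{p}"] p by (simp add: i_def m_def)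
 have ord: "zord p F = m" "zord p A = m + i" "zord p Y = m + j" "i >= 1"
  using p gY[OF p(1,2)] by (auto simp: m_def i_def j_def)
 note T = triple(1)[OF Y Y F] triple(1)[OF A A A] triple(1)[OF A A F] triple(1)[OF A F F] triple(1)[OF F F F]
 have z: "zord p (%v. Y v * Y v * F v) = 3 * m + 2 * j" "zord p (%v. A v * A v * A v) = 3 * m + 3 * i"
  "zord p (%v. A v * A v * F v) = 3 * m + 2 * i" "zord p (%v. A v * F v * F v) = 3 * m + i"
  "zord p (%v. F v * F v * F v) = 3 * m"
  using triple(2)[OF Y Y F p(1)] triple(2)[OF A A A p(1)] triple(2)[OF A A F p(1)] triple(2)[OF A F F p(1)] triple(2)[OF F F F p(1)] ord
  by auto
 have ge: "ordge p f l" if "nzf (3 * k) f" "l <= zord p f" for f l using ordge_iff[OF that(1) p(1)] that(2) by blast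
 show ?thesis
 \<comment> \<open>\<open>e\<close> is the value of the cubic at abscissa 0 and thus decides whether
   the ordinate vanishes at \<open>p\<close>.\<close>
 proof (cases "e = 0")
  case True
  have j1: "j >= 1"
  proof (rule ccontr)
   assume "\<not> j >= 1"
   then have j0: "j = 0" by simp
   have z0: "ordge p (%_. 0) (Suc (3 * m))" unfolding ordge_def by (rule order_geI[of 1 "%_. 0"]) auto
   have "ordge p (%v. 0 + a * (A v * A v * A v) + b * (A v * A v * F v) + c * (A v * F v * F v)) (Suc (3 * m))"
    by (intro ordge_lincomb z0 ge T; use z ord in simp)
   moreover have "zord p (%v. Y v * Y v * F v) = 3 * m" using z(1) j0 by simp
   ultimately have "(1::complex) = 0"
    by (intro leading_zero[OF T(1) p(1)]) (assumption+, simp add: eq True)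
   then show False by simp
  qed
  show ?thesis
  proof (cases "c = 0")
   case False
   have "2 * j <= i"
   proof (rule ccontr)
    assume "\<not> 2 * j <= i"
    then have "ordge p (%v. Y v * Y v * F v + (- a) * (A v * A v * A v) + (- b) * (A v * A v * F v)) (Suc (3 * m + i))"
     by (intro ordge_lincomb ge T; use z ord in simp)
    then have "c = 0" by (rule leading_zero[OF T(4) p(1) z(4)]) (use eq True in simp)
    then show False using False by simp
   qed
   then show ?thesis using j1 \<open>i <= 2\<close> ord by auto
  next
   \<comment> \<open>The cubic has a multiple root at 0. The square of \<open>Y/A\<close> is then
     \<open>a A/F + b\<close>, which is regular away from \<open>P\<close>, so \<open>Y/A\<close>
     has only the simple pole at \<open>P\<close> that the orders 3 and 2 leave.\<close>
   case True': True
   have "zord q A <= zord q Y" if q: "q : E" "q ~= P" for q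
   proof -
    have Lq: "ordge q (%v. (%_. 0) v + a * A v) (zord q F)"
     by (rule ordge_lincomb) (use ordge_iff[OF A q(1)] gA[OF q] in \<open>auto simp: ordge_def intro: order_geI[of 1 "%_. 0"]\<close>)
    have L: "ordge q (%v. 0 + a * A v + b * F v) (zord q F)"
     using ordge_lincomb[OF Lq ordge_zord[OF F q(1)], of b] by simp
    have AA: "has_order (%t. A (lift q t) * A (lift q t)) (zord q A + zord q A)"
     by (rule has_order_mult[OF zord[OF A q(1)] zord[OF A q(1)]])
    have "ordge q (%v. (A v * A v) * (0 + a * A v + b * F v)) (zord q A + zord q A + zord q F)"
     using order_ge_mult[OF has_order_ge[OF AA] L[unfolded ordge_def]] by (simp add: ordge_def)
    then have "ordge q (%v. Y v * Y v * F v) (zord q A + zord q A + zord q F)"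
     by (rule ordge_cong[OF q(1), rotated]) (use eq True True' in "auto simp: algebra_simps")
    then have "zord q A + zord q A + zord q F <= zord q Y + zord q Y + zord q F"
     using ordge_iff[OF T(1) q(1)] triple(2)[OF Y Y F q(1)] by simp
    then show ?thesis by simp
   qed
   then have "simple_pole P k Y A" unfolding simple_pole_def using P kK A Y FA FY by auto
   then show ?thesis using no by blast
  qed
 next
  case False
  have j0: "j = 0"
  proof (rule ccontr)
   assume "j ~= 0"
   then have "ordge p (%v. Y v * Y v * F v + (- a) * (A v * A v * A v) + (- b) * (A v * A v * F v) + (- c) * (A v * F v * F v)) (Suc (3 * m))"
    by (intro ordge_lincomb ge T; use z ord in simp)
   then have "e = 0" by (rule leading_zero[OF T(5) p(1) z(5)]) (use eq in simp)
   then show False using False by simp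
  qed
  \<comment> \<open>Suppose that the abscissa has a double zero at \<open>p\<close> although the
    ordinate there is \<open>-s\<close>, which is not 0. By the equation, \<open>B = Y + s F\<close>
    vanishes there to order at least 2 beyond \<open>F\<close>. This compensates both zeros of the
    abscissa, and \<open>B/A\<close> has a simple pole at \<open>P\<close> and no other.\<close>
  have "i = 1"
  proof (rule ccontr)
   assume "i ~= 1"
   then have i2: "i = 2" using \<open>i <= 2\<close> ord(4) by simp
   have "ordge p Y m" using ordge_iff[OF Y p(1)] ord by simp
   from subtract'[OF nzf_form[OF Y] F p(1) this ord(1)] obtain s where s: "ordge p (%v. Y v + s * F v) (m + 1)" ..
   define B where "B = (%v. Y v + s * F v)"
   have FO: "ordge P F (Suc (zord P Y))" using ordge_zord[OF F P] by (rule ordge_mono) (use FY in simp)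
   have B: "nzf k B" "zord P B = zord P Y" using zord_perturb[OF Y nzf_form[OF F] P FO, of s] by (auto simp: B_def)
   have Bp: "m + 1 <= zord p B" using s ordge_iff[OF B(1) p(1)] by (simp add: B_def)
   have Yb: "Y v = B v - s * F v" for v by (simp add: B_def)
   note TB = triple(1)[OF B(1) B(1) F] triple(1)[OF B(1) F F]
   define l where "l = zord p B - m"
   have l: "zord p B = m + l" "l >= 1" using Bp by (auto simp: l_def)
   have zB: "zord p (%v. B v * B v * F v) = 3 * m + 2 * l" "zord p (%v. B v * F v * F v) = 3 * m + l"
    using triple(2)[OF B(1) B(1) F p(1)] triple(2)[OF B(1) F F p(1)] ord l by auto
   have eq2: "(s ^ 2 - e) * (F v * F v * F v) - 2 * s * (B v * F v * F v) + B v * B v * F v =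
     a * (A v * A v * A v) + b * (A v * A v * F v) + c * (A v * F v * F v)" if "v : \<Union>E" for v
    using eq[OF that] by (simp add: Yb algebra_simps power2_eq_square)
   have z0: "ordge p (%_. 0) N" for N unfolding ordge_def by (rule order_geI[of 1 "%_. 0"]) auto
   have "ordge p (%v. 0 + a * (A v * A v * A v) + b * (A v * A v * F v) + c * (A v * F v * F v) + (2 * s) * (B v * F v * F v) + (- 1) * (B v * B v * F v)) (Suc (3 * m))"
    by (intro ordge_lincomb z0 ge T TB; use z zB ord l in simp)
   then have "s ^ 2 - e = 0"
   proof (rule leading_zero[OF T(5) p(1) z(5)])
    show "(s ^ 2 - e) * (F v * F v * F v) = 0 + a * (A v * A v * A v) + b * (A v * A v * F v) + c * (A v * F v * F v) + (2 * s) * (B v * F v * F v) + (- 1) * (B v * B v * F v)"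
     if "v : \<Union>E" for v using eq2[OF that] by algebra
   qed
   then have s0: "s ~= 0" "s ^ 2 - e = 0" using False by auto
   have "l >= 2"
   proof (rule ccontr)
    assume "\<not> l >= 2"
    then have l1: "l = 1" using l(2) by simp
    have "ordge p (%v. 0 + (- a) * (A v * A v * A v) + (- b) * (A v * A v * F v) + (- c) * (A v * F v * F v) + 1 * (B v * B v * F v)) (Suc (3 * m + l))"
     by (intro ordge_lincomb z0 ge T TB; use z zB ord l1 i2 in simp)
    then have "2 * s = 0"
    proof (rule leading_zero[OF TB(2) p(1) zB(2)])
     show "2 * s * (B v * F v * F v) = 0 + (- a) * (A v * A v * A v) + (- b) * (A v * A v * F v) + (- c) * (A v * F v * F v) + 1 * (B v * B v * F v)"
      if "v : \<Union>E" for v using eq2[OF that] s0(2) by algebra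
    qed
    then show False using s0(1) by simp
   qed
   have "zord q A <= zord q B" if q: "q : E" "q ~= P" for q
   proof (cases "q = p")
    case True
    then show ?thesis using l ord i2 \<open>l >= 2\<close> by simp
   next
    case False
    have "(zord p A - zord p F) + (zord q A - zord q F) <= 2" using ex[of "{p, q}"] False p q by simp
    then have "zord q A <= zord q F" using ord i2 by simp
    moreover have "ordge q B (zord q F)" unfolding B_def
     by (rule ordge_lincomb) (use ordge_iff[OF Y q(1)] gY[OF q] ordge_zord[OF F q(1)] in auto)
    ultimately show ?thesis using ordge_iff[OF B(1) q(1)] by fastforce
   qed
   then have "simple_pole P k B A" unfolding simple_pole_def using P kK A B FA FY by auto
   then show False using no by blast
  qed
  then show ?thesis using j0 ord by simp
 qed
qed

text \<open>The form \<open>d(X/F) / (2Y/F)\<close> has neither zeros nor poles.\<close>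

lemma one_form:
 assumes no: "!!O' l G H. \<not> simple_pole O' l G H" and W: "weierstrass P k F X Y" and a: "a ~= 0"
  and eq: "!!v. v : \<Union>E ==> Y v ^ 2 * F v = a * X v ^ 3 + b * X v ^ 2 * F v + c * X v * F v ^ 2 + e * F v ^ 3"
  and p: "p : E"
 obtains r w where "r > 0" "r <= 1" "w holomorphic_on ball 0 r" "!!t. t : ball 0 r ==> w t ~= 0"
  "!!t. t : ball 0 r ==> deriv (%t. X (lift p t)) t * F (lift p t) - X (lift p t) * deriv (%t. F (lift p t)) t
    = w t * (F (lift p t) * Y (lift p t))"
  "!!t. t : ball 0 r ==> t ~= 0 ==> F (lift p t) ~= 0 & Y (lift p t) ~= 0"
proof -
 have P: "P : E" and F: "nzf k F" and X: "nzf k X" and Y: "nzf k Y"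
  and FX: "zord P F = zord P X + 2" and FY: "zord P F = zord P Y + 3"
  and gX: "!!q. q : E ==> q ~= P ==> zord q F <= zord q X" and gY: "!!q. q : E ==> q ~= P ==> zord q F <= zord q Y"
  using W unfolding weierstrass_def by auto
 let ?f = "%t. F (lift p t)" and ?x = "%t. X (lift p t)" and ?y = "%t. Y (lift p t)"
 \<comment> \<open>\<open>?N\<close> divided by the square of \<open>F\<close> is the derivative of
   \<open>X/F\<close>. The identity to be shown therefore says that d(X/F) is \<open>w\<close> times
   \<open>Y/F\<close> times dt; the constant factor 2 is left out.\<close>
 let ?N = "%t. deriv ?x t * ?f t - ?x t * deriv ?f t"
 note hol = form_lift_hol[OF p nzf_form[OF F]] form_lift_hol[OF p nzf_form[OF X]]
 have N: "has_order ?N (zord p F + zord p Y)"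
 proof (cases "p = P")
  case True
  have "has_order ?N (zord p F + zord p X - 1)"
   by (rule wronskian_order[OF hol zord[OF F p] zord[OF X p]]) (use FX True in simp)
  moreover have "zord p F + zord p X - 1 = zord p F + zord p Y" using FX FY True by simp
  ultimately show ?thesis by simp
 next
  case False
  have "ordge p X (zord p F)" using ordge_iff[OF X p] gX[OF p False] by blast
  \<comment> \<open>The abscissa is translated so that it vanishes at \<open>p\<close>. The
    Wronskian with \<open>F\<close> does not change, and the cubic keeps its shape with new
    coefficients and the same \<open>a\<close>.\<close>
  from subtract'[OF nzf_form[OF X] F p this refl] obtain s where s: "ordge p (%v. X v + s * F v) (zord p F + 1)" ..
  define A where "A = (%v. X v + s * F v)"
  have FO: "ordge P F (Suc (zord P X))" using ordge_zord[OF F P] by (rule ordge_mono) (use FX in simp)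
  have A: "nzf k A" "zord P A = zord P X" using zord_perturb[OF X nzf_form[OF F] P FO, of s] by (auto simp: A_def)
  have "zord q F <= zord q A" if q: "q : E" "q ~= P" for q
  proof -
   have "ordge q A (zord q F)" unfolding A_def
    by (rule ordge_lincomb) (use ordge_iff[OF X q(1)] gX[OF q] ordge_zord[OF F q(1)] in auto)
   then show ?thesis using ordge_iff[OF A(1) q(1)] by blast
  qed
  then have WA: "weierstrass P k F A Y" using W A unfolding weierstrass_def by auto
  have Ap: "zord p F < zord p A" using s ordge_iff[OF A(1) p] by (simp add: A_def)
  have eqA: "Y v * Y v * F v = a * (A v * A v * A v) + (b - 3 * a * s) * (A v * A v * F v) +
    (3 * a * s ^ 2 - 2 * b * s + c) * (A v * F v * F v) + (- a * s ^ 3 + b * s ^ 2 - c * s + e) * (F v * F v * F v)"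
   if "v : \<Union>E" for v
   using eq[OF that] by (simp add: A_def algebra_simps power2_eq_square power3_eq_cube)
  have ram: "zord p F + zord p A - 1 = zord p F + zord p Y"
   using ramification[OF no WA a eqA p False Ap] by auto
  let ?g = "%t. A (lift p t)"
  note holA = form_lift_hol[OF p nzf_form[OF A(1)]]
  have "has_order (%t. deriv ?g t * ?f t - ?g t * deriv ?f t) (zord p F + zord p A - 1)"
   by (rule wronskian_order[OF hol(1) holA zord[OF F p] zord[OF A(1) p]]) (use Ap in simp)
  then have "has_order ?N (zord p F + zord p A - 1)"
  proof (rule has_order_cong[of _ _ 1])
   fix t :: complex assume t: "t : ball 0 1"
   have "(?x has_field_derivative deriv ?x t) (at t)" "(?f has_field_derivative deriv ?f t) (at t)"
    using holomorphic_derivI[OF hol(2) open_ball t] holomorphic_derivI[OF hol(1) open_ball t] by auto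
   then have "((%t. ?x t + s * ?f t) has_field_derivative (deriv ?x t + s * deriv ?f t)) (at t)"
    by (intro DERIV_add DERIV_cmult)
   then have "deriv ?g t = deriv ?x t + s * deriv ?f t" unfolding A_def by (rule DERIV_imp_deriv)
   then show "?N t = deriv ?g t * ?f t - ?g t * deriv ?f t" by (simp add: A_def algebra_simps)
  qed simp
  then show ?thesis using ram by simp
 qed
 have fy: "has_order (%t. ?f t * ?y t) (zord p F + zord p Y)" by (rule has_order_mult[OF zord[OF F p] zord[OF Y p]])
 obtain r w where r: "r > 0" "r <= 1" "w holomorphic_on ball 0 r" "!!t. t : ball 0 r ==> w t ~= 0"
  "!!t. t : ball 0 r ==> ?N t = w t * (?f t * ?y t)" "!!t. t : ball 0 r ==> t ~= 0 ==> ?f t * ?y t ~= 0"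
  by (rule has_order_quotient[OF N fy]) (rule that, assumption+)
 show ?thesis by (rule that[OF r(1-5)]) (use r(6) in auto)
qed

end

section \<open>Change of charts\<close>

context curve
begin

text \<open>The parameter of the chart at \<open>q\<close> is a quotient of two linear forms;
  evaluated on the lift of the chart at \<open>p\<close> it gives a holomorphic change of
  parameter.\<close>

lemma disc_transition:
 assumes p: "p : E" "q : E" and t1: "t1 : ball 0 1" and rh: "rh > 0" "rh <= 1" and meet: "disc p t1 : disc q ` ball 0 rh"
 obtains ep \<tau> where "ep > 0" "ball t1 ep <= ball 0 1" "\<tau> holomorphic_on ball t1 ep"
  "!!t. t : ball t1 ep ==> \<tau> t : ball 0 rh & disc q (\<tau> t) = disc p t"
proof -
 have b: "ball (0::complex) rh <= ball 0 1" using rh(2) by (rule subset_ball)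
 define U where "U = {t : ball 0 1. disc p t : disc q ` ball 0 rh}"
 have "openin (top_of_set (ball 0 1)) U"
  using openin_continuous_map_preimage[OF disc_continuous[OF p(1)] disc_open[OF p(2) open_ball b]] by (simp add: U_def)
 then have "open U" using openin_open_trans open_ball by blast
 moreover have "t1 : U" using t1 meet by (simp add: U_def)
 ultimately obtain ep where ep: "ep > 0" "ball t1 ep <= U" using open_contains_ball by blast
 let ?\<tau> = "%t. chart_form q (lift p t) / lift p t (chart_index q)"
 have key: "lift p t (chart_index q) ~= 0 & ?\<tau> t : ball 0 rh & disc q (?\<tau> t) = disc p t" if t: "t : U" for t
 proof -
  obtain s where s: "s : ball 0 rh" "disc p t = disc q s" using t unfolding U_def by blast
  have s1: "s : ball 0 1" using s(1) b by blast
  have "lift p t : disc q s" using lift_mem_disc s(2) by metis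
  then obtain c where c: "c ~= 0" "lift p t = cscale c (lift q s)" using lift_proportional[OF p(2) s1] by metis
  have 1: "lift p t (chart_index q) = c" unfolding c(2) using lift_index[OF p(2) s1] by (simp add: cscale_def)
  have "chart_form q (lift p t) = c * s"
   unfolding c(2) using form_fun_cscale[OF chart_form[OF p(2)], of c] chart_form_lift[OF p(2) s1] by simp
  then have "?\<tau> t = s" using 1 c(1) by simp
  then show ?thesis using 1 c(1) s by simp
 qed
 have e1: "ball t1 ep <= ball 0 1" using ep(2) U_def by blast
 show ?thesis
 proof (rule that[OF ep(1) e1])
  show "?\<tau> holomorphic_on ball t1 ep"
   by (intro holomorphic_on_divide holomorphic_on_subset[OF form_lift_hol[OF p(1) chart_form[OF p(2)]] e1]
     holomorphic_on_subset[OF lift_hol[OF p(1)] e1]) (use key ep(2) in blast)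
 qed (use key ep(2) in blast)
qed

end

section \<open>Entire curves in curves of genus one\<close>

text \<open>The local flow of a holomorphic vector field without zeros, reduced to what gluing
  needs: \<phi> takes \<open>p\<close> and a time \<open>h\<close> to the point reached from
  \<open>p\<close>, \<open>translate\<close> is the flow law for small times, and
  \<open>image\<close> says that short times already sweep out an open piece of the curve.\<close>

locale curve_flow = curve +
 fixes ep :: "ppoint => real" and \<phi> :: "ppoint => complex => ppoint"
 assumes eps: "p : E ==> ep p > 0"
  and hol: "p : E ==> hol_map n (ball 0 (ep p)) (\<phi> p)"
  and start: "p : E ==> \<phi> p 0 = p"
  and mem: "p : E ==> h : ball 0 (ep p) ==> \<phi> p h : E"
  and image: "p : E ==> 0 < \<delta> ==> \<delta> <= ep p ==> EX Om. open Om & Om ~= {} & Om <= ball 0 1 & \<phi> p ` ball 0 \<delta> = disc p ` Om"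
  and translate: "p : E ==> a : ball 0 (ep p) ==> EX \<delta>>0. ALL h:ball 0 \<delta>. \<phi> p (a + h) = \<phi> (\<phi> p a) h"
begin

text \<open>An integral curve: near each time it is the local flow started at the current point. The
  condition is local, which makes restriction and gluing immediate.\<close>

definition is_flow :: "complex set => (complex => ppoint) => bool" where
 "is_flow Om g \<longleftrightarrow> open Om & (ALL z:Om. g z : E & (EX \<delta>>0. ALL h:ball 0 \<delta>. g (z + h) = \<phi> (g z) h))"

lemma is_flowD:
 assumes "is_flow Om g" "z : Om"
 shows "g z : E" "EX \<delta>>0. ALL h:ball 0 \<delta>. g (z + h) = \<phi> (g z) h"
 using assms unfolding is_flow_def by blast+

lemma is_flow_subset: "is_flow Om g ==> open A ==> A <= Om ==> is_flow A g"
 unfolding is_flow_def by blast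

lemma is_flow_cong:
 assumes "is_flow Om g" "!!z. z : Om ==> h z = g z" shows "is_flow Om h"
 unfolding is_flow_def
proof (intro conjI ballI)
 show op: "open Om" using assms(1) by (simp add: is_flow_def)
 fix z assume z: "z : Om"
 show "h z : E" using is_flowD(1)[OF assms(1) z] assms(2)[OF z] by simp
 obtain \<delta> where \<delta>: "\<delta> > 0" "!!u. u : ball 0 \<delta> ==> g (z + u) = \<phi> (g z) u" using is_flowD(2)[OF assms(1) z] by blast
 obtain r where r: "r > 0" "ball z r <= Om" using op z open_contains_ball by blast
 have "h (z + u) = \<phi> (h z) u" if u: "u : ball 0 (min \<delta> r)" for u
 proof -
  have "z + u : ball z r" using u by (simp add: dist_norm)
  then have "z + u : Om" using r(2) by blast
  then show ?thesis using \<delta>(2)[of u] assms(2) z u by simp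
 qed
 then show "EX \<delta>>0. ALL u:ball 0 \<delta>. h (z + u) = \<phi> (h z) u" using \<delta>(1) r(1) by (intro exI[of _ "min \<delta> r"]) simp
qed

lemma is_flow_shift:
 assumes "is_flow (ball 0 e) g" shows "is_flow (ball z e) (%s. g (s - z))"
 unfolding is_flow_def
proof (intro conjI ballI)
 fix s assume "s : ball z e"
 then have s: "s - z : ball 0 e" by (simp add: dist_norm norm_minus_commute)
 show "g (s - z) : E" by (rule is_flowD(1)[OF assms s])
 show "EX \<delta>>0. ALL h:ball 0 \<delta>. g (s + h - z) = \<phi> (g (s - z)) h"
  using is_flowD(2)[OF assms s] by (simp add: algebra_simps)
qed simp

lemma is_flow_holomorphic:
 assumes g: "is_flow Om g" shows "hol_map n Om g"
proof (rule holomorphic_into_local)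
 show op: "open Om" using g by (simp add: is_flow_def)
 fix z assume z: "z : Om"
 obtain \<delta> where \<delta>: "\<delta> > 0" "!!u. u : ball 0 \<delta> ==> g (z + u) = \<phi> (g z) u" using is_flowD(2)[OF g z] by blast
 obtain r where r: "r > 0" "ball z r <= Om" using op z open_contains_ball by blast
 note gz = is_flowD(1)[OF g z]
 define d where "d = min (min \<delta> r) (ep (g z))"
 have d: "d > 0" "d <= \<delta>" "d <= r" "d <= ep (g z)" using \<delta>(1) r(1) eps[OF gz] by (auto simp: d_def)
 have "hol_map n (ball z d) (\<phi> (g z) \<circ> (%s. s - z))"
  by (rule holomorphic_into_compose[OF hol[OF gz]])
    (use d(4) in "auto intro!: holomorphic_intros simp: dist_norm norm_minus_commute")
 then have "hol_map n (ball z d) g"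
 proof (rule holomorphic_into_cong)
  fix s assume "s : ball z d"
  then have "s - z : ball 0 \<delta>" using d(2) by (simp add: dist_norm norm_minus_commute)
  then show "g s = (\<phi> (g z) \<circ> (%s. s - z)) s" using \<delta>(2)[of "s - z"] by simp
 qed
 moreover have "ball z d <= Om" using subset_ball[OF d(3)] r(2) by blast
 ultimately show "EX e>0. ball z e <= Om & hol_map n (ball z e) g" using d(1) by blast
qed

text \<open>Near a common point both curves are given by the same local flow; the identity theorem
  does the rest.\<close>

lemma is_flow_unique:
 assumes g: "is_flow Om g" and h: "is_flow Om h" and "connected Om" and z: "z : Om" "g z = h z" and "t : Om"
 shows "g t = h t"
proof -
 obtain \<delta> where \<delta>: "\<delta> > 0" "!!u. u : ball 0 \<delta> ==> g (z + u) = \<phi> (g z) u" using is_flowD(2)[OF g z(1)] by blast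
 obtain \<delta>' where \<delta>': "\<delta>' > 0" "!!u. u : ball 0 \<delta>' ==> h (z + u) = \<phi> (h z) u" using is_flowD(2)[OF h z(1)] by blast
 have "open Om" using g by (simp add: is_flow_def)
 then obtain r where r: "r > 0" "ball z r <= Om" using z(1) open_contains_ball by blast
 define d where "d = min (min \<delta> \<delta>') r"
 have d: "d > 0" "d <= \<delta>" "d <= \<delta>'" "d <= r" using \<delta>(1) \<delta>'(1) r(1) by (auto simp: d_def)
 have agree: "g s = h s" if "s : ball z d" for s
 proof -
  have "s - z : ball 0 \<delta>" "s - z : ball 0 \<delta>'" using that d by (auto simp: dist_norm norm_minus_commute)
  then show ?thesis using \<delta>(2)[of "s - z"] \<delta>'(2)[of "s - z"] z(2) by simp
 qed
 have sub: "ball z d <= Om" using subset_ball[OF d(4)] r(2) by blast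
 have ne: "ball z d ~= {}" using d(1) by simp
 show ?thesis
  by (rule holomorphic_into_identity[OF is_flow_holomorphic[OF g] is_flow_holomorphic[OF h] assms(3) open_ball sub ne agree assms(6)])
qed

text \<open>By compactness finitely many flow discs of half radius cover \<open>E\<close>. A point
  of one of them, reached at a time within half of the radius, can flow on for the other half, so
  the smallest half radius is a common life time.\<close>

lemma uniform_flow:
 obtains e \<psi> where "e > 0" "!!q. q : E ==> is_flow (ball 0 e) (\<psi> q)" "!!q. q : E ==> \<psi> q 0 = q"
proof -
 define W where "W = (%p. \<phi> p ` ball 0 (ep p / 2))"
 have opW: "openin TE (W p)" if p: "p : E" for p
 proof -
  obtain Om where "open Om" "Om <= ball 0 1" "W p = disc p ` Om" using image[OF p, of "ep p / 2"] eps[OF p] unfolding W_def by auto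
  then show ?thesis using disc_open[OF p] by simp
 qed
 have selfW: "p : W p" if p: "p : E" for p
  unfolding W_def by (rule image_eqI[of _ _ 0]) (use start[OF p] eps[OF p] in auto)
 have "topspace TE <= \<Union>(W ` E)" using topspace_TE selfW by blast
 moreover have "ALL U:W ` E. openin TE U" using opW by blast
 ultimately obtain \<F> where \<F>: "finite \<F>" "\<F> <= W ` E" "topspace TE <= \<Union>\<F>"
  using compact_TE unfolding compact_space_alt by metis
 obtain Q where Q: "finite Q" "Q <= E" "\<F> = W ` Q" using finite_subset_image[OF \<F>(1,2)] by blast
 have Qne: "Q ~= {}" using \<F>(3) Q(3) topspace_TE two_points by blast
 define e where "e = Min ((%p. ep p / 2) ` Q)"
 have e: "e > 0" unfolding e_def using Q eps Qne by (subst Min_gr_iff) auto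
 have ele: "e <= ep p / 2" if "p : Q" for p unfolding e_def using Q(1) that by (intro Min_le) auto
 have "EX \<psi>. is_flow (ball 0 e) \<psi> & \<psi> 0 = q" if q: "q : E" for q
 proof -
  obtain p where p: "p : Q" "q : W p" using \<F>(3) Q(3) topspace_TE q by blast
  then have pE: "p : E" using Q(2) by blast
  obtain a where a: "a : ball 0 (ep p / 2)" "q = \<phi> p a" using p(2) unfolding W_def by blast
  have in': "a + h : ball 0 (ep p)" if "h : ball 0 e" for h
   using that a(1) ele[OF p(1)] norm_triangle_ineq[of a h] by simp
  have "is_flow (ball 0 e) (%h. \<phi> p (a + h))"
   unfolding is_flow_def
  proof (intro conjI ballI open_ball)
   fix h assume h: "h : ball (0::complex) e"
   show "\<phi> p (a + h) : E" by (rule mem[OF pE in'[OF h]])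
   show "EX \<delta>>0. ALL u:ball 0 \<delta>. \<phi> p (a + (h + u)) = \<phi> (\<phi> p (a + h)) u"
    using translate[OF pE in'[OF h]] by (simp only: add.assoc)
  qed
  then show ?thesis using a(2) by (intro exI[of _ "%h. \<phi> p (a + h)"]) simp
 qed
 then obtain \<psi> where "!!q. q : E ==> is_flow (ball 0 e) (\<psi> q) & \<psi> q 0 = q" by metis
 then show ?thesis using that[OF e] by blast
qed

text \<open>The solution is continued by restarting it at points of its disc. Pieces restarted at
  \<open>z\<close> and \<open>z'\<close> are compatible: if their discs meet, the midpoint of
  \<open>z\<close> and \<open>z'\<close> lies in both discs and also in the disc where
  \<open>g\<close> is defined, so both pieces agree with \<open>g\<close> there and uniqueness
  applies.\<close>

lemma extend_flow:
 assumes e: "e > 0" and \<psi>: "!!q. q : E ==> is_flow (ball 0 e) (\<psi> q)" "!!q. q : E ==> \<psi> q 0 = q"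
  and R: "R > 0" and g: "is_flow (ball 0 R) g"
 obtains h where "is_flow (ball 0 (R + e / 2)) h" "!!z. z : ball 0 R ==> h z = g z"
proof -
 let ?loc = "%z s. \<psi> (g z) (s - z)"
 have gE: "g z : E" if "z : ball 0 R" for z by (rule is_flowD(1)[OF g that])
 have loc: "is_flow (ball z e) (?loc z)" if "z : ball 0 R" for z by (rule is_flow_shift[OF \<psi>(1)[OF gE[OF that]]])
 have loc_g: "?loc z s = g s" if z: "z : ball 0 R" and s: "s : ball z e \<inter> ball 0 R" for z s
 proof (rule is_flow_unique[of "ball z e \<inter> ball 0 R" "?loc z" g z])
  show "is_flow (ball z e \<inter> ball 0 R) (?loc z)" by (rule is_flow_subset[OF loc[OF z]]) auto
  show "is_flow (ball z e \<inter> ball 0 R) g" by (rule is_flow_subset[OF g]) auto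
  show "connected (ball z e \<inter> ball 0 R)" by (intro convex_connected convex_Int convex_ball)
  show "?loc z z = g z" using \<psi>(2)[OF gE[OF z]] by simp
 qed (use z s e in auto)
 have loc_loc: "?loc z s = ?loc z' s" if z: "z : ball 0 R" "z' : ball 0 R" and s: "s : ball z e \<inter> ball z' e" for z z' s
 proof -
  let ?m = "(z + z') / 2"
  have "cmod (z - z') < 2 * e"
   using s norm_triangle_ineq[of "z - s" "s - z'"] by (simp add: dist_norm norm_minus_commute)
  moreover have "cmod (?m - z) = cmod (z - z') / 2"
  proof -
   have "?m - z = (z' - z) / 2" by (simp add: field_simps)
   then show ?thesis by (simp only: norm_divide norm_minus_commute[of z' z]) simp
  qed
  moreover have "cmod (?m - z') = cmod (z - z') / 2"
  proof -
   have "?m - z' = (z - z') / 2" by (simp add: field_simps)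
   then show ?thesis by (simp only: norm_divide) simp
  qed
  ultimately have m: "?m : ball z e" "?m : ball z' e"
   unfolding mem_ball dist_norm norm_minus_commute[of z ?m] norm_minus_commute[of z' ?m] by linarith+
  have mR: "?m : ball 0 R" using z norm_triangle_ineq[of z z'] by (simp add: norm_divide)
  show ?thesis
  proof (rule is_flow_unique[of "ball z e \<inter> ball z' e" "?loc z" "?loc z'" ?m])
   show "is_flow (ball z e \<inter> ball z' e) (?loc z)" by (rule is_flow_subset[OF loc[OF z(1)]]) auto
   show "is_flow (ball z e \<inter> ball z' e) (?loc z')" by (rule is_flow_subset[OF loc[OF z(2)]]) auto
   show "connected (ball z e \<inter> ball z' e)" by (intro convex_connected convex_Int convex_ball)
   have "?loc z ?m = g ?m" by (rule loc_g[OF z(1)]) (use m mR in blast)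
   moreover have "?loc z' ?m = g ?m" by (rule loc_g[OF z(2)]) (use m mR in blast)
   ultimately show "?loc z ?m = ?loc z' ?m" by simp
  qed (use m s in blast)+
 qed
 \<comment> \<open>Shrinking by \<open>c\<close> maps the larger disc into the smaller one and moves
   no point by more than e/2; this selects a restarting point for every time.\<close>
 define c where "c = R / (R + e / 2)"
 have c: "0 < c" "c * (R + e / 2) = R" "c < 1" using R e by (auto simp: c_def field_simps)
 have near: "of_real c * s : ball 0 R" "s : ball (of_real c * s) e" if s: "s : ball (0::complex) (R + e / 2)" for s
 proof -
  have "c * cmod s < c * (R + e / 2)" using s c(1) by simp
  then show "of_real c * s : ball 0 R" using c by (simp add: norm_mult)
  have "s - of_real c * s = of_real (1 - c) * s" by (simp add: algebra_simps)
  then have "cmod (s - of_real c * s) = (1 - c) * cmod s" using c(3) by (simp only: norm_mult norm_of_real)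
  also have "\<dots> <= (1 - c) * (R + e / 2)" using c(3) s by (intro mult_left_mono) auto
  also have "\<dots> = e / 2" unfolding left_diff_distrib c(2) by simp
  finally show "s : ball (of_real c * s) e" using e by (simp add: dist_norm norm_minus_commute)
 qed
 define h where "h = (%s. ?loc (of_real c * s) s)"
 have hloc: "h s = ?loc z s" if "s : ball 0 (R + e / 2)" "z : ball 0 R" "s : ball z e" for s z
  unfolding h_def by (rule loc_loc) (use near[OF that(1)] that in auto)
 have "is_flow (ball 0 (R + e / 2)) h"
  unfolding is_flow_def
 proof (intro conjI ballI open_ball)
  fix s :: complex assume s: "s : ball 0 (R + e / 2)"
  let ?z = "of_real c * s"
  have "is_flow (ball ?z e \<inter> ball 0 (R + e / 2)) (?loc ?z)"
   by (rule is_flow_subset[OF loc[OF near(1)[OF s]]]) auto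
  then have "is_flow (ball ?z e \<inter> ball 0 (R + e / 2)) h"
   by (rule is_flow_cong) (use hloc near(1)[OF s] in auto)
  moreover have "s : ball ?z e \<inter> ball 0 (R + e / 2)" using near(2)[OF s] s by blast
  ultimately show "h s : E" "EX \<delta>>0. ALL u:ball 0 \<delta>. h (s + u) = \<phi> (h s) u" using is_flowD by blast+
 qed
 moreover have "h z = g z" if z: "z : ball 0 R" for z
 proof -
  have "h z = ?loc z z" by (rule hloc) (use z e in auto)
  then show ?thesis using \<psi>(2)[OF gE[OF z]] by simp
 qed
 ultimately show ?thesis using that by blast
qed

lemma flow_entire: "entire_image"
proof -
 obtain e \<psi> where e: "e > 0" and \<psi>: "!!q. q : E ==> is_flow (ball 0 e) (\<psi> q)" "!!q. q : E ==> \<psi> q 0 = q"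
  by (rule uniform_flow) (rule that, assumption+)
 obtain p where p: "p : E" using two_points by blast
 \<comment> \<open>The gain of radius in one extension is the same for every solution, so the radii
   are unbounded.\<close>
 let ?R = "%N. e + real N * (e / 2)"
 have Rpos: "?R N > 0" for N using e by (intro add_pos_nonneg) auto
 have "EX g. is_flow (ball 0 (?R N)) g & g 0 = p" for N
 proof (induction N)
  case 0
  then show ?case using \<psi>[OF p] by (intro exI[of _ "\<psi> p"]) simp
 next
  case (Suc N)
  then obtain g where g: "is_flow (ball 0 (?R N)) g" "g 0 = p" by blast
  obtain h where h: "is_flow (ball 0 (?R N + e / 2)) h" "!!z. z : ball 0 (?R N) ==> h z = g z"
   using extend_flow[OF e \<psi> Rpos g(1)] by metis
  have "?R N + e / 2 = ?R (Suc N)" by (simp add: field_simps)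
  moreover have "h 0 = p" using h(2)[of 0] g(2) Rpos[of N] by simp
  ultimately show ?case using h(1) by (intro exI[of _ h]) simp
 qed
 then obtain G where G: "!!N. is_flow (ball 0 (?R N)) (G N)" "!!N. G N 0 = p" by metis
 have mono: "ball (0::complex) (?R N) <= ball 0 (?R M)" if "N <= M" for N M
  by (rule subset_ball) (use that e in "simp add: mult_right_mono")
 have agree: "G N s = G M s" if "N <= M" "s : ball 0 (?R N)" for N M s
  by (rule is_flow_unique[OF G(1) is_flow_subset[OF G(1) open_ball mono[OF that(1)]] connected_ball _ _ that(2), of 0])
    (use G(2) Rpos[of N] in auto)
 define I where "I = (%s. nat \<lceil>cmod s * 2 / e\<rceil>)"
 define g where "g = (%s. G (I s) s)"
 have I: "s : ball 0 (?R (I s))" for s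
 proof -
  have "cmod s * 2 / e <= real (I s)" unfolding I_def by linarith
  then have "cmod s <= real (I s) * (e / 2)" using e by (simp add: field_simps)
  then show ?thesis using e by simp
 qed
 have gG: "g s = G M s" if "s : ball 0 (?R M)" for s M
  unfolding g_def using agree[of "I s" M s] agree[of M "I s" s] I that by (metis nat_le_linear)
 have flow: "is_flow UNIV g"
  unfolding is_flow_def
 proof (intro conjI ballI open_UNIV)
  fix s :: complex
  have "is_flow (ball 0 (?R (I s))) g" by (rule is_flow_cong[OF G(1)]) (rule gG)
  then show "g s : E" "EX \<delta>>0. ALL h:ball 0 \<delta>. g (s + h) = \<phi> (g s) h" using is_flowD I by blast+
 qed
 have g0: "g 0 = p" unfolding g_def by (rule G(2))
 obtain \<delta> where \<delta>: "\<delta> > 0" "!!h. h : ball 0 \<delta> ==> g (0 + h) = \<phi> (g 0) h" using is_flowD(2)[OF flow, of 0] by blast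
 define d where "d = min \<delta> (ep p)"
 have d: "d > 0" "d <= ep p" "d <= \<delta>" using \<delta>(1) eps[OF p] by (auto simp: d_def)
 obtain Om where Om: "open Om" "Om ~= {}" "Om <= ball 0 1" "\<phi> p ` ball 0 d = disc p ` Om" using image[OF p d(1,2)] by blast
 have "\<phi> p h : range g" if "h : ball 0 d" for h
 proof -
  have "h : ball 0 \<delta>" using subset_ball[OF d(3)] that by blast
  then have "\<phi> p h = g h" using \<delta>(2)[of h] g0 by simp
  then show ?thesis by (simp only: rangeI)
 qed
 then have "\<phi> p ` ball 0 d <= range g" by (rule image_subsetI)
 then have "disc p ` Om <= range g" by (simp only: Om(4))
 then show ?thesis unfolding entire_image_def
  using is_flow_holomorphic[OF flow] is_flowD(1)[OF flow] p Om(1-3)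
  by (intro exI[of _ g] exI[of _ p] exI[of _ Om] conjI) auto
qed

end

context genus_one
begin

text \<open>\<open>S\<close> is the primitive of the invariant differential in the chart at
  \<open>p\<close>, zero at the centre, and \<open>T\<close> is its local inverse. Time is thus the
  value of the integral, and \<open>T\<close> turns it into the chart parameter.\<close>

definition "flow_data F X Y p ep r w S T \<longleftrightarrow> ep > 0 & r > 0 & r <= 1 & w holomorphic_on ball 0 r \<and>
 (ALL t:ball 0 r. (S has_field_derivative w t) (at t)) \<and>
 T holomorphic_on ball 0 ep & (ALL s:ball 0 ep. T s : ball 0 r & S (T s) = s) & T 0 = 0 \<and>
 open (T ` ball 0 ep) & inj_on S (T ` ball 0 ep) \<and>
 (ALL t:ball 0 r. deriv (%t. X (lift p t)) t * F (lift p t) - X (lift p t) * deriv (%t. F (lift p t)) t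
    = w t * (F (lift p t) * Y (lift p t))) \<and>
 (ALL t:ball 0 r. t ~= 0 --> F (lift p t) ~= 0 & Y (lift p t) ~= 0)"

lemma flow_dataD:
 assumes "flow_data F X Y p ep r w S T"
 shows "ep > 0" "r > 0" "r <= 1" "w holomorphic_on ball 0 r" "!!t. t : ball 0 r ==> (S has_field_derivative w t) (at t)"
  "T holomorphic_on ball 0 ep" "!!s. s : ball 0 ep ==> T s : ball 0 r" "!!s. s : ball 0 ep ==> S (T s) = s" "T 0 = 0"
  "open (T ` ball 0 ep)" "inj_on S (T ` ball 0 ep)"
  "!!t. t : ball 0 r ==> deriv (%t. X (lift p t)) t * F (lift p t) - X (lift p t) * deriv (%t. F (lift p t)) t
    = w t * (F (lift p t) * Y (lift p t))"
  "!!t. t : ball 0 r ==> t ~= 0 ==> F (lift p t) ~= 0" "!!t. t : ball 0 r ==> t ~= 0 ==> Y (lift p t) ~= 0"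
 using assms unfolding flow_data_def by blast+

lemma flow_data_exists:
 assumes no: "!!O' l G H. \<not> simple_pole O' l G H" and W: "weierstrass P k F X Y" and a: "a ~= 0"
  and eq: "!!v. v : \<Union>E ==> Y v ^ 2 * F v = a * X v ^ 3 + b * X v ^ 2 * F v + c * X v * F v ^ 2 + e * F v ^ 3"
  and p: "p : E"
 shows "EX ep r w S T. flow_data F X Y p ep r w S T"
proof -
 obtain r w where r: "r > 0" "r <= 1" "w holomorphic_on ball 0 r" "!!t. t : ball 0 r ==> w t ~= 0"
  "!!t. t : ball 0 r ==> deriv (%t. X (lift p t)) t * F (lift p t) - X (lift p t) * deriv (%t. F (lift p t)) t
    = w t * (F (lift p t) * Y (lift p t))"
  "!!t. t : ball 0 r ==> t ~= 0 ==> F (lift p t) ~= 0 & Y (lift p t) ~= 0"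
  by (rule one_form[OF no W a eq p]) (assumption, rule that, assumption+)
 obtain S0 where S0: "!!t. t : ball 0 r ==> (S0 has_field_derivative w t) (at t within ball 0 r)"
  using holomorphic_convex_primitive'[OF convex_ball open_ball r(3)] by metis
 define S where "S = (%t. S0 t - S0 0)"
 have S: "(S has_field_derivative w t) (at t)" if t: "t : ball 0 r" for t
 proof -
  have "(S0 has_field_derivative w t) (at t)" using S0[OF t] at_within_open[OF t open_ball] by simp
  then show ?thesis unfolding S_def by (auto intro!: derivative_eq_intros)
 qed
 have Shol: "S holomorphic_on ball 0 r"
  by (rule holomorphic_onI) (use S in "auto simp: field_differentiable_def intro: has_field_derivative_at_within")
 have S00: "S 0 = 0" by (simp add: S_def)
 have "deriv S 0 = w 0" using S[of 0] r(1) by (intro DERIV_imp_deriv) simp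
 then have d: "deriv S 0 ~= 0" using r(1) r(4)[of 0] by simp
 obtain ep T where T: "ep > 0" "T holomorphic_on ball (S 0) ep" "!!s. s : ball (S 0) ep ==> T s : ball 0 r"
  "!!s. s : ball (S 0) ep ==> S (T s) = s" "T (S 0) = 0" "open (T ` ball (S 0) ep)" "inj_on S (T ` ball (S 0) ep)"
  by (rule local_inverse[OF Shol r(1) d]) (rule that, assumption+)
 note T = T[unfolded S00]
 have "flow_data F X Y p ep r w S T"
  unfolding flow_data_def using T r S by blast
 then show ?thesis by blast
qed

text \<open>The quotients \<open>X/F\<close> and \<open>Y/F\<close> do not depend on the lift, so
  two charts see the same differential. Under the change of charts the primitives differ by a
  constant, and at the common point this constant is seen to be \<open>- a\<close>: time in the
  second chart is time in the first one minus \<open>a\<close>.\<close>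

lemma flow_transition:
 assumes F: "nzf k F" and X: "nzf k X" and Y: "nzf k Y"
  and p: "p : E" "flow_data F X Y p ep r w S T" and a: "a : ball 0 ep" and q: "q = disc p (T a)" "flow_data F X Y q ep' r' w' S' T'"
 shows "EX \<delta>>0. ALL h:ball 0 \<delta>. disc p (T (a + h)) = disc q (T' h)"
proof -
 note D = flow_dataD[OF p(2)] and D' = flow_dataD[OF q(2)]
 have br: "ball (0::complex) r <= ball 0 1" "ball (0::complex) r' <= ball 0 1"
  by (rule subset_ball[OF D(3)], rule subset_ball[OF D'(3)])
 define t1 where "t1 = T a"
 have t1r: "t1 : ball 0 r" unfolding t1_def by (rule D(7)[OF a])
 then have t1: "t1 : ball 0 1" using br by blast
 have qE: "q : E" unfolding q(1) using disc_mem[OF p(1)] t1 by (simp add: t1_def)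
 have "0 : T' ` ball 0 ep'" by (rule image_eqI[of _ _ 0]) (use D'(1,9) in auto)
 then obtain rh0 where rh0: "rh0 > 0" "ball 0 rh0 <= T' ` ball 0 ep'" using D'(10) open_contains_ball by blast
 define rh where "rh = min rh0 r'"
 have rh: "rh > 0" "rh <= 1" "ball 0 rh <= T' ` ball 0 ep'" "ball (0::complex) rh <= ball 0 r'"
  using rh0 D'(2,3) by (auto simp: rh_def)
 have "disc p t1 = disc q 0" using disc_zero[OF qE] q(1) by (simp add: t1_def)
 then have meet: "disc p t1 : disc q ` ball 0 rh" using rh(1) by (auto intro: image_eqI[of _ _ 0])
 obtain ep1 \<tau> where \<tau>: "ep1 > 0" "ball t1 ep1 <= ball 0 1" "\<tau> holomorphic_on ball t1 ep1"
  "!!t. t : ball t1 ep1 ==> \<tau> t : ball 0 rh & disc q (\<tau> t) = disc p t"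
  by (rule disc_transition[OF p(1) qE t1 rh(1,2) meet]) (rule that, assumption+)
 obtain ep2 where ep2: "ep2 > 0" "ball t1 ep2 <= ball 0 r" using t1r open_contains_ball open_ball by blast
 define d where "d = min ep1 ep2"
 have d: "d > 0" "ball t1 d <= ball t1 ep1" "ball t1 d <= ball 0 r" using \<tau>(1) ep2 by (auto simp: d_def)
 have \<tau>d: "\<tau> holomorphic_on ball t1 d" using \<tau>(3) d(2) by (rule holomorphic_on_subset)
 have \<tau>m: "\<tau> t : ball 0 rh" "disc q (\<tau> t) = disc p t" "\<tau> t : ball 0 r'" "\<tau> t : ball 0 1" if "t : ball t1 d" for t
  using \<tau>(4)[of t] d(2) that rh(4) br(2) by blast+
 have \<tau>0: "t = t1 \<longleftrightarrow> \<tau> t = 0" if t: "t : ball t1 d" for t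
 proof
  assume "t = t1"
  then have "disc q (\<tau> t) = disc q 0" using \<tau>m(2)[OF t] \<open>disc p t1 = disc q 0\<close> by simp
  then show "\<tau> t = 0" using inj_onD[OF disc_inj[OF qE] _ \<tau>m(4)[OF t]] by simp
 next
  assume "\<tau> t = 0"
  then have "disc p t = disc p t1" using \<tau>m(2)[OF t] \<open>disc p t1 = disc q 0\<close> by simp
  then show "t = t1" using inj_onD[OF disc_inj[OF p(1)] _ _ t1] d(3) br(1) t by blast
 qed
 let ?f = "%t. F (lift p t)" and ?x = "%t. X (lift p t)" and ?y = "%t. Y (lift p t)"
 let ?f' = "%t. F (lift q t)" and ?x' = "%t. X (lift q t)" and ?y' = "%t. Y (lift q t)"
 have scale: "EX l. l ~= 0 & ?f' (\<tau> t) = l * ?f t & ?x' (\<tau> t) = l * ?x t & ?y' (\<tau> t) = l * ?y t" if t: "t : ball t1 d" for t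
 proof -
  have "t : ball 0 1" using t d(3) br(1) by blast
  moreover have "lift q (\<tau> t) : disc p t" using lift_mem_disc \<tau>m(2)[OF t] by metis
  ultimately obtain c where c: "c ~= 0" "lift q (\<tau> t) = cscale c (lift p t)"
   using lift_proportional[OF p(1)] by metis
  show ?thesis unfolding c(2)
   using form_fun_cscale[OF nzf_form[OF F], of c] form_fun_cscale[OF nzf_form[OF X], of c] form_fun_cscale[OF nzf_form[OF Y], of c] c(1)
   by (intro exI[of _ "c ^ k"]) simp
 qed
 have quot: "((%t. X (lift o' t) / F (lift o' t)) has_field_derivative \<omega> * (Y (lift o' t) / F (lift o' t))) (at t)"
  if o: "o' : E" "t : ball 0 1" "F (lift o' t) ~= 0"
   "deriv (%t. X (lift o' t)) t * F (lift o' t) - X (lift o' t) * deriv (%t. F (lift o' t)) t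
    = \<omega> * (F (lift o' t) * Y (lift o' t))" for o' t \<omega>
 proof -
  have "((%t. X (lift o' t)) has_field_derivative deriv (%t. X (lift o' t)) t) (at t)"
   "((%t. F (lift o' t)) has_field_derivative deriv (%t. F (lift o' t)) t) (at t)"
   using holomorphic_derivI[OF form_lift_hol[OF o(1) nzf_form[OF X]] open_ball o(2)]
    holomorphic_derivI[OF form_lift_hol[OF o(1) nzf_form[OF F]] open_ball o(2)] by auto
  from DERIV_divide[OF this o(3)] show ?thesis unfolding o(4) using o(3) by (simp add: field_simps)
 qed
 have Zhol: "(%t. w' (\<tau> t) * deriv \<tau> t - w t) holomorphic_on ball t1 d"
 proof (intro holomorphic_on_diff holomorphic_on_mult)
  have "(w' \<circ> \<tau>) holomorphic_on ball t1 d" by (rule holomorphic_on_compose_gen[OF \<tau>d D'(4)]) (use \<tau>m(3) in blast)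
  then show "(%t. w' (\<tau> t)) holomorphic_on ball t1 d" by (simp add: o_def)
  show "deriv \<tau> holomorphic_on ball t1 d" by (rule holomorphic_deriv[OF \<tau>d open_ball])
  show "w holomorphic_on ball t1 d" using D(4) d(3) by (rule holomorphic_on_subset)
 qed
 \<comment> \<open>The comparison is made where neither chart is at its centre, so that
   \<open>F\<close> and \<open>Y\<close> do not vanish; the identity theorem fills in the remaining
   points.\<close>
 have generic: "w' (\<tau> t) * deriv \<tau> t - w t = 0" if t: "t : ball t1 d - {0, t1}" for t
 proof -
  have td: "t : ball t1 d" and t0: "t ~= 0" "\<tau> t ~= 0" using t \<tau>0 by auto
  have tr: "t : ball 0 r" using td d(3) by blast
  have nz: "?f t ~= 0" "?y t ~= 0" "?f' (\<tau> t) ~= 0"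
   using D(13,14)[OF tr t0(1)] D'(13)[OF \<tau>m(3)[OF td] t0(2)] by auto
  have 1: "((%t. ?x t / ?f t) has_field_derivative w t * (?y t / ?f t)) (at t)"
   by (rule quot[OF p(1) _ nz(1) D(12)[OF tr]]) (use tr br(1) in blast)
  have "((%t. ?x' t / ?f' t) has_field_derivative w' (\<tau> t) * (?y' (\<tau> t) / ?f' (\<tau> t))) (at (\<tau> t))"
   by (rule quot[OF qE \<tau>m(4)[OF td] nz(3) D'(12)[OF \<tau>m(3)[OF td]]])
  from DERIV_chain2[OF this holomorphic_derivI[OF \<tau>d open_ball td]]
  have "((%t. ?x' (\<tau> t) / ?f' (\<tau> t)) has_field_derivative w' (\<tau> t) * (?y' (\<tau> t) / ?f' (\<tau> t)) * deriv \<tau> t) (at t)" .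
  then have "((%t. ?x t / ?f t) has_field_derivative w' (\<tau> t) * (?y' (\<tau> t) / ?f' (\<tau> t)) * deriv \<tau> t) (at t)"
  proof (rule has_field_derivative_transform_within_open[OF _ open_ball td])
   fix u assume "u : ball t1 d"
   then show "?x' (\<tau> u) / ?f' (\<tau> u) = ?x u / ?f u" using scale[of u] by auto
  qed
  from DERIV_unique[OF this 1] have "w' (\<tau> t) * (?y' (\<tau> t) / ?f' (\<tau> t)) * deriv \<tau> t = w t * (?y t / ?f t)" .
  moreover define \<kappa> where "\<kappa> = ?y t / ?f t"
  moreover have "?y' (\<tau> t) / ?f' (\<tau> t) = \<kappa>" using scale[OF td] by (auto simp: \<kappa>_def)
  ultimately have "w' (\<tau> t) * \<kappa> * deriv \<tau> t = w t * \<kappa>" by (simp only:)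
  then have "(w' (\<tau> t) * deriv \<tau> t - w t) * \<kappa> = 0" by algebra
  moreover have "\<kappa> ~= 0" using nz by (simp add: \<kappa>_def)
  ultimately show ?thesis by simp
 qed
 have "infinite (ball t1 d)" by (rule uncountable_infinite[OF uncountable_ball[OF d(1)]])
 then have "ball t1 d - {0, t1} ~= {}" by (metis Diff_eq_empty_iff finite.emptyI finite.insertI finite_subset)
 moreover have "open (ball t1 d - {0, t1})" by (intro open_Diff open_ball finite_imp_closed) simp
 ultimately have Z: "w' (\<tau> t) * deriv \<tau> t - w t = 0" if "t : ball t1 d" for t
  using holomorphic_zero_spread[OF Zhol, of "ball t1 d - {0, t1}"] generic that by blast
 have "EX c. ALL t:ball t1 d. S' (\<tau> t) - S t = c"
 proof (rule has_field_derivative_zero_constant[OF convex_ball])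
  fix t assume t: "t : ball t1 d"
  have "((%t. S' (\<tau> t)) has_field_derivative w' (\<tau> t) * deriv \<tau> t) (at t)"
   by (rule DERIV_chain2[OF D'(5)[OF \<tau>m(3)[OF t]] holomorphic_derivI[OF \<tau>d open_ball t]])
  moreover have "(S has_field_derivative w t) (at t)" using D(5) d(3) t by blast
  ultimately have "((%t. S' (\<tau> t) - S t) has_field_derivative w' (\<tau> t) * deriv \<tau> t - w t) (at t)" by (rule DERIV_diff)
  then show "((%t. S' (\<tau> t) - S t) has_field_derivative 0) (at t within ball t1 d)"
   using Z[OF t] by (simp add: has_field_derivative_at_within)
 qed
 then obtain c where c: "!!t. t : ball t1 d ==> S' (\<tau> t) - S t = c" by blast
 have "S' 0 = 0" using D'(8)[of 0] D'(1,9) by simp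
 moreover have "S t1 = a" unfolding t1_def by (rule D(8)[OF a])
 moreover have "\<tau> t1 = 0" using \<tau>0[of t1] d(1) by simp
 ultimately have "c = - a" using c[of t1] d(1) by simp
 then have S': "S' (\<tau> t) = S t - a" if "t : ball t1 d" for t using c[OF that] by (simp add: algebra_simps)
 have "open (ball 0 ep \<inter> T -` ball t1 d)"
  by (rule continuous_open_preimage[OF holomorphic_on_imp_continuous_on[OF D(6)] open_ball open_ball])
 moreover have "a : ball 0 ep \<inter> T -` ball t1 d" using a d(1) by (simp add: t1_def)
 ultimately obtain \<delta> where \<delta>: "\<delta> > 0" "ball a \<delta> <= ball 0 ep \<inter> T -` ball t1 d" using open_contains_ball by blast
 show ?thesis
 proof (rule exI[of _ "min \<delta> ep'"], intro conjI ballI)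
  show "min \<delta> ep' > 0" using \<delta>(1) D'(1) by simp
  fix h :: complex assume h: "h : ball 0 (min \<delta> ep')"
  then have "a + h : ball a \<delta>" by (simp add: dist_norm)
  then have ah: "a + h : ball 0 ep" "T (a + h) : ball t1 d" using \<delta>(2) by blast+
  have h': "h : ball 0 ep'" using h by simp
  have "S' (\<tau> (T (a + h))) = S' (T' h)" using S'[OF ah(2)] D(8)[OF ah(1)] D'(8)[OF h'] by simp
  moreover have "\<tau> (T (a + h)) : T' ` ball 0 ep'" using \<tau>m(1)[OF ah(2)] rh(3) by blast
  ultimately have "\<tau> (T (a + h)) = T' h" using inj_onD[OF D'(11)] h' by blast
  then show "disc p (T (a + h)) = disc q (T' h)" using \<tau>m(2)[OF ah(2)] by simp
 qed
qed

theorem entire: "entire_image"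
proof (cases "EX P l G H. simple_pole P l G H")
 case True
 then show ?thesis using simple_pole_entire by blast
next
 case False
 then have no: "\<not> simple_pole P l G H" for P l G H by blast
 obtain P k F X Y a b c e where W: "weierstrass P k F X Y" "a ~= 0"
  "!!v. v : \<Union>E ==> Y v ^ 2 * F v = a * X v ^ 3 + b * X v ^ 2 * F v + c * X v * F v ^ 2 + e * F v ^ 3"
  by (rule weierstrass_equation[OF no]) (rule that, assumption+)
 have nzf: "nzf k F" "nzf k X" "nzf k Y" using W(1) unfolding weierstrass_def by auto
 define Q where "Q = (%p (ep, r, w, S, T). flow_data F X Y p ep r w S T)"
 have "EX x. Q p x" if p: "p : E" for p
  using flow_data_exists[OF no W p] unfolding Q_def by auto
 then obtain D where D: "!!p. p : E ==> Q p (D p)" by metis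
 define ep where "ep = (%p. fst (D p))"
 define r where "r = (%p. fst (snd (D p)))"
 define w where "w = (%p. fst (snd (snd (D p))))"
 define S where "S = (%p. fst (snd (snd (snd (D p)))))"
 define T where "T = (%p. snd (snd (snd (snd (D p)))))"
 have D: "flow_data F X Y p (ep p) (r p) (w p) (S p) (T p)" if "p : E" for p
  using D[OF that] unfolding Q_def ep_def r_def w_def S_def T_def by (simp split: prod.splits)
 have br: "ball (0::complex) (r p) <= ball 0 1" if "p : E" for p using flow_dataD(3)[OF D[OF that]] by (rule subset_ball)
 have Tb: "T p h : ball 0 1" if "p : E" "h : ball 0 (ep p)" for p h
  using flow_dataD(7)[OF D[OF that(1)] that(2)] br[OF that(1)] by blast
 interpret curve_flow n E ep "%p h. disc p (T p h)"
 proof unfold_locales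
  fix p assume p: "p : E"
  note d = flow_dataD[OF D[OF p]]
  show "ep p > 0" by (rule d(1))
  show "disc p (T p 0) = p" using d(9) disc_zero[OF p] by simp
  have "hol_map n (ball 0 (ep p)) (disc p \<circ> T p)"
   by (rule holomorphic_into_compose[OF disc_holomorphic[OF p] d(6) open_ball]) (use Tb[OF p] in blast)
  then show "hol_map n (ball 0 (ep p)) (%h. disc p (T p h))" by (simp add: o_def)
  show "disc p (T p h) : E" if "h : ball 0 (ep p)" for h by (rule disc_mem[OF p Tb[OF p that]])
  show "EX Om. open Om & Om ~= {} & Om <= ball 0 1 & (%h. disc p (T p h)) ` ball 0 \<delta> = disc p ` Om"
   if \<delta>: "0 < \<delta>" "\<delta> <= ep p" for \<delta>
  proof (rule exI[of _ "T p ` ball 0 \<delta>"], intro conjI)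
   have sub: "ball (0::complex) \<delta> <= ball 0 (ep p)" using \<delta>(2) by (rule subset_ball)
   have "inj_on (T p) (ball 0 (ep p))" by (rule inj_on_inverseI[of _ "S p"]) (rule d(8))
   then have "inj_on (T p) (ball 0 \<delta>)" using sub by (rule inj_on_subset)
   then show "open (T p ` ball 0 \<delta>)" by (rule open_mapping_thm3[OF holomorphic_on_subset[OF d(6) sub] open_ball])
   show "T p ` ball 0 \<delta> <= ball 0 1" using Tb[OF p] sub by blast
  qed (use \<delta>(1) in "auto simp: image_image")
  show "EX \<delta>>0. ALL h:ball 0 \<delta>. disc p (T p (a + h)) = disc (disc p (T p a)) (T (disc p (T p a)) h)"
   if a: "a : ball 0 (ep p)" for a
   by (rule flow_transition[OF nzf p D[OF p] a refl D[OF disc_mem[OF p Tb[OF p a]]]])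
 qed
 show ?thesis by (rule flow_entire)
qed

end

text \<open>Holomorphy of \<open>f\<close> is tested on charts only, so the entire curve is written
  locally as a chart of the curve after a holomorphic change of parameter. If the composition were
  constant, \<open>f\<close> would be constant on an open piece and hence on the whole curve, which
  is connected.\<close>

lemma elliptic_curve_entire:
 assumes "elliptic_curve (proj_manifold N) C"
 obtains g a b where "hol_map N UNIV g" "range g <= C" "g a ~= g b"
proof -
 obtain n E f where E: "smooth_projective_curve n E" "curve_has_genus n E 1"
  and f: "holomorphic_curve_map n E (proj_manifold N) f" "\<not> f constant_on E" "C = f ` E"
  using assms unfolding elliptic_curve_def by blast
 interpret curve n E by unfold_locales (rule E(1))
 obtain d K where dK: "d > 0" "!!l. l >= K ==> hilbert_function n E l = d * l"
  "!!l F. l >= K ==> nzf l F ==> zeros E F = d * l" "!!q. q : E ==> component q = E"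
  by (rule degree[OF E(2)]) (rule that, assumption+)
 interpret genus_one n E d K by unfold_locales (fact dK)+
 obtain g p Om where g: "hol_map n UNIV g" "range g <= E" and p: "p : E"
  and Om: "open Om" "Om ~= {}" "Om <= ball 0 1" "disc p ` Om <= range g" using entire unfolding entire_image_def by blast
 have fdisc: "hol_map N (ball 0 1) (f \<circ> disc q)" if q: "q : E" for q
  using f(1) disc_inverse_chart[OF q open_ball subset_refl] unfolding holomorphic_curve_map_def by blast
 have hol: "hol_map N UNIV (f \<circ> g)"
 proof (rule holomorphic_into_local)
  fix z :: complex
  let ?q = "g z"
  have q: "?q : E" using g(2) by blast
  have kq: "!!v. v : g z ==> v (chart_index ?q) ~= 0"
  proof -
   fix v assume "v : g z"
   then obtain c where "c ~= 0" "v = cscale c (lift ?q 0)" using lift_proportional[OF q, of 0 v] disc_zero[OF q] by auto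
   then show "v (chart_index ?q) ~= 0" using lift_index[OF q, of 0] by (simp add: cscale_def)
  qed
  obtain e0 v where e0: "e0 > 0" "!!i. (%t. v t i) holomorphic_on ball z e0"
   "!!t. t : ball z e0 ==> v t (chart_index ?q) = 1" "!!t. t : ball z e0 ==> g t = proj_pt (v t)"
  proof (rule holomorphic_into_lift_chart[OF g(1), where z = z and k = "chart_index ?q"])
   show "z : UNIV" "chart_index ?q <= n" using chart_index_le[OF q] by simp_all
   show "!!w. w : g z ==> w (chart_index ?q) ~= 0" by (rule kq)
  qed (rule that, assumption+)
  have "continuous_map euclidean (proj_top n) g" using g(1) by (simp add: holomorphic_into_def proj_manifold_def)
  then have "continuous_map euclidean TE g" using g(2) by (auto simp: continuous_map_in_subtopology)
  from openin_continuous_map_preimage[OF this disc_open[OF q open_ball subset_refl]]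
  have "open {t. g t : disc ?q ` ball 0 1}" by simp
  moreover have "z : {t. g t : disc ?q ` ball 0 1}" using disc_zero[OF q] by (auto intro: image_eqI[of _ _ 0])
  ultimately obtain e1 where e1: "e1 > 0" "ball z e1 <= {t. g t : disc ?q ` ball 0 1}" using open_contains_ball by blast
  define e where "e = min e0 e1"
  have e: "e > 0" "ball z e <= ball z e0" "ball z e <= ball z e1" using e0(1) e1(1) by (auto simp: e_def)
  let ?\<sigma> = "%t. chart_form ?q (v t)"
  have \<sigma>: "?\<sigma> t : ball 0 1 & disc ?q (?\<sigma> t) = g t" if t: "t : ball z e" for t
  proof -
   have "g t : disc ?q ` ball 0 1" using t e(3) e1(2) by blast
   then obtain s where s: "s : ball 0 1" "g t = disc ?q s" by blast
   have te: "t : ball z e0" using t e(2) by blast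
   have "v t : disc ?q s" using e0(4)[OF te] s(2) proj_pt_self by metis
   then obtain c where c: "c ~= 0" "v t = cscale c (lift ?q s)" using lift_proportional[OF q s(1)] by metis
   have "c = 1" using e0(3)[OF te] lift_index[OF q s(1)] unfolding c(2) by (simp add: cscale_def)
   then have "v t = lift ?q s" using c(2) by (simp add: cscale_def)
   then show ?thesis using chart_form_lift[OF q s(1)] s by simp
  qed
  have "?\<sigma> holomorphic_on ball z e"
   by (rule poly_fun_holomorphic[OF form_fun_poly_fun[OF chart_form[OF q]] holomorphic_on_subset[OF e0(2) e(2)]])
  from holomorphic_into_compose[OF fdisc[OF q] this open_ball]
  have "hol_map N (ball z e) ((f \<circ> disc ?q) \<circ> ?\<sigma>)" using \<sigma> by blast
  then have "hol_map N (ball z e) (f \<circ> g)"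
   by (rule holomorphic_into_cong) (use \<sigma> in simp)
  then show "EX e>0. ball z e <= UNIV & hol_map N (ball z e) (f \<circ> g)" using e(1) by blast
 qed simp
 have "EX a b. (f \<circ> g) a ~= (f \<circ> g) b"
 proof (rule ccontr)
  assume "\<not> ?thesis"
  then have const: "f (g a) = f (g 0)" for a by auto
  have "f x = f (g 0)" if x: "x : E" for x
  proof (rule component_spread[where P = "%x. f x = f (g 0)" and ?q0.0 = p and ?p0.0 = p, OF _ component_refl[OF p] Om(1,3,2)])
   show "x : component p" using x dK(4)[OF p] by simp
   show "f (disc p t) = f (g 0)" if t: "t : Om" for t
   proof -
    obtain a where "disc p t = g a" using Om(4) t by blast
    then show ?thesis using const[of a] by (simp only:)
   qed
   fix q assume "q : component p"
   then have q: "q : E" using component_sub by blast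
   show "EX d>0. d <= 1 & (ALL Om. open Om --> Om <= ball 0 d --> Om ~= {} --> (ALL t:Om. f (disc q t) = f (g 0)) -->
     (ALL t:ball 0 d. f (disc q t) = f (g 0)))"
   proof (rule exI[of _ 1], intro conjI allI impI ballI)
    fix Om' :: "complex set" and t :: complex
    assume Om': "open Om'" "Om' <= ball 0 1" "Om' ~= {}" "ALL t:Om'. f (disc q t) = f (g 0)" and t: "t : ball 0 1"
    obtain t0 where t0: "t0 : Om'" using Om'(3) by blast
    have "hol_map N (ball 0 1) ((f \<circ> disc q) \<circ> (%_. t0))"
     by (rule holomorphic_into_compose[OF fdisc[OF q]]) (use t0 Om'(2) in auto)
    from holomorphic_into_identity[OF fdisc[OF q] this connected_ball Om'(1,2,3) _ t]
    show "f (disc q t) = f (g 0)" using Om'(4) t0 by simp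
   qed auto
  qed
  then show False using f(2) unfolding constant_on_def by blast
 qed
 then obtain a b where "(f \<circ> g) a ~= (f \<circ> g) b" by blast
 moreover have "range (f \<circ> g) <= C" using g(2) f(3) by auto
 ultimately show ?thesis using that hol by blast
qed

theorem proposition0p14:
  fixes n m :: nat and X Y :: "ppoint set" and \<phi> :: "ppoint \<Rightarrow> ppoint"
  assumes "smooth_projective_variety n X"
    and "smooth_projective_variety m Y"
    and "variety_morphism n X m Y \<phi>"
    and "\<phi> ` X = Y"
    and "variety_dim m Y > 0"
  shows "(strongly_approx_rationally_connected n X \<longrightarrow>
            (\<forall>N i. projective_embedding m Y N i \<longrightarrow>
               naively_approx_rationally_connected (proj_manifold N) (i ` Y)) \<and>
            \<not> kobayashi_hyperbolic m Y)
       \<and> (strongly_approx_elliptically_connected n X \<longrightarrow>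
            (\<forall>N i. projective_embedding m Y N i \<longrightarrow>
               naively_approx_elliptically_connected (proj_manifold N) (i ` Y)) \<and>
            \<not> kobayashi_hyperbolic m Y)"
proof -
 have X: "zariski_closed n X" and Y: "zariski_closed m Y"
  using assms(1,2) by (auto simp: smooth_projective_variety_def projective_variety_def)
 have sm: "surjective_morphism n m N X Y \<phi> i" if "projective_embedding m Y N i" for N i
  by (rule surjective_morphism.intro[OF X Y assms(3,4) that assms(5)])
 \<comment> \<open>Hyperbolicity concerns \<open>Y\<close> in its given projective space, so
   approximate connectedness is used for the identity embedding; a single curve in each neighborhood
   is enough.\<close>
 note emb = projective_embedding_id[OF Y]
 obtain x y where xy: "x : Y" "y : Y" using variety_dim_pos_two_points[OF assms(5)] by blast
 have rat: "\<not> kobayashi_hyperbolic m Y" if h: "naively_approx_rationally_connected (proj_manifold m) (id ` Y)"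
 proof (rule not_hyperbolic_if_entire_curves_nearby[OF Y])
  fix U assume U: "openin (proj_top m) U" "Y <= U"
  then obtain C where C: "rational_curve (proj_manifold m) C" "C <= U"
   using h[unfolded naively_approx_rationally_connected_def image_id id_apply mtop_proj_manifold, rule_format, OF conjI[OF U] xy] by blast
  obtain g a b where "hol_map m UNIV g" "range g <= C" "g a ~= g b"
   by (rule rational_curve_entire[OF C(1)])
  then show "EX g a b. hol_map m UNIV g & range g <= U & g a ~= g b" using C(2) by blast
 qed
 have ell: "\<not> kobayashi_hyperbolic m Y" if h: "naively_approx_elliptically_connected (proj_manifold m) (id ` Y)"
 proof (rule not_hyperbolic_if_entire_curves_nearby[OF Y])
  fix U assume U: "openin (proj_top m) U" "Y <= U"
  then obtain Cs where Cs: "elliptic_chain (proj_manifold m) Cs" "ALL C:set Cs. C <= U"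
   using h[unfolded naively_approx_elliptically_connected_def image_id id_apply mtop_proj_manifold, rule_format, OF conjI[OF U] xy] by blast
  then have "hd Cs : set Cs" by (simp add: elliptic_chain_def)
  then have C: "elliptic_curve (proj_manifold m) (hd Cs)" "hd Cs <= U" using Cs by (auto simp: elliptic_chain_def)
  obtain g a b where "hol_map m UNIV g" "range g <= hd Cs" "g a ~= g b"
   by (rule elliptic_curve_entire[OF C(1)])
  then show "EX g a b. hol_map m UNIV g & range g <= U & g a ~= g b" using C(2) by blast
 qed
 show ?thesis
  using surjective_morphism.rationally_connected_image[OF sm] surjective_morphism.elliptically_connected_image[OF sm]
   rat ell emb by blast
qed

end
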